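(* Let $\mathcal E$ be a topos, $T$ the class of its monomorphisms $C\hookrightarrow X$, $S$ the class of its objects, $R\subseteq T\times S$ the duality relation between monomorphisms and objects, and $$F_R:(\mathcal P(T),\subseteq)\to(\mathcal P(S),\supseteq),\qquad G_R:(\mathcal P(S),\supseteq)\to(\mathcal P(T),\subseteq)$$ the adjoint pair of order-preserving maps defined by $R$ (all defined in the context). Then: (i) A subclass $J\subseteq T$ is a fixed point of $G_R\circ F_R$ if and only if it is a topology, in the sense that it satisfies: (1) every isomorphism $C\xrightarrow{\sim}X$ is an element of $J$; (2) for every element $C\hookrightarrow X$ of $J$ and every morphism $X'\to X$ of $\mathcal E$, the monomorphism $C\times_XX'\hookrightarrow X'$ is again an element of $J$; (3) for a monomorphism $C\hookrightarrow X$ to be an element of $J$, it suffices that there exist an element $C'\hookrightarrow X$ of $J$ and a globally epimorphic family $(X_k\to C')_{k\in K}$ such that all the fibre products $C\times_XX_k\hookrightarrow X_k$, $k\in K$, are elements of $J$. (ii) A subclass $I\subseteq S$ is a fixed point of $F_R\circ G_R$ if and only if the full subcategory $\mathcal E_I\hookrightarrow\mathcal E$ on the objects that are elements of $I$ is a subtopos of $\mathcal E$, in the sense that it satisfies: (1) the fully faithful embedding functor $j_*:\mathcal E_I\hookrightarrow\mathcal E$ has a left adjoint $j^*:\mathcal E\to\mathcal E_I$; (2) this left adjoint preserves not only colimits but also finite limits; (3) an object $E$ of $\mathcal E$ is an object of $\mathcal E_I$ (i.e. an element of $I$) if and only if the canonical morphism $E\to j_*\circ j^*E$ is an isomorphi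sm.
   Context: Topos means Grothendieck topos. $\mathcal P(\cdot)$ denotes the collection of subclasses. The relation $R\subseteq T\times S$ consists of the pairs $(C\hookrightarrow X,E)$ such that, for every morphism $x:X'\to X$ of $\mathcal E$, the restriction map $${\rm Hom}(X',E)\to{\rm Hom}(C\times_XX',E)$$ to the subobject $C\times_XX'\hookrightarrow X'$ is a bijection. The associated maps are $$F_R(J)=\{s\in S\mid(t,s)\in R\ \forall t\in J\},\qquad G_R(I)=\{t\in T\mid(t,s)\in R\ \forall s\in I\}.$$ *)

theory Defs
  imports "HOL-Library.FuncSet" "HOL-Library.Equipollence"
begin

section \<open>Universe of small sets\<close>

text \<open>
  HOL has no type of all sets, so smallness is taken relative to a type \<open>'u\<close> whose
  cardinality \<open>\<kappa>\<close> is strongly inaccessible.  A set is small if it has fewer than \<open>\<kappa>\<close> elements.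
  Every set belonging to the Grothendieck universe of rank \<open>\<kappa>\<close> is in bijection with a small
  subset of \<open>'u\<close>, so the category \<open>set_cat\<close> below is equivalent to the category of sets of
  that universe.
\<close>

definition small :: "'u set \<Rightarrow> bool" where
  "small A \<longleftrightarrow> A \<prec> (UNIV :: 'u set)"

definition universe :: "'u itself \<Rightarrow> bool" where
  "universe U \<longleftrightarrow>
     (UNIV :: nat set) \<prec> (UNIV :: 'u set) \<and>
     (\<forall>A :: 'u set. small A \<longrightarrow> Pow A \<prec> (UNIV :: 'u set)) \<and>
     (\<forall>(A :: 'u set) (B :: 'u \<Rightarrow> 'u set).
        small A \<longrightarrow> (\<forall>x\<in>A. small (B x)) \<longrightarrow> small (\<Union>x\<in>A. B x))"


section \<open>Categories\<close>

record ('o, 'a) cat =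
  Ob :: "'o set"
  Arr :: "'a set"
  Dom :: "'a \<Rightarrow> 'o"
  Cod :: "'a \<Rightarrow> 'o"
  Idn :: "'o \<Rightarrow> 'a"
  Comp :: "'a \<Rightarrow> 'a \<Rightarrow> 'a" (infixl "\<cdot>\<index>" 70)  \<comment> \<open>\<open>g \<cdot> f\<close> is \<open>f\<close> followed by \<open>g\<close>\<close>

definition hom :: "('o, 'a) cat \<Rightarrow> 'o \<Rightarrow> 'o \<Rightarrow> 'a set" where
  "hom C a b = {f \<in> Arr C. Dom C f = a \<and> Cod C f = b}"

locale category =
  fixes C :: "('o, 'a) cat" (structure)
  assumes dom_Ob: "f \<in> Arr C \<Longrightarrow> Dom C f \<in> Ob C"
    and cod_Ob: "f \<in> Arr C \<Longrightarrow> Cod C f \<in> Ob C"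
    and id_hom: "a \<in> Ob C \<Longrightarrow> Idn C a \<in> hom C a a"
    and comp_hom: "f \<in> hom C a b \<Longrightarrow> g \<in> hom C b c \<Longrightarrow> g \<cdot> f \<in> hom C a c"
    and id_left: "f \<in> hom C a b \<Longrightarrow> Idn C b \<cdot> f = f"
    and id_right: "f \<in> hom C a b \<Longrightarrow> f \<cdot> Idn C a = f"
    and assoc: "f \<in> hom C a b \<Longrightarrow> g \<in> hom C b c \<Longrightarrow> h \<in> hom C c d
                  \<Longrightarrow> h \<cdot> g \<cdot> f = h \<cdot> (g \<cdot> f)"

definition op_cat :: "('o, 'a) cat \<Rightarrow> ('o, 'a) cat" where
  "op_cat C = \<lparr>Ob = Ob C, Arr = Arr C, Dom = Cod C, Cod = Dom C, Idn = Idn C,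
               Comp = (\<lambda>g f. Comp C f g)\<rparr>"

definition full_subcat :: "('o, 'a) cat \<Rightarrow> 'o set \<Rightarrow> ('o, 'a) cat" where
  "full_subcat C I = \<lparr>Ob = I, Arr = {f \<in> Arr C. Dom C f \<in> I \<and> Cod C f \<in> I},
                      Dom = Dom C, Cod = Cod C, Idn = Idn C, Comp = Comp C\<rparr>"

text \<open>The category of small subsets of \<open>'u\<close>; an arrow is a triple (domain, codomain, function).\<close>

definition set_cat :: "('u set, 'u set \<times> 'u set \<times> ('u \<Rightarrow> 'u)) cat" where
  "set_cat = \<lparr>Ob = {A. small A},
              Arr = {(A, B, f). small A \<and> small B \<and> f \<in> A \<rightarrow>\<^sub>E B},
              Dom = (\<lambda>(A, B, f). A),
              Cod = (\<lambda>(A, B, f). B),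
              Idn = (\<lambda>A. (A, A, \<lambda>x\<in>A. x)),
              Comp = (\<lambda>(B', C, g) (A, B, f). (A, C, compose A g f))\<rparr>"

definition is_iso :: "('o, 'a) cat \<Rightarrow> 'a \<Rightarrow> bool" where
  "is_iso C f \<longleftrightarrow> f \<in> Arr C \<and>
     (\<exists>g \<in> hom C (Cod C f) (Dom C f).
        Comp C g f = Idn C (Dom C f) \<and> Comp C f g = Idn C (Cod C f))"

definition is_mono :: "('o, 'a) cat \<Rightarrow> 'a \<Rightarrow> bool" where
  "is_mono C m \<longleftrightarrow> m \<in> Arr C \<and>
     (\<forall>g \<in> Arr C. \<forall>h \<in> Arr C. Cod C g = Dom C m \<longrightarrow> Cod C h = Dom C m \<longrightarrow>
        Dom C g = Dom C h \<longrightarrow> Comp C m g = Comp C m h \<longrightarrow> g = h)"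

definition all_monos :: "('o, 'a) cat \<Rightarrow> 'a set" where
  "all_monos C = {m. is_mono C m}"

text \<open>\<open>is_pullback C f g p q\<close>: the projections \<open>p\<close> (to the domain of \<open>f\<close>) and \<open>q\<close> (to the domain
  of \<open>g\<close>) exhibit their common domain as a fibre product of \<open>f\<close> and \<open>g\<close>.\<close>

definition is_pullback :: "('o, 'a) cat \<Rightarrow> 'a \<Rightarrow> 'a \<Rightarrow> 'a \<Rightarrow> 'a \<Rightarrow> bool" where
  "is_pullback C f g p q \<longleftrightarrow>
     f \<in> Arr C \<and> g \<in> Arr C \<and> Cod C f = Cod C g \<and>
     p \<in> hom C (Dom C p) (Dom C f) \<and> q \<in> hom C (Dom C p) (Dom C g) \<and>
     Comp C f p = Comp C g q \<and>
     (\<forall>z \<in> Ob C. \<forall>p' \<in> hom C z (Dom C f). \<forall>q' \<in> hom C z (Dom C g).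
        Comp C f p' = Comp C g q' \<longrightarrow>
        (\<exists>!u. u \<in> hom C z (Dom C p) \<and> Comp C p u = p' \<and> Comp C q u = q'))"


section \<open>Functors and natural transformations\<close>

record ('o, 'a, 'p, 'b) fctr =
  FOb :: "'o \<Rightarrow> 'p"
  FArr :: "'a \<Rightarrow> 'b"

definition is_functor ::
    "('o, 'a) cat \<Rightarrow> ('p, 'b) cat \<Rightarrow> ('o, 'a, 'p, 'b) fctr \<Rightarrow> bool" where
  "is_functor C D F \<longleftrightarrow>
     (\<forall>a \<in> Ob C. FOb F a \<in> Ob D) \<and>
     (\<forall>f \<in> Arr C. FArr F f \<in> hom D (FOb F (Dom C f)) (FOb F (Cod C f))) \<and>
     (\<forall>a \<in> Ob C. FArr F (Idn C a) = Idn D (FOb F a)) \<and>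
     (\<forall>f \<in> Arr C. \<forall>g \<in> Arr C. Cod C f = Dom C g \<longrightarrow>
        FArr F (Comp C g f) = Comp D (FArr F g) (FArr F f))"

definition id_functor :: "('o, 'a, 'o, 'a) fctr" where
  "id_functor = \<lparr>FOb = (\<lambda>a. a), FArr = (\<lambda>f. f)\<rparr>"

definition comp_functor ::
    "('p, 'b, 'q, 'c) fctr \<Rightarrow> ('o, 'a, 'p, 'b) fctr \<Rightarrow> ('o, 'a, 'q, 'c) fctr" where
  "comp_functor G F = \<lparr>FOb = FOb G \<circ> FOb F, FArr = FArr G \<circ> FArr F\<rparr>"

definition nat_trans ::
    "('o, 'a) cat \<Rightarrow> ('p, 'b) cat \<Rightarrow> ('o, 'a, 'p, 'b) fctr \<Rightarrow> ('o, 'a, 'p, 'b) fctr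
       \<Rightarrow> ('o \<Rightarrow> 'b) \<Rightarrow> bool" where
  "nat_trans C D F G \<eta> \<longleftrightarrow>
     (\<forall>a \<in> Ob C. \<eta> a \<in> hom D (FOb F a) (FOb G a)) \<and>
     (\<forall>f \<in> Arr C. Comp D (\<eta> (Cod C f)) (FArr F f) = Comp D (FArr G f) (\<eta> (Dom C f)))"

definition nat_iso ::
    "('o, 'a) cat \<Rightarrow> ('p, 'b) cat \<Rightarrow> ('o, 'a, 'p, 'b) fctr \<Rightarrow> ('o, 'a, 'p, 'b) fctr
       \<Rightarrow> ('o \<Rightarrow> 'b) \<Rightarrow> bool" where
  "nat_iso C D F G \<eta> \<longleftrightarrow> nat_trans C D F G \<eta> \<and> (\<forall>a \<in> Ob C. is_iso D (\<eta> a))"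

definition equivalent_cats :: "('o, 'a) cat \<Rightarrow> ('p, 'b) cat \<Rightarrow> bool" where
  "equivalent_cats C D \<longleftrightarrow>
     (\<exists>F G \<eta> \<epsilon>. is_functor C D F \<and> is_functor D C G \<and>
        nat_iso C C id_functor (comp_functor G F) \<eta> \<and>
        nat_iso D D (comp_functor F G) id_functor \<epsilon>)"

definition adjunction ::
    "('o, 'a) cat \<Rightarrow> ('p, 'b) cat \<Rightarrow> ('o, 'a, 'p, 'b) fctr \<Rightarrow> ('p, 'b, 'o, 'a) fctr
       \<Rightarrow> ('o \<Rightarrow> 'a) \<Rightarrow> ('p \<Rightarrow> 'b) \<Rightarrow> bool"
  \<comment> \<open>\<open>L : C \<rightarrow> D\<close> is left adjoint to \<open>R : D \<rightarrow> C\<close> with unit \<open>\<eta>\<close> and counit \<open>\<epsilon>\<close>\<close>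
where
  "adjunction C D L R \<eta> \<epsilon> \<longleftrightarrow>
     is_functor C D L \<and> is_functor D C R \<and>
     nat_trans C C id_functor (comp_functor R L) \<eta> \<and>
     nat_trans D D (comp_functor L R) id_functor \<epsilon> \<and>
     (\<forall>x \<in> Ob C. Comp D (\<epsilon> (FOb L x)) (FArr L (\<eta> x)) = Idn D (FOb L x)) \<and>
     (\<forall>y \<in> Ob D. Comp C (FArr R (\<epsilon> y)) (\<eta> (FOb R y)) = Idn C (FOb R y))"

text \<open>Components of arrows are required to be extensional, so that equality of arrows of the
  functor category is equality of natural transformations.\<close>

definition functor_cat ::
    "('o, 'a) cat \<Rightarrow> ('p, 'b) cat \<Rightarrow>
       (('o, 'a, 'p, 'b) fctr,
        ('o, 'a, 'p, 'b) fctr \<times> ('o, 'a, 'p, 'b) fctr \<times> ('o \<Rightarrow> 'b)) cat" where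
  "functor_cat C D =
     (let Fs = {F. is_functor C D F \<and> FOb F \<in> extensional (Ob C) \<and> FArr F \<in> extensional (Arr C)}
      in \<lparr>Ob = Fs,
          Arr = {(F, G, \<eta>). F \<in> Fs \<and> G \<in> Fs \<and> nat_trans C D F G \<eta> \<and> \<eta> \<in> extensional (Ob C)},
          Dom = (\<lambda>(F, G, \<eta>). F),
          Cod = (\<lambda>(F, G, \<eta>). G),
          Idn = (\<lambda>F. (F, F, \<lambda>a\<in>Ob C. Idn D (FOb F a))),
          Comp = (\<lambda>(G', H, \<theta>) (F, G, \<eta>). (F, H, \<lambda>a\<in>Ob C. Comp D (\<theta> a) (\<eta> a)))\<rparr>)"


section \<open>Limits and colimits\<close>

definition is_cone ::
    "('o, 'a) cat \<Rightarrow> ('k, 'l) cat \<Rightarrow> ('k, 'l, 'o, 'a) fctr \<Rightarrow> 'o \<Rightarrow> ('k \<Rightarrow> 'a) \<Rightarrow> bool" where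
  "is_cone C K D a \<pi> \<longleftrightarrow>
     is_functor K C D \<and> a \<in> Ob C \<and>
     (\<forall>k \<in> Ob K. \<pi> k \<in> hom C a (FOb D k)) \<and>
     (\<forall>u \<in> Arr K. Comp C (FArr D u) (\<pi> (Dom K u)) = \<pi> (Cod K u))"

definition is_limit ::
    "('o, 'a) cat \<Rightarrow> ('k, 'l) cat \<Rightarrow> ('k, 'l, 'o, 'a) fctr \<Rightarrow> 'o \<Rightarrow> ('k \<Rightarrow> 'a) \<Rightarrow> bool" where
  "is_limit C K D a \<pi> \<longleftrightarrow>
     is_cone C K D a \<pi> \<and>
     (\<forall>b \<sigma>. is_cone C K D b \<sigma> \<longrightarrow>
        (\<exists>!h. h \<in> hom C b a \<and> (\<forall>k \<in> Ob K. Comp C (\<pi> k) h = \<sigma> k)))"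

text \<open>A functor and its opposite have the same underlying data.\<close>

definition is_colimit ::
    "('o, 'a) cat \<Rightarrow> ('k, 'l) cat \<Rightarrow> ('k, 'l, 'o, 'a) fctr \<Rightarrow> 'o \<Rightarrow> ('k \<Rightarrow> 'a) \<Rightarrow> bool" where
  "is_colimit C K D a \<iota> \<longleftrightarrow> is_limit (op_cat C) (op_cat K) D a \<iota>"

definition small_category :: "('u, 'u) cat \<Rightarrow> bool" where
  "small_category K \<longleftrightarrow> category K \<and> small (Ob K) \<and> small (Arr K)"

text \<open>Any finite (respectively small) category is isomorphic to one whose objects and arrows
  are elements of \<open>'u\<close>, so it suffices to consider such diagram shapes.\<close>

definition preserves_finite_limits ::
    "'u itself \<Rightarrow> ('o, 'a) cat \<Rightarrow> ('p, 'b) cat \<Rightarrow> ('o, 'a, 'p, 'b) fctr \<Rightarrow> bool" where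
  "preserves_finite_limits U C D F \<longleftrightarrow>
     (\<forall>(K :: ('u, 'u) cat) \<Delta> a \<pi>. category K \<longrightarrow> finite (Ob K) \<longrightarrow> finite (Arr K) \<longrightarrow>
        is_limit C K \<Delta> a \<pi> \<longrightarrow>
        is_limit D K (comp_functor F \<Delta>) (FOb F a) (\<lambda>k. FArr F (\<pi> k)))"

definition preserves_small_colimits ::
    "'u itself \<Rightarrow> ('o, 'a) cat \<Rightarrow> ('p, 'b) cat \<Rightarrow> ('o, 'a, 'p, 'b) fctr \<Rightarrow> bool" where
  "preserves_small_colimits U C D F \<longleftrightarrow>
     (\<forall>(K :: ('u, 'u) cat) \<Delta> a \<iota>. small_category K \<longrightarrow>
        is_colimit C K \<Delta> a \<iota> \<longrightarrow>
        is_colimit D K (comp_functor F \<Delta>) (FOb F a) (\<lambda>k. FArr F (\<iota> k)))"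


section \<open>Sites, sheaves and Grothendieck toposes\<close>

definition is_sieve :: "('o, 'a) cat \<Rightarrow> 'o \<Rightarrow> 'a set \<Rightarrow> bool" where
  "is_sieve C c S \<longleftrightarrow> S \<subseteq> {f \<in> Arr C. Cod C f = c} \<and>
     (\<forall>f \<in> S. \<forall>g \<in> Arr C. Cod C g = Dom C f \<longrightarrow> Comp C f g \<in> S)"

definition pullback_sieve :: "('o, 'a) cat \<Rightarrow> 'a \<Rightarrow> 'a set \<Rightarrow> 'a set" where
  "pullback_sieve C f S = {g \<in> Arr C. Cod C g = Dom C f \<and> Comp C f g \<in> S}"

definition grothendieck_topology :: "('o, 'a) cat \<Rightarrow> ('o \<Rightarrow> 'a set set) \<Rightarrow> bool" where
  "grothendieck_topology C Cov \<longleftrightarrow>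
     (\<forall>c \<in> Ob C. \<forall>S \<in> Cov c. is_sieve C c S) \<and>
     (\<forall>c \<in> Ob C. {f \<in> Arr C. Cod C f = c} \<in> Cov c) \<and>
     (\<forall>f \<in> Arr C. \<forall>S \<in> Cov (Cod C f). pullback_sieve C f S \<in> Cov (Dom C f)) \<and>
     (\<forall>c \<in> Ob C. \<forall>S \<in> Cov c. \<forall>S'. is_sieve C c S' \<longrightarrow>
        (\<forall>f \<in> S. pullback_sieve C f S' \<in> Cov (Dom C f)) \<longrightarrow> S' \<in> Cov c)"

text \<open>\<open>restrict_along P f x\<close> is the restriction of the section \<open>x\<close> of the presheaf \<open>P\<close> along \<open>f\<close>.\<close>

definition restrict_along ::
    "('o, 'a, 'u set, 'u set \<times> 'u set \<times> ('u \<Rightarrow> 'u)) fctr \<Rightarrow> 'a \<Rightarrow> 'u \<Rightarrow> 'u" where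
  "restrict_along P f x = snd (snd (FArr P f)) x"

definition is_sheaf ::
    "('o, 'a) cat \<Rightarrow> ('o \<Rightarrow> 'a set set)
       \<Rightarrow> ('o, 'a, 'u set, 'u set \<times> 'u set \<times> ('u \<Rightarrow> 'u)) fctr \<Rightarrow> bool" where
  "is_sheaf C Cov P \<longleftrightarrow> is_functor (op_cat C) set_cat P \<and>
     (\<forall>c \<in> Ob C. \<forall>S \<in> Cov c. \<forall>x :: 'a \<Rightarrow> 'u.
        (\<forall>f \<in> S. x f \<in> FOb P (Dom C f)) \<longrightarrow>
        (\<forall>f \<in> S. \<forall>g \<in> Arr C. Cod C g = Dom C f \<longrightarrow>
           restrict_along P g (x f) = x (Comp C f g)) \<longrightarrow>
        (\<exists>!y. y \<in> FOb P c \<and> (\<forall>f \<in> S. restrict_along P f y = x f)))"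

definition sheaf_cat ::
    "('u, 'u) cat \<Rightarrow> ('u \<Rightarrow> 'u set set) \<Rightarrow>
       (('u, 'u, 'u set, 'u set \<times> 'u set \<times> ('u \<Rightarrow> 'u)) fctr,
        ('u, 'u, 'u set, 'u set \<times> 'u set \<times> ('u \<Rightarrow> 'u)) fctr
        \<times> ('u, 'u, 'u set, 'u set \<times> 'u set \<times> ('u \<Rightarrow> 'u)) fctr
        \<times> ('u \<Rightarrow> 'u set \<times> 'u set \<times> ('u \<Rightarrow> 'u))) cat" where
  "sheaf_cat C Cov =
     full_subcat (functor_cat (op_cat C) set_cat)
       {P \<in> Ob (functor_cat (op_cat C) set_cat). is_sheaf C Cov P}"

definition grothendieck_topos :: "'u itself \<Rightarrow> ('o, 'a) cat \<Rightarrow> bool" where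
  "grothendieck_topos U E \<longleftrightarrow> category E \<and>
     (\<exists>(C :: ('u, 'u) cat) Cov. small_category C \<and> grothendieck_topology C Cov \<and>
        equivalent_cats E (sheaf_cat C Cov))"


section \<open>The duality between monomorphisms and objects\<close>

definition polar_F :: "'t set \<Rightarrow> 's set \<Rightarrow> ('t \<times> 's) set \<Rightarrow> 't set \<Rightarrow> 's set" where
  "polar_F T S R J = {s \<in> S. \<forall>t \<in> J. (t, s) \<in> R}"

definition polar_G :: "'t set \<Rightarrow> 's set \<Rightarrow> ('t \<times> 's) set \<Rightarrow> 's set \<Rightarrow> 't set" where
  "polar_G T S R I = {t \<in> T. \<forall>s \<in> I. (t, s) \<in> R}"

text \<open>Fibre products are only determined up to isomorphism.  Conditions on a fibre product are
  stated for every choice of it, at least one of which exists in a topos.\<close>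

definition duality_rel :: "('o, 'a) cat \<Rightarrow> ('a \<times> 'o) set" where
  "duality_rel E = {(m, e). m \<in> all_monos E \<and> e \<in> Ob E \<and>
     (\<forall>x \<in> Arr E. Cod E x = Cod E m \<longrightarrow>
        (\<forall>p q. is_pullback E m x p q \<longrightarrow>
           bij_betw (\<lambda>f. Comp E f q) (hom E (Dom E x) e) (hom E (Dom E q) e)))}"

definition globally_epimorphic ::
    "('o, 'a) cat \<Rightarrow> 'o \<Rightarrow> 'k set \<Rightarrow> ('k \<Rightarrow> 'a) \<Rightarrow> bool" where
  "globally_epimorphic E c K x \<longleftrightarrow>
     (\<forall>k \<in> K. x k \<in> Arr E \<and> Cod E (x k) = c) \<and>
     (\<forall>g \<in> Arr E. \<forall>h \<in> Arr E. Dom E g = c \<longrightarrow> Dom E h = c \<longrightarrow> Cod E g = Cod E h \<longrightarrow>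
        (\<forall>k \<in> K. Comp E g (x k) = Comp E h (x k)) \<longrightarrow> g = h)"

definition is_topology :: "'u itself \<Rightarrow> ('o, 'a) cat \<Rightarrow> 'a set \<Rightarrow> bool" where
  "is_topology U E J \<longleftrightarrow>
     (\<forall>f. is_iso E f \<longrightarrow> f \<in> J) \<and>
     (\<forall>m \<in> J. \<forall>x \<in> Arr E. Cod E x = Cod E m \<longrightarrow>
        (\<forall>p q. is_pullback E m x p q \<longrightarrow> q \<in> J)) \<and>
     (\<forall>m \<in> all_monos E.
        (\<exists>m' \<in> J. Cod E m' = Cod E m \<and>
           (\<exists>(K :: 'u set) x. small K \<and> globally_epimorphic E (Dom E m') K x \<and>
              (\<forall>k \<in> K. \<forall>p q. is_pullback E m (Comp E m' (x k)) p q \<longrightarrow> q \<in> J)))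
        \<longrightarrow> m \<in> J)"

text \<open>The inclusion of a full subcategory is given by identities on objects and arrows, so the
  canonical morphism \<open>X \<rightarrow> j\<^sub>* j\<^sup>* X\<close> is the component \<open>\<eta> X\<close> of the unit.\<close>

definition is_subtopos :: "'u itself \<Rightarrow> ('o, 'a) cat \<Rightarrow> 'o set \<Rightarrow> bool" where
  "is_subtopos U E I \<longleftrightarrow>
     (\<exists>L \<eta> \<epsilon>. adjunction E (full_subcat E I) L id_functor \<eta> \<epsilon> \<and>
        preserves_small_colimits U E (full_subcat E I) L \<and>
        preserves_finite_limits U E (full_subcat E I) L \<and>
        (\<forall>X \<in> Ob E. X \<in> I \<longleftrightarrow> is_iso E (\<eta> X)))"

end

theory Submission
  imports Defs
begin

text \<open>
  A monomorphism \<open>m\<close> is dual to an object \<open>Z\<close> exactly when the functor represented by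
  \<open>Z\<close> satisfies the sheaf condition, universally, on the sieve generated by \<open>m\<close>
  (\<open>duality_iff\<close>).  Both parts of the theorem thereby become statements about Grothendieck
  topologies on the topos \<open>E\<close> itself and about sheaves for them.

  The sieves on which a presheaf is universally a sheaf form a topology (\<open>glue_top_topology\<close>),
  and in a topos a jointly epimorphic family covers for the canonical topology (\<open>epi_cov\<close>).
  Hence the monomorphisms dual to any class of objects satisfy the three axioms
  (\<open>GR_topology\<close>).  Conversely, a class \<open>J\<close> with these axioms defines a topology
  \<open>JCov\<close> finer than the canonical one, from which \<open>J\<close> can be recovered
  (\<open>J_of_gen_sieve\<close>), and the objects dual to \<open>J\<close> are those whose represented functor is
  a sheaf for \<open>JCov\<close> (\<open>FR_sheaf_iff\<close>).

  What remains is to sheafify.  A section over \<open>U\<close> of the sheafification of the functor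
  represented by \<open>X\<close> is a closed relation from \<open>U\<close> to \<open>X\<close> that is locally single valued and
  locally defined everywhere.  This is a sheaf by construction, it is determined by a small set of
  spans, and every such sheaf on a topos is represented by an object (\<open>representable\<close>).  The
  representing object \<open>L X\<close> comes with a unit \<open>X \<rightarrow> L X\<close> that is locally surjective and locally
  injective, and these two properties suffice for everything else: the universal property of the
  unit (\<open>local_gen_universal\<close>), the preservation of finite limits (\<open>reflection_lex\<close>) and the
  fact that a monomorphism dual to all sheaves for \<open>JCov\<close> belongs to \<open>J\<close>
  (\<open>GR_FR_subset\<close>).  This proves the first part, and it shows that the objects dual to a
  topology form a subtopos.

  Conversely, let \<open>L\<close> be the reflector of a subtopos.  Monomorphisms inverted by \<open>L\<close> are dual
  to the subtopos because \<open>L\<close> preserves pullbacks.  The diagonal of the kernel pair of a unit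
  \<open>X \<rightarrow> L X\<close> is such a monomorphism.  If \<open>X\<close> is dual to it, the two projections of the kernel pair
  are equal and the unit is itself a monomorphism inverted by \<open>L\<close>; if \<open>X\<close> is dual to the unit as
  well, the unit splits and \<open>X\<close> belongs to the subtopos (\<open>subtopos_fixed\<close>).

  The presentation of the topos by a small site serves to prove the representability of sheaves and
  to bound the size of families.  The site need not be subcanonical, so its objects are first replaced by their
  sheafifications, given by the same construction with relations; the result is a functor
  \<open>G\<close> from the site to the topos with the properties collected in the locale
  \<open>generated_topos\<close>.
\<close>

section \<open>Small sets\<close>

definition small_in :: "'u itself \<Rightarrow> 'x set \<Rightarrow> bool" where
  "small_in U A \<longleftrightarrow> A \<prec> (UNIV :: 'u set)"

lemma small_in_lepoll: "small_in U B \<Longrightarrow> A \<lesssim> B \<Longrightarrow> small_in U A"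
  unfolding small_in_def by (rule lesspoll_trans1)

lemma small_in_subset: "small_in U B \<Longrightarrow> A \<subseteq> B \<Longrightarrow> small_in U A"
  using small_in_lepoll subset_imp_lepoll by blast

lemma small_in_image: "small_in U A \<Longrightarrow> small_in U (f ` A)"
  using small_in_lepoll image_lepoll by blast

lemma small_in_inj: "small_in U B \<Longrightarrow> inj_on f A \<Longrightarrow> f ` A \<subseteq> B \<Longrightarrow> small_in U A"
  using small_in_lepoll unfolding lepoll_def by blast

lemma small_in_self: "small_in TYPE('u) (A :: 'u set) \<longleftrightarrow> small A"
  by (simp add: small_in_def small_def)

lemma small_in_code:
  assumes "small_in TYPE('u) A"
  obtains e :: "'x \<Rightarrow> 'u" where "inj_on e A" "small (e ` A)"
proof -
  obtain e :: "'x \<Rightarrow> 'u" where e: "inj_on e A"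
    using assms unfolding small_in_def lesspoll_def lepoll_def by blast
  have "small (e ` A)"
    using small_in_image[OF assms, of e] by (simp add: small_in_self)
  with e show thesis by (rule that)
qed

lemma small_in_Pow:
  assumes "universe TYPE('u)" "small_in TYPE('u) A"
  shows "small_in TYPE('u) (Pow A)"
proof -
  obtain e :: "'a \<Rightarrow> 'u" where e: "inj_on e A" "small (e ` A)"
    using assms(2) by (rule small_in_code)
  have "Pow (e ` A) \<prec> (UNIV :: 'u set)"
    using assms(1) e(2) unfolding universe_def by blast
  hence "small_in TYPE('u) (Pow (e ` A))" by (simp add: small_in_def)
  moreover have "inj_on ((`) e) (Pow A)"
    using e(1) by (rule inj_on_image_Pow)
  ultimately show ?thesis
    by (rule small_in_inj) auto
qed

text \<open>Pairs of elements of \<open>'u\<close> can be coded by elements of \<open>'u\<close>, which makes a union over a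
  small index set of any type an instance of the regularity of the universe.\<close>

lemma small_in_UN:
  assumes U: "universe TYPE('u)" and I: "small_in TYPE('u) I"
    and B: "\<And>i. i \<in> I \<Longrightarrow> small_in TYPE('u) (B i)"
  shows "small_in TYPE('u) (\<Union>i\<in>I. B i)"
proof -
  have "infinite (UNIV :: 'u set)"
    using U unfolding universe_def
    by (meson infinite_le_lepoll lesspoll_imp_lepoll)
  hence "(UNIV :: 'u set) \<times> (UNIV :: 'u set) \<approx> (UNIV :: 'u set)"
    using card_of_Times_same_infinite eqpoll_iff_card_of_ordIso by blast
  then obtain p :: "'u \<times> 'u \<Rightarrow> 'u" where p: "inj p"
    unfolding eqpoll_def bij_betw_def by auto
  obtain e :: "'a \<Rightarrow> 'u" where e: "inj_on e I" "small (e ` I)"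
    using I by (rule small_in_code)
  have "\<exists>d :: 'b \<Rightarrow> 'u. inj_on d (B i) \<and> small (d ` B i)" if "i \<in> I" for i
    using B[OF that] by (meson small_in_code)
  then obtain d :: "'a \<Rightarrow> 'b \<Rightarrow> 'u" where
    d: "\<And>i. i \<in> I \<Longrightarrow> inj_on (d i) (B i)" "\<And>i. i \<in> I \<Longrightarrow> small (d i ` B i)"
    by metis
  define ie where "ie = the_inv_into I e"
  have ie: "ie (e i) = i" if "i \<in> I" for i
    unfolding ie_def using e(1) that by (rule the_inv_into_f_f)
  define D where "D = (\<Union>k\<in>e ` I. (\<lambda>b. p (k, b)) ` (d (ie k) ` B (ie k)))"
  have "small ((\<lambda>b. p (k, b)) ` (d (ie k) ` B (ie k)))" if "k \<in> e ` I" for k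
  proof -
    from that obtain i where "i \<in> I" "k = e i" by blast
    thus ?thesis
      using small_in_image[of "TYPE('u)" "d i ` B i" "\<lambda>b. p (k, b)"] d(2) ie
      by (simp add: small_in_self)
  qed
  moreover have "\<forall>(A :: 'u set) B. small A \<longrightarrow> (\<forall>x\<in>A. small (B x :: 'u set)) \<longrightarrow> small (\<Union>x\<in>A. B x)"
    using U unfolding universe_def by (elim conjE)
  ultimately have D: "small D"
    using e(2) unfolding D_def by meson
  define c where "c = (\<lambda>x. SOME i. i \<in> I \<and> x \<in> B i)"
  have c: "c x \<in> I \<and> x \<in> B (c x)" if "x \<in> (\<Union>i\<in>I. B i)" for x
    unfolding c_def by (rule someI_ex) (use that in blast)
  have "inj_on (\<lambda>x. p (e (c x), d (c x) x)) (\<Union>i\<in>I. B i)"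
  proof (rule inj_onI)
    fix x y assume x: "x \<in> (\<Union>i\<in>I. B i)" and y: "y \<in> (\<Union>i\<in>I. B i)"
      and eq: "p (e (c x), d (c x) x) = p (e (c y), d (c y) y)"
    have "e (c x) = e (c y)" "d (c x) x = d (c y) y"
      using injD[OF p eq] by auto
    moreover from this have "c x = c y"
      using c[OF x] c[OF y] e(1) by (auto dest: inj_onD)
    ultimately show "x = y"
      using c[OF x] c[OF y] d(1) by (metis inj_onD)
  qed
  moreover have "(\<lambda>x. p (e (c x), d (c x) x)) ` (\<Union>i\<in>I. B i) \<subseteq> D"
  proof
    fix z assume "z \<in> (\<lambda>x. p (e (c x), d (c x) x)) ` (\<Union>i\<in>I. B i)"
    then obtain x where x: "x \<in> (\<Union>i\<in>I. B i)" "z = p (e (c x), d (c x) x)" by blast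
    show "z \<in> D"
      unfolding D_def x(2) using c[OF x(1)] ie by auto
  qed
  moreover have "small_in TYPE('u) D" using D by (simp add: small_in_self)
  ultimately show ?thesis by (metis small_in_inj)
qed

lemma small_in_Times:
  assumes "universe TYPE('u)" "small_in TYPE('u) A" "small_in TYPE('u) B"
  shows "small_in TYPE('u) (A \<times> B)"
proof -
  have "A \<times> B = (\<Union>a\<in>A. Pair a ` B)" by auto
  moreover have "small_in TYPE('u) (\<Union>a\<in>A. Pair a ` B)"
    by (intro small_in_UN assms small_in_image)
  ultimately show ?thesis by simp
qed


section \<open>Categories, sieves and pullbacks\<close>

context category
begin

lemma hom_iff: "f \<in> hom C a b \<longleftrightarrow> f \<in> Arr C \<and> Dom C f = a \<and> Cod C f = b"
  by (simp add: hom_def)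

lemma homI: "f \<in> Arr C \<Longrightarrow> Dom C f = a \<Longrightarrow> Cod C f = b \<Longrightarrow> f \<in> hom C a b"
  by (simp add: hom_def)

lemma comp_arr [simp]:
  assumes "f \<in> Arr C" "g \<in> Arr C" "Cod C f = Dom C g"
  shows "g \<cdot> f \<in> Arr C" "Dom C (g \<cdot> f) = Dom C f" "Cod C (g \<cdot> f) = Cod C g"
  using comp_hom[of f "Dom C f" "Cod C f" g "Cod C g"] assms by (auto simp: hom_def)

lemma comp_assoc [simp]:
  assumes "f \<in> Arr C" "g \<in> Arr C" "h \<in> Arr C" "Cod C f = Dom C g" "Cod C g = Dom C h"
  shows "h \<cdot> g \<cdot> f = h \<cdot> (g \<cdot> f)"
  using assoc[of f "Dom C f" "Cod C f" g "Cod C g" h "Cod C h"] assms by (auto simp: hom_def)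

lemma id_arr [simp]:
  assumes "a \<in> Ob C"
  shows "Idn C a \<in> Arr C" "Dom C (Idn C a) = a" "Cod C (Idn C a) = a"
  using id_hom[OF assms] by (auto simp: hom_def)

lemma id_comp [simp]: "f \<in> Arr C \<Longrightarrow> Cod C f = a \<Longrightarrow> Idn C a \<cdot> f = f"
  using id_left[of f "Dom C f" a] by (simp add: hom_def)

lemma comp_id [simp]: "f \<in> Arr C \<Longrightarrow> Dom C f = a \<Longrightarrow> f \<cdot> Idn C a = f"
  using id_right[of f a "Cod C f"] by (simp add: hom_def)

lemma ob [simp]: "f \<in> Arr C \<Longrightarrow> Dom C f \<in> Ob C" "f \<in> Arr C \<Longrightarrow> Cod C f \<in> Ob C"
  by (auto intro: dom_Ob cod_Ob)

lemma sieve_arr: "is_sieve C c S \<Longrightarrow> f \<in> S \<Longrightarrow> f \<in> Arr C \<and> Cod C f = c"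
  unfolding is_sieve_def by blast

lemma sieve_comp:
  "is_sieve C c S \<Longrightarrow> f \<in> S \<Longrightarrow> g \<in> Arr C \<Longrightarrow> Cod C g = Dom C f \<Longrightarrow> f \<cdot> g \<in> S"
  unfolding is_sieve_def by blast

lemma pullback_sieve_iff:
  "g \<in> pullback_sieve C f S \<longleftrightarrow> g \<in> Arr C \<and> Cod C g = Dom C f \<and> f \<cdot> g \<in> S"
  by (simp add: pullback_sieve_def)

lemma pullback_sieve_sieve:
  "is_sieve C c S \<Longrightarrow> f \<in> Arr C \<Longrightarrow> Cod C f = c \<Longrightarrow> is_sieve C (Dom C f) (pullback_sieve C f S)"
  unfolding is_sieve_def pullback_sieve_def by (force simp flip: comp_assoc)

lemma pullback_sieve_comp:
  assumes "f \<in> Arr C" "g \<in> Arr C" "Cod C g = Dom C f"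
  shows "pullback_sieve C g (pullback_sieve C f S) = pullback_sieve C (f \<cdot> g) S"
  using assms unfolding pullback_sieve_def by auto

lemma pullback_sieve_id:
  "is_sieve C c S \<Longrightarrow> c \<in> Ob C \<Longrightarrow> pullback_sieve C (Idn C c) S = S"
  unfolding is_sieve_def pullback_sieve_def by auto

lemma max_sieve: "is_sieve C c {f \<in> Arr C. Cod C f = c}"
  unfolding is_sieve_def by auto

lemma pullback_sieve_mem:
  assumes "is_sieve C c S" "f \<in> S"
  shows "pullback_sieve C f S = {g \<in> Arr C. Cod C g = Dom C f}"
  using assms unfolding is_sieve_def pullback_sieve_def by auto

end

definition gen_sieve :: "('o, 'a) cat \<Rightarrow> 'a set \<Rightarrow> 'a set" where
  "gen_sieve C B = {Comp C b g |b g. b \<in> B \<and> g \<in> Arr C \<and> Cod C g = Dom C b}"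

context category
begin

lemma gen_sieve_sieve:
  assumes "\<And>b. b \<in> B \<Longrightarrow> b \<in> Arr C \<and> Cod C b = c"
  shows "is_sieve C c (gen_sieve C B)"
  unfolding is_sieve_def
proof (intro conjI ballI impI subsetI)
  fix f assume "f \<in> gen_sieve C B"
  thus "f \<in> {f \<in> Arr C. Cod C f = c}" unfolding gen_sieve_def using assms by auto
next
  fix f g assume "f \<in> gen_sieve C B" and g: "g \<in> Arr C" "Cod C g = Dom C f"
  then obtain b h where "b \<in> B" "h \<in> Arr C" "Cod C h = Dom C b" "f = b \<cdot> h"
    unfolding gen_sieve_def by blast
  thus "f \<cdot> g \<in> gen_sieve C B"
    unfolding gen_sieve_def using assms g by (intro CollectI exI[of _ b] exI[of _ "h \<cdot> g"]) auto
qed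

lemma gen_sieveI: "b \<in> B \<Longrightarrow> g \<in> Arr C \<Longrightarrow> Cod C g = Dom C b \<Longrightarrow> b \<cdot> g \<in> gen_sieve C B"
  unfolding gen_sieve_def by blast

lemma gen_sieve_base:
  assumes "b \<in> B" "b \<in> Arr C" shows "b \<in> gen_sieve C B"
  using gen_sieveI[of b B "Idn C (Dom C b)"] assms by simp

lemma monoD:
  assumes "is_mono C m" "m \<cdot> g = m \<cdot> h" "g \<in> Arr C" "h \<in> Arr C"
    "Cod C g = Dom C m" "Cod C h = Dom C m" "Dom C g = Dom C h"
  shows "g = h"
  using assms unfolding is_mono_def by blast

lemma mono_arr: "is_mono C m \<Longrightarrow> m \<in> Arr C"
  unfolding is_mono_def by blast

lemma pullbackD:
  assumes "is_pullback C f g p q"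
  shows "f \<in> Arr C" "g \<in> Arr C" "Cod C f = Cod C g" "p \<in> Arr C" "q \<in> Arr C"
    "Dom C q = Dom C p" "Cod C p = Dom C f" "Cod C q = Dom C g" "f \<cdot> p = g \<cdot> q"
  using assms unfolding is_pullback_def hom_def by auto

lemma pullback_lift:
  assumes "is_pullback C f g p q" "a \<in> Arr C" "b \<in> Arr C" "Dom C a = Dom C b"
    "Cod C a = Dom C f" "Cod C b = Dom C g" "f \<cdot> a = g \<cdot> b"
  obtains u where "u \<in> Arr C" "Dom C u = Dom C a" "Cod C u = Dom C p" "p \<cdot> u = a" "q \<cdot> u = b"
proof -
  have "Dom C a \<in> Ob C" "a \<in> hom C (Dom C a) (Dom C f)" "b \<in> hom C (Dom C a) (Dom C g)"
    using assms by (auto simp: hom_def)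
  hence "\<exists>!u. u \<in> hom C (Dom C a) (Dom C p) \<and> p \<cdot> u = a \<and> q \<cdot> u = b"
    using assms(1,7) unfolding is_pullback_def by blast
  thus thesis using that by (auto simp: hom_iff)
qed

lemma pullback_comp:
  assumes pb: "is_pullback C f g p q" and u: "u \<in> Arr C" "Cod C u = Dom C p"
  shows "f \<cdot> (p \<cdot> u) = g \<cdot> (q \<cdot> u)"
proof -
  note D = pullbackD[OF pb]
  have "f \<cdot> p \<cdot> u = g \<cdot> q \<cdot> u" by (simp only: D(9))
  thus ?thesis using D(1-8) u by simp
qed

lemma pullback_eq:
  assumes pb: "is_pullback C f g p q" and "u \<in> Arr C" "v \<in> Arr C" "Dom C u = Dom C v"
    "Cod C u = Dom C p" "Cod C v = Dom C p" "p \<cdot> u = p \<cdot> v" "q \<cdot> u = q \<cdot> v"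
  shows "u = v"
proof -
  note D = pullbackD[OF pb]
  have "f \<cdot> (p \<cdot> u) = g \<cdot> (q \<cdot> u)"
    using pb assms by (intro pullback_comp)
  moreover have "Dom C u \<in> Ob C" "p \<cdot> u \<in> hom C (Dom C u) (Dom C f)"
    "q \<cdot> u \<in> hom C (Dom C u) (Dom C g)"
    using D assms by (auto simp: hom_def)
  ultimately have "\<exists>!w. w \<in> hom C (Dom C u) (Dom C p) \<and> p \<cdot> w = p \<cdot> u \<and> q \<cdot> w = q \<cdot> u"
    using pb unfolding is_pullback_def by blast
  thus ?thesis using assms by (metis homI)
qed

lemma pullback_mono:
  assumes pb: "is_pullback C m x p q" and m: "is_mono C m"
  shows "is_mono C q"
  unfolding is_mono_def
proof (intro conjI ballI impI)
  note D = pullbackD[OF pb]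
  show "q \<in> Arr C" by (rule D)
  fix g h assume h: "g \<in> Arr C" "h \<in> Arr C" "Cod C g = Dom C q" "Cod C h = Dom C q"
     "Dom C g = Dom C h" "q \<cdot> g = q \<cdot> h"
  have "m \<cdot> (p \<cdot> g) = m \<cdot> (p \<cdot> h)"
    using pullback_comp[OF pb] D h by metis
  hence "p \<cdot> g = p \<cdot> h"
    by (rule monoD[OF m]) (use D(1-8) h(1-5) in simp_all)
  thus "g = h"
    by (intro pullback_eq[OF pb, of g h]) (use D(1-8) h in simp_all)
qed

lemma isoE:
  assumes "is_iso C f"
  obtains g where "g \<in> Arr C" "Dom C g = Cod C f" "Cod C g = Dom C f"
    "g \<cdot> f = Idn C (Dom C f)" "f \<cdot> g = Idn C (Cod C f)"
  using assms unfolding is_iso_def hom_def by auto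

lemma isoI:
  assumes "f \<in> Arr C" "g \<in> Arr C" "Dom C g = Cod C f" "Cod C g = Dom C f"
    "g \<cdot> f = Idn C (Dom C f)" "f \<cdot> g = Idn C (Cod C f)"
  shows "is_iso C f"
  using assms unfolding is_iso_def hom_def by auto

lemma iso_arr: "is_iso C f \<Longrightarrow> f \<in> Arr C"
  by (simp add: is_iso_def)

lemma retraction_mono:
  assumes "f \<in> Arr C" "g \<in> Arr C" "Dom C g = Cod C f" "Cod C g = Dom C f"
    "g \<cdot> f = Idn C (Dom C f)"
  shows "is_mono C f"
  unfolding is_mono_def
proof (intro conjI ballI impI)
  fix a b assume h: "a \<in> Arr C" "b \<in> Arr C" "Cod C a = Dom C f" "Cod C b = Dom C f"
     "f \<cdot> a = f \<cdot> b"
  have "g \<cdot> f \<cdot> a = g \<cdot> f \<cdot> b" using h assms(1-4) by simp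
  thus "a = b" using h assms by simp
qed (rule assms)

lemma iso_mono: "is_iso C f \<Longrightarrow> is_mono C f"
  by (metis isoE iso_arr retraction_mono)

lemma mono_split_iso:
  assumes q: "is_mono C q" and s: "s \<in> Arr C" "Dom C s = Cod C q" "Cod C s = Dom C q"
    and qs: "q \<cdot> s = Idn C (Cod C q)"
  shows "is_iso C q"
proof -
  have a: "q \<in> Arr C" using q by (rule mono_arr)
  have "q \<cdot> (s \<cdot> q) = q \<cdot> Idn C (Dom C q)"
    using a s qs comp_assoc[of q s q] by simp
  hence "s \<cdot> q = Idn C (Dom C q)"
    by (rule monoD[OF q]) (use a s in auto)
  thus ?thesis using a s qs by (intro isoI) auto
qed

lemma pullback_of_factor_iso:
  assumes pb: "is_pullback C m x p q" and m: "is_mono C m"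
    and t: "t \<in> Arr C" "Dom C t = Dom C x" "Cod C t = Dom C m" "m \<cdot> t = x"
  shows "is_iso C q"
proof -
  note D = pullbackD[OF pb]
  have 1: "t \<in> Arr C" "Idn C (Dom C x) \<in> Arr C" "Dom C t = Dom C (Idn C (Dom C x))"
    "Cod C (Idn C (Dom C x)) = Dom C x" "m \<cdot> t = x \<cdot> Idn C (Dom C x)"
    using D(2) t by auto
  obtain u where u: "u \<in> Arr C" "Dom C u = Dom C t" "Cod C u = Dom C p" "q \<cdot> u = Idn C (Dom C x)"
    by (rule pullback_lift[OF pb 1(1,2,3) t(3) 1(4,5)])
  show ?thesis
    by (rule mono_split_iso[OF pullback_mono[OF pb m] u(1)]) (simp_all add: u D(6,8) t(2))
qed

end


section \<open>Presheaves, sheaves and local properties\<close>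

text \<open>A presheaf is a family of sets \<open>P\<close> over the objects with a restriction operation \<open>r\<close>.
  The values may have any type: the presheaves represented by the objects of a large category
  and the presheaves of sieves or relations on it do not take values in a fixed category of sets.\<close>

definition presheaf :: "('o, 'a) cat \<Rightarrow> ('o \<Rightarrow> 'x set) \<Rightarrow> ('a \<Rightarrow> 'x \<Rightarrow> 'x) \<Rightarrow> bool" where
  "presheaf C P r \<longleftrightarrow>
     (\<forall>f \<in> Arr C. \<forall>x \<in> P (Cod C f). r f x \<in> P (Dom C f)) \<and>
     (\<forall>a \<in> Ob C. \<forall>x \<in> P a. r (Idn C a) x = x) \<and>
     (\<forall>f \<in> Arr C. \<forall>g \<in> Arr C. Cod C f = Dom C g \<longrightarrow>
        (\<forall>x \<in> P (Cod C g). r (Comp C g f) x = r f (r g x)))"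

definition glues :: "('o, 'a) cat \<Rightarrow> ('o \<Rightarrow> 'x set) \<Rightarrow> ('a \<Rightarrow> 'x \<Rightarrow> 'x) \<Rightarrow> 'o \<Rightarrow> 'a set \<Rightarrow> bool" where
  "glues C P r c S \<longleftrightarrow> (\<forall>x. (\<forall>f \<in> S. x f \<in> P (Dom C f)) \<longrightarrow>
     (\<forall>f \<in> S. \<forall>g \<in> Arr C. Cod C g = Dom C f \<longrightarrow> r g (x f) = x (Comp C f g)) \<longrightarrow>
     (\<exists>!y. y \<in> P c \<and> (\<forall>f \<in> S. r f y = x f)))"

definition sheaf ::
    "('o, 'a) cat \<Rightarrow> ('o \<Rightarrow> 'a set set) \<Rightarrow> ('o \<Rightarrow> 'x set) \<Rightarrow> ('a \<Rightarrow> 'x \<Rightarrow> 'x) \<Rightarrow> bool" where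
  "sheaf C Cov P r \<longleftrightarrow> presheaf C P r \<and> (\<forall>c \<in> Ob C. \<forall>S \<in> Cov c. glues C P r c S)"

lemma presheafD:
  assumes "presheaf C P r"
  shows "f \<in> Arr C \<Longrightarrow> Cod C f = c \<Longrightarrow> x \<in> P c \<Longrightarrow> r f x \<in> P (Dom C f)"
    and "a \<in> Ob C \<Longrightarrow> x \<in> P a \<Longrightarrow> r (Idn C a) x = x"
    and "f \<in> Arr C \<Longrightarrow> g \<in> Arr C \<Longrightarrow> Cod C f = Dom C g \<Longrightarrow> Cod C g = c \<Longrightarrow> x \<in> P c
           \<Longrightarrow> r (Comp C g f) x = r f (r g x)"
  using assms unfolding presheaf_def by blast+

lemma gluesD:
  assumes "glues C P r c S" "\<And>f. f \<in> S \<Longrightarrow> x f \<in> P (Dom C f)"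
    "\<And>f g. f \<in> S \<Longrightarrow> g \<in> Arr C \<Longrightarrow> Cod C g = Dom C f \<Longrightarrow> r g (x f) = x (Comp C f g)"
  obtains y where "y \<in> P c" "\<And>f. f \<in> S \<Longrightarrow> r f y = x f"
proof -
  have "\<exists>!y. y \<in> P c \<and> (\<forall>f \<in> S. r f y = x f)"
    using assms unfolding glues_def by simp
  thus thesis using that by blast
qed

context category
begin

lemma glues_sep:
  assumes P: "presheaf C P r" and S: "is_sieve C c S" and g: "glues C P r c S"
    and xy: "x \<in> P c" "y \<in> P c" "\<And>f. f \<in> S \<Longrightarrow> r f x = r f y"
  shows "x = y"
proof -
  have "r f x \<in> P (Dom C f)" if "f \<in> S" for f
    using presheafD(1)[OF P, of f c x] sieve_arr[OF S that] xy(1) by simp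
  moreover have "r h (r f x) = r (f \<cdot> h) x" if "f \<in> S" "h \<in> Arr C" "Cod C h = Dom C f" for f h
    using presheafD(3)[OF P, of h f c x] sieve_arr[OF S that(1)] that xy(1) by simp
  ultimately have "\<exists>!z. z \<in> P c \<and> (\<forall>f\<in>S. r f z = r f x)"
    using g unfolding glues_def by simp
  thus ?thesis using xy by metis
qed

lemma glues_max:
  assumes P: "presheaf C P r" and c: "c \<in> Ob C"
  shows "glues C P r c {f \<in> Arr C. Cod C f = c}"
  unfolding glues_def
proof (intro allI impI)
  fix x assume x: "\<forall>f \<in> {f \<in> Arr C. Cod C f = c}. x f \<in> P (Dom C f)"
    "\<forall>f \<in> {f \<in> Arr C. Cod C f = c}. \<forall>g \<in> Arr C. Cod C g = Dom C f \<longrightarrow> r g (x f) = x (f \<cdot> g)"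
  show "\<exists>!y. y \<in> P c \<and> (\<forall>f \<in> {f \<in> Arr C. Cod C f = c}. r f y = x f)"
  proof (rule ex1I[of _ "x (Idn C c)"])
    have "x (Idn C c) \<in> P c" using x(1) c by (metis (mono_tags, lifting) id_arr mem_Collect_eq)
    moreover have "r f (x (Idn C c)) = x f" if "f \<in> Arr C" "Cod C f = c" for f
      using x(2) c that by (metis (mono_tags, lifting) id_arr id_comp mem_Collect_eq)
    ultimately show "x (Idn C c) \<in> P c \<and> (\<forall>f\<in>{f \<in> Arr C. Cod C f = c}. r f (x (Idn C c)) = x f)"
      by blast
  next
    fix y assume "y \<in> P c \<and> (\<forall>f \<in> {f \<in> Arr C. Cod C f = c}. r f y = x f)"
    thus "y = x (Idn C c)"
      using presheafD(2)[OF P c, of y] c by (metis (mono_tags, lifting) id_arr(1,3) mem_Collect_eq)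
  qed
qed

end

text \<open>The sieves on which \<open>P\<close> satisfies the sheaf condition universally.  They form the finest
  topology for which \<open>P\<close> is a sheaf.\<close>

definition glue_top :: "('o, 'a) cat \<Rightarrow> ('o \<Rightarrow> 'x set) \<Rightarrow> ('a \<Rightarrow> 'x \<Rightarrow> 'x) \<Rightarrow> 'o \<Rightarrow> 'a set set" where
  "glue_top C P r c = {S. is_sieve C c S \<and>
     (\<forall>f \<in> Arr C. Cod C f = c \<longrightarrow> glues C P r (Dom C f) (pullback_sieve C f S))}"

context category
begin

lemma glue_topD:
  assumes "S \<in> glue_top C P r c"
  shows "is_sieve C c S"
    and "f \<in> Arr C \<Longrightarrow> Cod C f = c \<Longrightarrow> glues C P r (Dom C f) (pullback_sieve C f S)"
    and "c \<in> Ob C \<Longrightarrow> glues C P r c S"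
proof -
  show 1: "is_sieve C c S" using assms unfolding glue_top_def by blast
  show 2: "f \<in> Arr C \<Longrightarrow> Cod C f = c \<Longrightarrow> glues C P r (Dom C f) (pullback_sieve C f S)" for f
    using assms unfolding glue_top_def by blast
  show "c \<in> Ob C \<Longrightarrow> glues C P r c S"
    using 2[of "Idn C c"] pullback_sieve_id[OF 1] by simp
qed

lemma glue_top_pullback:
  assumes "S \<in> glue_top C P r c" "f \<in> Arr C" "Cod C f = c"
  shows "pullback_sieve C f S \<in> glue_top C P r (Dom C f)"
proof -
  have "glues C P r (Dom C g) (pullback_sieve C g (pullback_sieve C f S))"
    if g: "g \<in> Arr C" "Cod C g = Dom C f" for g
    using glue_topD(2)[OF assms(1), of "f \<cdot> g"] g assms(2,3) by (simp add: pullback_sieve_comp)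
  thus ?thesis
    using pullback_sieve_sieve[OF glue_topD(1)[OF assms(1)] assms(2,3)]
    unfolding glue_top_def by simp
qed

text \<open>On each member \<open>f\<close> of \<open>S\<close> a compatible family on \<open>S'\<close> restricts to one on a covering sieve
  and so has an amalgamation \<open>t f\<close>.  The \<open>t f\<close> are compatible because covering sieves separate,
  hence they glue over \<open>S\<close>; that the result restricts to the given family on all of \<open>S'\<close>, not only
  on the members that factor through \<open>S\<close>, is checked on the pullbacks of \<open>S\<close>.\<close>

lemma glues_trans:
  assumes P: "presheaf C P r" and c: "c \<in> Ob C"
    and S: "S \<in> glue_top C P r c" and S': "is_sieve C c S'"
    and loc: "\<And>f. f \<in> S \<Longrightarrow> pullback_sieve C f S' \<in> glue_top C P r (Dom C f)"
  shows "glues C P r c S'"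
proof -
  note sS = glue_topD(1)[OF S] and gS = glue_topD(3)[OF S c]
  have aS: "f \<in> Arr C" "Cod C f = c" if "f \<in> S" for f using sieve_arr[OF sS that] by auto
  have aS': "f \<in> Arr C" "Cod C f = c" if "f \<in> S'" for f using sieve_arr[OF S' that] by auto
  have sep: "x = y" if xy: "x \<in> P c" "y \<in> P c" "\<And>f. f \<in> S' \<Longrightarrow> r f x = r f y" for x y
  proof (rule glues_sep[OF P sS gS xy(1,2)])
    fix f assume f: "f \<in> S"
    note a = aS[OF f]
    show "r f x = r f y"
    proof (rule glues_sep[OF P glue_topD(1)[OF loc[OF f]] glue_topD(3)[OF loc[OF f]]])
      show "Dom C f \<in> Ob C" using a by simp
      show "r f x \<in> P (Dom C f)" "r f y \<in> P (Dom C f)"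
        using a xy(1,2) by (auto intro: presheafD(1)[OF P])
      fix g assume "g \<in> pullback_sieve C f S'"
      hence "g \<in> Arr C" "Cod C g = Dom C f" "f \<cdot> g \<in> S'" by (auto simp: pullback_sieve_iff)
      thus "r g (r f x) = r g (r f y)"
        using xy a presheafD(3)[OF P, of g f c] by metis
    qed
  qed
  show ?thesis
    unfolding glues_def
  proof (intro allI impI)
    fix s assume s: "\<forall>f\<in>S'. s f \<in> P (Dom C f)"
      "\<forall>f\<in>S'. \<forall>g\<in>Arr C. Cod C g = Dom C f \<longrightarrow> r g (s f) = s (f \<cdot> g)"
    have "\<exists>t. t \<in> P (Dom C f) \<and> (\<forall>g\<in>pullback_sieve C f S'. r g t = s (f \<cdot> g))" if f: "f \<in> S" for f
    proof -
      note a = aS[OF f]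
      have "glues C P r (Dom C f) (pullback_sieve C f S')"
        using glue_topD(3)[OF loc[OF f]] a by simp
      then obtain t where "t \<in> P (Dom C f)" "\<And>g. g \<in> pullback_sieve C f S' \<Longrightarrow> r g t = s (f \<cdot> g)"
        by (rule gluesD[where x = "\<lambda>g. s (f \<cdot> g)"])
           (use s a in \<open>force simp: pullback_sieve_iff\<close>)+
      thus ?thesis by blast
    qed
    then obtain t where t: "\<And>f. f \<in> S \<Longrightarrow> t f \<in> P (Dom C f)"
        "\<And>f g. f \<in> S \<Longrightarrow> g \<in> pullback_sieve C f S' \<Longrightarrow> r g (t f) = s (f \<cdot> g)"
      by metis
    have tm: "r h (t f) = t (f \<cdot> h)" if f: "f \<in> S" and h: "h \<in> Arr C" "Cod C h = Dom C f" for f h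
    proof -
      note a = aS[OF f]
      have fh: "f \<cdot> h \<in> S" using sieve_comp[OF sS f h] .
      show ?thesis
      proof (rule glues_sep[OF P glue_topD(1)[OF loc[OF fh]] glue_topD(3)[OF loc[OF fh]]])
        show "Dom C (f \<cdot> h) \<in> Ob C" using a h by simp
        show "r h (t f) \<in> P (Dom C (f \<cdot> h))"
          using a h t(1)[OF f] presheafD(1)[OF P, of h "Dom C f"] by simp
        show "t (f \<cdot> h) \<in> P (Dom C (f \<cdot> h))" using t(1)[OF fh] .
        fix k assume k: "k \<in> pullback_sieve C (f \<cdot> h) S'"
        hence k': "k \<in> Arr C" "Cod C k = Dom C h" "f \<cdot> (h \<cdot> k) \<in> S'"
          using a h by (auto simp: pullback_sieve_iff)
        have "r k (r h (t f)) = r (h \<cdot> k) (t f)"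
          using presheafD(3)[OF P k'(1) h(1) k'(2) h(2) t(1)[OF f]] by simp
        also have "\<dots> = s (f \<cdot> (h \<cdot> k))"
          using t(2)[OF f, of "h \<cdot> k"] h k' by (simp add: pullback_sieve_iff)
        also have "\<dots> = r k (t (f \<cdot> h))"
          using t(2)[OF fh k] a h k' by simp
        finally show "r k (r h (t f)) = r k (t (f \<cdot> h))" .
      qed
    qed
    obtain y where y: "y \<in> P c" "\<And>f. f \<in> S \<Longrightarrow> r f y = t f"
      by (rule gluesD[OF gS, of t]) (use t tm in auto)
    have "r g y = s g" if g: "g \<in> S'" for g
    proof -
      note a = aS'[OF g]
      have gSt: "pullback_sieve C g S \<in> glue_top C P r (Dom C g)"
        using glue_top_pullback[OF S a] .
      show ?thesis
      proof (rule glues_sep[OF P glue_topD(1)[OF gSt] glue_topD(3)[OF gSt]])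
        show "Dom C g \<in> Ob C" using a by simp
        show "r g y \<in> P (Dom C g)" using presheafD(1)[OF P a y(1)] .
        show "s g \<in> P (Dom C g)" using s(1) g by blast
        fix k assume "k \<in> pullback_sieve C g S"
        hence k: "k \<in> Arr C" "Cod C k = Dom C g" "g \<cdot> k \<in> S" by (auto simp: pullback_sieve_iff)
        have "r k (r g y) = r (g \<cdot> k) y"
          using presheafD(3)[OF P k(1) a(1) k(2) a(2) y(1)] by simp
        also have "\<dots> = t (g \<cdot> k)" using y(2)[OF k(3)] .
        also have "\<dots> = r (Idn C (Dom C k)) (t (g \<cdot> k))"
          using presheafD(2)[OF P _ t(1)[OF k(3)]] k a by simp
        also have "\<dots> = s (g \<cdot> k)"
          using t(2)[OF k(3), of "Idn C (Dom C k)"] sieve_comp[OF S' g k(1,2)] k a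
          by (simp add: pullback_sieve_iff)
        also have "\<dots> = r k (s g)" using s(2) g k by simp
        finally show "r k (r g y) = r k (s g)" .
      qed
    qed
    thus "\<exists>!y. y \<in> P c \<and> (\<forall>f\<in>S'. r f y = s f)"
      using y(1) sep by (intro ex1I[of _ y]) auto
  qed
qed

lemma glue_top_topology:
  assumes P: "presheaf C P r"
  shows "grothendieck_topology C (glue_top C P r)"
  unfolding grothendieck_topology_def
proof (intro conjI ballI allI impI)
  fix c S assume "S \<in> glue_top C P r c"
  thus "is_sieve C c S" by (rule glue_topD)
next
  fix c assume "c \<in> Ob C"
  have "pullback_sieve C f {f \<in> Arr C. Cod C f = c} = {g \<in> Arr C. Cod C g = Dom C f}"
    if "f \<in> Arr C" "Cod C f = c" for f
    using that by (intro pullback_sieve_mem[OF max_sieve]) simp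
  thus "{f \<in> Arr C. Cod C f = c} \<in> glue_top C P r c"
    unfolding glue_top_def by (simp add: max_sieve glues_max[OF P])
next
  fix f S assume "f \<in> Arr C" "S \<in> glue_top C P r (Cod C f)"
  thus "pullback_sieve C f S \<in> glue_top C P r (Dom C f)" by (intro glue_top_pullback) auto
next
  fix c S S' assume c: "c \<in> Ob C" and S: "S \<in> glue_top C P r c" and S': "is_sieve C c S'"
    and loc: "\<forall>f\<in>S. pullback_sieve C f S' \<in> glue_top C P r (Dom C f)"
  have "glues C P r (Dom C h) (pullback_sieve C h S')" if h: "h \<in> Arr C" "Cod C h = c" for h
  proof (rule glues_trans[OF P _ glue_top_pullback[OF S h] pullback_sieve_sieve[OF S' h]])
    show "Dom C h \<in> Ob C" using h by simp
    fix f assume "f \<in> pullback_sieve C h S"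
    hence f: "f \<in> Arr C" "Cod C f = Dom C h" "h \<cdot> f \<in> S" by (auto simp: pullback_sieve_iff)
    have "pullback_sieve C (h \<cdot> f) S' \<in> glue_top C P r (Dom C (h \<cdot> f))" using loc f(3) by blast
    thus "pullback_sieve C f (pullback_sieve C h S') \<in> glue_top C P r (Dom C f)"
      using f h by (simp add: pullback_sieve_comp)
  qed
  thus "S' \<in> glue_top C P r c" using S' unfolding glue_top_def by blast
qed

end

locale site = category C for C :: "('o, 'a) cat" (structure) +
  fixes Cov :: "'o \<Rightarrow> 'a set set"
  assumes topology: "grothendieck_topology C Cov"
begin

lemma cov_sieve: "S \<in> Cov c \<Longrightarrow> c \<in> Ob C \<Longrightarrow> is_sieve C c S"
  using topology unfolding grothendieck_topology_def by blast

lemma cov_max: "c \<in> Ob C \<Longrightarrow> {f \<in> Arr C. Cod C f = c} \<in> Cov c"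
  using topology unfolding grothendieck_topology_def by blast

lemma cov_pullback: "S \<in> Cov c \<Longrightarrow> f \<in> Arr C \<Longrightarrow> Cod C f = c \<Longrightarrow> pullback_sieve C f S \<in> Cov (Dom C f)"
  using topology unfolding grothendieck_topology_def by blast

lemma cov_trans:
  "S \<in> Cov c \<Longrightarrow> c \<in> Ob C \<Longrightarrow> is_sieve C c S' \<Longrightarrow>
     (\<And>f. f \<in> S \<Longrightarrow> pullback_sieve C f S' \<in> Cov (Dom C f)) \<Longrightarrow> S' \<in> Cov c"
  using topology unfolding grothendieck_topology_def by blast

lemma cov_superset:
  assumes "S \<in> Cov c" "c \<in> Ob C" "is_sieve C c S'" "S \<subseteq> S'"
  shows "S' \<in> Cov c"
proof (rule cov_trans[OF assms(1-3)])
  fix f assume "f \<in> S"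
  hence "f \<in> S'" "Dom C f \<in> Ob C" using assms sieve_arr[OF assms(3)] by auto
  thus "pullback_sieve C f S' \<in> Cov (Dom C f)"
    using pullback_sieve_mem[OF assms(3)] cov_max by simp
qed

text \<open>A property holds locally on \<open>U\<close> if it holds on the members of a covering sieve.  The rules
  below let this be used like a quantifier; \<open>locally_trans\<close> contains the transitivity of the
  topology and does not need the property to be stable under restriction.\<close>

definition locally :: "'o \<Rightarrow> ('a \<Rightarrow> bool) \<Rightarrow> bool" where
  "locally U Q \<longleftrightarrow> U \<in> Ob C \<and> (\<exists>S\<in>Cov U. \<forall>g\<in>S. Q g)"

lemma locally_cov: "S \<in> Cov U \<Longrightarrow> U \<in> Ob C \<Longrightarrow> locally U (\<lambda>g. g \<in> S)"
  unfolding locally_def by blast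

lemma locally_mono:
  assumes "locally U Q" "\<And>g. g \<in> Arr C \<Longrightarrow> Cod C g = U \<Longrightarrow> Q g \<Longrightarrow> Q' g"
  shows "locally U Q'"
proof -
  obtain S where S: "S \<in> Cov U" "\<forall>g\<in>S. Q g" "U \<in> Ob C"
    using assms(1) unfolding locally_def by blast
  hence "\<forall>g\<in>S. Q' g" using sieve_arr[OF cov_sieve[OF S(1,3)]] assms(2) by blast
  thus ?thesis using S unfolding locally_def by blast
qed

lemma locally_all:
  assumes "U \<in> Ob C" "\<And>g. g \<in> Arr C \<Longrightarrow> Cod C g = U \<Longrightarrow> Q g"
  shows "locally U Q"
  unfolding locally_def using assms
  by (intro conjI bexI[of _ "{f \<in> Arr C. Cod C f = U}"] cov_max) auto

lemma locally_sieve: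
  assumes "locally U (\<lambda>g. g \<in> S)" "is_sieve C U S"
  shows "S \<in> Cov U"
proof -
  obtain T where "T \<in> Cov U" "\<forall>g\<in>T. g \<in> S" "U \<in> Ob C"
    using assms(1) unfolding locally_def by blast
  thus ?thesis using cov_superset[of T U S] assms(2) by blast
qed

lemma locally_pull:
  assumes "locally U Q" "f \<in> Arr C" "Cod C f = U"
  shows "locally (Dom C f) (\<lambda>g. Q (f \<cdot> g))"
proof -
  obtain S where "S \<in> Cov U" "\<forall>g\<in>S. Q g" using assms(1) unfolding locally_def by blast
  hence "pullback_sieve C f S \<in> Cov (Dom C f)" "\<forall>g\<in>pullback_sieve C f S. Q (f \<cdot> g)"
    using cov_pullback assms by (auto simp: pullback_sieve_iff)
  thus ?thesis using assms(2) unfolding locally_def by auto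
qed

lemma locally_trans:
  assumes Q: "locally U Q"
    and Q': "\<And>g. g \<in> Arr C \<Longrightarrow> Cod C g = U \<Longrightarrow> Q g \<Longrightarrow> locally (Dom C g) (\<lambda>h. Q' (g \<cdot> h))"
  shows "locally U Q'"
proof -
  obtain S where S: "S \<in> Cov U" "\<forall>g\<in>S. Q g" and U: "U \<in> Ob C"
    using Q unfolding locally_def by blast
  note sS = cov_sieve[OF S(1) U]
  have "\<forall>g\<in>S. \<exists>T. T \<in> Cov (Dom C g) \<and> (\<forall>h\<in>T. Q' (g \<cdot> h))"
    using Q' S(2) sieve_arr[OF sS] unfolding locally_def by blast
  then obtain T where T: "\<And>g. g \<in> S \<Longrightarrow> T g \<in> Cov (Dom C g)"
      "\<And>g h. g \<in> S \<Longrightarrow> h \<in> T g \<Longrightarrow> Q' (g \<cdot> h)"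
    by metis
  define S' where "S' = {g \<cdot> h |g h. g \<in> S \<and> h \<in> T g}"
  have aS: "g \<in> Arr C" "Cod C g = U" "Dom C g \<in> Ob C" if "g \<in> S" for g
    using sieve_arr[OF sS that] by auto
  have sT: "is_sieve C (Dom C g) (T g)" if "g \<in> S" for g
    using cov_sieve T(1) aS that by simp
  have aT: "h \<in> Arr C" "Cod C h = Dom C g" if "g \<in> S" "h \<in> T g" for g h
    using sieve_arr[OF sT] that by auto
  have sS': "is_sieve C U S'"
    unfolding is_sieve_def
  proof (intro conjI subsetI ballI impI)
    fix f assume "f \<in> S'"
    thus "f \<in> {f \<in> Arr C. Cod C f = U}" unfolding S'_def using aS aT by auto
  next
    fix f k assume "f \<in> S'" and k: "k \<in> Arr C" "Cod C k = Dom C f"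
    then obtain g h where gh: "g \<in> S" "h \<in> T g" "f = g \<cdot> h" unfolding S'_def by blast
    note a = aS[OF gh(1)] aT[OF gh(1,2)]
    have "h \<cdot> k \<in> T g" using k a gh by (intro sieve_comp[OF sT]) auto
    moreover have "f \<cdot> k = g \<cdot> (h \<cdot> k)" using k a gh by simp
    ultimately show "f \<cdot> k \<in> S'" unfolding S'_def using gh(1) by blast
  qed
  have "S' \<in> Cov U"
  proof (rule cov_trans[OF S(1) U sS'])
    fix g assume g: "g \<in> S"
    show "pullback_sieve C g S' \<in> Cov (Dom C g)"
    proof (rule cov_superset[OF T(1)[OF g]])
      show "is_sieve C (Dom C g) (pullback_sieve C g S')"
        using pullback_sieve_sieve[OF sS'] aS[OF g] by blast
      show "T g \<subseteq> pullback_sieve C g S'"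
        using g aT[OF g] unfolding S'_def pullback_sieve_def by blast
    qed (use aS g in auto)
  qed
  moreover have "\<forall>f\<in>S'. Q' f" using T(2) unfolding S'_def by auto
  ultimately show ?thesis using U unfolding locally_def by blast
qed

lemma locally_conj:
  assumes "locally U Q" "locally U Q'"
  shows "locally U (\<lambda>g. Q g \<and> Q' g)"
proof -
  obtain S where S: "S \<in> Cov U" "\<forall>g\<in>S. Q g" and U: "U \<in> Ob C"
    using assms(1) unfolding locally_def by blast
  note sS = cov_sieve[OF S(1) U]
  show ?thesis
  proof (rule locally_trans[OF locally_cov[OF S(1) U]])
    fix g assume g: "g \<in> Arr C" "Cod C g = U" "g \<in> S"
    show "locally (Dom C g) (\<lambda>h. Q (g \<cdot> h) \<and> Q' (g \<cdot> h))"
      by (rule locally_mono[OF locally_pull[OF assms(2) g(1,2)]])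
         (use S(2) sieve_comp[OF sS g(3)] in blast)
  qed
qed

lemma locally_finite:
  assumes "finite K" "U \<in> Ob C" "\<And>k. k \<in> K \<Longrightarrow> locally U (Q k)"
  shows "locally U (\<lambda>g. \<forall>k\<in>K. Q k g)"
  using assms(1,3)
proof (induction K)
  case empty
  show ?case using assms(2) by (intro locally_all) auto
next
  case (insert k K)
  have "locally U (\<lambda>g. Q k g \<and> (\<forall>k\<in>K. Q k g))"
    using insert by (intro locally_conj) auto
  thus ?case by (rule locally_mono) auto
qed

lemma sheaf_locally_eq:
  assumes F: "sheaf C Cov F r" and "x \<in> F U" "y \<in> F U" "locally U (\<lambda>g. r g x = r g y)"
  shows "x = y"
proof -
  obtain S where S: "S \<in> Cov U" "\<forall>g\<in>S. r g x = r g y" and U: "U \<in> Ob C"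
    using assms(4) unfolding locally_def by blast
  thus ?thesis
    using glues_sep[of F r U S x y] cov_sieve F assms(2,3) unfolding sheaf_def by blast
qed

text \<open>Gluing over a family that only generates a covering sieve: the family may have several members
  with the same arrow, so it is indexed.\<close>

lemma glue_family:
  assumes F: "sheaf C Cov F r"
    and x: "\<And>l. l \<in> L \<Longrightarrow> x l \<in> Arr C \<and> Cod C (x l) = U"
    and cov: "locally U (\<lambda>f. \<exists>l\<in>L. \<exists>w\<in>Arr C. Cod C w = Dom C (x l) \<and> f = x l \<cdot> w)"
    and s: "\<And>l. l \<in> L \<Longrightarrow> s l \<in> F (Dom C (x l))"
    and compat: "\<And>l m w v. l \<in> L \<Longrightarrow> m \<in> L \<Longrightarrow> w \<in> Arr C \<Longrightarrow> v \<in> Arr C \<Longrightarrow>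
      Cod C w = Dom C (x l) \<Longrightarrow> Cod C v = Dom C (x m) \<Longrightarrow> Dom C w = Dom C v \<Longrightarrow>
      x l \<cdot> w = x m \<cdot> v \<Longrightarrow> r w (s l) = r v (s m)"
  obtains y where "y \<in> F U" "\<And>l. l \<in> L \<Longrightarrow> r (x l) y = s l"
proof -
  note P = F[unfolded sheaf_def, THEN conjunct1]
  have U: "U \<in> Ob C" using cov unfolding locally_def by blast
  define S where "S = {f. \<exists>l\<in>L. \<exists>w\<in>Arr C. Cod C w = Dom C (x l) \<and> f = x l \<cdot> w}"
  have "S = gen_sieve C (x ` L)" unfolding S_def gen_sieve_def by blast
  hence sS: "is_sieve C U S" using gen_sieve_sieve[of "x ` L" U] x by auto
  have covS: "S \<in> Cov U"
    by (rule locally_sieve[OF _ sS]) (use cov in \<open>simp add: S_def\<close>)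
  have "\<forall>f\<in>S. \<exists>l w. l \<in> L \<and> w \<in> Arr C \<and> Cod C w = Dom C (x l) \<and> f = x l \<cdot> w"
    unfolding S_def by blast
  then obtain l w where lw: "\<And>f. f \<in> S \<Longrightarrow> l f \<in> L" "\<And>f. f \<in> S \<Longrightarrow> w f \<in> Arr C"
     "\<And>f. f \<in> S \<Longrightarrow> Cod C (w f) = Dom C (x (l f))" "\<And>f. f \<in> S \<Longrightarrow> f = x (l f) \<cdot> w f"
    by metis
  define t where "t = (\<lambda>f. r (w f) (s (l f)))"
  have dw: "Dom C (w f) = Dom C f" if "f \<in> S" for f
    using lw[OF that] x[OF lw(1)[OF that]] comp_arr(2)[of "w f" "x (l f)"] by simp
  have t: "t f = r v (s m)" if "f \<in> S" "m \<in> L" "v \<in> Arr C" "Cod C v = Dom C (x m)" "f = x m \<cdot> v" for f m v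
  proof -
    have "Dom C (w f) = Dom C v" using dw[OF that(1)] that x by simp
    thus ?thesis unfolding t_def using lw[OF that(1)] that by (intro compat) auto
  qed
  have gl: "glues C F r U S" using F covS U unfolding sheaf_def by blast
  have t1: "t f \<in> F (Dom C f)" if f: "f \<in> S" for f
    unfolding t_def using presheafD(1)[OF P lw(2,3)[OF f] s[OF lw(1)[OF f]]] dw[OF f] by simp
  have t2: "r g (t f) = t (f \<cdot> g)" if f: "f \<in> S" and g: "g \<in> Arr C" "Cod C g = Dom C f" for f g
  proof -
    have "t (f \<cdot> g) = r (w f \<cdot> g) (s (l f))"
    proof (rule t)
      show "f \<cdot> g \<in> S" using sieve_comp[OF sS f g] .
      show "l f \<in> L" using lw(1)[OF f] .
      show "w f \<cdot> g \<in> Arr C" "Cod C (w f \<cdot> g) = Dom C (x (l f))"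
        using lw(2,3)[OF f] g dw[OF f] by simp_all
      have "f \<cdot> g = x (l f) \<cdot> w f \<cdot> g" using lw(4)[OF f] by simp
      thus "f \<cdot> g = x (l f) \<cdot> (w f \<cdot> g)"
        using lw(1-3)[OF f] x[OF lw(1)[OF f]] g dw[OF f] by simp
    qed
    also have "\<dots> = r g (t f)"
      unfolding t_def using presheafD(3)[OF P g(1) lw(2)[OF f] _ lw(3)[OF f] s[OF lw(1)[OF f]]] g dw[OF f]
      by simp
    finally show ?thesis by simp
  qed
  obtain y where y: "y \<in> F U" "\<And>f. f \<in> S \<Longrightarrow> r f y = t f"
    by (rule gluesD[OF gl t1 t2]) blast+
  have ys: "r (x k) y = s k" if k: "k \<in> L" for k
  proof -
    have xk: "x k \<in> Arr C" "x k = x k \<cdot> Idn C (Dom C (x k))" using x[OF k] by auto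
    hence "x k \<in> S"
      unfolding S_def using k by (intro CollectI bexI[of _ k] bexI[of _ "Idn C (Dom C (x k))"]) auto
    hence "r (x k) y = r (Idn C (Dom C (x k))) (s k)"
      using y(2) t[of "x k" k "Idn C (Dom C (x k))"] k xk by simp
    thus ?thesis using presheafD(2)[OF P _ s[OF k]] xk by simp
  qed
  show thesis by (rule that[OF y(1) ys])
qed

end


section \<open>Closed relations and the sheafification of a representable presheaf\<close>

text \<open>A closed relation from \<open>U\<close> to \<open>X\<close> is a closed subpresheaf of the product of the presheaves
  represented by \<open>U\<close> and \<open>X\<close>, given as a set of spans.  Closed relations form a sheaf in \<open>U\<close>.
  Those that are locally single valued and locally defined everywhere form the sheafification of
  the presheaf represented by \<open>X\<close>; this describes the sheafification in one step.\<close>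

context site
begin

definition closed_rel :: "'o \<Rightarrow> 'o \<Rightarrow> ('a \<times> 'a) set set" where
  "closed_rel X U = {A.
     (\<forall>f x. (f, x) \<in> A \<longrightarrow>
        f \<in> Arr C \<and> Cod C f = U \<and> x \<in> Arr C \<and> Cod C x = X \<and> Dom C x = Dom C f) \<and>
     (\<forall>f x g. (f, x) \<in> A \<longrightarrow> g \<in> Arr C \<longrightarrow> Cod C g = Dom C f \<longrightarrow> (f \<cdot> g, x \<cdot> g) \<in> A) \<and>
     (\<forall>f\<in>Arr C. \<forall>x\<in>Arr C. Cod C f = U \<longrightarrow> Cod C x = X \<longrightarrow> Dom C x = Dom C f \<longrightarrow>
        locally (Dom C f) (\<lambda>g. (f \<cdot> g, x \<cdot> g) \<in> A) \<longrightarrow> (f, x) \<in> A)}"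

definition restrict_rel :: "'a \<Rightarrow> ('a \<times> 'a) set \<Rightarrow> ('a \<times> 'a) set" where
  "restrict_rel h A = {(f, x). f \<in> Arr C \<and> Cod C f = Dom C h \<and> (h \<cdot> f, x) \<in> A}"

definition functional_rel :: "'o \<Rightarrow> 'o \<Rightarrow> ('a \<times> 'a) set set" where
  "functional_rel X U = {A \<in> closed_rel X U.
     (\<forall>f x y. (f, x) \<in> A \<longrightarrow> (f, y) \<in> A \<longrightarrow> locally (Dom C f) (\<lambda>g. x \<cdot> g = y \<cdot> g)) \<and>
     locally U (\<lambda>f. \<exists>x. (f, x) \<in> A)}"

definition graph :: "'a \<Rightarrow> ('a \<times> 'a) set" where
  "graph x = {(f, y). f \<in> Arr C \<and> Cod C f = Dom C x \<and> y \<in> Arr C \<and> Cod C y = Cod C x \<and>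
     Dom C y = Dom C f \<and> locally (Dom C f) (\<lambda>g. y \<cdot> g = x \<cdot> f \<cdot> g)}"

lemma closed_relD:
  assumes "A \<in> closed_rel X U" "(f, x) \<in> A"
  shows "f \<in> Arr C" "Cod C f = U" "x \<in> Arr C" "Cod C x = X" "Dom C x = Dom C f"
  using assms unfolding closed_rel_def by blast+

lemma closed_rel_comp:
  assumes "A \<in> closed_rel X U" "(f, x) \<in> A" "g \<in> Arr C" "Cod C g = Dom C f"
  shows "(f \<cdot> g, x \<cdot> g) \<in> A"
  using assms unfolding closed_rel_def by blast

lemma closed_rel_closed:
  assumes "A \<in> closed_rel X U" "f \<in> Arr C" "x \<in> Arr C" "Cod C f = U" "Cod C x = X" "Dom C x = Dom C f"
    "locally (Dom C f) (\<lambda>g. (f \<cdot> g, x \<cdot> g) \<in> A)"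
  shows "(f, x) \<in> A"
proof -
  have "\<forall>f\<in>Arr C. \<forall>x\<in>Arr C. Cod C f = U \<longrightarrow> Cod C x = X \<longrightarrow> Dom C x = Dom C f \<longrightarrow>
        locally (Dom C f) (\<lambda>g. (f \<cdot> g, x \<cdot> g) \<in> A) \<longrightarrow> (f, x) \<in> A"
    using assms(1) unfolding closed_rel_def by (elim CollectE conjE)
  from this[rule_format, OF assms(2-7)] show ?thesis .
qed

lemma closed_relI:
  assumes "\<And>f x. (f, x) \<in> A \<Longrightarrow>
      f \<in> Arr C \<and> Cod C f = U \<and> x \<in> Arr C \<and> Cod C x = X \<and> Dom C x = Dom C f"
    and "\<And>f x g. (f, x) \<in> A \<Longrightarrow> g \<in> Arr C \<Longrightarrow> Cod C g = Dom C f \<Longrightarrow> (f \<cdot> g, x \<cdot> g) \<in> A"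
    and "\<And>f x. f \<in> Arr C \<Longrightarrow> x \<in> Arr C \<Longrightarrow> Cod C f = U \<Longrightarrow> Cod C x = X \<Longrightarrow> Dom C x = Dom C f \<Longrightarrow>
      locally (Dom C f) (\<lambda>g. (f \<cdot> g, x \<cdot> g) \<in> A) \<Longrightarrow> (f, x) \<in> A"
  shows "A \<in> closed_rel X U"
proof -
  have 1: "\<forall>f x. (f, x) \<in> A \<longrightarrow>
        f \<in> Arr C \<and> Cod C f = U \<and> x \<in> Arr C \<and> Cod C x = X \<and> Dom C x = Dom C f"
    by (intro allI impI assms(1))
  have 2: "\<forall>f x g. (f, x) \<in> A \<longrightarrow> g \<in> Arr C \<longrightarrow> Cod C g = Dom C f \<longrightarrow> (f \<cdot> g, x \<cdot> g) \<in> A"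
    by (intro allI impI assms(2))
  have 3: "\<forall>f\<in>Arr C. \<forall>x\<in>Arr C. Cod C f = U \<longrightarrow> Cod C x = X \<longrightarrow> Dom C x = Dom C f \<longrightarrow>
        locally (Dom C f) (\<lambda>g. (f \<cdot> g, x \<cdot> g) \<in> A) \<longrightarrow> (f, x) \<in> A"
    by (intro ballI impI assms(3))
  show ?thesis unfolding closed_rel_def by (intro CollectI conjI 1 2 3)
qed

lemma closed_rel_eqI:
  assumes A: "A \<in> closed_rel X U" and B: "B \<in> closed_rel X U"
    and eq: "\<And>f x. f \<in> Arr C \<Longrightarrow> x \<in> Arr C \<Longrightarrow> Cod C f = U \<Longrightarrow> Cod C x = X \<Longrightarrow> Dom C x = Dom C f \<Longrightarrow>
      (f, x) \<in> A \<longleftrightarrow> (f, x) \<in> B"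
  shows "A = B"
proof -
  have "(f, x) \<in> A \<longleftrightarrow> (f, x) \<in> B" for f x
  proof
    assume fx: "(f, x) \<in> A"
    note d = closed_relD[OF A fx]
    show "(f, x) \<in> B" using eq[OF d(1,3,2,4,5)] fx by blast
  next
    assume fx: "(f, x) \<in> B"
    note d = closed_relD[OF B fx]
    show "(f, x) \<in> A" using eq[OF d(1,3,2,4,5)] fx by blast
  qed
  thus ?thesis by auto
qed

lemma restrict_rel_iff: "(f, x) \<in> restrict_rel h A \<longleftrightarrow> f \<in> Arr C \<and> Cod C f = Dom C h \<and> (h \<cdot> f, x) \<in> A"
  by (simp add: restrict_rel_def)

lemma restrict_rel_id_iff:
  assumes "h \<in> Arr C"
  shows "(Idn C (Dom C h), x) \<in> restrict_rel h A \<longleftrightarrow> (h, x) \<in> A"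
  using assms by (simp add: restrict_rel_iff)

lemma restrict_rel_closed:
  assumes A: "A \<in> closed_rel X U" and h: "h \<in> Arr C" "Cod C h = U"
  shows "restrict_rel h A \<in> closed_rel X (Dom C h)"
proof (rule closed_relI)
  fix f x assume "(f, x) \<in> restrict_rel h A"
  hence f: "f \<in> Arr C" "Cod C f = Dom C h" "(h \<cdot> f, x) \<in> A" by (auto simp: restrict_rel_iff)
  show "f \<in> Arr C \<and> Cod C f = Dom C h \<and> x \<in> Arr C \<and> Cod C x = X \<and> Dom C x = Dom C f"
    using closed_relD[OF A f(3)] f(1,2) h by simp
  fix g assume g: "g \<in> Arr C" "Cod C g = Dom C f"
  have "(h \<cdot> f \<cdot> g, x \<cdot> g) \<in> A"
    by (rule closed_rel_comp[OF A f(3)]) (use g f(1,2) h in simp_all)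
  thus "(f \<cdot> g, x \<cdot> g) \<in> restrict_rel h A" using g f(1,2) h by (simp add: restrict_rel_iff)
next
  fix f x assume f: "f \<in> Arr C" "x \<in> Arr C" "Cod C f = Dom C h" "Cod C x = X" "Dom C x = Dom C f"
    and loc: "locally (Dom C f) (\<lambda>g. (f \<cdot> g, x \<cdot> g) \<in> restrict_rel h A)"
  have "locally (Dom C (h \<cdot> f)) (\<lambda>g. (h \<cdot> f \<cdot> g, x \<cdot> g) \<in> A)"
    using f h locally_mono[OF loc] by (simp add: restrict_rel_iff)
  hence "(h \<cdot> f, x) \<in> A"
    using f h by (intro closed_rel_closed[OF A]) simp_all
  thus "(f, x) \<in> restrict_rel h A" using f by (simp add: restrict_rel_iff)
qed

lemma restrict_rel_comp:
  assumes "f \<in> Arr C" "g \<in> Arr C" "Cod C f = Dom C g"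
  shows "restrict_rel (g \<cdot> f) A = restrict_rel f (restrict_rel g A)"
  using assms unfolding restrict_rel_def by auto

lemma restrict_rel_id:
  assumes "A \<in> closed_rel X U" "U \<in> Ob C" shows "restrict_rel (Idn C U) A = A"
proof -
  have "p \<in> restrict_rel (Idn C U) A \<longleftrightarrow> p \<in> A" for p
    using assms(2) closed_relD(1,2)[OF assms(1), of "fst p" "snd p"]
    by (cases p) (auto simp: restrict_rel_iff)
  thus ?thesis by blast
qed

lemma closed_rel_presheaf: "presheaf C (closed_rel X) restrict_rel"
  unfolding presheaf_def by (auto simp: restrict_rel_closed restrict_rel_id restrict_rel_comp)

text \<open>The amalgamation of compatible closed relations \<open>A f\<close> consists of the spans that belong
  locally to them.  The members of \<open>A (f \<cdot> g)\<close> over the identity are those of \<open>A f\<close> over \<open>g\<close>, which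
  is how the relations for different \<open>f\<close> are compared.\<close>

lemma closed_rel_sheaf: "sheaf C Cov (closed_rel X) restrict_rel"
  unfolding sheaf_def
proof (intro conjI ballI closed_rel_presheaf)
  fix U S assume U: "U \<in> Ob C" and S: "S \<in> Cov U"
  note sS = cov_sieve[OF S U]
  have locS: "locally (Dom C f) (\<lambda>g. f \<cdot> g \<in> S)" if "f \<in> Arr C" "Cod C f = U" for f
    using locally_pull[OF locally_cov[OF S U] that] .
  show "glues C (closed_rel X) restrict_rel U S"
    unfolding glues_def
  proof (intro allI impI)
    fix A assume A: "\<forall>f\<in>S. A f \<in> closed_rel X (Dom C f)"
      and m: "\<forall>f\<in>S. \<forall>g\<in>Arr C. Cod C g = Dom C f \<longrightarrow> restrict_rel g (A f) = A (f \<cdot> g)"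
    have aS: "f \<in> Arr C" "Cod C f = U" if "f \<in> S" for f using sieve_arr[OF sS that] by auto
    have shift: "(g, x) \<in> A f \<longleftrightarrow> (Idn C (Dom C g), x) \<in> A (f \<cdot> g)"
      if "f \<in> S" "g \<in> Arr C" "Cod C g = Dom C f" for f g x
      using restrict_rel_id_iff[OF that(2), of x "A f"] m that by simp
    define B where "B = {(f, x). f \<in> Arr C \<and> Cod C f = U \<and> x \<in> Arr C \<and> Cod C x = X \<and>
      Dom C x = Dom C f \<and>
      locally (Dom C f) (\<lambda>g. f \<cdot> g \<in> S \<and> (Idn C (Dom C g), x \<cdot> g) \<in> A (f \<cdot> g))}"
    have B: "B \<in> closed_rel X U"
    proof (rule closed_relI)
      fix f x assume "(f, x) \<in> B"
      hence f: "f \<in> Arr C" "Cod C f = U" "x \<in> Arr C" "Cod C x = X" "Dom C x = Dom C f"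
        and loc: "locally (Dom C f) (\<lambda>g. f \<cdot> g \<in> S \<and> (Idn C (Dom C g), x \<cdot> g) \<in> A (f \<cdot> g))"
        unfolding B_def by auto
      show "f \<in> Arr C \<and> Cod C f = U \<and> x \<in> Arr C \<and> Cod C x = X \<and> Dom C x = Dom C f"
        using f by simp
      fix g assume g: "g \<in> Arr C" "Cod C g = Dom C f"
      have "locally (Dom C g) (\<lambda>k. f \<cdot> g \<cdot> k \<in> S \<and> (Idn C (Dom C k), x \<cdot> g \<cdot> k) \<in> A (f \<cdot> g \<cdot> k))"
        by (rule locally_mono[OF locally_pull[OF loc g]]) (use f g in simp)
      thus "(f \<cdot> g, x \<cdot> g) \<in> B" unfolding B_def using f g by simp
    next
      fix f x assume f: "f \<in> Arr C" "x \<in> Arr C" "Cod C f = U" "Cod C x = X" "Dom C x = Dom C f"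
        and loc: "locally (Dom C f) (\<lambda>g. (f \<cdot> g, x \<cdot> g) \<in> B)"
      have "locally (Dom C f) (\<lambda>g. f \<cdot> g \<in> S \<and> (Idn C (Dom C g), x \<cdot> g) \<in> A (f \<cdot> g))"
      proof (rule locally_trans[OF loc])
        fix g assume g: "g \<in> Arr C" "Cod C g = Dom C f" and gB: "(f \<cdot> g, x \<cdot> g) \<in> B"
        have "locally (Dom C g)
          (\<lambda>k. f \<cdot> g \<cdot> k \<in> S \<and> (Idn C (Dom C k), x \<cdot> g \<cdot> k) \<in> A (f \<cdot> g \<cdot> k))"
          using gB f g unfolding B_def by simp
        thus "locally (Dom C g) (\<lambda>h. f \<cdot> (g \<cdot> h) \<in> S \<and>
          (Idn C (Dom C (g \<cdot> h)), x \<cdot> (g \<cdot> h)) \<in> A (f \<cdot> (g \<cdot> h)))"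
          by (rule locally_mono) (use f g in simp)
      qed
      thus "(f, x) \<in> B" unfolding B_def using f by simp
    qed
    have rB: "restrict_rel f B = A f" if f: "f \<in> S" for f
    proof (rule closed_rel_eqI)
      show "restrict_rel f B \<in> closed_rel X (Dom C f)" using restrict_rel_closed[OF B aS[OF f]] .
      show Af: "A f \<in> closed_rel X (Dom C f)" using A f by blast
      fix h x assume h: "h \<in> Arr C" "x \<in> Arr C" "Cod C h = Dom C f" "Cod C x = X" "Dom C x = Dom C h"
      have fS: "f \<cdot> h \<cdot> g \<in> S" if "g \<in> Arr C" "Cod C g = Dom C h" for g
        using sieve_comp[OF sS f, of "h \<cdot> g"] that h aS[OF f] by simp
      have "(h, x) \<in> restrict_rel f B \<longleftrightarrow>
          locally (Dom C h) (\<lambda>g. f \<cdot> h \<cdot> g \<in> S \<and> (Idn C (Dom C g), x \<cdot> g) \<in> A (f \<cdot> h \<cdot> g))"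
        unfolding restrict_rel_iff B_def using h aS[OF f] by simp
      also have "\<dots> \<longleftrightarrow> locally (Dom C h) (\<lambda>g. (h \<cdot> g, x \<cdot> g) \<in> A f)"
      proof (intro iffI; erule locally_mono)
        fix g assume g: "g \<in> Arr C" "Cod C g = Dom C h"
        have "(h \<cdot> g, x \<cdot> g) \<in> A f \<longleftrightarrow> (Idn C (Dom C g), x \<cdot> g) \<in> A (f \<cdot> h \<cdot> g)"
          using shift[OF f, of "h \<cdot> g" "x \<cdot> g"] g h aS[OF f] by simp
        thus "f \<cdot> h \<cdot> g \<in> S \<and> (Idn C (Dom C g), x \<cdot> g) \<in> A (f \<cdot> h \<cdot> g) \<Longrightarrow> (h \<cdot> g, x \<cdot> g) \<in> A f"
          "(h \<cdot> g, x \<cdot> g) \<in> A f \<Longrightarrow> f \<cdot> h \<cdot> g \<in> S \<and> (Idn C (Dom C g), x \<cdot> g) \<in> A (f \<cdot> h \<cdot> g)"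
          using fS[OF g] by simp_all
      qed
      also have "\<dots> \<longleftrightarrow> (h, x) \<in> A f"
      proof
        assume "locally (Dom C h) (\<lambda>g. (h \<cdot> g, x \<cdot> g) \<in> A f)"
        thus "(h, x) \<in> A f" using h by (intro closed_rel_closed[OF Af]) simp_all
      next
        assume "(h, x) \<in> A f"
        thus "locally (Dom C h) (\<lambda>g. (h \<cdot> g, x \<cdot> g) \<in> A f)"
          using h closed_rel_comp[OF Af] by (intro locally_all) simp_all
      qed
      finally show "(h, x) \<in> restrict_rel f B \<longleftrightarrow> (h, x) \<in> A f" .
    qed
    show "\<exists>!y. y \<in> closed_rel X U \<and> (\<forall>f\<in>S. restrict_rel f y = A f)"
    proof (intro ex1I[of _ B] conjI ballI)
      fix B' assume B': "B' \<in> closed_rel X U \<and> (\<forall>f\<in>S. restrict_rel f B' = A f)"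
      show "B' = B"
      proof (rule closed_rel_eqI[of _ X U])
        fix f x assume f: "f \<in> Arr C" "x \<in> Arr C" "Cod C f = U" "Cod C x = X" "Dom C x = Dom C f"
        have *: "(f, x) \<in> D" if D: "D \<in> closed_rel X U" "D' \<in> closed_rel X U"
            "\<forall>h\<in>S. restrict_rel h D = restrict_rel h D'" "(f, x) \<in> D'" for D D'
        proof (rule closed_rel_closed[OF D(1) f(1,2,3,4,5)])
          show "locally (Dom C f) (\<lambda>g. (f \<cdot> g, x \<cdot> g) \<in> D)"
          proof (rule locally_mono[OF locS[OF f(1,3)]])
            fix g assume g: "g \<in> Arr C" "Cod C g = Dom C f" and fg: "f \<cdot> g \<in> S"
            have "(f \<cdot> g, x \<cdot> g) \<in> D'" using closed_rel_comp[OF D(2,4) g] .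
            moreover have "restrict_rel (f \<cdot> g) D = restrict_rel (f \<cdot> g) D'" using D(3) fg by blast
            ultimately show "(f \<cdot> g, x \<cdot> g) \<in> D"
              using restrict_rel_id_iff[of "f \<cdot> g" "x \<cdot> g" D] restrict_rel_id_iff[of "f \<cdot> g" "x \<cdot> g" D'] f g
              by simp
          qed
        qed
        show "(f, x) \<in> B' \<longleftrightarrow> (f, x) \<in> B"
          using *[of B' B] *[of B B'] B B' rB by auto
      qed (use B B' in auto)
    qed (use B rB in auto)
  qed
qed

lemma subsheaf:
  assumes F: "sheaf C Cov F r" and sub: "\<And>U. F' U \<subseteq> F U"
    and res: "\<And>f x. f \<in> Arr C \<Longrightarrow> x \<in> F' (Cod C f) \<Longrightarrow> r f x \<in> F' (Dom C f)"
    and loc: "\<And>U x. x \<in> F U \<Longrightarrow> locally U (\<lambda>f. r f x \<in> F' (Dom C f)) \<Longrightarrow> x \<in> F' U"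
  shows "sheaf C Cov F' r"
  unfolding sheaf_def
proof (intro conjI ballI)
  have P: "presheaf C F r" using F unfolding sheaf_def by blast
  show "presheaf C F' r"
    unfolding presheaf_def using presheafD(2,3)[OF P] res sub by (auto dest!: subsetD[OF sub])
  fix U S assume US: "U \<in> Ob C" "S \<in> Cov U"
  hence gl: "glues C F r U S" using F unfolding sheaf_def by blast
  show "glues C F' r U S"
    unfolding glues_def
  proof (intro allI impI)
    fix x assume x: "\<forall>f\<in>S. x f \<in> F' (Dom C f)"
      "\<forall>f\<in>S. \<forall>g\<in>Arr C. Cod C g = Dom C f \<longrightarrow> r g (x f) = x (f \<cdot> g)"
    have "\<forall>f\<in>S. x f \<in> F (Dom C f)" using x(1) sub by blast
    with gl x(2) have ex: "\<exists>!y. y \<in> F U \<and> (\<forall>f\<in>S. r f y = x f)"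
      unfolding glues_def by blast
    then obtain y where y: "y \<in> F U" "\<forall>f\<in>S. r f y = x f" by blast
    have "locally U (\<lambda>f. r f y \<in> F' (Dom C f))"
      by (rule locally_mono[OF locally_cov[OF US(2,1)]]) (use y(2) x(1) in simp)
    hence "y \<in> F' U" by (rule loc[OF y(1)])
    with y show "\<exists>!y. y \<in> F' U \<and> (\<forall>f\<in>S. r f y = x f)"
      using ex sub by (intro ex1I[of _ y]) blast+
  qed
qed

lemma functional_relD:
  assumes "A \<in> functional_rel X U"
  shows "A \<in> closed_rel X U"
    and "(f, x) \<in> A \<Longrightarrow> (f, y) \<in> A \<Longrightarrow> locally (Dom C f) (\<lambda>g. x \<cdot> g = y \<cdot> g)"
    and "locally U (\<lambda>f. \<exists>x. (f, x) \<in> A)"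
  using assms unfolding functional_rel_def by simp_all

lemma functional_rel_restrict:
  assumes A: "A \<in> functional_rel X U" and h: "h \<in> Arr C" "Cod C h = U"
  shows "restrict_rel h A \<in> functional_rel X (Dom C h)"
  unfolding functional_rel_def
proof (intro CollectI conjI allI impI)
  show "restrict_rel h A \<in> closed_rel X (Dom C h)" using restrict_rel_closed[OF functional_relD(1)[OF A] h] .
  fix f x y assume xy: "(f, x) \<in> restrict_rel h A" "(f, y) \<in> restrict_rel h A"
  hence "locally (Dom C (h \<cdot> f)) (\<lambda>g. x \<cdot> g = y \<cdot> g)"
    by (intro functional_relD(2)[OF A]) (simp_all add: restrict_rel_iff)
  thus "locally (Dom C f) (\<lambda>g. x \<cdot> g = y \<cdot> g)" using xy h by (simp add: restrict_rel_iff)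
next
  show "locally (Dom C h) (\<lambda>f. \<exists>x. (f, x) \<in> restrict_rel h A)"
    by (rule locally_mono[OF locally_pull[OF functional_relD(3)[OF A] h]]) (simp add: restrict_rel_iff)
qed

lemma functional_rel_sheaf: "sheaf C Cov (functional_rel X) restrict_rel"
proof (rule subsheaf[OF closed_rel_sheaf])
  show "functional_rel X U \<subseteq> closed_rel X U" for U unfolding functional_rel_def by blast
  show "restrict_rel f A \<in> functional_rel X (Dom C f)" if "f \<in> Arr C" "A \<in> functional_rel X (Cod C f)" for f A
    using functional_rel_restrict that by blast
  fix U A assume A: "A \<in> closed_rel X U" and loc: "locally U (\<lambda>f. restrict_rel f A \<in> functional_rel X (Dom C f))"
  show "A \<in> functional_rel X U"
    unfolding functional_rel_def
  proof (intro CollectI conjI allI impI A)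
    fix f x y assume xy: "(f, x) \<in> A" "(f, y) \<in> A"
    note f = closed_relD[OF A xy(1)] and y = closed_relD(3-5)[OF A xy(2)]
    show "locally (Dom C f) (\<lambda>g. x \<cdot> g = y \<cdot> g)"
    proof (rule locally_trans[OF locally_pull[OF loc f(1,2)]])
      fix g assume g: "g \<in> Arr C" "Cod C g = Dom C f"
        and R: "restrict_rel (f \<cdot> g) A \<in> functional_rel X (Dom C (f \<cdot> g))"
      have "(Idn C (Dom C (f \<cdot> g)), x \<cdot> g) \<in> restrict_rel (f \<cdot> g) A"
        "(Idn C (Dom C (f \<cdot> g)), y \<cdot> g) \<in> restrict_rel (f \<cdot> g) A"
        using closed_rel_comp[OF A xy(1) g] closed_rel_comp[OF A xy(2) g] f(1) g
        by (simp_all add: restrict_rel_iff)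
      hence "locally (Dom C (Idn C (Dom C (f \<cdot> g)))) (\<lambda>h. x \<cdot> g \<cdot> h = y \<cdot> g \<cdot> h)"
        by (rule functional_relD(2)[OF R])
      hence "locally (Dom C g) (\<lambda>h. x \<cdot> g \<cdot> h = y \<cdot> g \<cdot> h)" using f g by simp
      thus "locally (Dom C g) (\<lambda>h. x \<cdot> (g \<cdot> h) = y \<cdot> (g \<cdot> h))"
        by (rule locally_mono) (use f y g in simp)
    qed
  next
    show "locally U (\<lambda>f. \<exists>x. (f, x) \<in> A)"
    proof (rule locally_trans[OF loc])
      fix f assume "f \<in> Arr C" "Cod C f = U" "restrict_rel f A \<in> functional_rel X (Dom C f)"
      hence "locally (Dom C f) (\<lambda>g. \<exists>x. (g, x) \<in> restrict_rel f A)" using functional_relD(3) by blast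
      thus "locally (Dom C f) (\<lambda>g. \<exists>x. (f \<cdot> g, x) \<in> A)"
        by (rule locally_mono) (auto simp: restrict_rel_iff)
    qed
  qed
qed

lemma graph_iff:
  "(f, y) \<in> graph x \<longleftrightarrow> f \<in> Arr C \<and> Cod C f = Dom C x \<and> y \<in> Arr C \<and> Cod C y = Cod C x \<and>
     Dom C y = Dom C f \<and> locally (Dom C f) (\<lambda>g. y \<cdot> g = x \<cdot> f \<cdot> g)"
  by (simp add: graph_def)

lemma graph_self:
  assumes "x \<in> Arr C" "f \<in> Arr C" "Cod C f = Dom C x"
  shows "(f, x \<cdot> f) \<in> graph x"
  unfolding graph_iff using assms by (auto intro!: locally_all)

lemma graph_rel:
  assumes x: "x \<in> Arr C"
  shows "graph x \<in> functional_rel (Cod C x) (Dom C x)"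
  unfolding functional_rel_def
proof (intro CollectI conjI allI impI closed_relI)
  fix f y assume fy: "(f, y) \<in> graph x"
  show "f \<in> Arr C" "Cod C f = Dom C x" "y \<in> Arr C" "Cod C y = Cod C x" "Dom C y = Dom C f"
    using fy by (auto simp: graph_iff)
  have loc: "locally (Dom C f) (\<lambda>g. y \<cdot> g = x \<cdot> f \<cdot> g)" using fy by (simp add: graph_iff)
  show "(f \<cdot> g, y \<cdot> g) \<in> graph x" if g: "g \<in> Arr C" "Cod C g = Dom C f" for g
  proof -
    have "locally (Dom C g) (\<lambda>k. y \<cdot> g \<cdot> k = x \<cdot> (f \<cdot> g) \<cdot> k)"
      by (rule locally_mono[OF locally_pull[OF loc g]]) (use fy g x in \<open>simp add: graph_iff\<close>)
    thus ?thesis using fy g x by (simp add: graph_iff)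
  qed
  fix y' assume fy': "(f, y') \<in> graph x"
  have loc': "locally (Dom C f) (\<lambda>g. y' \<cdot> g = x \<cdot> f \<cdot> g)" using fy' by (simp add: graph_iff)
  show "locally (Dom C f) (\<lambda>g. y \<cdot> g = y' \<cdot> g)"
    by (rule locally_mono[OF locally_conj[OF loc loc']]) simp
next
  fix f y assume f: "f \<in> Arr C" "y \<in> Arr C" "Cod C f = Dom C x" "Cod C y = Cod C x" "Dom C y = Dom C f"
    and loc: "locally (Dom C f) (\<lambda>g. (f \<cdot> g, y \<cdot> g) \<in> graph x)"
  have "locally (Dom C f) (\<lambda>g. y \<cdot> g = x \<cdot> f \<cdot> g)"
  proof (rule locally_trans[OF loc])
    fix g assume g: "g \<in> Arr C" "Cod C g = Dom C f" "(f \<cdot> g, y \<cdot> g) \<in> graph x"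
    hence "locally (Dom C (f \<cdot> g)) (\<lambda>k. y \<cdot> g \<cdot> k = x \<cdot> (f \<cdot> g) \<cdot> k)" by (simp add: graph_iff)
    thus "locally (Dom C g) (\<lambda>k. y \<cdot> (g \<cdot> k) = x \<cdot> f \<cdot> (g \<cdot> k))"
      using f g x by (auto elim!: locally_mono)
  qed
  thus "(f, y) \<in> graph x" using f by (simp add: graph_iff)
next
  show "locally (Dom C x) (\<lambda>f. \<exists>y. (f, y) \<in> graph x)"
    using x graph_self[OF x] by (intro locally_all) auto
qed

lemma restrict_rel_graph:
  assumes x: "x \<in> Arr C" "h \<in> Arr C" "Cod C h = Dom C x"
  shows "restrict_rel h (graph x) = graph (x \<cdot> h)"
proof -
  have "locally (Dom C f) (\<lambda>g. y \<cdot> g = x \<cdot> (h \<cdot> f) \<cdot> g) \<longleftrightarrow>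
        locally (Dom C f) (\<lambda>g. y \<cdot> g = x \<cdot> h \<cdot> f \<cdot> g)"
    if "f \<in> Arr C" "Cod C f = Dom C h" for f y
    using x that by simp
  thus ?thesis using x unfolding restrict_rel_def graph_def by auto
qed

text \<open>A functional relation behaves like an element with partial values: having the value \<open>x\<close> at \<open>f\<close>
  means that its restriction along \<open>f\<close> is the arrow \<open>x\<close>.\<close>

lemma functional_rel_mem_iff:
  assumes A: "A \<in> functional_rel X U" and f: "f \<in> Arr C" "Cod C f = U" "x \<in> Arr C" "Cod C x = X"
    "Dom C x = Dom C f"
  shows "(f, x) \<in> A \<longleftrightarrow> restrict_rel f A = graph x"
proof
  note A' = functional_relD(1)[OF A]
  assume fx: "(f, x) \<in> A"
  show "restrict_rel f A = graph x"
  proof (rule closed_rel_eqI)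
    show "restrict_rel f A \<in> closed_rel X (Dom C f)" using restrict_rel_closed[OF A' f(1,2)] .
    show "graph x \<in> closed_rel X (Dom C f)" using functional_relD(1)[OF graph_rel[OF f(3)]] f by simp
    fix g y assume g: "g \<in> Arr C" "y \<in> Arr C" "Cod C g = Dom C f" "Cod C y = X" "Dom C y = Dom C g"
    have xg: "(f \<cdot> g, x \<cdot> g) \<in> A" using closed_rel_comp[OF A' fx g(1,3)] .
    have "(f \<cdot> g, y) \<in> A \<longleftrightarrow> locally (Dom C g) (\<lambda>h. y \<cdot> h = x \<cdot> g \<cdot> h)"
    proof
      assume "(f \<cdot> g, y) \<in> A"
      hence "locally (Dom C (f \<cdot> g)) (\<lambda>h. y \<cdot> h = x \<cdot> g \<cdot> h)" using xg by (rule functional_relD(2)[OF A])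
      thus "locally (Dom C g) (\<lambda>h. y \<cdot> h = x \<cdot> g \<cdot> h)" using f g by simp
    next
      assume loc: "locally (Dom C g) (\<lambda>h. y \<cdot> h = x \<cdot> g \<cdot> h)"
      have "locally (Dom C g) (\<lambda>h. (f \<cdot> g \<cdot> h, y \<cdot> h) \<in> A)"
        by (rule locally_mono[OF loc]) (use closed_rel_comp[OF A' xg] f g in simp)
      thus "(f \<cdot> g, y) \<in> A" using f g by (intro closed_rel_closed[OF A']) simp_all
    qed
    thus "(g, y) \<in> restrict_rel f A \<longleftrightarrow> (g, y) \<in> graph x"
      unfolding restrict_rel_iff graph_iff using f g by simp
  qed
next
  assume eq: "restrict_rel f A = graph x"
  have "(Idn C (Dom C f), x) \<in> graph x" using graph_self[of x "Idn C (Dom C f)"] f by simp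
  thus "(f, x) \<in> A" unfolding eq[symmetric] restrict_rel_id_iff[OF f(1)] .
qed

text \<open>This and the next lemma say that the map \<open>x \<mapsto> graph x\<close> from the represented presheaf is
  locally surjective and locally injective.\<close>

lemma functional_rel_locally_graph:
  assumes A: "A \<in> functional_rel X U"
  shows "locally U (\<lambda>f. \<exists>x\<in>Arr C. Cod C x = X \<and> Dom C x = Dom C f \<and> restrict_rel f A = graph x)"
proof (rule locally_mono[OF functional_relD(3)[OF A]])
  fix f assume f: "f \<in> Arr C" "Cod C f = U" "\<exists>x. (f, x) \<in> A"
  then obtain x where x: "(f, x) \<in> A" by blast
  thus "\<exists>x\<in>Arr C. Cod C x = X \<and> Dom C x = Dom C f \<and> restrict_rel f A = graph x"
    using closed_relD[OF functional_relD(1)[OF A] x] functional_rel_mem_iff[OF A f(1,2), of x] by auto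
qed

lemma graph_eqD:
  assumes "x \<in> Arr C" "y \<in> Arr C" "graph x = graph y"
  shows "locally (Dom C x) (\<lambda>g. x \<cdot> g = y \<cdot> g)"
proof -
  have "(Idn C (Dom C x), x) \<in> graph y"
    using graph_self[of x "Idn C (Dom C x)"] assms by simp
  hence "locally (Dom C x) (\<lambda>g. x \<cdot> g = y \<cdot> Idn C (Dom C x) \<cdot> g)" "Dom C x = Dom C y"
    using assms by (auto simp: graph_iff)
  thus ?thesis using assms by simp
qed

end


section \<open>Local generators\<close>

text \<open>An element \<open>e\<close> of \<open>Y X\<close> is a local generator if the map from the presheaf represented by
  \<open>X\<close> to \<open>Y\<close> that it defines is locally surjective and locally injective.  Such a map has the
  universal property of a sheafification with respect to every sheaf.\<close>

context site
begin

definition local_gen :: "('o \<Rightarrow> 'x set) \<Rightarrow> ('a \<Rightarrow> 'x \<Rightarrow> 'x) \<Rightarrow> 'o \<Rightarrow> 'x \<Rightarrow> bool" where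
  "local_gen Y q X e \<longleftrightarrow> X \<in> Ob C \<and> e \<in> Y X \<and>
     (\<forall>U\<in>Ob C. \<forall>z\<in>Y U.
        locally U (\<lambda>f. \<exists>x\<in>Arr C. Cod C x = X \<and> Dom C x = Dom C f \<and> q f z = q x e)) \<and>
     (\<forall>x\<in>Arr C. \<forall>y\<in>Arr C. Cod C x = X \<longrightarrow> Cod C y = X \<longrightarrow> Dom C x = Dom C y \<longrightarrow>
        q x e = q y e \<longrightarrow> locally (Dom C x) (\<lambda>g. x \<cdot> g = y \<cdot> g))"

lemma local_genD:
  assumes "local_gen Y q X e"
  shows "X \<in> Ob C" "e \<in> Y X"
    and "U \<in> Ob C \<Longrightarrow> z \<in> Y U \<Longrightarrow>
      locally U (\<lambda>f. \<exists>x\<in>Arr C. Cod C x = X \<and> Dom C x = Dom C f \<and> q f z = q x e)"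
    and "x \<in> Arr C \<Longrightarrow> y \<in> Arr C \<Longrightarrow> Cod C x = X \<Longrightarrow> Cod C y = X \<Longrightarrow> Dom C x = Dom C y \<Longrightarrow>
      q x e = q y e \<Longrightarrow> locally (Dom C x) (\<lambda>g. x \<cdot> g = y \<cdot> g)"
  using assms unfolding local_gen_def by simp_all

lemma functional_rel_local_gen:
  assumes X: "X \<in> Ob C"
  shows "local_gen (functional_rel X) restrict_rel X (graph (Idn C X))"
  unfolding local_gen_def
proof (intro conjI ballI impI X)
  have g: "restrict_rel x (graph (Idn C X)) = graph x" if "x \<in> Arr C" "Cod C x = X" for x
    using restrict_rel_graph[of "Idn C X" x] X that by simp
  show "graph (Idn C X) \<in> functional_rel X X" using graph_rel[of "Idn C X"] X by simp
  fix U z assume z: "z \<in> functional_rel X U"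
  show "locally U (\<lambda>f. \<exists>x\<in>Arr C. Cod C x = X \<and> Dom C x = Dom C f \<and>
      restrict_rel f z = restrict_rel x (graph (Idn C X)))"
  proof (rule locally_mono[OF functional_rel_locally_graph[OF z]])
    fix f assume "\<exists>x\<in>Arr C. Cod C x = X \<and> Dom C x = Dom C f \<and> restrict_rel f z = graph x"
    then obtain x where "x \<in> Arr C" "Cod C x = X" "Dom C x = Dom C f" "restrict_rel f z = graph x" by blast
    thus "\<exists>x\<in>Arr C. Cod C x = X \<and> Dom C x = Dom C f \<and> restrict_rel f z = restrict_rel x (graph (Idn C X))"
      using g[of x] by (intro bexI[of _ x]) simp_all
  qed
next
  fix x y assume x: "x \<in> Arr C" "y \<in> Arr C" "Cod C x = X" "Cod C y = X"
    "restrict_rel x (graph (Idn C X)) = restrict_rel y (graph (Idn C X))"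
  hence "graph x = graph y" using restrict_rel_graph[of "Idn C X"] X by simp
  thus "locally (Dom C x) (\<lambda>g. x \<cdot> g = y \<cdot> g)" using graph_eqD x by blast
qed

text \<open>Two maps into a sheaf that agree on \<open>e\<close> agree on all restrictions of \<open>e\<close>, and every element is
  locally such a restriction.\<close>

lemma local_gen_unique:
  assumes F: "sheaf C Cov F r" and P: "presheaf C Y q" and e: "local_gen Y q X e"
    and th: "\<And>U z. U \<in> Ob C \<Longrightarrow> z \<in> Y U \<Longrightarrow> th U z \<in> F U"
      "\<And>f z. f \<in> Arr C \<Longrightarrow> z \<in> Y (Cod C f) \<Longrightarrow> th (Dom C f) (q f z) = r f (th (Cod C f) z)"
    and th': "\<And>U z. U \<in> Ob C \<Longrightarrow> z \<in> Y U \<Longrightarrow> th' U z \<in> F U"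
      "\<And>f z. f \<in> Arr C \<Longrightarrow> z \<in> Y (Cod C f) \<Longrightarrow> th' (Dom C f) (q f z) = r f (th' (Cod C f) z)"
    and eq: "th X e = th' X e" and z: "U \<in> Ob C" "z \<in> Y U"
  shows "th U z = th' U z"
proof (rule sheaf_locally_eq[OF F th(1)[OF z] th'(1)[OF z] locally_mono[OF local_genD(3)[OF e z]]])
  fix f assume f: "f \<in> Arr C" "Cod C f = U"
    "\<exists>x\<in>Arr C. Cod C x = X \<and> Dom C x = Dom C f \<and> q f z = q x e"
  then obtain x where x: "x \<in> Arr C" "Cod C x = X" "Dom C x = Dom C f" "q f z = q x e" by blast
  note eX = local_genD(2)[OF e]
  have "r f (th U z) = r x (th X e)"
    using th(2)[OF f(1), of z] th(2)[OF x(1), of e] f(2) z(2) x(2-4) eX by simp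
  also have "\<dots> = r f (th' U z)"
    using th'(2)[OF f(1), of z] th'(2)[OF x(1), of e] f(2) z(2) x(2-4) eX eq by simp
  finally show "r f (th U z) = r f (th' U z)" .
qed

text \<open>The value at \<open>z\<close> is glued from the restrictions of \<open>s\<close> along those \<open>x\<close> for which the
  restriction of \<open>e\<close> along \<open>x\<close> is a restriction of \<open>z\<close>; they are compatible because two such \<open>x\<close>
  agree locally.\<close>

lemma local_gen_extend_ex:
  assumes F: "sheaf C Cov F r" and P: "presheaf C Y q" and e: "local_gen Y q X e"
    and s: "s \<in> F X" and z: "U \<in> Ob C" "z \<in> Y U"
  shows "\<exists>t. t \<in> F U \<and> (\<forall>f\<in>Arr C. \<forall>x\<in>Arr C. Cod C f = U \<longrightarrow> Cod C x = X \<longrightarrow>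
           Dom C x = Dom C f \<longrightarrow> q f z = q x e \<longrightarrow> r f t = r x s)"
proof -
  have PF: "presheaf C F r" using F unfolding sheaf_def by blast
  note eX = local_genD(2)[OF e]
  define A where "A = {(f, x). f \<in> Arr C \<and> x \<in> Arr C \<and> Cod C f = U \<and> Cod C x = X \<and>
    Dom C x = Dom C f \<and> q f z = q x e}"
  have res: "r k s \<in> F (Dom C k)" if "k \<in> Arr C" "Cod C k = X" for k
    using presheafD(1)[OF PF that s] .
  obtain t where t: "t \<in> F U" "\<And>p. p \<in> A \<Longrightarrow> r (fst p) t = r (snd p) s"
  proof (rule glue_family[OF F, where L = A and x = fst and s = "\<lambda>p. r (snd p) s" and U = U])
    fix p assume p: "p \<in> A"
    show "fst p \<in> Arr C \<and> Cod C (fst p) = U" using p by (auto simp: A_def)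
    show "r (snd p) s \<in> F (Dom C (fst p))"
      using res[of "snd p"] p by (auto simp: A_def)
  next
    show "locally U (\<lambda>f. \<exists>l\<in>A. \<exists>w\<in>Arr C. Cod C w = Dom C (fst l) \<and> f = fst l \<cdot> w)"
    proof (rule locally_mono[OF local_genD(3)[OF e z]])
      fix f assume f: "f \<in> Arr C" "Cod C f = U"
        "\<exists>x\<in>Arr C. Cod C x = X \<and> Dom C x = Dom C f \<and> q f z = q x e"
      then obtain x where "(f, x) \<in> A" unfolding A_def by blast
      thus "\<exists>l\<in>A. \<exists>w\<in>Arr C. Cod C w = Dom C (fst l) \<and> f = fst l \<cdot> w"
        using f(1) by (intro bexI[of _ "(f, x)"] bexI[of _ "Idn C (Dom C f)"]) simp_all
    qed
  next
    fix p p' w v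
    assume "p \<in> A" "p' \<in> A" and w: "w \<in> Arr C" "v \<in> Arr C" "Cod C w = Dom C (fst p)"
      "Cod C v = Dom C (fst p')" "Dom C w = Dom C v" "fst p \<cdot> w = fst p' \<cdot> v"
    then obtain f x f' x' where p: "p = (f, x)" "p' = (f', x')" and
      a: "f \<in> Arr C" "x \<in> Arr C" "Cod C f = U" "Cod C x = X" "Dom C x = Dom C f" "q f z = q x e" and
      a': "f' \<in> Arr C" "x' \<in> Arr C" "Cod C f' = U" "Cod C x' = X" "Dom C x' = Dom C f'" "q f' z = q x' e"
      by (auto simp: A_def)
    have w': "Cod C w = Dom C f" "Cod C v = Dom C f'" "f \<cdot> w = f' \<cdot> v" using w p by simp_all
    have "q (x \<cdot> w) e = q (f \<cdot> w) z"
      using presheafD(3)[OF P w(1) a(2) _ a(4) eX] presheafD(3)[OF P w(1) a(1) _ a(3) z(2)] w' a(5,6)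
      by simp
    also have "\<dots> = q (x' \<cdot> v) e"
      using presheafD(3)[OF P w(2) a'(2) _ a'(4) eX] presheafD(3)[OF P w(2) a'(1) _ a'(3) z(2)] w' a'(5,6)
      by simp
    finally have loc: "locally (Dom C w) (\<lambda>g. x \<cdot> w \<cdot> g = x' \<cdot> v \<cdot> g)"
      using local_genD(4)[OF e, of "x \<cdot> w" "x' \<cdot> v"] w(1,2,5) w' a a' by simp
    have e1: "r w (r x s) = r (x \<cdot> w) s" "r v (r x' s) = r (x' \<cdot> v) s"
      using presheafD(3)[OF PF w(1) a(2) _ a(4) s] presheafD(3)[OF PF w(2) a'(2) _ a'(4) s] w' a(5) a'(5)
      by simp_all
    have "r (x \<cdot> w) s = r (x' \<cdot> v) s"
    proof (rule sheaf_locally_eq[OF F _ _ locally_mono[OF loc]])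
      show "r (x \<cdot> w) s \<in> F (Dom C w)" using res[of "x \<cdot> w"] a w(1) w' by simp
      show "r (x' \<cdot> v) s \<in> F (Dom C w)" using res[of "x' \<cdot> v"] a' w(2,5) w' by simp
      fix g assume g: "g \<in> Arr C" "Cod C g = Dom C w" "x \<cdot> w \<cdot> g = x' \<cdot> v \<cdot> g"
      have "r g (r (x \<cdot> w) s) = r (x \<cdot> w \<cdot> g) s"
        using presheafD(3)[OF PF g(1), of "x \<cdot> w" X s] a w(1) w' g(2) s by simp
      moreover have "r g (r (x' \<cdot> v) s) = r (x' \<cdot> v \<cdot> g) s"
        using presheafD(3)[OF PF g(1), of "x' \<cdot> v" X s] a' w(2,5) w' g(2) s by simp
      ultimately show "r g (r (x \<cdot> w) s) = r g (r (x' \<cdot> v) s)" using g(3) by simp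
    qed
    thus "r w (r (snd p) s) = r v (r (snd p') s)" using e1 p by simp
  qed blast
  thus ?thesis
    by (intro exI[of _ t] conjI t(1) ballI impI) (use t(2)[of "(f, x)" for f x] in \<open>simp add: A_def\<close>)
qed

lemma local_gen_extend:
  assumes F: "sheaf C Cov F r" and P: "presheaf C Y q" and e: "local_gen Y q X e" and s: "s \<in> F X"
  obtains th where "\<And>U z. U \<in> Ob C \<Longrightarrow> z \<in> Y U \<Longrightarrow> th U z \<in> F U"
    "\<And>f z. f \<in> Arr C \<Longrightarrow> z \<in> Y (Cod C f) \<Longrightarrow> th (Dom C f) (q f z) = r f (th (Cod C f) z)"
    "th X e = s"
proof -
  have PF: "presheaf C F r" using F unfolding sheaf_def by blast
  note eX = local_genD(1,2)[OF e]
  have "\<exists>th. \<forall>U z. U \<in> Ob C \<longrightarrow> z \<in> Y U \<longrightarrow> th U z \<in> F U \<and>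
      (\<forall>f\<in>Arr C. \<forall>x\<in>Arr C. Cod C f = U \<longrightarrow> Cod C x = X \<longrightarrow>
           Dom C x = Dom C f \<longrightarrow> q f z = q x e \<longrightarrow> r f (th U z) = r x s)"
    by (intro choice allI) (use local_gen_extend_ex[OF F P e s] in blast)
  then obtain th where th: "\<And>U z. U \<in> Ob C \<Longrightarrow> z \<in> Y U \<Longrightarrow> th U z \<in> F U"
      "\<And>U z f x. U \<in> Ob C \<Longrightarrow> z \<in> Y U \<Longrightarrow> f \<in> Arr C \<Longrightarrow> x \<in> Arr C \<Longrightarrow> Cod C f = U \<Longrightarrow> Cod C x = X \<Longrightarrow>
           Dom C x = Dom C f \<Longrightarrow> q f z = q x e \<Longrightarrow> r f (th U z) = r x s"
    by blast
  show thesis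
  proof (rule that)
    show "th U z \<in> F U" if "U \<in> Ob C" "z \<in> Y U" for U z using th(1) that .
    show "th X e = s"
      using th(2)[OF eX, of "Idn C X" "Idn C X"] presheafD(2)[OF PF eX(1)] th(1)[OF eX] eX(1) s by simp
    fix h z assume h: "h \<in> Arr C" and z: "z \<in> Y (Cod C h)"
    have qz: "q h z \<in> Y (Dom C h)" using presheafD(1)[OF P h refl z] .
    have tz: "th (Cod C h) z \<in> F (Cod C h)" using th(1) h z by simp
    show "th (Dom C h) (q h z) = r h (th (Cod C h) z)"
    proof (rule sheaf_locally_eq[OF F _ _ locally_mono[OF local_genD(3)[OF e _ qz]]])
      show "th (Dom C h) (q h z) \<in> F (Dom C h)" using th(1)[OF _ qz] h by simp
      show "r h (th (Cod C h) z) \<in> F (Dom C h)" using presheafD(1)[OF PF h refl tz] .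
      show "Dom C h \<in> Ob C" using h by simp
      fix f assume f: "f \<in> Arr C" "Cod C f = Dom C h"
        "\<exists>x\<in>Arr C. Cod C x = X \<and> Dom C x = Dom C f \<and> q f (q h z) = q x e"
      then obtain x where x: "x \<in> Arr C" "Cod C x = X" "Dom C x = Dom C f" "q f (q h z) = q x e"
        by blast
      have "r f (th (Dom C h) (q h z)) = r x s"
        using th(2)[OF _ qz f(1) x(1) f(2) x(2-4)] h by simp
      also have "\<dots> = r (h \<cdot> f) (th (Cod C h) z)"
        using th(2)[OF _ z, of "h \<cdot> f" x] presheafD(3)[OF P f(1) h f(2) refl z] h f x by simp
      also have "\<dots> = r f (r h (th (Cod C h) z))"
        using presheafD(3)[OF PF f(1) h f(2) refl tz] .
      finally show "r f (th (Dom C h) (q h z)) = r f (r h (th (Cod C h) z))" .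
    qed
  qed
qed

end


section \<open>Sheaves of small sets\<close>

lemma op_cat_simps [simp]:
  "Ob (op_cat C) = Ob C" "Arr (op_cat C) = Arr C" "Dom (op_cat C) = Cod C" "Cod (op_cat C) = Dom C"
  "Idn (op_cat C) = Idn C" "Comp (op_cat C) g f = Comp C f g"
  by (simp_all add: op_cat_def)

lemma full_subcat_simps [simp]:
  "Ob (full_subcat C I) = I" "Dom (full_subcat C I) = Dom C" "Cod (full_subcat C I) = Cod C"
  "Idn (full_subcat C I) = Idn C" "Comp (full_subcat C I) = Comp C"
  "f \<in> Arr (full_subcat C I) \<longleftrightarrow> f \<in> Arr C \<and> Dom C f \<in> I \<and> Cod C f \<in> I"
  by (simp_all add: full_subcat_def)

text \<open>Being a sheaf is invariant under natural bijections, also between presheaves with values in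
  different types.\<close>

lemma (in site) sheaf_transport:
  assumes F: "sheaf C Cov F r"
    and bij: "\<And>c. c \<in> Ob C \<Longrightarrow> bij_betw (b c) (F c) (F' c)"
    and nat: "\<And>f x. f \<in> Arr C \<Longrightarrow> x \<in> F (Cod C f) \<Longrightarrow> b (Dom C f) (r f x) = r' f (b (Cod C f) x)"
  shows "sheaf C Cov F' r'"
proof -
  have P: "presheaf C F r" using F unfolding sheaf_def by blast
  define i where "i = (\<lambda>c. inv_into (F c) (b c))"
  have i: "i c y \<in> F c" "b c (i c y) = y" if "c \<in> Ob C" "y \<in> F' c" for c y
    using bij[OF that(1)] that(2) unfolding i_def bij_betw_def
    by (auto simp: inv_into_into f_inv_into_f)
  have bF: "b c x \<in> F' c" if "c \<in> Ob C" "x \<in> F c" for c x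
    using bij[OF that(1)] that(2) bij_betwE by blast
  have inj: "x = y" if "c \<in> Ob C" "x \<in> F c" "y \<in> F c" "b c x = b c y" for c x y
    using bij[OF that(1)] that(2-4) unfolding bij_betw_def by (meson inj_onD)
  have r': "r' f y = b (Dom C f) (r f (i (Cod C f) y))" if "f \<in> Arr C" "y \<in> F' (Cod C f)" for f y
    using nat[OF that(1)] i[OF _ that(2)] that(1) by simp
  have rF: "r f x \<in> F (Dom C f)" if "f \<in> Arr C" "x \<in> F (Cod C f)" for f x
    using presheafD(1)[OF P that(1) refl that(2)] .
  have P': "presheaf C F' r'"
    unfolding presheaf_def
  proof (intro conjI ballI impI)
    fix f y assume f: "f \<in> Arr C" "y \<in> F' (Cod C f)"
    thus "r' f y \<in> F' (Dom C f)" using r' i rF bF by simp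
  next
    fix a y assume a: "a \<in> Ob C" "y \<in> F' a"
    thus "r' (Idn C a) y = y" using r'[of "Idn C a" y] i[OF a] presheafD(2)[OF P a(1)] by simp
  next
    fix f g y assume f: "f \<in> Arr C" "g \<in> Arr C" "Cod C f = Dom C g" "y \<in> F' (Cod C g)"
    define x where "x = i (Cod C g) y"
    have x: "x \<in> F (Cod C g)" "y = b (Cod C g) x" using i[OF _ f(4)] f(2) by (auto simp: x_def)
    have "r' (g \<cdot> f) y = b (Dom C f) (r (g \<cdot> f) x)"
      using nat[of "g \<cdot> f" x] f x by simp
    also have "\<dots> = b (Dom C f) (r f (r g x))"
      using presheafD(3)[OF P f(1-3) refl x(1)] by simp
    also have "\<dots> = r' f (r' g y)"
      using nat[of f "r g x"] nat[of g x] rF[OF f(2) x(1)] f x by simp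
    finally show "r' (g \<cdot> f) y = r' f (r' g y)" .
  qed
  show ?thesis
    unfolding sheaf_def
  proof (intro conjI ballI P')
    fix c S assume c: "c \<in> Ob C" "S \<in> Cov c"
    note sS = cov_sieve[OF c(2,1)]
    have gl: "glues C F r c S" using F c unfolding sheaf_def by blast
    have aS: "f \<in> Arr C" "Cod C f = c" if "f \<in> S" for f using sieve_arr[OF sS that] by auto
    show "glues C F' r' c S"
      unfolding glues_def
    proof (intro allI impI)
      fix y assume y: "\<forall>f\<in>S. y f \<in> F' (Dom C f)"
        "\<forall>f\<in>S. \<forall>g\<in>Arr C. Cod C g = Dom C f \<longrightarrow> r' g (y f) = y (f \<cdot> g)"
      have y1: "y f \<in> F' (Dom C f)" if "f \<in> S" for f using y(1) that by blast
      have m1: "i (Dom C f) (y f) \<in> F (Dom C f)" if "f \<in> S" for f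
        using i(1)[OF _ y1[OF that]] aS[OF that] by simp
      have m2: "r g (i (Dom C f) (y f)) = i (Dom C (f \<cdot> g)) (y (f \<cdot> g))"
        if f: "f \<in> S" and g: "g \<in> Arr C" "Cod C g = Dom C f" for f g
      proof (rule inj)
        have fg: "f \<cdot> g \<in> S" using sieve_comp[OF sS f g] .
        show "Dom C g \<in> Ob C" using g by simp
        show "r g (i (Dom C f) (y f)) \<in> F (Dom C g)"
          using rF[OF g(1)] i(1)[OF _ y1[OF f]] aS[OF f] g by simp
        show "i (Dom C (f \<cdot> g)) (y (f \<cdot> g)) \<in> F (Dom C g)"
          using i(1)[OF _ y1[OF fg]] aS[OF f] g by simp
        show "b (Dom C g) (r g (i (Dom C f) (y f))) = b (Dom C g) (i (Dom C (f \<cdot> g)) (y (f \<cdot> g)))"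
          using nat[OF g(1), of "i (Dom C f) (y f)"] i[OF _ y1[OF f]] i(2)[OF _ y1[OF fg]] aS[OF f] g
            y(2) f by simp
      qed
      obtain x where x: "x \<in> F c" "\<And>f. f \<in> S \<Longrightarrow> r f x = i (Dom C f) (y f)"
        by (rule gluesD[OF gl, of "\<lambda>f. i (Dom C f) (y f)"]) (use m1 m2 in blast)+
      have ex: "r' f (b c x) = y f" if "f \<in> S" for f
        using nat[of f x] x aS[OF that] that i(2)[OF _ y1[OF that]] by simp
      have un: "z = b c x" if z: "z \<in> F' c" "\<forall>f\<in>S. r' f z = y f" for z
      proof -
        have "i c z = x"
        proof (rule glues_sep[OF P sS gl i(1)[OF c(1) z(1)] x(1)])
          fix f assume f: "f \<in> S"
          have "b (Dom C f) (r f (i c z)) = y f"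
            using nat[of f "i c z"] i[OF c(1) z(1)] aS[OF f] z(2) f by simp
          thus "r f (i c z) = r f x"
            using x(2)[OF f] i[OF _ y1[OF f]] rF[of f "i c z"] i(1)[OF c(1) z(1)] aS[OF f]
            by (intro inj[of "Dom C f"]) auto
        qed
        thus ?thesis using i(2)[OF c(1) z(1)] by simp
      qed
      show "\<exists>!z. z \<in> F' c \<and> (\<forall>f\<in>S. r' f z = y f)"
        by (rule ex1I[of _ "b c x"]) (use bF[OF c(1) x(1)] ex un in blast)+
    qed
  qed
qed

text \<open>The action of an arrow of the category of sheaves on sections.\<close>

definition component :: "('f \<times> 'g \<times> ('c \<Rightarrow> 'u set \<times> 'u set \<times> ('u \<Rightarrow> 'u))) \<Rightarrow> 'c \<Rightarrow> 'u \<Rightarrow> 'u" where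
  "component t c x = snd (snd (snd (snd t) c)) x"

lemma set_hom_iff:
  "p \<in> hom set_cat A B \<longleftrightarrow> p = (A, B, snd (snd p)) \<and> small A \<and> small B \<and> snd (snd p) \<in> A \<rightarrow>\<^sub>E B"
  by (cases p) (auto simp: hom_def set_cat_def)

lemma set_cat_simps:
  "Idn set_cat A = (A, A, \<lambda>x\<in>A. x)" "Comp set_cat (B', D, g) (A, B, f) = (A, D, compose A g f)"
  "Ob set_cat = {A. small A}"
  by (simp_all add: set_cat_def)

locale small_site = site C K for C :: "('u, 'u) cat" (structure) and K +
  assumes univ: "universe TYPE('u)" and small_cat: "small_category C"
begin

abbreviation "Sh \<equiv> sheaf_cat C K"

lemma sh_ob:
  "F \<in> Ob Sh \<longleftrightarrow> is_functor (op_cat C) set_cat F \<and> FOb F \<in> extensional (Ob C) \<and>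
     FArr F \<in> extensional (Arr C) \<and> is_sheaf C K F"
  by (auto simp: sheaf_cat_def functor_cat_def Let_def)

lemma sh_simps:
  "Dom Sh t = fst t" "Cod Sh t = fst (snd t)" "Idn Sh F = (F, F, \<lambda>a\<in>Ob C. Idn set_cat (FOb F a))"
  "Comp Sh s t = (fst t, fst (snd s), \<lambda>a\<in>Ob C. Comp set_cat (snd (snd s) a) (snd (snd t) a))"
  by (simp_all add: sheaf_cat_def functor_cat_def Let_def case_prod_unfold)

lemma sh_arr:
  "t \<in> Arr Sh \<longleftrightarrow> fst t \<in> Ob Sh \<and> fst (snd t) \<in> Ob Sh \<and>
     nat_trans (op_cat C) set_cat (fst t) (fst (snd t)) (snd (snd t)) \<and>
     snd (snd t) \<in> extensional (Ob C)"
  by (cases t) (auto simp: sh_ob sheaf_cat_def functor_cat_def Let_def)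

lemma sh_FArr:
  assumes "F \<in> Ob Sh" "f \<in> Arr C"
  shows "FArr F f = (FOb F (Cod C f), FOb F (Dom C f), restrict_along F f)"
    and "restrict_along F f \<in> FOb F (Cod C f) \<rightarrow>\<^sub>E FOb F (Dom C f)"
proof -
  have "FArr F f \<in> hom set_cat (FOb F (Cod C f)) (FOb F (Dom C f))"
    using assms unfolding sh_ob is_functor_def by simp
  moreover have "restrict_along F f = snd (snd (FArr F f))"
    by (simp add: restrict_along_def fun_eq_iff)
  ultimately show "FArr F f = (FOb F (Cod C f), FOb F (Dom C f), restrict_along F f)"
    "restrict_along F f \<in> FOb F (Cod C f) \<rightarrow>\<^sub>E FOb F (Dom C f)"
    unfolding set_hom_iff by simp_all
qed

lemma sh_small: "F \<in> Ob Sh \<Longrightarrow> c \<in> Ob C \<Longrightarrow> small (FOb F c)"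
  unfolding sh_ob is_functor_def by (simp add: set_cat_simps)

lemma sh_sheaf:
  assumes F: "F \<in> Ob Sh"
  shows "sheaf C K (FOb F) (restrict_along F)"
proof -
  have fun_F: "is_functor (op_cat C) set_cat F" and sF: "is_sheaf C K F" using F sh_ob by auto
  have "presheaf C (FOb F) (restrict_along F)"
    unfolding presheaf_def
  proof (intro conjI ballI impI)
    fix f x assume "f \<in> Arr C" "x \<in> FOb F (Cod C f)"
    thus "restrict_along F f x \<in> FOb F (Dom C f)" using sh_FArr(2)[OF F] by blast
  next
    fix a x assume "a \<in> Ob C" "x \<in> FOb F a"
    moreover from this have "FArr F (Idn C a) = Idn set_cat (FOb F a)"
      using fun_F unfolding is_functor_def by simp
    ultimately show "restrict_along F (Idn C a) x = x"
      by (simp add: restrict_along_def set_cat_simps)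
  next
    fix f g x assume f: "f \<in> Arr C" "g \<in> Arr C" "Cod C f = Dom C g" "x \<in> FOb F (Cod C g)"
    have "FArr F (g \<cdot> f) = Comp set_cat (FArr F f) (FArr F g)"
      using fun_F f unfolding is_functor_def by simp
    also have "\<dots> = (FOb F (Cod C g), FOb F (Dom C f),
        compose (FOb F (Cod C g)) (restrict_along F f) (restrict_along F g))"
      by (simp add: sh_FArr(1)[OF F f(1)] sh_FArr(1)[OF F f(2)] set_cat_simps)
    finally show "restrict_along F (g \<cdot> f) x = restrict_along F f (restrict_along F g x)"
      using f(4) by (simp add: restrict_along_def[of F "g \<cdot> f"] compose_def)
  qed
  thus ?thesis using sF unfolding sheaf_def is_sheaf_def glues_def by blast
qed

lemma sh_mk:
  assumes F: "sheaf C K P r" and small: "\<And>c. c \<in> Ob C \<Longrightarrow> small (P c :: 'u set)"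
  obtains F where "F \<in> Ob Sh" "\<And>c. c \<in> Ob C \<Longrightarrow> FOb F c = P c"
    "\<And>f x. f \<in> Arr C \<Longrightarrow> x \<in> P (Cod C f) \<Longrightarrow> restrict_along F f x = r f x"
proof -
  have P: "presheaf C P r" using F unfolding sheaf_def by blast
  define F where "F = \<lparr>FOb = (\<lambda>c\<in>Ob C. P c),
    FArr = (\<lambda>f\<in>Arr C. (P (Cod C f), P (Dom C f), \<lambda>x\<in>P (Cod C f). r f x))\<rparr>"
  have FOb: "FOb F c = P c" if "c \<in> Ob C" for c using that by (simp add: F_def)
  have FArr: "FArr F f = (P (Cod C f), P (Dom C f), \<lambda>x\<in>P (Cod C f). r f x)" if "f \<in> Arr C" for f
    using that by (simp add: F_def)
  have res: "restrict_along F f x = r f x" if "f \<in> Arr C" "x \<in> P (Cod C f)" for f x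
    using that by (simp add: restrict_along_def FArr)
  have "is_functor (op_cat C) set_cat F"
    unfolding is_functor_def
  proof (intro conjI ballI impI)
    fix a assume "a \<in> Ob (op_cat C)"
    thus "FOb F a \<in> Ob set_cat" by (simp add: FOb small set_cat_simps)
  next
    fix f assume "f \<in> Arr (op_cat C)"
    thus "FArr F f \<in> hom set_cat (FOb F (Dom (op_cat C) f)) (FOb F (Cod (op_cat C) f))"
      using presheafD(1)[OF P, of f "Cod C f"] by (simp add: FOb FArr set_hom_iff small)
  next
    fix a assume "a \<in> Ob (op_cat C)"
    thus "FArr F (Idn (op_cat C) a) = Idn set_cat (FOb F a)"
      using presheafD(2)[OF P] by (simp add: FOb FArr set_cat_simps restrict_def fun_eq_iff)
  next
    fix f g assume "f \<in> Arr (op_cat C)" "g \<in> Arr (op_cat C)" "Cod (op_cat C) f = Dom (op_cat C) g"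
    hence f: "f \<in> Arr C" "g \<in> Arr C" "Cod C g = Dom C f" by simp_all
    have "(\<lambda>x\<in>P (Cod C f). r (f \<cdot> g) x) =
        compose (P (Cod C f)) (\<lambda>x\<in>P (Dom C f). r g x) (\<lambda>x\<in>P (Cod C f). r f x)"
      using presheafD(1)[OF P f(1) refl] presheafD(3)[OF P f(2,1,3) refl]
      by (auto simp: compose_def restrict_def fun_eq_iff)
    thus "FArr F (Comp (op_cat C) g f) = Comp set_cat (FArr F g) (FArr F f)"
      using f by (simp add: FArr set_cat_simps)
  qed
  moreover have "sheaf C K (FOb F) (restrict_along F)"
    by (rule sheaf_transport[OF F, of "\<lambda>_ x. x"]) (simp_all add: FOb res bij_betw_def)
  ultimately have "F \<in> Ob Sh"
    unfolding sh_ob is_sheaf_def sheaf_def glues_def by (simp add: F_def)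
  thus thesis using FOb res by (rule that)
qed

lemma sh_component:
  assumes t: "t \<in> hom Sh F F'"
  shows "c \<in> Ob C \<Longrightarrow> x \<in> FOb F c \<Longrightarrow> component t c x \<in> FOb F' c"
    and "f \<in> Arr C \<Longrightarrow> x \<in> FOb F (Cod C f) \<Longrightarrow>
      component t (Dom C f) (restrict_along F f x) = restrict_along F' f (component t (Cod C f) x)"
    and "c \<in> Ob C \<Longrightarrow> snd (snd t) c = (FOb F c, FOb F' c, component t c)"
    and "c \<in> Ob C \<Longrightarrow> component t c \<in> FOb F c \<rightarrow>\<^sub>E FOb F' c"
proof -
  have F: "F \<in> Ob Sh" "F' \<in> Ob Sh" and nt: "nat_trans (op_cat C) set_cat F F' (snd (snd t))"
    using t unfolding hom_def by (auto simp: sh_arr sh_simps)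
  have "snd (snd t) c \<in> hom set_cat (FOb F c) (FOb F' c)" if "c \<in> Ob C" for c
    using nt that unfolding nat_trans_def by simp
  moreover have "component t c = snd (snd (snd (snd t) c))" for c by (simp add: component_def fun_eq_iff)
  ultimately have c: "snd (snd t) c = (FOb F c, FOb F' c, component t c)"
    "component t c \<in> FOb F c \<rightarrow>\<^sub>E FOb F' c" if "c \<in> Ob C" for c
    using that unfolding set_hom_iff by simp_all
  show "c \<in> Ob C \<Longrightarrow> snd (snd t) c = (FOb F c, FOb F' c, component t c)"
    "c \<in> Ob C \<Longrightarrow> component t c \<in> FOb F c \<rightarrow>\<^sub>E FOb F' c" by (fact c)+
  show "c \<in> Ob C \<Longrightarrow> x \<in> FOb F c \<Longrightarrow> component t c x \<in> FOb F' c" using c(2) by blast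
  assume f: "f \<in> Arr C" "x \<in> FOb F (Cod C f)"
  have "Comp set_cat (snd (snd t) (Dom C f)) (FArr F f) = Comp set_cat (FArr F' f) (snd (snd t) (Cod C f))"
    using nt f unfolding nat_trans_def by simp
  hence "compose (FOb F (Cod C f)) (component t (Dom C f)) (restrict_along F f) =
      compose (FOb F (Cod C f)) (restrict_along F' f) (component t (Cod C f))"
    using f c(1) by (simp add: sh_FArr(1)[OF F(1)] sh_FArr(1)[OF F(2)] set_cat_simps)
  from fun_cong[OF this, of x]
  show "component t (Dom C f) (restrict_along F f x) = restrict_along F' f (component t (Cod C f) x)"
    using f(2) by (simp add: compose_eq)
qed

lemma sh_ext:
  assumes t: "t \<in> hom Sh F F'" and s: "s \<in> hom Sh F F'"
    and eq: "\<And>c x. c \<in> Ob C \<Longrightarrow> x \<in> FOb F c \<Longrightarrow> component t c x = component s c x"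
  shows "t = s"
proof -
  have "snd (snd t) = snd (snd s)"
  proof (rule extensionalityI)
    show "snd (snd t) \<in> extensional (Ob C)" "snd (snd s) \<in> extensional (Ob C)"
      using t s unfolding hom_def by (auto simp: sh_arr)
    fix c assume c: "c \<in> Ob C"
    have "component t c = component s c"
      using sh_component(4)[OF t c] sh_component(4)[OF s c] eq[OF c] by (intro PiE_ext) auto
    thus "snd (snd t) c = snd (snd s) c" using sh_component(3)[OF t c] sh_component(3)[OF s c] by simp
  qed
  moreover have "fst t = fst s" "fst (snd t) = fst (snd s)"
    using t s unfolding hom_def by (auto simp: sh_simps)
  ultimately show ?thesis by (simp add: prod_eq_iff)
qed

lemma sh_mk_arr:
  assumes F: "F \<in> Ob Sh" "F' \<in> Ob Sh"
    and th: "\<And>c x. c \<in> Ob C \<Longrightarrow> x \<in> FOb F c \<Longrightarrow> th c x \<in> FOb F' c"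
    and nat: "\<And>f x. f \<in> Arr C \<Longrightarrow> x \<in> FOb F (Cod C f) \<Longrightarrow>
      th (Dom C f) (restrict_along F f x) = restrict_along F' f (th (Cod C f) x)"
  obtains t where "t \<in> hom Sh F F'" "\<And>c x. c \<in> Ob C \<Longrightarrow> x \<in> FOb F c \<Longrightarrow> component t c x = th c x"
proof -
  define t where "t = (F, F', \<lambda>c\<in>Ob C. (FOb F c, FOb F' c, \<lambda>x\<in>FOb F c. th c x))"
  have "nat_trans (op_cat C) set_cat F F' (snd (snd t))"
    unfolding nat_trans_def
  proof (intro conjI ballI)
    fix a assume "a \<in> Ob (op_cat C)"
    thus "snd (snd t) a \<in> hom set_cat (FOb F a) (FOb F' a)"
      using F sh_small th by (simp add: t_def set_hom_iff)
  next
    fix f assume "f \<in> Arr (op_cat C)"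
    hence f: "f \<in> Arr C" by simp
    have "compose (FOb F (Cod C f)) (\<lambda>x\<in>FOb F (Dom C f). th (Dom C f) x) (restrict_along F f) =
        compose (FOb F (Cod C f)) (restrict_along F' f) (\<lambda>x\<in>FOb F (Cod C f). th (Cod C f) x)"
      using nat[OF f] sh_FArr(2)[OF F(1) f] by (auto simp: compose_def restrict_def fun_eq_iff)
    thus "Comp set_cat (snd (snd t) (Cod (op_cat C) f)) (FArr F f) =
        Comp set_cat (FArr F' f) (snd (snd t) (Dom (op_cat C) f))"
      using f by (simp add: t_def sh_FArr(1)[OF F(1)] sh_FArr(1)[OF F(2)] set_cat_simps)
  qed
  hence "t \<in> hom Sh F F'"
    using F by (simp add: hom_def sh_arr sh_simps t_def)
  thus thesis by (rule that) (simp add: component_def t_def)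
qed

lemma sh_comp:
  assumes t: "t \<in> hom Sh F F'" and s: "s \<in> hom Sh F' F''"
  shows "Comp Sh s t \<in> hom Sh F F''"
    and "c \<in> Ob C \<Longrightarrow> x \<in> FOb F c \<Longrightarrow> component (Comp Sh s t) c x = component s c (component t c x)"
proof -
  have comp: "Comp Sh s t = (F, F'', \<lambda>c\<in>Ob C. (FOb F c, FOb F'' c, compose (FOb F c) (component s c) (component t c)))"
    using t s sh_component(3)[OF t] sh_component(3)[OF s]
    by (auto simp: sh_simps hom_def set_cat_simps restrict_def fun_eq_iff)
  show "c \<in> Ob C \<Longrightarrow> x \<in> FOb F c \<Longrightarrow> component (Comp Sh s t) c x = component s c (component t c x)"
    unfolding comp by (simp add: component_def[of "(F, x)" for x] compose_eq)
  have F: "F \<in> Ob Sh" "F'' \<in> Ob Sh" using t s by (auto simp: hom_def sh_arr sh_simps)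
  obtain u where u: "u \<in> hom Sh F F''"
    "\<And>c x. c \<in> Ob C \<Longrightarrow> x \<in> FOb F c \<Longrightarrow> component u c x = component s c (component t c x)"
    using sh_component(1,2)[OF t] sh_component(1,2)[OF s] by (elim sh_mk_arr[OF F, rotated 2]) auto
  have "u = (F, F'', \<lambda>c\<in>Ob C. (FOb F c, FOb F'' c, compose (FOb F c) (component s c) (component t c)))"
  proof -
    have "snd (snd u) = (\<lambda>c\<in>Ob C. (FOb F c, FOb F'' c, compose (FOb F c) (component s c) (component t c)))"
    proof (rule extensionalityI[of _ "Ob C"])
      show "snd (snd u) \<in> extensional (Ob C)" using u(1) by (simp add: hom_def sh_arr)
      fix c assume c: "c \<in> Ob C"
      have "component u c = compose (FOb F c) (component s c) (component t c)"
        using sh_component(4)[OF u(1) c] u(2)[OF c]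
        by (intro extensionalityI[of _ "FOb F c"]) (auto simp: compose_eq PiE_def)
      thus "snd (snd u) c = (\<lambda>c\<in>Ob C. (FOb F c, FOb F'' c, compose (FOb F c) (component s c) (component t c))) c"
        using sh_component(3)[OF u(1) c] c by simp
    qed simp
    thus ?thesis using u(1) by (simp add: hom_def sh_simps prod_eq_iff)
  qed
  thus "Comp Sh s t \<in> hom Sh F F''" using u(1) comp by simp
qed

lemma sh_id:
  assumes F: "F \<in> Ob Sh"
  shows "Idn Sh F \<in> hom Sh F F" and "c \<in> Ob C \<Longrightarrow> x \<in> FOb F c \<Longrightarrow> component (Idn Sh F) c x = x"
proof -
  show "c \<in> Ob C \<Longrightarrow> x \<in> FOb F c \<Longrightarrow> component (Idn Sh F) c x = x"
    by (simp add: component_def sh_simps set_cat_simps)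
  have "nat_trans (op_cat C) set_cat F F (\<lambda>a\<in>Ob C. Idn set_cat (FOb F a))"
    unfolding nat_trans_def
  proof (intro conjI ballI)
    fix a assume "a \<in> Ob (op_cat C)"
    thus "(\<lambda>a\<in>Ob C. Idn set_cat (FOb F a)) a \<in> hom set_cat (FOb F a) (FOb F a)"
      using F sh_small by (simp add: set_hom_iff set_cat_simps)
  next
    fix f assume "f \<in> Arr (op_cat C)"
    hence f: "f \<in> Arr C" by simp
    have "compose (FOb F (Cod C f)) (\<lambda>x\<in>FOb F (Dom C f). x) (restrict_along F f) =
        compose (FOb F (Cod C f)) (restrict_along F f) (\<lambda>x\<in>FOb F (Cod C f). x)"
      using sh_FArr(2)[OF F f] by (intro extensionalityI[of _ "FOb F (Cod C f)"]) (auto simp: compose_eq)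
    thus "Comp set_cat ((\<lambda>a\<in>Ob C. Idn set_cat (FOb F a)) (Cod (op_cat C) f)) (FArr F f) =
        Comp set_cat (FArr F f) ((\<lambda>a\<in>Ob C. Idn set_cat (FOb F a)) (Dom (op_cat C) f))"
      using f by (simp add: sh_FArr(1)[OF F] set_cat_simps)
  qed
  thus "Idn Sh F \<in> hom Sh F F" using F by (simp add: hom_def sh_arr sh_simps)
qed

lemma sh_category: "category Sh"
proof
  fix f assume "f \<in> Arr Sh"
  thus "Dom Sh f \<in> Ob Sh" "Cod Sh f \<in> Ob Sh" by (auto simp: sh_arr sh_simps)
next
  fix a b f assume f: "f \<in> hom Sh a b"
  have ab: "a \<in> Ob Sh" "b \<in> Ob Sh" using f by (auto simp: hom_def sh_arr sh_simps)
  show "Comp Sh (Idn Sh b) f = f"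
    using sh_comp[OF f sh_id(1)[OF ab(2)]] sh_id(2)[OF ab(2)] sh_component(1)[OF f]
    by (intro sh_ext[OF _ f]) auto
  show "Comp Sh f (Idn Sh a) = f"
    using sh_comp[OF sh_id(1)[OF ab(1)] f] sh_id(2)[OF ab(1)]
    by (intro sh_ext[OF _ f]) auto
next
  fix a b c d f g h assume f: "f \<in> hom Sh a b" and g: "g \<in> hom Sh b c" and h: "h \<in> hom Sh c d"
  show "Comp Sh (Comp Sh h g) f = Comp Sh h (Comp Sh g f)"
    using sh_comp[OF f sh_comp(1)[OF g h]] sh_comp[OF sh_comp(1)[OF f g] h] sh_comp(2)[OF f g]
      sh_comp(2)[OF g h] sh_component(1)[OF f]
    by (intro sh_ext) auto
qed (use sh_id(1) sh_comp(1) in auto)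

end


section \<open>A generating functor into a topos\<close>

lemma (in category) iso_epi:
  assumes "is_iso C e" "a \<cdot> e = b \<cdot> e" "a \<in> Arr C" "b \<in> Arr C" "Dom C a = Cod C e" "Dom C b = Cod C e"
  shows "a = b"
proof -
  obtain g where g: "g \<in> Arr C" "Dom C g = Cod C e" "Cod C g = Dom C e" "e \<cdot> g = Idn C (Cod C e)"
    using assms(1) by (rule isoE)
  have "a \<cdot> e \<cdot> g = b \<cdot> e \<cdot> g" using assms(2) by simp
  thus ?thesis using g assms(3-6) iso_arr[OF assms(1)] by simp
qed

text \<open>Only one of the two functors of an equivalence is needed, as a fully faithful and essentially
  surjective functor.\<close>

lemma equivalent_cats_functor:
  assumes E: "category E" and D: "category D" and eq: "equivalent_cats E D"
  obtains F where "is_functor E D F"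
    "\<And>X Y h. X \<in> Ob E \<Longrightarrow> Y \<in> Ob E \<Longrightarrow> h \<in> hom D (FOb F X) (FOb F Y) \<Longrightarrow>
       \<exists>!f. f \<in> hom E X Y \<and> FArr F f = h"
    "\<And>A. A \<in> Ob D \<Longrightarrow> \<exists>X\<in>Ob E. \<exists>t. is_iso D t \<and> t \<in> hom D (FOb F X) A"
proof -
  interpret E: category E by fact
  interpret D: category D by fact
  obtain F G \<eta> \<epsilon> where F: "is_functor E D F" and G: "is_functor D E G"
    and eta: "nat_iso E E id_functor (comp_functor G F) \<eta>"
    and eps: "nat_iso D D (comp_functor F G) id_functor \<epsilon>"
    using eq unfolding equivalent_cats_def by blast
  have FO: "FOb F X \<in> Ob D" if "X \<in> Ob E" for X using F that unfolding is_functor_def by blast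
  have FA: "FArr F f \<in> Arr D" "Dom D (FArr F f) = FOb F (Dom E f)" "Cod D (FArr F f) = FOb F (Cod E f)"
    if "f \<in> Arr E" for f using F that unfolding is_functor_def by (auto simp: hom_def)
  have GO: "FOb G X \<in> Ob E" if "X \<in> Ob D" for X using G that unfolding is_functor_def by blast
  have GA: "FArr G f \<in> Arr E" "Dom E (FArr G f) = FOb G (Dom D f)" "Cod E (FArr G f) = FOb G (Cod D f)"
    if "f \<in> Arr D" for f using G that unfolding is_functor_def by (auto simp: hom_def)
  have et: "\<eta> X \<in> Arr E" "Dom E (\<eta> X) = X" "Cod E (\<eta> X) = FOb G (FOb F X)" "is_iso E (\<eta> X)"
    if "X \<in> Ob E" for X
    using eta that unfolding nat_iso_def nat_trans_def
    by (auto simp: hom_def id_functor_def comp_functor_def)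
  have etn: "Comp E (\<eta> (Cod E f)) f = Comp E (FArr G (FArr F f)) (\<eta> (Dom E f))" if "f \<in> Arr E" for f
    using eta that unfolding nat_iso_def nat_trans_def by (simp add: id_functor_def comp_functor_def)
  have ep: "\<epsilon> A \<in> Arr D" "Cod D (\<epsilon> A) = A" "Dom D (\<epsilon> A) = FOb F (FOb G A)" "is_iso D (\<epsilon> A)"
    if "A \<in> Ob D" for A
    using eps that unfolding nat_iso_def nat_trans_def
    by (auto simp: hom_def id_functor_def comp_functor_def)
  have epn: "Comp D (\<epsilon> (Cod D f)) (FArr F (FArr G f)) = Comp D f (\<epsilon> (Dom D f))" if "f \<in> Arr D" for f
    using eps that unfolding nat_iso_def nat_trans_def by (simp add: id_functor_def comp_functor_def)
  show thesis
  proof (rule that[OF F])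
    show "\<exists>X\<in>Ob E. \<exists>t. is_iso D t \<and> t \<in> hom D (FOb F X) A" if A: "A \<in> Ob D" for A
      using GO[OF A] ep[OF A] by (auto simp: hom_def)
  next
    fix X Y h assume X: "X \<in> Ob E" and Y: "Y \<in> Ob E" and "h \<in> hom D (FOb F X) (FOb F Y)"
    hence h: "h \<in> Arr D" "Dom D h = FOb F X" "Cod D h = FOb F Y" by (auto simp: hom_def)
    obtain i where i: "i \<in> Arr E" "Dom E i = FOb G (FOb F Y)" "Cod E i = Y"
       "Comp E (\<eta> Y) i = Idn E (FOb G (FOb F Y))"
      using E.isoE[OF et(4)[OF Y]] et[OF Y] by metis
    define f where "f = Comp E i (Comp E (FArr G h) (\<eta> X))"
    have f: "f \<in> Arr E" "Dom E f = X" "Cod E f = Y"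
      unfolding f_def using i et[OF X] GA[OF h(1)] h by simp_all
    have "Comp E (\<eta> Y) f = Comp E (Comp E (\<eta> Y) i) (Comp E (FArr G h) (\<eta> X))"
      unfolding f_def using i(1-3) et[OF X] et[OF Y] GA[OF h(1)] h by simp
    also have "\<dots> = Comp E (FArr G h) (\<eta> X)"
      unfolding i(4) using et[OF X] GA[OF h(1)] h by simp
    finally have "Comp E (FArr G (FArr F f)) (\<eta> X) = Comp E (FArr G h) (\<eta> X)"
      using etn[OF f(1)] f by simp
    hence Gh: "FArr G (FArr F f) = FArr G h"
      by (rule E.iso_epi[OF et(4)[OF X]])
         (use et[OF X] GA[OF h(1)] GA[OF FA(1)[OF f(1)]] FA[OF f(1)] h f in simp_all)
    have "Comp D (FArr F f) (\<epsilon> (FOb F X)) = Comp D h (\<epsilon> (FOb F X))"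
      using epn[OF h(1)] epn[OF FA(1)[OF f(1)]] Gh FA[OF f(1)] f h by simp
    hence Ff: "FArr F f = h"
      by (rule D.iso_epi[OF ep(4)[OF FO[OF X]]]) (use ep[OF FO[OF X]] h FA[OF f(1)] f in simp_all)
    show "\<exists>!f. f \<in> hom E X Y \<and> FArr F f = h"
    proof (rule ex1I[of _ f])
      show "f \<in> hom E X Y \<and> FArr F f = h" using f Ff by (simp add: hom_def)
      fix g assume "g \<in> hom E X Y \<and> FArr F g = h"
      hence g: "g \<in> Arr E" "Dom E g = X" "Cod E g = Y" "FArr F g = h" by (auto simp: hom_def)
      have "Comp E (\<eta> Y) g = Comp E (\<eta> Y) f"
        using etn[OF g(1)] etn[OF f(1)] g f Ff by simp
      thus "g = f"
        by (rule E.monoD[OF E.iso_mono[OF et(4)[OF Y]]]) (use g f et[OF Y] in simp_all)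
    qed
  qed
qed

text \<open>The properties of a topos that are used from here on: a functor \<open>G\<close> from a small site
  such that the functors represented by objects restrict along \<open>G\<close> to sheaves, all sheaves of small
  sets arise in this way, and so do all maps between them.  Arrows between the objects in the
  image of \<open>G\<close> come from the site only locally, as the topology of the site need not be
  subcanonical.\<close>

locale generated_topos = E: category E + S: site C K
  for E :: "('o, 'a) cat" (structure) and C :: "('u, 'u) cat" and K +
  fixes G :: "('u, 'u, 'o, 'a) fctr"
  assumes univ: "universe TYPE('u)"
    and small_gen: "small (Ob C)"
    and G_functor: "is_functor C E G"
    and small_hom: "c \<in> Ob C \<Longrightarrow> X \<in> Ob E \<Longrightarrow> small_in TYPE('u) (hom E (FOb G c) X)"
    and nerve_sheaf: "X \<in> Ob E \<Longrightarrow>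
      sheaf C K (\<lambda>c. hom E (FOb G c) X) (\<lambda>f u. Comp E u (FArr G f))"
    and gen_full: "c \<in> Ob C \<Longrightarrow> d \<in> Ob C \<Longrightarrow> a \<in> hom E (FOb G d) (FOb G c) \<Longrightarrow>
      S.locally d (\<lambda>g. \<exists>f\<in>Arr C. Dom C f = Dom C g \<and> Cod C f = c \<and> Comp E a (FArr G g) = FArr G f)"
    and gen_faithful: "f \<in> Arr C \<Longrightarrow> f' \<in> Arr C \<Longrightarrow> Dom C f = Dom C f' \<Longrightarrow> Cod C f = Cod C f' \<Longrightarrow>
      FArr G f = FArr G f' \<Longrightarrow> S.locally (Dom C f) (\<lambda>g. Comp C f g = Comp C f' g)"
    and nerve_ess: "sheaf C K P r \<Longrightarrow> (\<And>c. c \<in> Ob C \<Longrightarrow> small (P c :: 'u set)) \<Longrightarrow>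
      \<exists>X\<in>Ob E. \<exists>\<rho>. (\<forall>c\<in>Ob C. bij_betw (\<rho> c) (hom E (FOb G c) X) (P c)) \<and>
        (\<forall>f\<in>Arr C. \<forall>u\<in>hom E (FOb G (Cod C f)) X.
           \<rho> (Dom C f) (Comp E u (FArr G f)) = r f (\<rho> (Cod C f) u))"
    and nerve_ff: "X \<in> Ob E \<Longrightarrow> Y \<in> Ob E \<Longrightarrow>
      (\<And>c u. c \<in> Ob C \<Longrightarrow> u \<in> hom E (FOb G c) X \<Longrightarrow> th c u \<in> hom E (FOb G c) Y) \<Longrightarrow>
      (\<And>f u. f \<in> Arr C \<Longrightarrow> u \<in> hom E (FOb G (Cod C f)) X \<Longrightarrow>
         th (Dom C f) (Comp E u (FArr G f)) = Comp E (th (Cod C f) u) (FArr G f)) \<Longrightarrow>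
      \<exists>!y. y \<in> hom E X Y \<and> (\<forall>c\<in>Ob C. \<forall>u\<in>hom E (FOb G c) X. Comp E y u = th c u)"

text \<open>Objects of \<open>sheaf_cat\<close> take values in subsets of \<open>'u\<close>, while relations and hom sets
  have other types.\<close>

lemma (in site) encode_sheaf:
  assumes F: "sheaf C Cov P r" and small: "\<And>c. c \<in> Ob C \<Longrightarrow> small_in TYPE('u) (P c)"
  obtains P' :: "'o \<Rightarrow> 'u set" and r' b where "sheaf C Cov P' r'" "\<And>c. c \<in> Ob C \<Longrightarrow> small (P' c)"
    "\<And>c. c \<in> Ob C \<Longrightarrow> bij_betw (b c) (P c) (P' c)"
    "\<And>f x. f \<in> Arr C \<Longrightarrow> x \<in> P (Cod C f) \<Longrightarrow> b (Dom C f) (r f x) = r' f (b (Cod C f) x)"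
proof -
  have "\<exists>e :: 'b \<Rightarrow> 'u. inj_on e (P c) \<and> small (e ` P c)" if "c \<in> Ob C" for c
    using small[OF that] by (rule small_in_code) blast
  then obtain b :: "'o \<Rightarrow> 'b \<Rightarrow> 'u" where
    b: "\<And>c. c \<in> Ob C \<Longrightarrow> inj_on (b c) (P c)" "\<And>c. c \<in> Ob C \<Longrightarrow> small (b c ` P c)"
    by metis
  define r' where "r' = (\<lambda>f y. b (Dom C f) (r f (inv_into (P (Cod C f)) (b (Cod C f)) y)))"
  have bij: "bij_betw (b c) (P c) (b c ` P c)" if "c \<in> Ob C" for c
    using b(1)[OF that] by (rule inj_on_imp_bij_betw)
  have nat: "b (Dom C f) (r f x) = r' f (b (Cod C f) x)" if "f \<in> Arr C" "x \<in> P (Cod C f)" for f x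
    using b(1)[of "Cod C f"] that by (simp add: r'_def inv_into_f_f)
  have "sheaf C Cov (\<lambda>c. b c ` P c) r'"
    by (rule sheaf_transport[OF F bij nat])
  thus thesis using b(2) bij nat by (rule that)
qed

lemma (in site) local_gen_transport:
  assumes e: "local_gen Y q X e" and P: "presheaf C Y q"
    and bij: "\<And>c. c \<in> Ob C \<Longrightarrow> bij_betw (b c) (Y c) (Y' c)"
    and nat: "\<And>f x. f \<in> Arr C \<Longrightarrow> x \<in> Y (Cod C f) \<Longrightarrow> b (Dom C f) (q f x) = q' f (b (Cod C f) x)"
  shows "local_gen Y' q' X (b X e)"
  unfolding local_gen_def
proof (intro conjI ballI impI)
  note eX = local_genD(1,2)[OF e]
  show "X \<in> Ob C" by (rule eX)
  show "b X e \<in> Y' X" using bij eX bij_betwE by blast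
  have n: "q' x (b X e) = b (Dom C x) (q x e)" if "x \<in> Arr C" "Cod C x = X" for x
    using nat[OF that(1)] that(2) eX by simp
  fix U z' assume U: "U \<in> Ob C" "z' \<in> Y' U"
  then obtain z where z: "z \<in> Y U" "z' = b U z" using bij[of U] unfolding bij_betw_def by blast
  show "locally U (\<lambda>f. \<exists>x\<in>Arr C. Cod C x = X \<and> Dom C x = Dom C f \<and> q' f z' = q' x (b X e))"
  proof (rule locally_mono[OF local_genD(3)[OF e U(1) z(1)]])
    fix f assume f: "f \<in> Arr C" "Cod C f = U"
      "\<exists>x\<in>Arr C. Cod C x = X \<and> Dom C x = Dom C f \<and> q f z = q x e"
    then obtain x where x: "x \<in> Arr C" "Cod C x = X" "Dom C x = Dom C f" "q f z = q x e" by blast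
    hence "q' f z' = q' x (b X e)" using n[of x] nat[of f z] f z by simp
    thus "\<exists>x\<in>Arr C. Cod C x = X \<and> Dom C x = Dom C f \<and> q' f z' = q' x (b X e)" using x by blast
  qed
next
  note eX = local_genD(1,2)[OF e]
  have n: "q' x (b X e) = b (Dom C x) (q x e)" if "x \<in> Arr C" "Cod C x = X" for x
    using nat[OF that(1)] that(2) eX by simp
  fix x y assume xy: "x \<in> Arr C" "y \<in> Arr C" "Cod C x = X" "Cod C y = X" "Dom C x = Dom C y"
    "q' x (b X e) = q' y (b X e)"
  have "q x e \<in> Y (Dom C x)" using presheafD(1)[OF P xy(1,3) eX(2)] .
  moreover have "q y e \<in> Y (Dom C x)" using presheafD(1)[OF P xy(2,4) eX(2)] xy(5) by simp
  moreover have "b (Dom C x) (q x e) = b (Dom C x) (q y e)"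
    using n[of x] n[of y] xy by simp
  ultimately have "q x e = q y e"
    using bij_betw_imp_inj_on[OF bij[of "Dom C x"]] xy(1) by (meson inj_onD ob(1))
  thus "locally (Dom C x) (\<lambda>g. x \<cdot> g = y \<cdot> g)" using local_genD(4)[OF e] xy by blast
qed

locale sheaf_model = small_site C K + E: category E
  for C :: "('u, 'u) cat" (structure) and K and E :: "('o, 'a) cat" +
  fixes \<Phi> :: "('o, 'a, ('u, 'u, 'u set, 'u set \<times> 'u set \<times> ('u \<Rightarrow> 'u)) fctr,
    ('u, 'u, 'u set, 'u set \<times> 'u set \<times> ('u \<Rightarrow> 'u)) fctr
    \<times> ('u, 'u, 'u set, 'u set \<times> 'u set \<times> ('u \<Rightarrow> 'u)) fctr
    \<times> ('u \<Rightarrow> 'u set \<times> 'u set \<times> ('u \<Rightarrow> 'u))) fctr"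
  assumes \<Phi>: "is_functor E Sh \<Phi>"
    and ff: "X \<in> Ob E \<Longrightarrow> Y \<in> Ob E \<Longrightarrow> h \<in> hom Sh (FOb \<Phi> X) (FOb \<Phi> Y) \<Longrightarrow>
       \<exists>!f. f \<in> hom E X Y \<and> FArr \<Phi> f = h"
    and ess: "A \<in> Ob Sh \<Longrightarrow> \<exists>X\<in>Ob E. \<exists>t. is_iso Sh t \<and> t \<in> hom Sh (FOb \<Phi> X) A"
begin

abbreviation "sec X \<equiv> FOb (FOb \<Phi> X)"
abbreviation "res X \<equiv> restrict_along (FOb \<Phi> X)"

lemma \<Phi>_ob: "X \<in> Ob E \<Longrightarrow> FOb \<Phi> X \<in> Ob Sh"
  using \<Phi> unfolding is_functor_def by blast

lemma \<Phi>_hom: "f \<in> hom E X Y \<Longrightarrow> FArr \<Phi> f \<in> hom Sh (FOb \<Phi> X) (FOb \<Phi> Y)"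
  using \<Phi> unfolding is_functor_def by (auto simp: hom_def)

lemma sec_sheaf: "X \<in> Ob E \<Longrightarrow> sheaf C K (sec X) (res X)"
  using sh_sheaf \<Phi>_ob by blast

lemma sec_presheaf: "X \<in> Ob E \<Longrightarrow> presheaf C (sec X) (res X)"
  using sec_sheaf unfolding sheaf_def by blast

lemma realize:
  assumes F: "sheaf C K P r" and small: "\<And>c. c \<in> Ob C \<Longrightarrow> small_in TYPE('u) (P c)"
  obtains X b where "X \<in> Ob E" "\<And>c. c \<in> Ob C \<Longrightarrow> bij_betw (b c) (P c) (sec X c)"
    "\<And>f x. f \<in> Arr C \<Longrightarrow> x \<in> P (Cod C f) \<Longrightarrow> b (Dom C f) (r f x) = res X f (b (Cod C f) x)"
proof -
  interpret Sh: category Sh by (rule sh_category)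
  obtain P' :: "'u \<Rightarrow> 'u set" and r' b where P': "sheaf C K P' r'" "\<And>c. c \<in> Ob C \<Longrightarrow> small (P' c)"
    and b: "\<And>c. c \<in> Ob C \<Longrightarrow> bij_betw (b c) (P c) (P' c)"
    "\<And>f x. f \<in> Arr C \<Longrightarrow> x \<in> P (Cod C f) \<Longrightarrow> b (Dom C f) (r f x) = r' f (b (Cod C f) x)"
    using encode_sheaf[OF F small] by blast
  obtain A where A: "A \<in> Ob Sh" "\<And>c. c \<in> Ob C \<Longrightarrow> FOb A c = P' c"
    "\<And>f x. f \<in> Arr C \<Longrightarrow> x \<in> P' (Cod C f) \<Longrightarrow> restrict_along A f x = r' f x"
    using sh_mk[OF P'] by blast
  obtain X t where X: "X \<in> Ob E" and t: "is_iso Sh t" "t \<in> hom Sh (FOb \<Phi> X) A"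
    using ess[OF A(1)] by blast
  obtain s where s: "s \<in> hom Sh A (FOb \<Phi> X)" "Comp Sh s t = Idn Sh (FOb \<Phi> X)" "Comp Sh t s = Idn Sh A"
  proof (rule Sh.isoE[OF t(1)])
    fix s assume "s \<in> Arr Sh" "Dom Sh s = Cod Sh t" "Cod Sh s = Dom Sh t"
      "Comp Sh s t = Idn Sh (Dom Sh t)" "Comp Sh t s = Idn Sh (Cod Sh t)"
    thus thesis using t(2) by (intro that[of s]) (simp_all add: hom_def)
  qed
  have bs: "bij_betw (component s c) (P' c) (sec X c)" if c: "c \<in> Ob C" for c
  proof (rule bij_betw_byWitness[of _ "component t c"])
    show "\<forall>a\<in>P' c. component t c (component s c a) = a"
      using sh_comp(2)[OF s(1) t(2) c] sh_id(2)[OF A(1) c] A(2)[OF c] s(3) by simp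
    show "\<forall>a\<in>sec X c. component s c (component t c a) = a"
      using sh_comp(2)[OF t(2) s(1) c] sh_id(2)[OF \<Phi>_ob[OF X] c] s(2) by simp
    show "component s c ` P' c \<subseteq> sec X c" using sh_component(1)[OF s(1) c] A(2)[OF c] by auto
    show "component t c ` sec X c \<subseteq> P' c" using sh_component(1)[OF t(2) c] A(2)[OF c] by auto
  qed
  show thesis
  proof (rule that[OF X, of "\<lambda>c. component s c \<circ> b c"])
    show "bij_betw (component s c \<circ> b c) (P c) (sec X c)" if "c \<in> Ob C" for c
      using bij_betw_trans[OF b(1) bs] that by blast
    fix f x assume f: "f \<in> Arr C" "x \<in> P (Cod C f)"
    have bx: "b (Cod C f) x \<in> P' (Cod C f)" using b(1)[of "Cod C f"] f bij_betwE by fastforce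
    show "(component s (Dom C f) \<circ> b (Dom C f)) (r f x) = res X f ((component s (Cod C f) \<circ> b (Cod C f)) x)"
      using b(2)[OF f] A(2,3) bx f sh_component(2)[OF s(1) f(1), of "b (Cod C f) x"] by simp
  qed
qed

text \<open>The object \<open>X\<close> corresponds to the sheafification of the presheaf represented by \<open>c\<close>, and
  \<open>e\<close> to the image of the identity.\<close>

lemma ex_gen:
  assumes c: "c \<in> Ob C"
  shows "\<exists>X. X \<in> Ob E \<and> (\<exists>e. local_gen (sec X) (res X) c e)"
proof -
  have "small_in TYPE('u) (Arr C)" using small_cat small_in_self unfolding small_category_def by blast
  hence "small_in TYPE('u) (Pow (Arr C \<times> Arr C))" using small_in_Pow small_in_Times univ by blast
  moreover have "functional_rel c d \<subseteq> Pow (Arr C \<times> Arr C)" for d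
  proof
    fix A assume A: "A \<in> functional_rel c d"
    show "A \<in> Pow (Arr C \<times> Arr C)" using closed_relD(1,3)[OF functional_relD(1)[OF A]] by auto
  qed
  ultimately have small: "small_in TYPE('u) (functional_rel c d)" for d using small_in_subset by blast
  obtain X b where X: "X \<in> Ob E" and b: "\<And>d. d \<in> Ob C \<Longrightarrow> bij_betw (b d) (functional_rel c d) (sec X d)"
    "\<And>f x. f \<in> Arr C \<Longrightarrow> x \<in> functional_rel c (Cod C f) \<Longrightarrow> b (Dom C f) (restrict_rel f x) = res X f (b (Cod C f) x)"
    using realize[OF functional_rel_sheaf small] by blast
  have P: "presheaf C (functional_rel c) restrict_rel" using functional_rel_sheaf unfolding sheaf_def by blast
  show ?thesis
    using local_gen_transport[OF functional_rel_local_gen[OF c] P b] X by blast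
qed

definition gen_ob :: "'u \<Rightarrow> 'o" where
  "gen_ob c = (SOME X. X \<in> Ob E \<and> (\<exists>e. local_gen (sec X) (res X) c e))"

definition gen_elt :: "'u \<Rightarrow> 'u" where
  "gen_elt c = (SOME e. local_gen (sec (gen_ob c)) (res (gen_ob c)) c e)"

lemma gen_ob: "c \<in> Ob C \<Longrightarrow> gen_ob c \<in> Ob E"
  and gen_elt: "c \<in> Ob C \<Longrightarrow> local_gen (sec (gen_ob c)) (res (gen_ob c)) c (gen_elt c)"
proof -
  assume "c \<in> Ob C"
  from someI_ex[OF ex_gen[OF this]]
  have 1: "gen_ob c \<in> Ob E \<and> (\<exists>e. local_gen (sec (gen_ob c)) (res (gen_ob c)) c e)"
    unfolding gen_ob_def .
  thus "gen_ob c \<in> Ob E" by (rule conjunct1)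
  show "local_gen (sec (gen_ob c)) (res (gen_ob c)) c (gen_elt c)"
    unfolding gen_elt_def by (rule someI_ex[OF conjunct2[OF 1]])
qed

lemma gen_elt_sec: "c \<in> Ob C \<Longrightarrow> gen_elt c \<in> sec (gen_ob c) c"
  using local_genD(2)[OF gen_elt] .

text \<open>The bijection between arrows \<open>gen_ob c \<rightarrow> X\<close> and sections of \<open>X\<close> over \<open>c\<close>.\<close>

definition el :: "'u \<Rightarrow> 'a \<Rightarrow> 'u" where
  "el c v = component (FArr \<Phi> v) c (gen_elt c)"

lemma el_bij:
  assumes c: "c \<in> Ob C" and X: "X \<in> Ob E"
  shows "bij_betw (el c) (hom E (gen_ob c) X) (sec X c)"
  unfolding bij_betw_def
proof (intro conjI equalityI subsetI)
  note g = gen_ob[OF c] and e = gen_elt[OF c] and es = gen_elt_sec[OF c]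
  note Fs = sec_sheaf[OF X] and Ps = sec_presheaf[OF g]
  show "inj_on (el c) (hom E (gen_ob c) X)"
  proof (rule inj_onI)
    fix v w assume v: "v \<in> hom E (gen_ob c) X" and w: "w \<in> hom E (gen_ob c) X" and eq: "el c v = el c w"
    have "FArr \<Phi> v = FArr \<Phi> w"
    proof (rule sh_ext[OF \<Phi>_hom[OF v] \<Phi>_hom[OF w]])
      fix d x assume "d \<in> Ob C" "x \<in> sec (gen_ob c) d"
      thus "component (FArr \<Phi> v) d x = component (FArr \<Phi> w) d x"
        by (rule local_gen_unique[OF Fs Ps e, of "component (FArr \<Phi> v)" "component (FArr \<Phi> w)", rotated 5])
           (use sh_component(1,2)[OF \<Phi>_hom[OF v]] sh_component(1,2)[OF \<Phi>_hom[OF w]] eq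
             in \<open>simp_all add: el_def\<close>)
    qed
    thus "v = w" using ff[OF g X \<Phi>_hom[OF v]] v w by metis
  qed
  fix x assume "x \<in> el c ` hom E (gen_ob c) X"
  thus "x \<in> sec X c" using sh_component(1)[OF \<Phi>_hom c es] by (auto simp: el_def)
next
  note g = gen_ob[OF c] and e = gen_elt[OF c] and es = gen_elt_sec[OF c]
  note Fs = sec_sheaf[OF X] and Ps = sec_presheaf[OF g]
  fix x assume x: "x \<in> sec X c"
  obtain th where th: "\<And>U z. U \<in> Ob C \<Longrightarrow> z \<in> sec (gen_ob c) U \<Longrightarrow> th U z \<in> sec X U"
    "\<And>f z. f \<in> Arr C \<Longrightarrow> z \<in> sec (gen_ob c) (Cod C f) \<Longrightarrow>
       th (Dom C f) (res (gen_ob c) f z) = res X f (th (Cod C f) z)"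
    "th c (gen_elt c) = x"
    using local_gen_extend[OF Fs Ps e x] by blast
  obtain t where t: "t \<in> hom Sh (FOb \<Phi> (gen_ob c)) (FOb \<Phi> X)"
    "\<And>d z. d \<in> Ob C \<Longrightarrow> z \<in> sec (gen_ob c) d \<Longrightarrow> component t d z = th d z"
    using sh_mk_arr[OF \<Phi>_ob[OF g] \<Phi>_ob[OF X], of th] th(1,2) by blast
  obtain v where "v \<in> hom E (gen_ob c) X" "FArr \<Phi> v = t" using ff[OF g X t(1)] by blast
  moreover from this have "el c v = x" using t(2)[OF c es] th(3) by (simp add: el_def)
  ultimately show "x \<in> el c ` hom E (gen_ob c) X" by blast
qed

lemma el_sec: "c \<in> Ob C \<Longrightarrow> X \<in> Ob E \<Longrightarrow> v \<in> hom E (gen_ob c) X \<Longrightarrow> el c v \<in> sec X c"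
  using el_bij bij_betwE by blast

lemma el_inj:
  "c \<in> Ob C \<Longrightarrow> X \<in> Ob E \<Longrightarrow> v \<in> hom E (gen_ob c) X \<Longrightarrow> w \<in> hom E (gen_ob c) X \<Longrightarrow> el c v = el c w \<Longrightarrow> v = w"
  using el_bij unfolding bij_betw_def by (meson inj_onD)

lemma el_surj:
  assumes "c \<in> Ob C" "X \<in> Ob E" "x \<in> sec X c"
  obtains v where "v \<in> hom E (gen_ob c) X" "el c v = x"
proof -
  have "x \<in> el c ` hom E (gen_ob c) X"
    using el_bij[OF assms(1,2)] assms(3) by (simp add: bij_betw_def)
  thus thesis using that by blast
qed

lemma el_comp:
  assumes c: "c \<in> Ob C" and v: "v \<in> hom E (gen_ob c) X" and w: "w \<in> hom E X Y"
  shows "el c (Comp E w v) = component (FArr \<Phi> w) c (el c v)"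
proof -
  have "FArr \<Phi> (Comp E w v) = Comp Sh (FArr \<Phi> w) (FArr \<Phi> v)"
    using \<Phi> v w unfolding is_functor_def by (simp add: hom_def)
  thus ?thesis
    using sh_comp(2)[OF \<Phi>_hom[OF v] \<Phi>_hom[OF w] c gen_elt_sec[OF c]] by (simp add: el_def)
qed

text \<open>The arrow \<open>gen_ob (Dom f) \<rightarrow> gen_ob (Cod f)\<close> that corresponds, by Yoneda, to the
  restriction of the generic section along \<open>f\<close>.\<close>

definition gen_arr :: "'u \<Rightarrow> 'a" where
  "gen_arr f = (SOME v. v \<in> hom E (gen_ob (Dom C f)) (gen_ob (Cod C f)) \<and>
     el (Dom C f) v = res (gen_ob (Cod C f)) f (gen_elt (Cod C f)))"

lemma gen_arr:
  assumes f: "f \<in> Arr C"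
  shows "gen_arr f \<in> hom E (gen_ob (Dom C f)) (gen_ob (Cod C f))"
    and "el (Dom C f) (gen_arr f) = res (gen_ob (Cod C f)) f (gen_elt (Cod C f))"
proof -
  have c: "Cod C f \<in> Ob C" "Dom C f \<in> Ob C" using f by auto
  have "res (gen_ob (Cod C f)) f (gen_elt (Cod C f)) \<in> sec (gen_ob (Cod C f)) (Dom C f)"
    using presheafD(1)[OF sec_presheaf[OF gen_ob[OF c(1)]] f refl gen_elt_sec[OF c(1)]] .
  then obtain v where "v \<in> hom E (gen_ob (Dom C f)) (gen_ob (Cod C f))"
      "el (Dom C f) v = res (gen_ob (Cod C f)) f (gen_elt (Cod C f))"
    using el_surj[OF c(2) gen_ob[OF c(1)]] by blast
  hence "\<exists>v. v \<in> hom E (gen_ob (Dom C f)) (gen_ob (Cod C f)) \<and>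
      el (Dom C f) v = res (gen_ob (Cod C f)) f (gen_elt (Cod C f))" by blast
  hence "gen_arr f \<in> hom E (gen_ob (Dom C f)) (gen_ob (Cod C f)) \<and>
      el (Dom C f) (gen_arr f) = res (gen_ob (Cod C f)) f (gen_elt (Cod C f))"
    unfolding gen_arr_def by (rule someI_ex)
  thus "gen_arr f \<in> hom E (gen_ob (Dom C f)) (gen_ob (Cod C f))"
    "el (Dom C f) (gen_arr f) = res (gen_ob (Cod C f)) f (gen_elt (Cod C f))" by blast+
qed

lemma gen_arr_arr [simp]:
  assumes "f \<in> Arr C"
  shows "gen_arr f \<in> Arr E" "Dom E (gen_arr f) = gen_ob (Dom C f)" "Cod E (gen_arr f) = gen_ob (Cod C f)"
  using gen_arr(1)[OF assms] by (auto simp: hom_def)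

lemma el_gen_arr:
  assumes f: "f \<in> Arr C" and v: "v \<in> hom E (gen_ob (Cod C f)) X"
  shows "el (Dom C f) (Comp E v (gen_arr f)) = res X f (el (Cod C f) v)"
  using el_comp[OF _ gen_arr(1)[OF f] v] gen_arr(2)[OF f] sh_component(2)[OF \<Phi>_hom[OF v] f gen_elt_sec] f
  by (simp add: el_def)

lemma el_id: "c \<in> Ob C \<Longrightarrow> el c (Idn E (gen_ob c)) = gen_elt c"
  using \<Phi> gen_ob gen_elt_sec sh_id(2)[OF \<Phi>_ob] unfolding is_functor_def by (simp add: el_def)

lemma gen_arr_id:
  assumes c: "c \<in> Ob C" shows "gen_arr (Idn C c) = Idn E (gen_ob c)"
proof (rule el_inj[OF c gen_ob[OF c]])
  show "gen_arr (Idn C c) \<in> hom E (gen_ob c) (gen_ob c)" "Idn E (gen_ob c) \<in> hom E (gen_ob c) (gen_ob c)"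
    using c gen_ob[OF c] by (simp_all add: hom_def)
  show "el c (gen_arr (Idn C c)) = el c (Idn E (gen_ob c))"
    using gen_arr(2)[of "Idn C c"] c el_id[OF c] presheafD(2)[OF sec_presheaf[OF gen_ob[OF c]] c gen_elt_sec[OF c]]
    by simp
qed

lemma gen_arr_comp:
  assumes f: "f \<in> Arr C" and g: "g \<in> Arr C" "Cod C f = Dom C g"
  shows "gen_arr (g \<cdot> f) = Comp E (gen_arr g) (gen_arr f)"
proof (rule el_inj[of "Dom C f" "gen_ob (Cod C g)"])
  show "Dom C f \<in> Ob C" "gen_ob (Cod C g) \<in> Ob E" using f g gen_ob by auto
  show "gen_arr (g \<cdot> f) \<in> hom E (gen_ob (Dom C f)) (gen_ob (Cod C g))"
    "Comp E (gen_arr g) (gen_arr f) \<in> hom E (gen_ob (Dom C f)) (gen_ob (Cod C g))"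
    using f g by (simp_all add: hom_def)
  have cg: "Cod C g \<in> Ob C" using g by simp
  have gg: "gen_arr g \<in> hom E (gen_ob (Cod C f)) (gen_ob (Cod C g))" using gen_arr(1)[OF g(1)] g by simp
  have "el (Dom C f) (gen_arr (g \<cdot> f)) = res (gen_ob (Cod C g)) f (res (gen_ob (Cod C g)) g (gen_elt (Cod C g)))"
    using gen_arr(2)[of "g \<cdot> f"] f g
      presheafD(3)[OF sec_presheaf[OF gen_ob[OF cg]] f g refl gen_elt_sec[OF cg]] by simp
  thus "el (Dom C f) (gen_arr (g \<cdot> f)) = el (Dom C f) (Comp E (gen_arr g) (gen_arr f))"
    using el_gen_arr[OF f gg] gen_arr(2)[OF g(1)] g(2) by simp
qed

theorem generated: "generated_topos E C K \<lparr>FOb = gen_ob, FArr = gen_arr\<rparr>"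
proof (unfold_locales, unfold fctr.select_convs)
  show "universe TYPE('u)" by (rule univ)
  show "small (Ob C)" using small_cat unfolding small_category_def by blast
  show "is_functor C E \<lparr>FOb = gen_ob, FArr = gen_arr\<rparr>"
    unfolding is_functor_def using gen_ob gen_arr(1) by (simp add: gen_arr_id gen_arr_comp)
  fix c X assume c: "c \<in> Ob C" and X: "X \<in> Ob E"
  have "small_in TYPE('u) (sec X c)" using sh_small[OF \<Phi>_ob[OF X] c] by (simp add: small_in_self)
  thus "small_in TYPE('u) (hom E (gen_ob c) X)"
    by (rule small_in_inj[of _ _ "el c"]) (use el_bij[OF c X] in \<open>simp_all add: bij_betw_def\<close>)
next
  fix X assume X: "X \<in> Ob E"
  let ?i = "\<lambda>c. inv_into (hom E (gen_ob c) X) (el c)"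
  have i: "?i c x \<in> hom E (gen_ob c) X" "el c (?i c x) = x" if "c \<in> Ob C" "x \<in> sec X c" for c x
    using el_bij[OF that(1) X] that(2) unfolding bij_betw_def
    by (simp_all add: inv_into_into f_inv_into_f)
  show "sheaf C K (\<lambda>c. hom E (gen_ob c) X) (\<lambda>f u. Comp E u (gen_arr f))"
  proof (rule sheaf_transport[OF sec_sheaf[OF X], of ?i])
    show "bij_betw (?i c) (sec X c) (hom E (gen_ob c) X)" if "c \<in> Ob C" for c
      using el_bij[OF that X] by (rule bij_betw_inv_into)
    fix f x assume f: "f \<in> Arr C" "x \<in> sec X (Cod C f)"
    have u: "?i (Cod C f) x \<in> hom E (gen_ob (Cod C f)) X" "el (Cod C f) (?i (Cod C f) x) = x"
      using i[OF _ f(2)] f(1) by simp_all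
    have rx: "res X f x \<in> sec X (Dom C f)" using presheafD(1)[OF sec_presheaf[OF X] f(1) refl f(2)] .
    show "?i (Dom C f) (res X f x) = Comp E (?i (Cod C f) x) (gen_arr f)"
    proof (rule el_inj[OF _ X])
      show "Comp E (?i (Cod C f) x) (gen_arr f) \<in> hom E (gen_ob (Dom C f)) X"
        using u(1) f(1) by (simp add: hom_def)
      show "el (Dom C f) (?i (Dom C f) (res X f x)) = el (Dom C f) (Comp E (?i (Cod C f) x) (gen_arr f))"
        using el_gen_arr[OF f(1) u(1)] u(2) i(2)[OF _ rx] f(1) by simp
    qed (use i(1)[OF _ rx] f(1) in simp_all)
  qed
next
  fix c d a assume c: "c \<in> Ob C" and d: "d \<in> Ob C" and a: "a \<in> hom E (gen_ob d) (gen_ob c)"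
  show "locally d (\<lambda>g. \<exists>f\<in>Arr C. Dom C f = Dom C g \<and> Cod C f = c \<and> Comp E a (gen_arr g) = gen_arr f)"
  proof (rule locally_mono[OF local_genD(3)[OF gen_elt[OF c] d el_sec[OF d gen_ob[OF c] a]]])
    fix g assume g: "g \<in> Arr C" "Cod C g = d"
      "\<exists>f\<in>Arr C. Cod C f = c \<and> Dom C f = Dom C g \<and> res (gen_ob c) g (el d a) = res (gen_ob c) f (gen_elt c)"
    then obtain f where f: "f \<in> Arr C" "Cod C f = c" "Dom C f = Dom C g"
      "res (gen_ob c) g (el d a) = res (gen_ob c) f (gen_elt c)" by blast
    have "Comp E a (gen_arr g) = gen_arr f"
    proof (rule el_inj[OF _ gen_ob[OF c]])
      show "Dom C g \<in> Ob C" using g by simp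
      show "Comp E a (gen_arr g) \<in> hom E (gen_ob (Dom C g)) (gen_ob c)" using a g by (simp add: hom_def)
      show "gen_arr f \<in> hom E (gen_ob (Dom C g)) (gen_ob c)" using gen_arr(1)[OF f(1)] f by simp
      show "el (Dom C g) (Comp E a (gen_arr g)) = el (Dom C g) (gen_arr f)"
        using el_gen_arr[OF g(1), of a "gen_ob c"] gen_arr(2)[OF f(1)] a g f by simp
    qed
    thus "\<exists>f\<in>Arr C. Dom C f = Dom C g \<and> Cod C f = c \<and> Comp E a (gen_arr g) = gen_arr f" using f by blast
  qed
next
  fix f f' assume f: "f \<in> Arr C" "f' \<in> Arr C" "Dom C f = Dom C f'" "Cod C f = Cod C f'"
    "gen_arr f = gen_arr f'"
  hence "res (gen_ob (Cod C f)) f (gen_elt (Cod C f)) = res (gen_ob (Cod C f)) f' (gen_elt (Cod C f))"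
    using gen_arr(2)[OF f(1)] gen_arr(2)[OF f(2)] by simp
  moreover have "Cod C f \<in> Ob C" using f(1) by simp
  ultimately show "locally (Dom C f) (\<lambda>g. f \<cdot> g = f' \<cdot> g)"
    by (intro local_genD(4)[OF gen_elt[of "Cod C f"] f(1,2) refl f(4)[symmetric] f(3)])
next
  fix P :: "'u \<Rightarrow> 'u set" and r assume P: "sheaf C K P r" and small: "\<And>c. c \<in> Ob C \<Longrightarrow> small (P c)"
  obtain X b where X: "X \<in> Ob E" and b: "\<And>c. c \<in> Ob C \<Longrightarrow> bij_betw (b c) (P c) (sec X c)"
    "\<And>f x. f \<in> Arr C \<Longrightarrow> x \<in> P (Cod C f) \<Longrightarrow> b (Dom C f) (r f x) = res X f (b (Cod C f) x)"
    using realize[OF P] small small_in_self by blast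
  define \<rho> where "\<rho> = (\<lambda>c u. inv_into (P c) (b c) (el c u))"
  have \<rho>: "\<rho> c u \<in> P c" "b c (\<rho> c u) = el c u" if "c \<in> Ob C" "u \<in> hom E (gen_ob c) X" for c u
    using b(1)[OF that(1)] el_sec[OF that(1) X that(2)] unfolding \<rho>_def bij_betw_def
    by (simp_all add: inv_into_into f_inv_into_f)
  have "bij_betw (\<rho> c) (hom E (gen_ob c) X) (P c)" if "c \<in> Ob C" for c
    using bij_betw_trans[OF el_bij[OF that X] bij_betw_inv_into[OF b(1)[OF that]]]
    by (simp add: \<rho>_def o_def)
  moreover have "\<rho> (Dom C f) (Comp E u (gen_arr f)) = r f (\<rho> (Cod C f) u)"
    if f: "f \<in> Arr C" and u: "u \<in> hom E (gen_ob (Cod C f)) X" for f u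
  proof -
    have d: "Dom C f \<in> Ob C" "Cod C f \<in> Ob C" using f by auto
    have ug: "Comp E u (gen_arr f) \<in> hom E (gen_ob (Dom C f)) X" using u f by (simp add: hom_def)
    have "b (Dom C f) (\<rho> (Dom C f) (Comp E u (gen_arr f))) = b (Dom C f) (r f (\<rho> (Cod C f) u))"
      using b(2)[OF f \<rho>(1)[OF d(2) u]] \<rho>(2)[OF d(2) u] \<rho>(2)[OF d(1) ug] el_gen_arr[OF f u] by simp
    moreover have "r f (\<rho> (Cod C f) u) \<in> P (Dom C f)"
      using presheafD(1)[OF conjunct1[OF P[unfolded sheaf_def]] f refl \<rho>(1)[OF d(2) u]] .
    ultimately show ?thesis
      using b(1)[OF d(1)] \<rho>(1)[OF d(1) ug] unfolding bij_betw_def by (meson inj_onD)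
  qed
  ultimately show "\<exists>X\<in>Ob E. \<exists>\<rho>. (\<forall>c\<in>Ob C. bij_betw (\<rho> c) (hom E (gen_ob c) X) (P c)) \<and>
        (\<forall>f\<in>Arr C. \<forall>u\<in>hom E (gen_ob (Cod C f)) X.
           \<rho> (Dom C f) (Comp E u (gen_arr f)) = r f (\<rho> (Cod C f) u))"
    using X by blast
next
  fix X Y th assume X: "X \<in> Ob E" and Y: "Y \<in> Ob E"
    and th: "\<And>c u. c \<in> Ob C \<Longrightarrow> u \<in> hom E (gen_ob c) X \<Longrightarrow> th c u \<in> hom E (gen_ob c) Y"
      "\<And>f u. f \<in> Arr C \<Longrightarrow> u \<in> hom E (gen_ob (Cod C f)) X \<Longrightarrow>
         th (Dom C f) (Comp E u (gen_arr f)) = Comp E (th (Cod C f) u) (gen_arr f)"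
  define i where "i = (\<lambda>c. inv_into (hom E (gen_ob c) X) (el c))"
  have i: "i c x \<in> hom E (gen_ob c) X" "el c (i c x) = x" if "c \<in> Ob C" "x \<in> sec X c" for c x
    using el_bij[OF that(1) X] that(2) unfolding bij_betw_def i_def
    by (simp_all add: inv_into_into f_inv_into_f)
  have i_el: "i c (el c u) = u" if "c \<in> Ob C" "u \<in> hom E (gen_ob c) X" for c u
    using el_inj[OF that(1) X _ that(2)] i[OF that(1) el_sec[OF that(1) X that(2)]] by blast
  have n: "el (Dom C f) (th (Dom C f) (i (Dom C f) (res X f x))) = res Y f (el (Cod C f) (th (Cod C f) (i (Cod C f) x)))"
    if f: "f \<in> Arr C" and x: "x \<in> sec X (Cod C f)" for f x
  proof -
    have d: "Dom C f \<in> Ob C" "Cod C f \<in> Ob C" using f by auto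
    define u where "u = i (Cod C f) x"
    have u: "u \<in> hom E (gen_ob (Cod C f)) X" "el (Cod C f) u = x" using i[OF d(2) x] by (auto simp: u_def)
    have ug: "Comp E u (gen_arr f) \<in> hom E (gen_ob (Dom C f)) X" using u f by (simp add: hom_def)
    have "i (Dom C f) (res X f x) = Comp E u (gen_arr f)"
      using i_el[OF d(1) ug] el_gen_arr[OF f u(1)] u(2) by simp
    thus ?thesis using th(2)[OF f u(1)] el_gen_arr[OF f th(1)[OF d(2) u(1)]] by (simp add: u_def)
  qed
  obtain t where t: "t \<in> hom Sh (FOb \<Phi> X) (FOb \<Phi> Y)"
    "\<And>c x. c \<in> Ob C \<Longrightarrow> x \<in> sec X c \<Longrightarrow> component t c x = el c (th c (i c x))"
    by (rule sh_mk_arr[OF \<Phi>_ob[OF X] \<Phi>_ob[OF Y], of "\<lambda>c x. el c (th c (i c x))"])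
       (use el_sec[OF _ Y th(1)[OF _ i(1)]] n in blast)+
  have iff: "(\<forall>c\<in>Ob C. \<forall>u\<in>hom E (gen_ob c) X. Comp E y u = th c u) \<longleftrightarrow> FArr \<Phi> y = t"
    if y: "y \<in> hom E X Y" for y
  proof
    assume yu: "\<forall>c\<in>Ob C. \<forall>u\<in>hom E (gen_ob c) X. Comp E y u = th c u"
    show "FArr \<Phi> y = t"
    proof (rule sh_ext[OF \<Phi>_hom[OF y] t(1)])
      fix c x assume c: "c \<in> Ob C" "x \<in> sec X c"
      show "component (FArr \<Phi> y) c x = component t c x"
        using el_comp[OF c(1) i(1)[OF c] y] yu i[OF c] c t(2)[OF c] by simp
    qed
  next
    assume yt: "FArr \<Phi> y = t"
    show "\<forall>c\<in>Ob C. \<forall>u\<in>hom E (gen_ob c) X. Comp E y u = th c u"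
    proof (intro ballI)
      fix c u assume c: "c \<in> Ob C" "u \<in> hom E (gen_ob c) X"
      show "Comp E y u = th c u"
      proof (rule el_inj[OF c(1) Y _ th(1)[OF c]])
        show "Comp E y u \<in> hom E (gen_ob c) Y" using c(2) y by (simp add: hom_def)
        show "el c (Comp E y u) = el c (th c u)"
          using el_comp[OF c y] yt t(2)[OF c(1) el_sec[OF c(1) X c(2)]] i_el[OF c] by simp
      qed
    qed
  qed
  show "\<exists>!y. y \<in> hom E X Y \<and> (\<forall>c\<in>Ob C. \<forall>u\<in>hom E (gen_ob c) X. Comp E y u = th c u)"
    using ff[OF X Y t(1)] iff by metis
qed

end

lemma topos_generated:
  fixes E :: "('o, 'a) cat"
  assumes U: "universe TYPE('u)" and E: "grothendieck_topos TYPE('u) E"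
  obtains C :: "('u, 'u) cat" and K G where "generated_topos E C K G"
proof -
  obtain C :: "('u, 'u) cat" and K where C: "small_category C" "grothendieck_topology C K"
    and eq: "equivalent_cats E (sheaf_cat C K)"
    using E unfolding grothendieck_topos_def by blast
  have cE: "category E" using E unfolding grothendieck_topos_def by blast
  have cC: "category C" using C unfolding small_category_def by blast
  interpret small_site C K
    using cC C U by (intro small_site.intro site.intro site_axioms.intro small_site_axioms.intro)
  obtain F where F: "is_functor E Sh F"
    "\<And>X Y h. X \<in> Ob E \<Longrightarrow> Y \<in> Ob E \<Longrightarrow> h \<in> hom Sh (FOb F X) (FOb F Y) \<Longrightarrow>
       \<exists>!f. f \<in> hom E X Y \<and> FArr F f = h"
    "\<And>A. A \<in> Ob Sh \<Longrightarrow> \<exists>X\<in>Ob E. \<exists>t. is_iso Sh t \<and> t \<in> hom Sh (FOb F X) A"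
    using equivalent_cats_functor[OF cE sh_category eq] by blast
  interpret sheaf_model C K E F
    using small_site_axioms cE F by (intro sheaf_model.intro sheaf_model_axioms.intro)
  show thesis using generated by (rule that)
qed


section \<open>The canonical topology and representability\<close>

context generated_topos
begin

lemma G_ob [simp]: "c \<in> Ob C \<Longrightarrow> FOb G c \<in> Ob E"
  using G_functor unfolding is_functor_def by blast

lemma G_arr [simp]:
  assumes "f \<in> Arr C"
  shows "FArr G f \<in> Arr E" "Dom E (FArr G f) = FOb G (Dom C f)" "Cod E (FArr G f) = FOb G (Cod C f)"
  using G_functor assms unfolding is_functor_def by (auto simp: hom_def)

lemma G_comp:
  "f \<in> Arr C \<Longrightarrow> g \<in> Arr C \<Longrightarrow> Cod C f = Dom C g \<Longrightarrow>
     FArr G (g \<cdot>\<^bsub>C\<^esub> f) = FArr G g \<cdot> FArr G f"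
  using G_functor unfolding is_functor_def by blast

lemma G_id: "c \<in> Ob C \<Longrightarrow> FArr G (Idn C c) = Idn E (FOb G c)"
  using G_functor unfolding is_functor_def by blast

text \<open>Arrows \<open>FOb G c \<rightarrow> X\<close> are the sections of \<open>X\<close> over \<open>c\<close>, so a sieve is covering if
  it is locally surjective on sections.  This is the canonical topology of the topos: its coverings
  are the sieves that contain jointly epimorphic families, by \<open>cov_epi\<close> and \<open>epi_cov\<close> below.\<close>

definition Cov :: "'o \<Rightarrow> 'a set set" where
  "Cov X = {S. is_sieve E X S \<and>
     (\<forall>c\<in>Ob C. \<forall>u\<in>hom E (FOb G c) X. S.locally c (\<lambda>g. u \<cdot> FArr G g \<in> S))}"

lemma CovD:
  assumes "S \<in> Cov X"
  shows "is_sieve E X S"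
    and "c \<in> Ob C \<Longrightarrow> u \<in> Arr E \<Longrightarrow> Dom E u = FOb G c \<Longrightarrow> Cod E u = X \<Longrightarrow>
      S.locally c (\<lambda>g. u \<cdot> FArr G g \<in> S)"
  using assms unfolding Cov_def by (simp_all add: hom_def)

lemma CovI:
  assumes "is_sieve E X S"
    and "\<And>c u. c \<in> Ob C \<Longrightarrow> u \<in> Arr E \<Longrightarrow> Dom E u = FOb G c \<Longrightarrow> Cod E u = X \<Longrightarrow>
      S.locally c (\<lambda>g. u \<cdot> FArr G g \<in> S)"
  shows "S \<in> Cov X"
  using assms unfolding Cov_def by (simp add: hom_def)

lemma Cov_topology: "grothendieck_topology E Cov"
  unfolding grothendieck_topology_def
proof (intro conjI ballI allI impI)
  fix c S assume "S \<in> Cov c"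
  thus "is_sieve E c S" by (rule CovD)
next
  fix X
  show "{f \<in> Arr E. Cod E f = X} \<in> Cov X"
    by (rule CovI[OF E.max_sieve]) (rule S.locally_all, simp_all)
next
  fix f S assume f: "f \<in> Arr E" and S: "S \<in> Cov (Cod E f)"
  show "pullback_sieve E f S \<in> Cov (Dom E f)"
  proof (rule CovI)
    show "is_sieve E (Dom E f) (pullback_sieve E f S)"
      using E.pullback_sieve_sieve[OF CovD(1)[OF S] f refl] .
    fix c u assume u: "c \<in> Ob C" "u \<in> Arr E" "Dom E u = FOb G c" "Cod E u = Dom E f"
    have "S.locally c (\<lambda>g. f \<cdot> u \<cdot> FArr G g \<in> S)"
      using CovD(2)[OF S u(1), of "f \<cdot> u"] f u by simp
    thus "S.locally c (\<lambda>g. u \<cdot> FArr G g \<in> pullback_sieve E f S)"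
      by (rule S.locally_mono) (use f u in \<open>simp add: E.pullback_sieve_iff\<close>)
  qed
next
  fix X S S' assume X: "X \<in> Ob E" and S: "S \<in> Cov X" and S': "is_sieve E X S'"
    and loc: "\<forall>f\<in>S. pullback_sieve E f S' \<in> Cov (Dom E f)"
  show "S' \<in> Cov X"
  proof (rule CovI[OF S'])
    fix c u assume u: "c \<in> Ob C" "u \<in> Arr E" "Dom E u = FOb G c" "Cod E u = X"
    show "S.locally c (\<lambda>g. u \<cdot> FArr G g \<in> S')"
    proof (rule S.locally_trans[OF CovD(2)[OF S u]])
      fix g assume g: "g \<in> Arr C" "Cod C g = c" "u \<cdot> FArr G g \<in> S"
      have "pullback_sieve E (u \<cdot> FArr G g) S' \<in> Cov (FOb G (Dom C g))"
        using loc g u by force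
      from CovD(2)[OF this, of "Dom C g" "Idn E (FOb G (Dom C g))"]
      have "S.locally (Dom C g) (\<lambda>h. Idn E (FOb G (Dom C g)) \<cdot> FArr G h
          \<in> pullback_sieve E (u \<cdot> FArr G g) S')"
        using g by simp
      thus "S.locally (Dom C g) (\<lambda>h. u \<cdot> FArr G (g \<cdot>\<^bsub>C\<^esub> h) \<in> S')"
        by (rule S.locally_mono) (use g u in \<open>simp add: E.pullback_sieve_iff G_comp\<close>)
    qed
  qed
qed

sublocale T: site E Cov
  by unfold_locales (rule Cov_topology)

text \<open>Coverings of the site become coverings in the topos, although the image of a sieve generates
  more arrows than the sieve has: arrows between objects in the image of \<open>G\<close> are locally images.\<close>

lemma locally_gen:
  assumes Q: "S.locally c Q"
  shows "T.locally (FOb G c) (\<lambda>f. \<exists>g\<in>Arr C. Cod C g = c \<and> Q g \<and>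
           (\<exists>w\<in>Arr E. Cod E w = FOb G (Dom C g) \<and> f = FArr G g \<cdot> w))"
proof -
  have c: "c \<in> Ob C" using Q unfolding S.locally_def by blast
  define S where "S = {f. \<exists>g\<in>Arr C. Cod C g = c \<and> Q g \<and>
           (\<exists>w\<in>Arr E. Cod E w = FOb G (Dom C g) \<and> f = FArr G g \<cdot> w)}"
  have "S = gen_sieve E (FArr G ` {g \<in> Arr C. Cod C g = c \<and> Q g})"
    unfolding S_def gen_sieve_def by (auto 0 4)
  hence sS: "is_sieve E (FOb G c) S"
    by (simp only:) (rule E.gen_sieve_sieve, auto)
  have "S \<in> Cov (FOb G c)"
  proof (rule CovI[OF sS])
    fix d u assume d: "d \<in> Ob C" and u: "u \<in> Arr E" "Dom E u = FOb G d" "Cod E u = FOb G c"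
    have "S.locally d (\<lambda>g. \<exists>f\<in>Arr C. Dom C f = Dom C g \<and> Cod C f = c \<and>
        u \<cdot> FArr G g = FArr G f)"
      using gen_full[OF c d, of u] u by (simp add: hom_def)
    thus "S.locally d (\<lambda>g. u \<cdot> FArr G g \<in> S)"
    proof (rule S.locally_trans)
      fix h assume h: "h \<in> Arr C" "Cod C h = d"
        "\<exists>f\<in>Arr C. Dom C f = Dom C h \<and> Cod C f = c \<and> u \<cdot> FArr G h = FArr G f"
      then obtain f where f: "f \<in> Arr C" "Dom C f = Dom C h" "Cod C f = c"
        "u \<cdot> FArr G h = FArr G f" by blast
      have "S.locally (Dom C h) (\<lambda>k. Q (f \<cdot>\<^bsub>C\<^esub> k))"
        using S.locally_pull[OF Q f(1,3)] f(2) by simp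
      thus "S.locally (Dom C h) (\<lambda>k. u \<cdot> FArr G (h \<cdot>\<^bsub>C\<^esub> k) \<in> S)"
      proof (rule S.locally_mono)
        fix k assume k: "k \<in> Arr C" "Cod C k = Dom C h" "Q (f \<cdot>\<^bsub>C\<^esub> k)"
        have "u \<cdot> FArr G (h \<cdot>\<^bsub>C\<^esub> k) = (u \<cdot> FArr G h) \<cdot> FArr G k"
          using h k u by (simp add: G_comp)
        also have "\<dots> = FArr G (f \<cdot>\<^bsub>C\<^esub> k) \<cdot> Idn E (FOb G (Dom C k))"
          using f k by (simp add: G_comp)
        finally show "u \<cdot> FArr G (h \<cdot>\<^bsub>C\<^esub> k) \<in> S"
          unfolding S_def using k f
          by (intro CollectI bexI[of _ "f \<cdot>\<^bsub>C\<^esub> k"] conjI bexI[of _ "Idn E (FOb G (Dom C k))"]) simp_all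
      qed
    qed
  qed
  hence "T.locally (FOb G c) (\<lambda>f. f \<in> S)" using c by (intro T.locally_cov) simp_all
  thus ?thesis unfolding S_def by simp
qed

lemma gen_cover:
  assumes X: "X \<in> Ob E"
  shows "T.locally X (\<lambda>f. \<exists>c\<in>Ob C. \<exists>u\<in>Arr E. Dom E u = FOb G c \<and> Cod E u = X \<and>
           (\<exists>w\<in>Arr E. Cod E w = Dom E u \<and> f = u \<cdot> w))"
proof -
  define B where "B = {u \<in> Arr E. \<exists>c\<in>Ob C. Dom E u = FOb G c \<and> Cod E u = X}"
  have sS: "is_sieve E X (gen_sieve E B)"
    using E.gen_sieve_sieve[of B X] by (auto simp: B_def)
  have "gen_sieve E B \<in> Cov X"
  proof (rule CovI[OF sS])
    fix c u assume c: "c \<in> Ob C" "u \<in> Arr E" "Dom E u = FOb G c" "Cod E u = X"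
    hence "u \<in> B" by (auto simp: B_def)
    thus "S.locally c (\<lambda>g. u \<cdot> FArr G g \<in> gen_sieve E B)"
      using c by (intro S.locally_all E.gen_sieveI) auto
  qed
  from T.locally_cov[OF this X] show ?thesis
    by (rule T.locally_mono) (auto simp: gen_sieve_def B_def)
qed

lemma locally_via_gen:
  assumes X: "X \<in> Ob E"
    and Q: "\<And>c u. c \<in> Ob C \<Longrightarrow> u \<in> Arr E \<Longrightarrow> Dom E u = FOb G c \<Longrightarrow> Cod E u = X \<Longrightarrow>
      T.locally (FOb G c) (\<lambda>w. Q (u \<cdot> w))"
  shows "T.locally X Q"
proof (rule T.locally_trans[OF gen_cover[OF X]])
  fix f assume f: "f \<in> Arr E" "Cod E f = X"
    "\<exists>c\<in>Ob C. \<exists>u\<in>Arr E. Dom E u = FOb G c \<and> Cod E u = X \<and>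
           (\<exists>w\<in>Arr E. Cod E w = Dom E u \<and> f = u \<cdot> w)"
  then obtain c u w where u: "c \<in> Ob C" "u \<in> Arr E" "Dom E u = FOb G c" "Cod E u = X"
    and w: "w \<in> Arr E" "Cod E w = FOb G c" "f = u \<cdot> w" by metis
  have loc: "T.locally (Dom E w) (\<lambda>h. Q (u \<cdot> (w \<cdot> h)))"
    by (rule T.locally_pull[OF Q[OF u] w(1,2)])
  have "T.locally (Dom E w) (\<lambda>h. Q (f \<cdot> h))"
    by (rule T.locally_mono[OF loc]) (use u w in simp)
  thus "T.locally (Dom E f) (\<lambda>h. Q (f \<cdot> h))"
    using u w by simp
qed

lemma sheaf_gen_eq:
  assumes F: "sheaf E Cov F r" and X: "X \<in> Ob E" and xy: "x \<in> F X" "y \<in> F X"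
    and eq: "\<And>c u. c \<in> Ob C \<Longrightarrow> u \<in> Arr E \<Longrightarrow> Dom E u = FOb G c \<Longrightarrow> Cod E u = X \<Longrightarrow> r u x = r u y"
  shows "x = y"
proof (rule T.sheaf_locally_eq[OF F xy T.locally_mono[OF gen_cover[OF X]]])
  have P: "presheaf E F r" using F unfolding sheaf_def by blast
  fix f assume "\<exists>c\<in>Ob C. \<exists>u\<in>Arr E. Dom E u = FOb G c \<and> Cod E u = X \<and>
           (\<exists>w\<in>Arr E. Cod E w = Dom E u \<and> f = u \<cdot> w)"
  then obtain c u w where u: "c \<in> Ob C" "u \<in> Arr E" "Dom E u = FOb G c" "Cod E u = X"
    and w: "w \<in> Arr E" "Cod E w = Dom E u" "f = u \<cdot> w" by blast
  show "r f x = r f y"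
    using presheafD(3)[OF P w(1) u(2) w(2) u(4)] xy eq[OF u] w(3) by simp
qed

lemma sheaf_site_eq:
  assumes F: "sheaf E Cov F r" and xy: "x \<in> F (FOb G c)" "y \<in> F (FOb G c)"
    and eq: "S.locally c (\<lambda>g. r (FArr G g) x = r (FArr G g) y)"
  shows "x = y"
proof (rule T.sheaf_locally_eq[OF F xy T.locally_mono[OF locally_gen[OF eq]]])
  have P: "presheaf E F r" using F unfolding sheaf_def by blast
  fix f assume "\<exists>g\<in>Arr C. Cod C g = c \<and> r (FArr G g) x = r (FArr G g) y \<and>
           (\<exists>w\<in>Arr E. Cod E w = FOb G (Dom C g) \<and> f = FArr G g \<cdot> w)"
  then obtain g w where g: "g \<in> Arr C" "Cod C g = c" "r (FArr G g) x = r (FArr G g) y"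
    and w: "w \<in> Arr E" "Cod E w = FOb G (Dom C g)" "f = FArr G g \<cdot> w" by blast
  have "r f z = r w (r (FArr G g) z)" if "z \<in> F (FOb G c)" for z
    using presheafD(3)[OF P w(1), of "FArr G g" "FOb G c" z] g w that by simp
  thus "r f x = r f y" using xy g(3) by simp
qed

text \<open>To compare restrictions along \<open>w\<close> and \<open>v\<close> it suffices to do so after composition with
  generalized elements for which both composites come from the site.\<close>

lemma sheaf_span_eq:
  assumes F: "sheaf E Cov F r" and c: "c \<in> Ob C" "d \<in> Ob C"
    and w: "w \<in> Arr E" "Cod E w = FOb G c" and v: "v \<in> Arr E" "Cod E v = FOb G d"
    and dom: "Dom E w = Dom E v" and s: "s \<in> F (FOb G c)" and t: "t \<in> F (FOb G d)"
    and eq: "\<And>e k f f'. e \<in> Ob C \<Longrightarrow> k \<in> Arr E \<Longrightarrow> Dom E k = FOb G e \<Longrightarrow> Cod E k = Dom E w \<Longrightarrow>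
      f \<in> Arr C \<Longrightarrow> f' \<in> Arr C \<Longrightarrow> Dom C f = e \<Longrightarrow> Dom C f' = e \<Longrightarrow> Cod C f = c \<Longrightarrow> Cod C f' = d \<Longrightarrow>
      w \<cdot> k = FArr G f \<Longrightarrow> v \<cdot> k = FArr G f' \<Longrightarrow> r (FArr G f) s = r (FArr G f') t"
  shows "r w s = r v t"
proof (rule sheaf_gen_eq[OF F, of "Dom E w"])
  have P: "presheaf E F r" using F unfolding sheaf_def by blast
  show "Dom E w \<in> Ob E" using w by simp
  show ws: "r w s \<in> F (Dom E w)" using presheafD(1)[OF P w s] .
  show vt: "r v t \<in> F (Dom E w)" using presheafD(1)[OF P v t] dom by simp
  fix e k assume e: "e \<in> Ob C" and k: "k \<in> Arr E" "Dom E k = FOb G e" "Cod E k = Dom E w"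
  note kv = k(3)[unfolded dom]
  show "r k (r w s) = r k (r v t)"
  proof (rule sheaf_site_eq[OF F, of _ e])
    show "r k (r w s) \<in> F (FOb G e)" using presheafD(1)[OF P k(1,3) ws] k(2) by simp
    show "r k (r v t) \<in> F (FOb G e)" using presheafD(1)[OF P k(1,3) vt] k(2) by simp
    have 1: "S.locally e (\<lambda>g. \<exists>f\<in>Arr C. Dom C f = Dom C g \<and> Cod C f = c \<and>
        w \<cdot> k \<cdot> FArr G g = FArr G f)"
      using gen_full[OF c(1) e, of "w \<cdot> k"] w k by (simp add: hom_def)
    have 2: "S.locally e (\<lambda>g. \<exists>f\<in>Arr C. Dom C f = Dom C g \<and> Cod C f = d \<and>
        v \<cdot> k \<cdot> FArr G g = FArr G f)"
      using gen_full[OF c(2) e, of "v \<cdot> k"] v k kv by (simp add: hom_def)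
    show "S.locally e (\<lambda>g. r (FArr G g) (r k (r w s)) = r (FArr G g) (r k (r v t)))"
    proof (rule S.locally_mono[OF S.locally_conj[OF 1 2]])
      fix g assume g: "g \<in> Arr C" "Cod C g = e" and
        "(\<exists>f\<in>Arr C. Dom C f = Dom C g \<and> Cod C f = c \<and>
          w \<cdot> k \<cdot> FArr G g = FArr G f) \<and>
         (\<exists>f\<in>Arr C. Dom C f = Dom C g \<and> Cod C f = d \<and> v \<cdot> k \<cdot> FArr G g = FArr G f)"
      then obtain f f' where f: "f \<in> Arr C" "Dom C f = Dom C g" "Cod C f = c"
          "w \<cdot> k \<cdot> FArr G g = FArr G f"
        and f': "f' \<in> Arr C" "Dom C f' = Dom C g" "Cod C f' = d"
          "v \<cdot> k \<cdot> FArr G g = FArr G f'" by blast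
      have kg: "k \<cdot> FArr G g \<in> Arr E" "Dom E (k \<cdot> FArr G g) = FOb G (Dom C g)"
        "Cod E (k \<cdot> FArr G g) = Dom E w"
        using k g by simp_all
      have "r (FArr G f) s = r (FArr G f') t"
      proof (rule eq[of "Dom C g" "k \<cdot> FArr G g"])
        show "w \<cdot> (k \<cdot> FArr G g) = FArr G f" "v \<cdot> (k \<cdot> FArr G g) = FArr G f'"
          using f(4) f'(4) w v k kv g by simp_all
      qed (use kg f f' g in simp_all)
      moreover have "r (FArr G g) (r k (r w s)) = r (FArr G f) s"
      proof -
        have "r k (r w s) = r (w \<cdot> k) s" using presheafD(3)[OF P k(1) w(1) k(3) w(2) s] by simp
        thus ?thesis
          using presheafD(3)[OF P, of "FArr G g" "w \<cdot> k" "FOb G c" s] f(4) g k w s by simp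
      qed
      moreover have "r (FArr G g) (r k (r v t)) = r (FArr G f') t"
      proof -
        have "r k (r v t) = r (v \<cdot> k) t" using presheafD(3)[OF P k(1) v(1) kv v(2) t] by simp
        thus ?thesis
          using presheafD(3)[OF P, of "FArr G g" "v \<cdot> k" "FOb G d" t] f'(4) g k kv v t by simp
      qed
      ultimately show "r (FArr G g) (r k (r w s)) = r (FArr G g) (r k (r v t))" by simp
    qed
  qed
qed

abbreviation hom_to :: "'o \<Rightarrow> 'o \<Rightarrow> 'a set" where
  "hom_to Y \<equiv> (\<lambda>X. hom E X Y)"

abbreviation precomp :: "'a \<Rightarrow> 'a \<Rightarrow> 'a" where
  "precomp \<equiv> (\<lambda>f u. u \<cdot> f)"

lemma hom_presheaf: "presheaf E (hom_to Y) precomp"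
  unfolding presheaf_def by (auto simp: hom_def)

text \<open>A compatible family of arrows is turned into a map of sheaves on the site by gluing its values
  at every section \<open>u\<close>; this map comes from an arrow of the topos.\<close>

lemma hom_sheaf:
  assumes Y: "Y \<in> Ob E"
  shows "sheaf E Cov (hom_to Y) precomp"
  unfolding sheaf_def
proof (intro conjI ballI hom_presheaf)
  fix X S assume X: "X \<in> Ob E" and S: "S \<in> Cov X"
  have N: "presheaf C (\<lambda>c. hom E (FOb G c) Y) (\<lambda>f u. u \<cdot> FArr G f)"
    using nerve_sheaf[OF Y] unfolding sheaf_def by blast
  have sS: "is_sieve E X S" using CovD(1)[OF S] .
  have aS: "f \<in> Arr E" "Cod E f = X" if "f \<in> S" for f using E.sieve_arr[OF sS that] by auto
  show "glues E (hom_to Y) precomp X S"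
    unfolding glues_def
  proof (intro allI impI)
    fix x assume x: "\<forall>f\<in>S. x f \<in> hom E (Dom E f) Y"
      and m: "\<forall>f\<in>S. \<forall>g\<in>Arr E. Cod E g = Dom E f \<longrightarrow> x f \<cdot> g = x (f \<cdot> g)"
    have x': "x f \<in> Arr E" "Dom E (x f) = Dom E f" "Cod E (x f) = Y" if "f \<in> S" for f
      using x that by (auto simp: hom_def)
    have ex: "\<exists>v. v \<in> hom E (FOb G c) Y \<and>
        (\<forall>g\<in>Arr C. Cod C g = c \<longrightarrow> u \<cdot> FArr G g \<in> S \<longrightarrow> v \<cdot> FArr G g = x (u \<cdot> FArr G g))"
      if c: "c \<in> Ob C" and u: "u \<in> hom E (FOb G c) X" for c u
    proof -
      have u': "u \<in> Arr E" "Dom E u = FOb G c" "Cod E u = X" using u by (auto simp: hom_def)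
      define L where "L = {g \<in> Arr C. Cod C g = c \<and> u \<cdot> FArr G g \<in> S}"
      have sL: "is_sieve C c L"
        unfolding is_sieve_def
      proof (intro conjI subsetI ballI impI)
        fix g h assume g: "g \<in> L" and h: "h \<in> Arr C" "Cod C h = Dom C g"
        have "(u \<cdot> FArr G g) \<cdot> FArr G h \<in> S"
          by (rule E.sieve_comp[OF sS]) (use g h u' in \<open>auto simp: L_def\<close>)
        thus "g \<cdot>\<^bsub>C\<^esub> h \<in> L" using g h u' by (simp add: L_def G_comp)
      qed (auto simp: L_def)
      have "S.locally c (\<lambda>g. g \<in> L)"
        by (rule S.locally_mono[OF CovD(2)[OF S c u']]) (simp add: L_def)
      hence "L \<in> K c" using S.locally_sieve sL by blast
      hence gl: "glues C (\<lambda>c. hom E (FOb G c) Y) (\<lambda>f u. u \<cdot> FArr G f) c L"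
        using nerve_sheaf[OF Y] c unfolding sheaf_def by blast
      have m1: "x (u \<cdot> FArr G g) \<in> hom E (FOb G (Dom C g)) Y" if "g \<in> L" for g
        using that x'[of "u \<cdot> FArr G g"] u' by (simp add: L_def hom_def)
      have m2: "x (u \<cdot> FArr G g) \<cdot> FArr G h = x (u \<cdot> FArr G (g \<cdot>\<^bsub>C\<^esub> h))"
        if "g \<in> L" "h \<in> Arr C" "Cod C h = Dom C g" for g h
        using m[rule_format, of "u \<cdot> FArr G g" "FArr G h"] that u' by (simp add: L_def G_comp)
      obtain v where "v \<in> hom E (FOb G c) Y" "\<And>g. g \<in> L \<Longrightarrow> v \<cdot> FArr G g = x (u \<cdot> FArr G g)"
        by (rule gluesD[OF gl, of "\<lambda>g. x (u \<cdot> FArr G g)"]) (use m1 m2 in blast)+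
      thus ?thesis by (intro exI[of _ v]) (simp add: L_def)
    qed
    define th where "th = (\<lambda>c u. SOME v. v \<in> hom E (FOb G c) Y \<and>
        (\<forall>g\<in>Arr C. Cod C g = c \<longrightarrow> u \<cdot> FArr G g \<in> S \<longrightarrow> v \<cdot> FArr G g = x (u \<cdot> FArr G g)))"
    have th_all: "th c u \<in> hom E (FOb G c) Y \<and>
        (\<forall>g\<in>Arr C. Cod C g = c \<longrightarrow> u \<cdot> FArr G g \<in> S \<longrightarrow> th c u \<cdot> FArr G g = x (u \<cdot> FArr G g))"
      if "c \<in> Ob C" "u \<in> hom E (FOb G c) X" for c u
      unfolding th_def by (rule someI_ex[OF ex[OF that]])
    note th = th_all[THEN conjunct1]
    note thx = th_all[THEN conjunct2, rule_format]
    have th_nat: "th (Dom C f) (u \<cdot> FArr G f) = th (Cod C f) u \<cdot> FArr G f"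
      if f: "f \<in> Arr C" and u: "u \<in> hom E (FOb G (Cod C f)) X" for f u
    proof (rule S.sheaf_locally_eq[OF nerve_sheaf[OF Y], of _ "Dom C f"])
      have u': "u \<in> Arr E" "Dom E u = FOb G (Cod C f)" "Cod E u = X" using u by (auto simp: hom_def)
      have d: "Dom C f \<in> Ob C" "Cod C f \<in> Ob C" using f by auto
      have uf: "u \<cdot> FArr G f \<in> hom E (FOb G (Dom C f)) X" using u' f by (simp add: hom_def)
      show "th (Dom C f) (u \<cdot> FArr G f) \<in> hom E (FOb G (Dom C f)) Y" using th[OF d(1) uf] .
      note t = th[OF d(2) u]
      show "th (Cod C f) u \<cdot> FArr G f \<in> hom E (FOb G (Dom C f)) Y"
        using t f by (auto simp: hom_def)
      have loc: "S.locally (Dom C f) (\<lambda>g. u \<cdot> FArr G (f \<cdot>\<^bsub>C\<^esub> g) \<in> S)"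
        using S.locally_pull[OF CovD(2)[OF S d(2) u'] f refl] .
      show "S.locally (Dom C f) (\<lambda>g. th (Dom C f) (u \<cdot> FArr G f) \<cdot> FArr G g =
          th (Cod C f) u \<cdot> FArr G f \<cdot> FArr G g)"
      proof (rule S.locally_mono[OF loc])
        fix g assume g: "g \<in> Arr C" "Cod C g = Dom C f" "u \<cdot> FArr G (f \<cdot>\<^bsub>C\<^esub> g) \<in> S"
        have "th (Dom C f) (u \<cdot> FArr G f) \<cdot> FArr G g = x (u \<cdot> FArr G (f \<cdot>\<^bsub>C\<^esub> g))"
          using thx[OF d(1) uf g(1,2)] g u' f by (simp add: G_comp)
        also have "\<dots> = th (Cod C f) u \<cdot> FArr G (f \<cdot>\<^bsub>C\<^esub> g)"
          using thx[OF d(2) u, of "f \<cdot>\<^bsub>C\<^esub> g"] g f by simp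
        finally show "th (Dom C f) (u \<cdot> FArr G f) \<cdot> FArr G g =
          th (Cod C f) u \<cdot> FArr G f \<cdot> FArr G g"
          using t f g by (simp add: G_comp hom_def)
      qed
    qed
    have ex1: "\<exists>!y. y \<in> hom E X Y \<and> (\<forall>c\<in>Ob C. \<forall>u\<in>hom E (FOb G c) X. y \<cdot> u = th c u)"
      by (rule nerve_ff[OF X Y th th_nat])
    then obtain y where y0: "y \<in> hom E X Y \<and> (\<forall>c\<in>Ob C. \<forall>u\<in>hom E (FOb G c) X. y \<cdot> u = th c u)"
      by (rule ex1E)
    note y = y0[THEN conjunct1] y0[THEN conjunct2, rule_format]
    have y': "y \<in> Arr E" "Dom E y = X" "Cod E y = Y" using y(1) by (auto simp: hom_def)
    have nerve_faithful: "a = b"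
      if ab: "a \<in> hom E Z Y" "b \<in> hom E Z Y" "Z \<in> Ob E" and
        eq: "\<And>c u. c \<in> Ob C \<Longrightarrow> u \<in> hom E (FOb G c) Z \<Longrightarrow> a \<cdot> u = b \<cdot> u" for a b Z
    proof -
      have "\<exists>!y. y \<in> hom E Z Y \<and> (\<forall>c\<in>Ob C. \<forall>u\<in>hom E (FOb G c) Z. y \<cdot> u = a \<cdot> u)"
        by (rule nerve_ff[OF ab(3) Y]) (use ab(1) in \<open>auto simp: hom_def\<close>)
      thus ?thesis using ab eq by (metis (no_types, lifting))
    qed
    show "\<exists>!y. y \<in> hom E X Y \<and> (\<forall>f\<in>S. y \<cdot> f = x f)"
    proof (rule ex1I[of _ y])
      have "y \<cdot> f = x f" if f: "f \<in> S" for f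
      proof (rule nerve_faithful[of _ "Dom E f"])
        note a = aS[OF f]
        show "y \<cdot> f \<in> hom E (Dom E f) Y" using y' a by (simp add: hom_def)
        show "x f \<in> hom E (Dom E f) Y" using x f by blast
        show "Dom E f \<in> Ob E" using a by simp
        fix c w assume c: "c \<in> Ob C" and "w \<in> hom E (FOb G c) (Dom E f)"
        hence w: "w \<in> Arr E" "Dom E w = FOb G c" "Cod E w = Dom E f" by (auto simp: hom_def)
        have fw: "f \<cdot> w \<in> S" using E.sieve_comp[OF sS f w(1,3)] .
        have fwh: "f \<cdot> w \<in> hom E (FOb G c) X" using a w by (simp add: hom_def)
        have "y \<cdot> f \<cdot> w = th c (f \<cdot> w)" using y(2)[OF c fwh] y' a w by simp
        also have "\<dots> = x (f \<cdot> w)"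
          using thx[OF c fwh, of "Idn C c"] fw fwh th[OF c fwh] c by (simp add: G_id hom_def)
        also have "\<dots> = x f \<cdot> w" using m f w by simp
        finally show "y \<cdot> f \<cdot> w = x f \<cdot> w" .
      qed
      thus "y \<in> hom E X Y \<and> (\<forall>f\<in>S. y \<cdot> f = x f)" using y(1) by blast
    next
      fix z assume z: "z \<in> hom E X Y \<and> (\<forall>f\<in>S. z \<cdot> f = x f)"
      hence z': "z \<in> Arr E" "Dom E z = X" "Cod E z = Y" by (auto simp: hom_def)
      have "z \<cdot> u = th c u" if c: "c \<in> Ob C" and u: "u \<in> hom E (FOb G c) X" for c u
      proof (rule S.sheaf_locally_eq[OF nerve_sheaf[OF Y], of _ c])
        have u': "u \<in> Arr E" "Dom E u = FOb G c" "Cod E u = X" using u by (auto simp: hom_def)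
        show "z \<cdot> u \<in> hom E (FOb G c) Y" using z' u' by (simp add: hom_def)
        show "th c u \<in> hom E (FOb G c) Y" using th[OF c u] .
        show "S.locally c (\<lambda>g. z \<cdot> u \<cdot> FArr G g = th c u \<cdot> FArr G g)"
          by (rule S.locally_mono[OF CovD(2)[OF S c u']]) (use thx[OF c u] z z' u' in simp)
      qed
      hence "z \<in> hom E X Y \<and> (\<forall>c\<in>Ob C. \<forall>u\<in>hom E (FOb G c) X. z \<cdot> u = th c u)"
        using z by blast
      with ex1 y0 show "z = y" by (elim ex1E) (metis (no_types, lifting))
    qed
  qed
qed

text \<open>A sheaf on the topos is determined by its restriction to the site, where it is a sheaf of
  small sets and hence comes from an object.\<close>

lemma representable:
  assumes F: "sheaf E Cov F r" and small: "\<And>c. c \<in> Ob C \<Longrightarrow> small_in TYPE('u) (F (FOb G c))"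
  obtains R e where "R \<in> Ob E" "e \<in> F R"
    "\<And>X. X \<in> Ob E \<Longrightarrow> bij_betw (\<lambda>x. r x e) (hom E X R) (F X)"
proof -
  have P: "presheaf E F r" using F unfolding sheaf_def by blast
  have sheafC: "sheaf C K (\<lambda>c. F (FOb G c)) (\<lambda>f. r (FArr G f))"
    unfolding sheaf_def
  proof (intro conjI ballI)
    show "presheaf C (\<lambda>c. F (FOb G c)) (\<lambda>f. r (FArr G f))"
      unfolding presheaf_def
    proof (intro conjI ballI impI)
      fix f x assume "f \<in> Arr C" "x \<in> F (FOb G (Cod C f))"
      thus "r (FArr G f) x \<in> F (FOb G (Dom C f))"
        using presheafD(1)[OF P, of "FArr G f" "FOb G (Cod C f)"] by simp
    next
      fix a x assume "a \<in> Ob C" "x \<in> F (FOb G a)"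
      thus "r (FArr G (Idn C a)) x = x" using presheafD(2)[OF P] by (simp add: G_id)
    next
      fix f g x assume "f \<in> Arr C" "g \<in> Arr C" "Cod C f = Dom C g" "x \<in> F (FOb G (Cod C g))"
      thus "r (FArr G (g \<cdot>\<^bsub>C\<^esub> f)) x = r (FArr G f) (r (FArr G g) x)"
        using presheafD(3)[OF P, of "FArr G f" "FArr G g" "FOb G (Cod C g)" x] by (simp add: G_comp)
    qed
    fix c L assume c: "c \<in> Ob C" and L: "L \<in> K c"
    note sL = S.cov_sieve[OF L c]
    have aL: "g \<in> Arr C" "Cod C g = c" if "g \<in> L" for g using S.sieve_arr[OF sL that] by auto
    show "glues C (\<lambda>c. F (FOb G c)) (\<lambda>f. r (FArr G f)) c L"
      unfolding glues_def
    proof (intro allI impI)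
      fix s assume s: "\<forall>g\<in>L. s g \<in> F (FOb G (Dom C g))"
        and m: "\<forall>g\<in>L. \<forall>h\<in>Arr C. Cod C h = Dom C g \<longrightarrow> r (FArr G h) (s g) = s (g \<cdot>\<^bsub>C\<^esub> h)"
      obtain y where y: "y \<in> F (FOb G c)" "\<And>g. g \<in> L \<Longrightarrow> r (FArr G g) y = s g"
      proof (rule T.glue_family[OF F, where L = L and x = "FArr G" and s = s and U = "FOb G c"])
        show "FArr G g \<in> Arr E \<and> Cod E (FArr G g) = FOb G c" if "g \<in> L" for g using aL[OF that] by simp
        show "s g \<in> F (Dom E (FArr G g))" if "g \<in> L" for g using aL[OF that] s that by simp
        show "T.locally (FOb G c) (\<lambda>f. \<exists>l\<in>L. \<exists>w\<in>Arr E.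
            Cod E w = Dom E (FArr G l) \<and> f = FArr G l \<cdot> w)"
          by (rule T.locally_mono[OF locally_gen[OF S.locally_cov[OF L c]]]) force
      next
        fix g g' w v
        assume g: "g \<in> L" "g' \<in> L" and w: "w \<in> Arr E" "v \<in> Arr E" "Cod E w = Dom E (FArr G g)"
          "Cod E v = Dom E (FArr G g')" "Dom E w = Dom E v" "FArr G g \<cdot> w = FArr G g' \<cdot> v"
        note a = aL[OF g(1)] aL[OF g(2)]
        show "r w (s g) = r v (s g')"
        proof (rule sheaf_span_eq[OF F, of "Dom C g" "Dom C g'"])
          fix e k f f'
          assume k: "k \<in> Arr E" "Dom E k = FOb G e" "Cod E k = Dom E w"
            and f: "f \<in> Arr C" "f' \<in> Arr C" "Dom C f = e" "Dom C f' = e" "Cod C f = Dom C g"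
              "Cod C f' = Dom C g'" "w \<cdot> k = FArr G f" "v \<cdot> k = FArr G f'"
          have "FArr G (g \<cdot>\<^bsub>C\<^esub> f) = FArr G g \<cdot> w \<cdot> k"
            using f a w(1-5) k by (simp add: G_comp)
          also have "\<dots> = FArr G (g' \<cdot>\<^bsub>C\<^esub> f')"
            unfolding w(6) using f a w(1-5) k by (simp add: G_comp)
          finally have "S.locally (Dom C (g \<cdot>\<^bsub>C\<^esub> f)) (\<lambda>h. g \<cdot>\<^bsub>C\<^esub> f \<cdot>\<^bsub>C\<^esub> h = g' \<cdot>\<^bsub>C\<^esub> f' \<cdot>\<^bsub>C\<^esub> h)"
            using f a by (intro gen_faithful) simp_all
          hence loc: "S.locally e (\<lambda>h. g \<cdot>\<^bsub>C\<^esub> f \<cdot>\<^bsub>C\<^esub> h = g' \<cdot>\<^bsub>C\<^esub> f' \<cdot>\<^bsub>C\<^esub> h)"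
            using f a by simp
          have gf: "g \<cdot>\<^bsub>C\<^esub> f \<in> L" "g' \<cdot>\<^bsub>C\<^esub> f' \<in> L"
            using S.sieve_comp[OF sL g(1) f(1,5)] S.sieve_comp[OF sL g(2) f(2,6)] .
          have "s (g \<cdot>\<^bsub>C\<^esub> f) = s (g' \<cdot>\<^bsub>C\<^esub> f')"
          proof (rule sheaf_site_eq[OF F _ _ S.locally_mono[OF loc]])
            show "s (g \<cdot>\<^bsub>C\<^esub> f) \<in> F (FOb G e)" "s (g' \<cdot>\<^bsub>C\<^esub> f') \<in> F (FOb G e)"
              using s gf f a by force+
            fix h assume h: "h \<in> Arr C" "Cod C h = e" "g \<cdot>\<^bsub>C\<^esub> f \<cdot>\<^bsub>C\<^esub> h = g' \<cdot>\<^bsub>C\<^esub> f' \<cdot>\<^bsub>C\<^esub> h"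
            have "r (FArr G h) (s (g \<cdot>\<^bsub>C\<^esub> f)) = s (g \<cdot>\<^bsub>C\<^esub> f \<cdot>\<^bsub>C\<^esub> h)"
              using m[rule_format, OF gf(1) h(1)] h f a by simp
            moreover have "r (FArr G h) (s (g' \<cdot>\<^bsub>C\<^esub> f')) = s (g' \<cdot>\<^bsub>C\<^esub> f' \<cdot>\<^bsub>C\<^esub> h)"
              using m[rule_format, OF gf(2) h(1)] h f a by simp
            ultimately show "r (FArr G h) (s (g \<cdot>\<^bsub>C\<^esub> f)) = r (FArr G h) (s (g' \<cdot>\<^bsub>C\<^esub> f'))"
              using h(3) by simp
          qed
          thus "r (FArr G f) (s g) = r (FArr G f') (s g')" using m g f by simp
        qed (use a w s g in simp_all)
      qed blast
      show "\<exists>!y. y \<in> F (FOb G c) \<and> (\<forall>f\<in>L. r (FArr G f) y = s f)"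
      proof (rule ex1I[of _ y])
        show "y \<in> F (FOb G c) \<and> (\<forall>f\<in>L. r (FArr G f) y = s f)" using y by blast
        fix z assume z: "z \<in> F (FOb G c) \<and> (\<forall>f\<in>L. r (FArr G f) z = s f)"
        show "z = y"
          by (rule sheaf_site_eq[OF F _ y(1) S.locally_mono[OF S.locally_cov[OF L c]]])
             (use z y(2) in simp_all)
      qed
    qed
  qed
  obtain P' :: "'u \<Rightarrow> 'u set" and r' b where P': "sheaf C K P' r'" "\<And>c. c \<in> Ob C \<Longrightarrow> small (P' c)"
    and b: "\<And>c. c \<in> Ob C \<Longrightarrow> bij_betw (b c) (F (FOb G c)) (P' c)"
    "\<And>f x. f \<in> Arr C \<Longrightarrow> x \<in> F (FOb G (Cod C f)) \<Longrightarrow> b (Dom C f) (r (FArr G f) x) = r' f (b (Cod C f) x)"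
    using S.encode_sheaf[OF sheafC small] by blast
  obtain R \<rho>' where R: "R \<in> Ob E" and \<rho>': "\<And>c. c \<in> Ob C \<Longrightarrow> bij_betw (\<rho>' c) (hom E (FOb G c) R) (P' c)"
    "\<And>f u. f \<in> Arr C \<Longrightarrow> u \<in> hom E (FOb G (Cod C f)) R \<Longrightarrow>
       \<rho>' (Dom C f) (u \<cdot> FArr G f) = r' f (\<rho>' (Cod C f) u)"
    using nerve_ess[OF P'] by blast
  define \<rho> where "\<rho> = (\<lambda>c u. inv_into (F (FOb G c)) (b c) (\<rho>' c u))"
  have \<rho>: "bij_betw (\<rho> c) (hom E (FOb G c) R) (F (FOb G c))" if "c \<in> Ob C" for c
    using bij_betw_trans[OF \<rho>'(1)[OF that] bij_betw_inv_into[OF b(1)[OF that]]]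
    by (simp add: \<rho>_def o_def)
  have \<rho>F: "\<rho> c u \<in> F (FOb G c)" if "c \<in> Ob C" "u \<in> hom E (FOb G c) R" for c u
    using \<rho>[OF that(1)] that(2) bij_betwE by blast
  have b\<rho>: "b c (\<rho> c u) = \<rho>' c u" if "c \<in> Ob C" "u \<in> hom E (FOb G c) R" for c u
    using bij_betw_inv_into_right[OF b(1)[OF that(1)]] \<rho>'(1)[OF that(1)] that(2) bij_betwE
    unfolding \<rho>_def by blast
  have \<rho>_nat: "\<rho> (Dom C f) (u \<cdot> FArr G f) = r (FArr G f) (\<rho> (Cod C f) u)"
    if f: "f \<in> Arr C" and u: "u \<in> hom E (FOb G (Cod C f)) R" for f u
  proof -
    have d: "Dom C f \<in> Ob C" "Cod C f \<in> Ob C" using f by auto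
    have uf: "u \<cdot> FArr G f \<in> hom E (FOb G (Dom C f)) R" using u f by (auto simp: hom_def)
    have "b (Dom C f) (\<rho> (Dom C f) (u \<cdot> FArr G f)) = b (Dom C f) (r (FArr G f) (\<rho> (Cod C f) u))"
      using b\<rho>[OF d(1) uf] \<rho>'(2)[OF f u] b\<rho>[OF d(2) u] b(2)[OF f \<rho>F[OF d(2) u]] by simp
    moreover have "r (FArr G f) (\<rho> (Cod C f) u) \<in> F (FOb G (Dom C f))"
      using presheafD(1)[OF P, of "FArr G f" "FOb G (Cod C f)"] \<rho>F[OF d(2) u] f by simp
    ultimately show ?thesis
      using bij_betw_imp_inj_on[OF b(1)[OF d(1)]] \<rho>F[OF d(1) uf] by (meson inj_onD)
  qed
  define L where "L = {(c, u). c \<in> Ob C \<and> u \<in> hom E (FOb G c) R}"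
  obtain e where e: "e \<in> F R" "\<And>p. p \<in> L \<Longrightarrow> r (snd p) e = \<rho> (fst p) (snd p)"
  proof (rule T.glue_family[OF F, where L = L and x = snd and s = "\<lambda>p. \<rho> (fst p) (snd p)" and U = R])
    show "snd p \<in> Arr E \<and> Cod E (snd p) = R" if "p \<in> L" for p using that by (auto simp: L_def hom_def)
    show "\<rho> (fst p) (snd p) \<in> F (Dom E (snd p))" if "p \<in> L" for p
      using that \<rho>F[of "fst p" "snd p"] by (auto simp: L_def hom_def)
    show "T.locally R (\<lambda>f. \<exists>l\<in>L. \<exists>w\<in>Arr E. Cod E w = Dom E (snd l) \<and> f = snd l \<cdot> w)"
    proof (rule T.locally_mono[OF gen_cover[OF R]])
      fix f assume "\<exists>c\<in>Ob C. \<exists>u\<in>Arr E. Dom E u = FOb G c \<and> Cod E u = R \<and>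
           (\<exists>w\<in>Arr E. Cod E w = Dom E u \<and> f = u \<cdot> w)"
      then obtain c u w where "c \<in> Ob C" "u \<in> Arr E" "Dom E u = FOb G c" "Cod E u = R"
        "w \<in> Arr E" "Cod E w = Dom E u" "f = u \<cdot> w" by blast
      thus "\<exists>l\<in>L. \<exists>w\<in>Arr E. Cod E w = Dom E (snd l) \<and> f = snd l \<cdot> w"
        by (intro bexI[of _ "(c, u)"] bexI[of _ w]) (simp_all add: L_def hom_def)
    qed
  next
    fix p p' w v
    assume "p \<in> L" "p' \<in> L" and w: "w \<in> Arr E" "v \<in> Arr E" "Cod E w = Dom E (snd p)"
      "Cod E v = Dom E (snd p')" "Dom E w = Dom E v" "snd p \<cdot> w = snd p' \<cdot> v"
    then obtain c u c' u' where p: "p = (c, u)" "p' = (c', u')" and c: "c \<in> Ob C" "c' \<in> Ob C" and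
      u: "u \<in> hom E (FOb G c) R" "u' \<in> hom E (FOb G c') R"
      by (auto simp: L_def)
    have ua: "u \<in> Arr E" "Dom E u = FOb G c" "u' \<in> Arr E" "Dom E u' = FOb G c'"
      using u by (auto simp: hom_def)
    have "r w (\<rho> c u) = r v (\<rho> c' u')"
    proof (rule sheaf_span_eq[OF F c])
      fix d k f f'
      assume k: "k \<in> Arr E" "Dom E k = FOb G d" "Cod E k = Dom E w"
        and f: "f \<in> Arr C" "f' \<in> Arr C" "Dom C f = d" "Dom C f' = d" "Cod C f = c"
          "Cod C f' = c'" "w \<cdot> k = FArr G f" "v \<cdot> k = FArr G f'"
      have uw: "u \<cdot> w = u' \<cdot> v" using w(6) p by simp
      have "u \<cdot> FArr G f = u \<cdot> w \<cdot> k"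
        unfolding f(7)[symmetric] using ua k w(1-5) p by simp
      also have "\<dots> = u' \<cdot> v \<cdot> k" by (simp only: uw)
      also have "\<dots> = u' \<cdot> FArr G f'"
        unfolding f(8)[symmetric] using ua k w(1-5) p by simp
      finally show "r (FArr G f) (\<rho> c u) = r (FArr G f') (\<rho> c' u')"
        using \<rho>_nat[OF f(1), of u] \<rho>_nat[OF f(2), of u'] f u by simp
    qed (use w p ua \<rho>F[OF c(1) u(1)] \<rho>F[OF c(2) u(2)] in simp_all)
    thus "r w (\<rho> (fst p) (snd p)) = r v (\<rho> (fst p') (snd p'))" using p by simp
  qed blast
  have eu: "r u e = \<rho> c u" if "c \<in> Ob C" "u \<in> hom E (FOb G c) R" for c u
    using e(2)[of "(c, u)"] that by (simp add: L_def)
  have comp: "r (x \<cdot> u) e = r u (r x e)" if "x \<in> hom E X R" "u \<in> Arr E" "Cod E u = X" for x u X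
    using presheafD(3)[OF P that(2), of x R e] that e(1) by (auto simp: hom_def)
  have xF: "r x e \<in> F X" if "x \<in> hom E X R" for x X
    using presheafD(1)[OF P, of x R e] that e(1) by (auto simp: hom_def)
  show thesis
  proof (rule that[OF R e(1)])
    fix X assume X: "X \<in> Ob E"
    show "bij_betw (\<lambda>x. r x e) (hom E X R) (F X)"
      unfolding bij_betw_def
    proof (intro conjI equalityI subsetI)
      show "inj_on (\<lambda>x. r x e) (hom E X R)"
      proof (rule inj_onI)
        fix x y assume x: "x \<in> hom E X R" and y: "y \<in> hom E X R" and eq: "r x e = r y e"
        show "x = y"
        proof (rule sheaf_gen_eq[OF hom_sheaf[OF R] X x y])
          fix c u assume c: "c \<in> Ob C" and u: "u \<in> Arr E" "Dom E u = FOb G c" "Cod E u = X"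
          have h: "x \<cdot> u \<in> hom E (FOb G c) R" "y \<cdot> u \<in> hom E (FOb G c) R"
            using x y u by (auto simp: hom_def)
          have "\<rho> c (x \<cdot> u) = \<rho> c (y \<cdot> u)"
            using eu[OF c h(1)] eu[OF c h(2)] comp[OF x u(1,3)] comp[OF y u(1,3)] eq by simp
          thus "x \<cdot> u = y \<cdot> u"
            using bij_betw_imp_inj_on[OF \<rho>[OF c]] h by (meson inj_onD)
        qed
      qed
      fix s assume "s \<in> (\<lambda>x. r x e) ` hom E X R"
      thus "s \<in> F X" using xF by blast
    next
      fix s assume s: "s \<in> F X"
      define th where "th = (\<lambda>c u. inv_into (hom E (FOb G c) R) (\<rho> c) (r u s))"
      have rs: "r u s \<in> F (FOb G c)" if "u \<in> hom E (FOb G c) X" for c u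
        using presheafD(1)[OF P, of u X s] that s by (auto simp: hom_def)
      have th: "th c u \<in> hom E (FOb G c) R" "\<rho> c (th c u) = r u s"
        if "c \<in> Ob C" "u \<in> hom E (FOb G c) X" for c u
        using \<rho>[OF that(1)] rs[OF that(2)] unfolding th_def bij_betw_def
        by (simp_all add: inv_into_into f_inv_into_f)
      have th_nat: "th (Dom C f) (u \<cdot> FArr G f) = th (Cod C f) u \<cdot> FArr G f"
        if f: "f \<in> Arr C" and u: "u \<in> hom E (FOb G (Cod C f)) X" for f u
      proof -
        have d: "Dom C f \<in> Ob C" "Cod C f \<in> Ob C" using f by auto
        have uf: "u \<cdot> FArr G f \<in> hom E (FOb G (Dom C f)) X" using u f by (auto simp: hom_def)
        have tf: "th (Cod C f) u \<cdot> FArr G f \<in> hom E (FOb G (Dom C f)) R"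
          using th(1)[OF d(2) u] f by (auto simp: hom_def)
        have "r (u \<cdot> FArr G f) s = r (FArr G f) (r u s)"
          using presheafD(3)[OF P, of "FArr G f" u X s] f u s by (simp add: hom_def)
        hence "\<rho> (Dom C f) (th (Dom C f) (u \<cdot> FArr G f)) =
            \<rho> (Dom C f) (th (Cod C f) u \<cdot> FArr G f)"
          using th(2)[OF d(1) uf] \<rho>_nat[OF f th(1)[OF d(2) u]] th(2)[OF d(2) u] by simp
        thus ?thesis
          using bij_betw_imp_inj_on[OF \<rho>[OF d(1)]] th(1)[OF d(1) uf] tf by (meson inj_onD)
      qed
      obtain x where x: "x \<in> hom E X R" "\<And>c u. c \<in> Ob C \<Longrightarrow> u \<in> hom E (FOb G c) X \<Longrightarrow> x \<cdot> u = th c u"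
        using nerve_ff[OF X R th(1) th_nat] by blast
      have "r x e = s"
      proof (rule sheaf_gen_eq[OF F X xF[OF x(1)] s])
        fix c u assume c: "c \<in> Ob C" and u: "u \<in> Arr E" "Dom E u = FOb G c" "Cod E u = X"
        have uh: "u \<in> hom E (FOb G c) X" using u by (simp add: hom_def)
        show "r u (r x e) = r u s"
          using comp[OF x(1) u(1,3)] x(2)[OF c uh] eu[OF c th(1)[OF c uh]] th(2)[OF c uh] by simp
      qed
      thus "s \<in> (\<lambda>x. r x e) ` hom E X R" using x(1) by blast
    qed
  qed
qed

end


section \<open>Pullbacks, images and epimorphic families\<close>

context generated_topos
begin

lemma hom_glue:
  assumes Y: "Y \<in> Ob E" and X: "X \<in> Ob E" and S: "S \<in> Cov X"
    and x: "\<And>f. f \<in> S \<Longrightarrow> x f \<in> hom E (Dom E f) Y"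
    and m: "\<And>f g. f \<in> S \<Longrightarrow> g \<in> Arr E \<Longrightarrow> Cod E g = Dom E f \<Longrightarrow> x f \<cdot> g = x (f \<cdot> g)"
  obtains y where "y \<in> hom E X Y" "\<And>f. f \<in> S \<Longrightarrow> y \<cdot> f = x f"
proof -
  have gl: "glues E (hom_to Y) precomp X S" using hom_sheaf[OF Y] X S unfolding sheaf_def by blast
  show thesis by (rule gluesD[OF gl, of x]) (use x m that in blast)+
qed

lemma hom_locally_eq:
  assumes "x \<in> Arr E" "y \<in> Arr E" "Dom E x = Dom E y" "Cod E x = Cod E y"
    "T.locally (Dom E x) (\<lambda>g. x \<cdot> g = y \<cdot> g)"
  shows "x = y"
  by (rule T.sheaf_locally_eq[OF hom_sheaf[of "Cod E x"], of x "Dom E x" y])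
     (use assms in \<open>simp_all add: hom_def\<close>)

text \<open>The pairs of arrows with equal composites to the common codomain form a sheaf.\<close>

lemma pullback_ex:
  assumes f: "f \<in> Arr E" and g: "g \<in> Arr E" and fg: "Cod E f = Cod E g"
  obtains p q where "is_pullback E f g p q"
proof -
  define F where "F = (\<lambda>U. {(a, b). a \<in> hom E U (Dom E f) \<and> b \<in> hom E U (Dom E g) \<and>
    f \<cdot> a = g \<cdot> b})"
  define r where "r = (\<lambda>h p. (fst p \<cdot> h, snd p \<cdot> h))"
  have FI: "(a, b) \<in> F U \<longleftrightarrow> a \<in> Arr E \<and> Dom E a = U \<and> Cod E a = Dom E f \<and>
      b \<in> Arr E \<and> Dom E b = U \<and> Cod E b = Dom E g \<and> f \<cdot> a = g \<cdot> b" for a b U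
    by (auto simp: F_def hom_def)
  have rF: "r h p \<in> F (Dom E h)" if h: "h \<in> Arr E" and p: "p \<in> F (Cod E h)" for h p
  proof -
    obtain a b where ab: "p = (a, b)" "a \<in> Arr E" "Dom E a = Cod E h" "Cod E a = Dom E f"
      "b \<in> Arr E" "Dom E b = Cod E h" "Cod E b = Dom E g" "f \<cdot> a = g \<cdot> b"
      using p FI by (cases p) auto
    have "f \<cdot> a \<cdot> h = g \<cdot> b \<cdot> h" by (simp only: ab(8))
    hence "f \<cdot> (a \<cdot> h) = g \<cdot> (b \<cdot> h)" using ab(1-7) f g h by simp
    thus ?thesis using ab(1-7) h by (simp add: r_def FI)
  qed
  have P: "presheaf E F r"
    unfolding presheaf_def
  proof (intro conjI ballI impI)
    fix h p assume "h \<in> Arr E" "p \<in> F (Cod E h)" thus "r h p \<in> F (Dom E h)" by (rule rF)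
  next
    fix a p assume "a \<in> Ob E" "p \<in> F a" thus "r (Idn E a) p = p"
      by (cases p) (simp add: r_def FI)
  next
    fix h k p assume "h \<in> Arr E" "k \<in> Arr E" "Cod E h = Dom E k" "p \<in> F (Cod E k)"
    thus "r (k \<cdot> h) p = r h (r k p)" by (cases p) (simp add: r_def FI)
  qed
  have ob: "Dom E f \<in> Ob E" "Dom E g \<in> Ob E" using f g by auto
  have "sheaf E Cov F r"
    unfolding sheaf_def
  proof (intro conjI ballI P)
    fix U S assume U: "U \<in> Ob E" and S: "S \<in> Cov U"
    have aS: "k \<in> Arr E" "Cod E k = U" if "k \<in> S" for k
      using E.sieve_arr[OF CovD(1)[OF S] that] by auto
    show "glues E F r U S"
      unfolding glues_def
    proof (intro allI impI)
      fix x assume x: "\<forall>k\<in>S. x k \<in> F (Dom E k)"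
        and m: "\<forall>k\<in>S. \<forall>h\<in>Arr E. Cod E h = Dom E k \<longrightarrow> r h (x k) = x (k \<cdot> h)"
      have xF: "fst (x k) \<in> Arr E" "Dom E (fst (x k)) = Dom E k" "Cod E (fst (x k)) = Dom E f"
        "snd (x k) \<in> Arr E" "Dom E (snd (x k)) = Dom E k" "Cod E (snd (x k)) = Dom E g"
        "f \<cdot> fst (x k) = g \<cdot> snd (x k)" if "k \<in> S" for k
        using x[rule_format, OF that] FI[of "fst (x k)" "snd (x k)"] by auto
      have mm: "fst (x k) \<cdot> h = fst (x (k \<cdot> h))" "snd (x k) \<cdot> h = snd (x (k \<cdot> h))"
        if "k \<in> S" "h \<in> Arr E" "Cod E h = Dom E k" for k h
        using m that unfolding r_def by (metis fst_conv snd_conv)+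
      obtain a where "a \<in> hom E U (Dom E f)" and a2: "\<And>k. k \<in> S \<Longrightarrow> a \<cdot> k = fst (x k)"
        by (rule hom_glue[OF ob(1) U S, of "\<lambda>k. fst (x k)"]) (use xF mm in \<open>auto simp: hom_def\<close>)
      hence a: "a \<in> Arr E" "Dom E a = U" "Cod E a = Dom E f" by (auto simp: hom_def)
      obtain b where "b \<in> hom E U (Dom E g)" and b2: "\<And>k. k \<in> S \<Longrightarrow> b \<cdot> k = snd (x k)"
        by (rule hom_glue[OF ob(2) U S, of "\<lambda>k. snd (x k)"]) (use xF mm in \<open>auto simp: hom_def\<close>)
      hence b: "b \<in> Arr E" "Dom E b = U" "Cod E b = Dom E g" by (auto simp: hom_def)
      have "f \<cdot> a = g \<cdot> b"
      proof (rule hom_locally_eq)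
        show "T.locally (Dom E (f \<cdot> a)) (\<lambda>k. f \<cdot> a \<cdot> k = g \<cdot> b \<cdot> k)"
          using a b f g T.locally_mono[OF T.locally_cov[OF S U]] a2 b2 xF(7) by simp
      qed (use a b f g fg in simp_all)
      hence ab: "(a, b) \<in> F U" using a b by (simp add: FI)
      show "\<exists>!y. y \<in> F U \<and> (\<forall>k\<in>S. r k y = x k)"
      proof (rule ex1I[of _ "(a, b)"])
        show "(a, b) \<in> F U \<and> (\<forall>k\<in>S. r k (a, b) = x k)" using ab a2 b2 by (simp add: r_def)
        fix y assume y: "y \<in> F U \<and> (\<forall>k\<in>S. r k y = x k)"
        obtain a' b' where y': "y = (a', b')" by (cases y)
        have ya: "a' \<in> Arr E" "Dom E a' = U" "Cod E a' = Dom E f" "b' \<in> Arr E" "Dom E b' = U"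
          "Cod E b' = Dom E g" using y y' FI by auto
        have yk: "a' \<cdot> k = fst (x k)" "b' \<cdot> k = snd (x k)" if "k \<in> S" for k
          using y y' that by (auto simp: r_def) (metis fst_conv snd_conv)+
        have "a' = a"
          by (rule hom_locally_eq)
             (use ya a T.locally_mono[OF T.locally_cov[OF S U]] a2 yk(1) in simp_all)
        moreover have "b' = b"
          by (rule hom_locally_eq)
             (use ya b T.locally_mono[OF T.locally_cov[OF S U]] b2 yk(2) in simp_all)
        ultimately show "y = (a, b)" using y' by simp
      qed
    qed
  qed
  moreover have "small_in TYPE('u) (F (FOb G c))" if "c \<in> Ob C" for c
    by (rule small_in_subset[OF small_in_Times[OF univ small_hom[OF that ob(1)] small_hom[OF that ob(2)]]])
       (auto simp: F_def)
  ultimately obtain R e where R: "R \<in> Ob E" "e \<in> F R"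
    "\<And>X. X \<in> Ob E \<Longrightarrow> bij_betw (\<lambda>x. r x e) (hom E X R) (F X)"
    using representable by blast
  obtain p q where pq: "e = (p, q)" by (cases e)
  have a: "p \<in> Arr E" "Dom E p = R" "Cod E p = Dom E f" "q \<in> Arr E" "Dom E q = R" "Cod E q = Dom E g"
    "f \<cdot> p = g \<cdot> q"
    using R(2) pq FI by auto
  have "is_pullback E f g p q"
    unfolding is_pullback_def
  proof (intro conjI ballI impI f g fg)
    fix z p' q' assume z: "z \<in> Ob E" and "p' \<in> hom E z (Dom E f)" "q' \<in> hom E z (Dom E g)"
      "f \<cdot> p' = g \<cdot> q'"
    hence pF: "(p', q') \<in> F z" by (simp add: F_def)
    hence "(p', q') \<in> (\<lambda>x. r x e) ` hom E z R"
      using bij_betw_imp_surj_on[OF R(3)[OF z]] by simp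
    then obtain u where u: "u \<in> hom E z R" "r u e = (p', q')" by auto
    show "\<exists>!u. u \<in> hom E z (Dom E p) \<and> p \<cdot> u = p' \<and> q \<cdot> u = q'"
    proof (rule ex1I[of _ u])
      show "u \<in> hom E z (Dom E p) \<and> p \<cdot> u = p' \<and> q \<cdot> u = q'"
        using u pq a(2) by (simp add: r_def)
      fix v assume v: "v \<in> hom E z (Dom E p) \<and> p \<cdot> v = p' \<and> q \<cdot> v = q'"
      hence "r v e = r u e" using u(2) pq by (simp add: r_def)
      thus "v = u" using inj_onD[OF bij_betw_imp_inj_on[OF R(3)[OF z]]] u(1) v a(2) by blast
    qed
  qed (use a in \<open>simp_all add: hom_def\<close>)
  thus thesis by (rule that)
qed

text \<open>The image of a sieve is the largest subobject that it covers.\<close>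

lemma image_ex:
  assumes X: "X \<in> Ob E" and S: "is_sieve E X S"
  obtains m where "is_mono E m" "Cod E m = X"
    "\<And>f. f \<in> Arr E \<Longrightarrow> Cod E f = X \<Longrightarrow>
       (\<exists>h\<in>hom E (Dom E f) (Dom E m). m \<cdot> h = f) \<longleftrightarrow> T.locally (Dom E f) (\<lambda>g. f \<cdot> g \<in> S)"
proof -
  define F where "F = (\<lambda>U. {f \<in> hom E U X. T.locally U (\<lambda>g. f \<cdot> g \<in> S)})"
  have sh: "sheaf E Cov F precomp"
  proof (rule T.subsheaf[OF hom_sheaf[OF X]])
    show "F U \<subseteq> hom E U X" for U by (auto simp: F_def)
    fix f x assume f: "f \<in> Arr E" and x: "x \<in> F (Cod E f)"
    hence x': "x \<in> Arr E" "Dom E x = Cod E f" "Cod E x = X"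
      and loc: "T.locally (Cod E f) (\<lambda>g. x \<cdot> g \<in> S)" by (auto simp: F_def hom_def)
    have "T.locally (Dom E f) (\<lambda>g. x \<cdot> f \<cdot> g \<in> S)"
      by (rule T.locally_mono[OF T.locally_pull[OF loc f refl]]) (use f x' in simp)
    thus "x \<cdot> f \<in> F (Dom E f)" using f x' by (simp add: F_def hom_def)
  next
    fix U x assume x: "x \<in> hom E U X" and loc: "T.locally U (\<lambda>f. x \<cdot> f \<in> F (Dom E f))"
    have x': "x \<in> Arr E" "Dom E x = U" "Cod E x = X" using x by (auto simp: hom_def)
    have "T.locally U (\<lambda>g. x \<cdot> g \<in> S)"
    proof (rule T.locally_trans[OF loc])
      fix f assume f: "f \<in> Arr E" "Cod E f = U" "x \<cdot> f \<in> F (Dom E f)"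
      hence "T.locally (Dom E f) (\<lambda>g. x \<cdot> f \<cdot> g \<in> S)" by (simp add: F_def)
      thus "T.locally (Dom E f) (\<lambda>g. x \<cdot> (f \<cdot> g) \<in> S)"
        by (rule T.locally_mono) (use f x' in simp)
    qed
    thus "x \<in> F U" using x by (simp add: F_def)
  qed
  have small: "small_in TYPE('u) (F (FOb G c))" if "c \<in> Ob C" for c
    by (rule small_in_subset[OF small_hom[OF that X]]) (auto simp: F_def)
  obtain R m where R: "R \<in> Ob E" "m \<in> F R"
    "\<And>U. U \<in> Ob E \<Longrightarrow> bij_betw (\<lambda>x. m \<cdot> x) (hom E U R) (F U)"
    using representable[OF sh small] by blast
  have m: "m \<in> Arr E" "Dom E m = R" "Cod E m = X" using R(2) by (auto simp: F_def hom_def)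
  show thesis
  proof (rule that[OF _ m(3)])
    show "is_mono E m"
      unfolding is_mono_def
    proof (intro conjI ballI impI m)
      fix g h assume "g \<in> Arr E" "h \<in> Arr E" "Cod E g = Dom E m" "Cod E h = Dom E m"
        "Dom E g = Dom E h" "m \<cdot> g = m \<cdot> h"
      thus "g = h"
        using inj_onD[OF bij_betw_imp_inj_on[OF R(3)[of "Dom E g"]], of g h] m(2)
        by (simp add: hom_def)
    qed
    fix f assume f: "f \<in> Arr E" "Cod E f = X"
    have "(\<exists>h\<in>hom E (Dom E f) (Dom E m). m \<cdot> h = f) \<longleftrightarrow> f \<in> F (Dom E f)"
      using bij_betw_imp_surj_on[OF R(3)[OF E.ob(1)[OF f(1)]], symmetric]
      unfolding m(2) by (auto simp only: image_iff)
    thus "(\<exists>h\<in>hom E (Dom E f) (Dom E m). m \<cdot> h = f) \<longleftrightarrow> T.locally (Dom E f) (\<lambda>g. f \<cdot> g \<in> S)"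
      using f by (simp add: F_def hom_def)
  qed
qed

text \<open>For every topology finer than the canonical one, closed relations are determined by their
  spans with apex in the image of \<open>G\<close>.\<close>

lemma small_closed_rel:
  assumes J: "site E J" and fine: "\<And>X. X \<in> Ob E \<Longrightarrow> Cov X \<subseteq> J X"
    and X: "X \<in> Ob E" and U: "U \<in> Ob E"
  shows "small_in TYPE('u) (site.closed_rel E J X U)"
proof -
  interpret J: site E J by (rule J)
  define W where "W = (\<Union>d\<in>Ob C. hom E (FOb G d) U \<times> hom E (FOb G d) X)"
  have "small_in TYPE('u) (Ob C)" using small_gen by (simp add: small_in_self)
  hence W: "small_in TYPE('u) W"
    unfolding W_def by (intro small_in_UN small_in_Times univ small_hom X U)
  have "inj_on (\<lambda>A. A \<inter> W) (J.closed_rel X U)"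
  proof (rule inj_onI)
    fix A B assume A: "A \<in> J.closed_rel X U" and B: "B \<in> J.closed_rel X U" and eq: "A \<inter> W = B \<inter> W"
    have *: "(f, x) \<in> B'" if A': "A' \<in> J.closed_rel X U" and B': "B' \<in> J.closed_rel X U" and
      eq: "A' \<inter> W = B' \<inter> W" and fx: "(f, x) \<in> A'" for A' B' f x
    proof (rule J.closed_rel_closed[OF B'])
      note a = J.closed_relD[OF A' fx]
      show "f \<in> Arr E" "x \<in> Arr E" "Cod E f = U" "Cod E x = X" "Dom E x = Dom E f" by (fact a)+
      have "T.locally (Dom E f) (\<lambda>g. (f \<cdot> g, x \<cdot> g) \<in> B')"
      proof (rule locally_via_gen)
        show "Dom E f \<in> Ob E" using a by simp
        fix c u assume c: "c \<in> Ob C" and u: "u \<in> Arr E" "Dom E u = FOb G c" "Cod E u = Dom E f"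
        have "(f \<cdot> u, x \<cdot> u) \<in> A'" using J.closed_rel_comp[OF A' fx u(1,3)] .
        moreover have "(f \<cdot> u, x \<cdot> u) \<in> W"
          using c u a by (auto simp: W_def hom_def intro!: bexI[of _ c])
        ultimately have fB: "(f \<cdot> u, x \<cdot> u) \<in> B'" using eq by blast
        show "T.locally (FOb G c) (\<lambda>w. (f \<cdot> (u \<cdot> w), x \<cdot> (u \<cdot> w)) \<in> B')"
        proof (rule T.locally_all)
          show "FOb G c \<in> Ob E" using c by simp
          fix w assume w: "w \<in> Arr E" "Cod E w = FOb G c"
          thus "(f \<cdot> (u \<cdot> w), x \<cdot> (u \<cdot> w)) \<in> B'"
            using J.closed_rel_comp[OF B' fB, of w] u a by simp
        qed
      qed
      thus "J.locally (Dom E f) (\<lambda>g. (f \<cdot> g, x \<cdot> g) \<in> B')"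
        using fine unfolding T.locally_def J.locally_def by blast
    qed
    have "p \<in> A \<longleftrightarrow> p \<in> B" for p
      using *[OF A B eq, of "fst p" "snd p"] *[OF B A eq[symmetric], of "fst p" "snd p"] by auto
    thus "A = B" by blast
  qed
  moreover have "(\<lambda>A. A \<inter> W) ` J.closed_rel X U \<subseteq> Pow W" by blast
  ultimately show ?thesis using small_in_inj[OF small_in_Pow[OF univ W]] by blast
qed

text \<open>Represented functors are separated.\<close>

lemma cov_epi:
  assumes x: "\<And>k. k \<in> L \<Longrightarrow> x k \<in> Arr E \<and> Cod E (x k) = X" and cov: "gen_sieve E (x ` L) \<in> Cov X"
    and X: "X \<in> Ob E"
  shows "globally_epimorphic E X L x"
  unfolding globally_epimorphic_def
proof (intro conjI ballI impI)
  show "k \<in> L \<Longrightarrow> x k \<in> Arr E" "k \<in> L \<Longrightarrow> Cod E (x k) = X" for k using x by blast+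
  fix g h assume g: "g \<in> Arr E" "Dom E g = X" and h: "h \<in> Arr E" "Dom E h = X" "Cod E g = Cod E h"
    and eq: "\<forall>k\<in>L. g \<cdot> x k = h \<cdot> x k"
  show "g = h"
  proof (rule hom_locally_eq)
    have "T.locally X (\<lambda>f. g \<cdot> f = h \<cdot> f)"
    proof (rule T.locally_mono[OF T.locally_cov[OF cov X]])
      fix f assume "f \<in> gen_sieve E (x ` L)"
      then obtain k w where k: "k \<in> L" "w \<in> Arr E" "Cod E w = Dom E (x k)" "f = x k \<cdot> w"
        unfolding gen_sieve_def by blast
      have "g \<cdot> x k \<cdot> w = h \<cdot> x k \<cdot> w" using eq k(1) by simp
      thus "g \<cdot> f = h \<cdot> f" using k x[OF k(1)] g h by simp
    qed
    thus "T.locally (Dom E g) (\<lambda>f. g \<cdot> f = h \<cdot> f)" using g by simp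
  qed (use g h in simp_all)
qed

text \<open>Conversely, two closed relations on the target of a jointly epimorphic family are compared:
  the full one and the one that holds locally in the generated sieve.  They agree on the family, so
  they are equal because closed relations are represented by an object.\<close>

lemma epi_cov:
  assumes X: "X \<in> Ob E" and epi: "globally_epimorphic E X L x"
  shows "gen_sieve E (x ` L) \<in> Cov X"
proof -
  let ?S = "gen_sieve E (x ` L)"
  have x: "x k \<in> Arr E" "Cod E (x k) = X" if "k \<in> L" for k
    using epi that unfolding globally_epimorphic_def by blast+
  have sS: "is_sieve E X ?S" using x by (intro E.gen_sieve_sieve) auto
  obtain R e where R: "R \<in> Ob E" "e \<in> T.closed_rel X R"
    "\<And>U. U \<in> Ob E \<Longrightarrow> bij_betw (\<lambda>x. T.restrict_rel x e) (hom E U R) (T.closed_rel X U)"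
    using representable[OF T.closed_rel_sheaf small_closed_rel[OF T.site_axioms _ X]] by auto
  define A where "A = {(f, y). f \<in> Arr E \<and> Cod E f = X \<and> y \<in> Arr E \<and> Cod E y = X \<and> Dom E y = Dom E f}"
  define B where "B = {(f, y). (f, y) \<in> A \<and> T.locally (Dom E f) (\<lambda>g. f \<cdot> g \<in> ?S)}"
  have A: "A \<in> T.closed_rel X X" by (rule T.closed_relI) (auto simp: A_def)
  have B: "B \<in> T.closed_rel X X"
  proof (rule T.closed_relI)
    fix f y assume "(f, y) \<in> B"
    hence f: "f \<in> Arr E" "Cod E f = X" "y \<in> Arr E" "Cod E y = X" "Dom E y = Dom E f"
      and loc: "T.locally (Dom E f) (\<lambda>g. f \<cdot> g \<in> ?S)" by (auto simp: A_def B_def)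
    show "f \<in> Arr E \<and> Cod E f = X \<and> y \<in> Arr E \<and> Cod E y = X \<and> Dom E y = Dom E f" using f by simp
    fix g assume g: "g \<in> Arr E" "Cod E g = Dom E f"
    have "T.locally (Dom E g) (\<lambda>h. f \<cdot> g \<cdot> h \<in> ?S)"
      by (rule T.locally_mono[OF T.locally_pull[OF loc g]]) (use f g in simp)
    thus "(f \<cdot> g, y \<cdot> g) \<in> B" using f g by (simp add: A_def B_def)
  next
    fix f y assume f: "f \<in> Arr E" "y \<in> Arr E" "Cod E f = X" "Cod E y = X" "Dom E y = Dom E f"
      and loc: "T.locally (Dom E f) (\<lambda>g. (f \<cdot> g, y \<cdot> g) \<in> B)"
    have "T.locally (Dom E f) (\<lambda>g. f \<cdot> g \<in> ?S)"
    proof (rule T.locally_trans[OF loc])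
      fix g assume g: "g \<in> Arr E" "Cod E g = Dom E f" "(f \<cdot> g, y \<cdot> g) \<in> B"
      hence "T.locally (Dom E g) (\<lambda>h. f \<cdot> g \<cdot> h \<in> ?S)" using f by (simp add: B_def)
      thus "T.locally (Dom E g) (\<lambda>h. f \<cdot> (g \<cdot> h) \<in> ?S)"
        by (rule T.locally_mono) (use f g in simp)
    qed
    thus "(f, y) \<in> B" using f by (simp add: A_def B_def)
  qed
  have "A \<in> (\<lambda>x. T.restrict_rel x e) ` hom E X R" "B \<in> (\<lambda>x. T.restrict_rel x e) ` hom E X R"
    using bij_betw_imp_surj_on[OF R(3)[OF X]] A B by simp_all
  then obtain a b where ah: "a \<in> hom E X R" "T.restrict_rel a e = A" and bh: "b \<in> hom E X R" "T.restrict_rel b e = B"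
    by auto
  have a: "a \<in> Arr E" "Dom E a = X" "Cod E a = R" and b: "b \<in> Arr E" "Dom E b = X" "Cod E b = R"
    using ah(1) bh(1) by (auto simp: hom_def)
  have "a \<cdot> x k = b \<cdot> x k" if k: "k \<in> L" for k
  proof (rule inj_onD[OF bij_betw_imp_inj_on[OF R(3)[of "Dom E (x k)"]]])
    note xk = x[OF k]
    have "T.restrict_rel (x k) A = T.restrict_rel (x k) B"
    proof -
      have "T.locally (Dom E f) (\<lambda>g. x k \<cdot> f \<cdot> g \<in> ?S)" if f: "f \<in> Arr E" "Cod E f = Dom E (x k)" for f
      proof (rule T.locally_all)
        show "Dom E f \<in> Ob E" using f by simp
        fix g assume "g \<in> Arr E" "Cod E g = Dom E f"
        thus "x k \<cdot> f \<cdot> g \<in> ?S"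
          using E.gen_sieveI[of "x k" "x ` L" "f \<cdot> g"] k f xk by simp
      qed
      thus ?thesis using xk unfolding T.restrict_rel_def B_def by auto
    qed
    thus "T.restrict_rel (a \<cdot> x k) e = T.restrict_rel (b \<cdot> x k) e"
      using T.restrict_rel_comp[of "x k" a e] T.restrict_rel_comp[of "x k" b e] a b xk ah bh by simp
  qed (use a b x[OF k] in \<open>simp_all add: hom_def\<close>)
  hence "a = b"
    using epi a b unfolding globally_epimorphic_def by metis
  hence "(Idn E X, Idn E X) \<in> B" using ah bh X by (simp add: A_def)
  hence "T.locally X (\<lambda>g. Idn E X \<cdot> g \<in> ?S)" using X by (simp add: B_def)
  hence "T.locally X (\<lambda>g. g \<in> ?S)" by (rule T.locally_mono) simp
  thus ?thesis using T.locally_sieve sS by blast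
qed

end


section \<open>The duality in terms of sieves\<close>

context category
begin

lemma pullback_gen_sieve:
  assumes pb: "is_pullback C m x p q"
  shows "pullback_sieve C x (gen_sieve C {m}) = gen_sieve C {q}"
proof (intro equalityI subsetI)
  note D = pullbackD[OF pb]
  fix f assume "f \<in> pullback_sieve C x (gen_sieve C {m})"
  then obtain w where f: "f \<in> Arr C" "Cod C f = Dom C x" and w: "w \<in> Arr C" "Cod C w = Dom C m"
    "x \<cdot> f = m \<cdot> w"
    by (auto simp: pullback_sieve_iff gen_sieve_def)
  have "Dom C w = Dom C f"
    using comp_arr(2)[of w m] comp_arr(2)[of f x] D f w by simp
  then obtain u where "u \<in> Arr C" "Cod C u = Dom C p" "q \<cdot> u = f"
    using pullback_lift[OF pb w(1) f(1) _ w(2) f(2) w(3)[symmetric]] by metis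
  thus "f \<in> gen_sieve C {q}" using D by (auto simp: gen_sieve_def)
next
  note D = pullbackD[OF pb]
  fix f assume "f \<in> gen_sieve C {q}"
  then obtain w where w: "w \<in> Arr C" "Cod C w = Dom C q" "f = q \<cdot> w" by (auto simp: gen_sieve_def)
  have "x \<cdot> f = m \<cdot> (p \<cdot> w)" using pullback_comp[OF pb w(1)] w D by simp
  thus "f \<in> pullback_sieve C x (gen_sieve C {m})"
    using w D by (auto simp: pullback_sieve_iff gen_sieve_def)
qed

lemma glues_mono_iff:
  assumes q: "is_mono C q"
  shows "glues C (\<lambda>X. hom C X Z) (\<lambda>f u. u \<cdot> f) (Cod C q) (gen_sieve C {q}) \<longleftrightarrow>
    bij_betw (\<lambda>f. f \<cdot> q) (hom C (Cod C q) Z) (hom C (Dom C q) Z)"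
proof
  have qa: "q \<in> Arr C" using mono_arr[OF q] .
  have qs: "q \<in> gen_sieve C {q}" using gen_sieve_base qa by simp
  assume gl: "glues C (\<lambda>X. hom C X Z) (\<lambda>f u. u \<cdot> f) (Cod C q) (gen_sieve C {q})"
  have P: "presheaf C (\<lambda>X. hom C X Z) (\<lambda>f u. u \<cdot> f)"
    unfolding presheaf_def by (auto simp: hom_def)
  show "bij_betw (\<lambda>f. f \<cdot> q) (hom C (Cod C q) Z) (hom C (Dom C q) Z)"
    unfolding bij_betw_def
  proof (intro conjI equalityI subsetI)
    show "inj_on (\<lambda>f. f \<cdot> q) (hom C (Cod C q) Z)"
    proof (rule inj_onI)
      fix a b assume a: "a \<in> hom C (Cod C q) Z" and b: "b \<in> hom C (Cod C q) Z" and eq: "a \<cdot> q = b \<cdot> q"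
      show "a = b"
      proof (rule glues_sep[OF P gen_sieve_sieve gl a b])
        show "c \<in> {q} \<Longrightarrow> c \<in> Arr C \<and> Cod C c = Cod C q" for c using qa by simp
        fix f assume "f \<in> gen_sieve C {q}"
        then obtain w where w: "w \<in> Arr C" "Cod C w = Dom C q" "f = q \<cdot> w" by (auto simp: gen_sieve_def)
        have "a \<cdot> q \<cdot> w = b \<cdot> q \<cdot> w" by (simp only: eq)
        thus "a \<cdot> f = b \<cdot> f" using w a b qa by (simp add: hom_def)
      qed
    qed
    fix b assume "b \<in> (\<lambda>f. f \<cdot> q) ` hom C (Cod C q) Z"
    thus "b \<in> hom C (Dom C q) Z" using qa by (auto simp: hom_def)
  next
    fix b assume b: "b \<in> hom C (Dom C q) Z"
    define x where "x = (\<lambda>f. b \<cdot> (THE w. w \<in> Arr C \<and> Cod C w = Dom C q \<and> q \<cdot> w = f))"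
    have x: "x (q \<cdot> w) = b \<cdot> w" if w: "w \<in> Arr C" "Cod C w = Dom C q" for w
    proof -
      have "(THE w'. w' \<in> Arr C \<and> Cod C w' = Dom C q \<and> q \<cdot> w' = q \<cdot> w) = w"
      proof (rule the_equality)
        fix w' assume w': "w' \<in> Arr C \<and> Cod C w' = Dom C q \<and> q \<cdot> w' = q \<cdot> w"
        have "Dom C w' = Dom C (q \<cdot> w')"
          using comp_arr(2)[OF w'[THEN conjunct1] qa] w' by metis
        also have "\<dots> = Dom C w" unfolding w'[THEN conjunct2, THEN conjunct2] using w qa by simp
        finally have d: "Dom C w' = Dom C w" .
        show "w' = w" by (rule monoD[OF q, of w' w]) (use w' w d in blast)+
      qed (use w in simp)
      thus ?thesis by (simp add: x_def)
    qed
    obtain y where y: "y \<in> hom C (Cod C q) Z" "\<And>f. f \<in> gen_sieve C {q} \<Longrightarrow> y \<cdot> f = x f"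
    proof (rule gluesD[OF gl, of x])
      fix f assume "f \<in> gen_sieve C {q}"
      then obtain w where w: "w \<in> Arr C" "Cod C w = Dom C q" "f = q \<cdot> w" by (auto simp: gen_sieve_def)
      show "x f \<in> hom C (Dom C f) Z" using x[OF w(1,2)] w b qa by (simp add: hom_def)
      fix g assume g: "g \<in> Arr C" "Cod C g = Dom C f"
      show "x f \<cdot> g = x (f \<cdot> g)"
        using x[OF w(1,2)] x[of "w \<cdot> g"] w b qa g by (simp add: hom_def)
    qed blast
    have "y \<cdot> q = b"
      using y(2)[OF qs] x[of "Idn C (Dom C q)"] b qa by (simp add: hom_def)
    thus "b \<in> (\<lambda>f. f \<cdot> q) ` hom C (Cod C q) Z" using y(1) by blast
  qed
next
  have qa: "q \<in> Arr C" using mono_arr[OF q] .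
  have qs: "q \<in> gen_sieve C {q}" using gen_sieve_base qa by simp
  assume bij: "bij_betw (\<lambda>f. f \<cdot> q) (hom C (Cod C q) Z) (hom C (Dom C q) Z)"
  show "glues C (\<lambda>X. hom C X Z) (\<lambda>f u. u \<cdot> f) (Cod C q) (gen_sieve C {q})"
    unfolding glues_def
  proof (intro allI impI)
    fix x assume x: "\<forall>f\<in>gen_sieve C {q}. x f \<in> hom C (Dom C f) Z"
      and m: "\<forall>f\<in>gen_sieve C {q}. \<forall>g\<in>Arr C. Cod C g = Dom C f \<longrightarrow> x f \<cdot> g = x (f \<cdot> g)"
    have "x q \<in> (\<lambda>f. f \<cdot> q) ` hom C (Cod C q) Z"
      using bij_betw_imp_surj_on[OF bij] x qs by simp
    then obtain y where y: "y \<in> hom C (Cod C q) Z" "y \<cdot> q = x q" by auto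
    show "\<exists>!y. y \<in> hom C (Cod C q) Z \<and> (\<forall>f\<in>gen_sieve C {q}. y \<cdot> f = x f)"
    proof (rule ex1I[of _ y], intro conjI ballI y(1))
      fix f assume "f \<in> gen_sieve C {q}"
      then obtain w where w: "w \<in> Arr C" "Cod C w = Dom C q" "f = q \<cdot> w" by (auto simp: gen_sieve_def)
      have "y \<cdot> q \<cdot> w = x q \<cdot> w" by (simp only: y(2))
      thus "y \<cdot> f = x f" using m qs w y(1) qa by (simp add: hom_def)
    next
      fix z assume "z \<in> hom C (Cod C q) Z \<and> (\<forall>f\<in>gen_sieve C {q}. z \<cdot> f = x f)"
      thus "z = y" using inj_onD[OF bij_betw_imp_inj_on[OF bij], of z y] y qs by simp
    qed
  qed
qed

end

context generated_topos
begin

abbreviation "ZCov Z \<equiv> glue_top E (hom_to Z) precomp"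

lemma ZCov_site: "site E (ZCov Z)"
  by unfold_locales (rule E.glue_top_topology[OF hom_presheaf])

lemma Cov_ZCov:
  assumes Z: "Z \<in> Ob E"
  shows "Cov X \<subseteq> ZCov Z X"
proof
  fix S assume S: "S \<in> Cov X"
  have "glues E (hom_to Z) precomp (Dom E f) (pullback_sieve E f S)" if "f \<in> Arr E" "Cod E f = X" for f
    using hom_sheaf[OF Z] T.cov_pullback[OF S that] that(1) unfolding sheaf_def by simp
  thus "S \<in> ZCov Z X" using CovD(1)[OF S] unfolding glue_top_def by simp
qed

text \<open>The duality between a monomorphism and an object says that the sheaf condition for the
  functor represented by the object holds universally on the sieve generated by the
  monomorphism.\<close>

lemma duality_iff:
  assumes m: "is_mono E m" and Z: "Z \<in> Ob E"
  shows "(m, Z) \<in> duality_rel E \<longleftrightarrow> gen_sieve E {m} \<in> ZCov Z (Cod E m)"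
proof -
  have ma: "m \<in> Arr E" using E.mono_arr[OF m] .
  have eq: "glues E (hom_to Z) precomp (Dom E x) (pullback_sieve E x (gen_sieve E {m})) \<longleftrightarrow>
      bij_betw (\<lambda>f. f \<cdot> q) (hom E (Dom E x) Z) (hom E (Dom E q) Z)"
    if pb: "is_pullback E m x p q" for x p q
    using E.glues_mono_iff[OF E.pullback_mono[OF pb m], of Z] E.pullbackD(8)[OF pb]
      E.pullback_gen_sieve[OF pb] by simp
  have sv: "is_sieve E (Cod E m) (gen_sieve E {m})" using ma by (intro E.gen_sieve_sieve) simp
  show ?thesis
  proof
    assume R: "(m, Z) \<in> duality_rel E"
    have "glues E (hom_to Z) precomp (Dom E x) (pullback_sieve E x (gen_sieve E {m}))"
      if x: "x \<in> Arr E" "Cod E x = Cod E m" for x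
    proof -
      obtain p q where pb: "is_pullback E m x p q" using pullback_ex[OF ma x(1)] x(2) by metis
      thus ?thesis using R x unfolding eq[OF pb] duality_rel_def by simp
    qed
    thus "gen_sieve E {m} \<in> ZCov Z (Cod E m)" using sv unfolding glue_top_def by simp
  next
    assume G: "gen_sieve E {m} \<in> ZCov Z (Cod E m)"
    show "(m, Z) \<in> duality_rel E"
      unfolding duality_rel_def
    proof (intro CollectI case_prodI conjI ballI impI allI)
      fix x p q assume "x \<in> Arr E" "Cod E x = Cod E m" and pb: "is_pullback E m x p q"
      thus "bij_betw (\<lambda>f. f \<cdot> q) (hom E (Dom E x) Z) (hom E (Dom E q) Z)"
        using E.glue_topD(2)[OF G, of x] eq[OF pb] by simp
    qed (use m Z in \<open>simp_all add: all_monos_def\<close>)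
  qed
qed

abbreviation "FR \<equiv> polar_F (all_monos E) (Ob E) (duality_rel E)"
abbreviation "GR \<equiv> polar_G (all_monos E) (Ob E) (duality_rel E)"

lemma GR_iff:
  assumes "I \<subseteq> Ob E"
  shows "m \<in> GR I \<longleftrightarrow> is_mono E m \<and> (\<forall>Z\<in>I. gen_sieve E {m} \<in> ZCov Z (Cod E m))"
  using assms duality_iff unfolding polar_G_def all_monos_def by blast

lemma FR_iff:
  assumes "J \<subseteq> all_monos E"
  shows "Z \<in> FR J \<longleftrightarrow> Z \<in> Ob E \<and> (\<forall>m\<in>J. gen_sieve E {m} \<in> ZCov Z (Cod E m))"
  using assms duality_iff unfolding polar_F_def all_monos_def by blast

text \<open>The axioms are those of the Grothendieck topologies \<open>ZCov Z\<close>, read off on the sieves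
  generated by single monomorphisms.\<close>

lemma GR_topology:
  assumes I: "I \<subseteq> Ob E"
  shows "is_topology TYPE('u) E (GR I)"
  unfolding is_topology_def
proof (intro conjI allI impI ballI)
  fix f assume f: "is_iso E f"
  then obtain g where g: "g \<in> Arr E" "Dom E g = Cod E f" "Cod E g = Dom E f"
    "f \<cdot> g = Idn E (Cod E f)" by (rule E.isoE)
  have fa: "f \<in> Arr E" using E.iso_arr[OF f] .
  have "gen_sieve E {f} \<in> ZCov Z (Cod E f)" if Z: "Z \<in> I" for Z
  proof -
    interpret Z: site E "ZCov Z" by (rule ZCov_site)
    have sv: "is_sieve E (Cod E f) (gen_sieve E {f})" using fa by (intro E.gen_sieve_sieve) simp
    have "h \<in> gen_sieve E {f}" if h: "h \<in> Arr E" "Cod E h = Cod E f" for h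
    proof -
      have "h = f \<cdot> g \<cdot> h" unfolding g(4) using h by simp
      hence "h = f \<cdot> (g \<cdot> h)" using h g(1-3) fa by simp
      moreover have "g \<cdot> h \<in> Arr E" "Cod E (g \<cdot> h) = Dom E f" using g h by simp_all
      ultimately show ?thesis unfolding gen_sieve_def by blast
    qed
    hence "{h \<in> Arr E. Cod E h = Cod E f} \<subseteq> gen_sieve E {f}" by blast
    thus ?thesis
      using Z.cov_superset[OF Z.cov_max _ sv] fa by simp
  qed
  thus "f \<in> GR I" using E.iso_mono[OF f] GR_iff[OF I] by blast
next
  fix m x p q assume m: "m \<in> GR I" and pb: "is_pullback E m x p q"
  note D = E.pullbackD[OF pb]
  have "gen_sieve E {q} \<in> ZCov Z (Cod E q)" if "Z \<in> I" for Z
  proof -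
    interpret Z: site E "ZCov Z" by (rule ZCov_site)
    have "gen_sieve E {m} \<in> ZCov Z (Cod E m)" using m that GR_iff[OF I] by blast
    from Z.cov_pullback[OF this D(2) D(3)[symmetric]]
    show ?thesis by (simp only: E.pullback_gen_sieve[OF pb] D(8))
  qed
  thus "q \<in> GR I" using E.pullback_mono[OF pb] m GR_iff[OF I] by blast
next
  fix m assume m: "m \<in> all_monos E" and ex: "\<exists>m'\<in>GR I. Cod E m' = Cod E m \<and>
      (\<exists>(L :: 'u set) x. small L \<and> globally_epimorphic E (Dom E m') L x \<and>
        (\<forall>k\<in>L. \<forall>p q. is_pullback E m (m' \<cdot> x k) p q \<longrightarrow> q \<in> GR I))"
  then obtain m' and L :: "'u set" and x where m': "m' \<in> GR I" "Cod E m' = Cod E m"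
    and epi: "globally_epimorphic E (Dom E m') L x"
    and loc: "\<And>k p q. k \<in> L \<Longrightarrow> is_pullback E m (m' \<cdot> x k) p q \<Longrightarrow> q \<in> GR I"
    by blast
  have mm: "is_mono E m" using m by (simp add: all_monos_def)
  have ma: "m \<in> Arr E" using E.mono_arr[OF mm] .
  have ma': "m' \<in> Arr E" using m'(1) GR_iff[OF I] E.mono_arr by blast
  have x: "x k \<in> Arr E" "Cod E (x k) = Dom E m'" if "k \<in> L" for k
    using epi that unfolding globally_epimorphic_def by blast+
  have sv: "is_sieve E (Cod E m) (gen_sieve E {m})" using ma by (intro E.gen_sieve_sieve) simp
  have "gen_sieve E {m} \<in> ZCov Z (Cod E m)" if Z: "Z \<in> I" for Z
  proof -
    interpret Z: site E "ZCov Z" by (rule ZCov_site)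
    have Zo: "Z \<in> Ob E" using Z I by blast
    have sv': "is_sieve E (Dom E m') (pullback_sieve E m' (gen_sieve E {m}))"
      using E.pullback_sieve_sieve[OF sv ma' m'(2)] .
    have *: "pullback_sieve E m' (gen_sieve E {m}) \<in> ZCov Z (Dom E m')"
    proof (rule Z.cov_trans[OF _ _ sv'])
      show "gen_sieve E (x ` L) \<in> ZCov Z (Dom E m')"
        using epi_cov[OF _ epi] Cov_ZCov[OF Zo] ma' by auto
      show "Dom E m' \<in> Ob E" using ma' by simp
      fix f assume "f \<in> gen_sieve E (x ` L)"
      then obtain k w where k: "k \<in> L" and w: "w \<in> Arr E" "Cod E w = Dom E (x k)" "f = x k \<cdot> w"
        unfolding gen_sieve_def by blast
      note xk = x[OF k]
      have mx: "m' \<cdot> x k \<in> Arr E" "Dom E (m' \<cdot> x k) = Dom E (x k)"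
        "Cod E (m' \<cdot> x k) = Cod E m"
        using xk ma' m'(2) by simp_all
      obtain p q where pb: "is_pullback E m (m' \<cdot> x k) p q"
        using pullback_ex[OF ma mx(1)] mx(3) by metis
      have "gen_sieve E {q} \<in> ZCov Z (Cod E q)" using loc[OF k pb] GR_iff[OF I] Z by blast
      hence "gen_sieve E {q} \<in> ZCov Z (Dom E (x k))" using E.pullbackD(8)[OF pb] mx(2) by simp
      hence "pullback_sieve E w (gen_sieve E {q}) \<in> ZCov Z (Dom E w)"
        using Z.cov_pullback w by blast
      moreover have "pullback_sieve E f (pullback_sieve E m' (gen_sieve E {m})) =
          pullback_sieve E w (gen_sieve E {q})"
        unfolding E.pullback_gen_sieve[OF pb, symmetric] using xk ma' w
        by (simp add: E.pullback_sieve_comp)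
      ultimately show "pullback_sieve E f (pullback_sieve E m' (gen_sieve E {m})) \<in> ZCov Z (Dom E f)"
        using w xk by simp
    qed
    show ?thesis
    proof (rule Z.cov_trans[OF _ _ sv])
      show "gen_sieve E {m'} \<in> ZCov Z (Cod E m)" using m' Z GR_iff[OF I] by metis
      show "Cod E m \<in> Ob E" using ma by simp
      fix f assume "f \<in> gen_sieve E {m'}"
      then obtain w where w: "w \<in> Arr E" "Cod E w = Dom E m'" "f = m' \<cdot> w"
        unfolding gen_sieve_def by blast
      have "pullback_sieve E f (gen_sieve E {m}) =
          pullback_sieve E w (pullback_sieve E m' (gen_sieve E {m}))"
        using w ma' by (simp add: E.pullback_sieve_comp)
      thus "pullback_sieve E f (gen_sieve E {m}) \<in> ZCov Z (Dom E f)"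
        using Z.cov_pullback[OF * w(1,2)] w ma' by simp
    qed
  qed
  thus "m \<in> GR I" using mm GR_iff[OF I] by blast
qed

end

section \<open>The topology on objects defined by a class of monomorphisms\<close>

locale topos_topology = generated_topos E C K G
  for E :: "('o, 'a) cat" (structure) and C :: "('u, 'u) cat" and K and G +
  fixes J :: "'a set"
  assumes J_mono: "J \<subseteq> all_monos E" and J_top: "is_topology TYPE('u) E J"
begin

lemma J_arr: "m \<in> J \<Longrightarrow> is_mono E m" "m \<in> J \<Longrightarrow> m \<in> Arr E"
  using J_mono E.mono_arr unfolding all_monos_def by blast+

lemma J_iso: "is_iso E f \<Longrightarrow> f \<in> J"
  using J_top unfolding is_topology_def by (elim conjE) blast

lemma J_pullback: "m \<in> J \<Longrightarrow> is_pullback E m x p q \<Longrightarrow> q \<in> J"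
  using J_top E.pullbackD(2,3) unfolding is_topology_def by (elim conjE) metis

text \<open>The third axiom for a topology, with the family replaced by an arbitrary covering sieve: the
  members of the sieve with domain in the image of \<open>G\<close> form a small family.\<close>

lemma J_local:
  assumes m: "is_mono E m" and n: "n \<in> J" "Cod E n = Cod E m" and S: "S \<in> Cov (Dom E n)"
    and loc: "\<And>u p q. u \<in> S \<Longrightarrow> is_pullback E m (n \<cdot> u) p q \<Longrightarrow> q \<in> J"
  shows "m \<in> J"
proof -
  have na: "n \<in> Arr E" using J_arr n by blast
  define L where "L = {u \<in> S. \<exists>c\<in>Ob C. Dom E u = FOb G c}"
  have aS: "u \<in> Arr E" "Cod E u = Dom E n" if "u \<in> S" for u
    using E.sieve_arr[OF CovD(1)[OF S] that] by auto
  have sv: "is_sieve E (Dom E n) (gen_sieve E L)" by (intro E.gen_sieve_sieve) (auto simp: L_def aS)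
  have cov: "gen_sieve E L \<in> Cov (Dom E n)"
  proof (rule CovI[OF sv])
    fix c u assume u: "c \<in> Ob C" "u \<in> Arr E" "Dom E u = FOb G c" "Cod E u = Dom E n"
    show "S.locally c (\<lambda>g. u \<cdot> FArr G g \<in> gen_sieve E L)"
    proof (rule S.locally_mono[OF CovD(2)[OF S u]])
      fix g assume g: "g \<in> Arr C" "Cod C g = c" "u \<cdot> FArr G g \<in> S"
      hence "u \<cdot> FArr G g \<in> L" using u unfolding L_def by auto
      thus "u \<cdot> FArr G g \<in> gen_sieve E L" using E.gen_sieve_base u g by simp
    qed
  qed
  have "L \<subseteq> (\<Union>c\<in>Ob C. hom E (FOb G c) (Dom E n))" using aS by (auto simp: L_def hom_def)
  moreover have "small_in TYPE('u) (\<Union>c\<in>Ob C. hom E (FOb G c) (Dom E n))"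
    using small_gen na by (intro small_in_UN univ small_hom) (simp_all add: small_in_self)
  ultimately have "small_in TYPE('u) L" using small_in_subset by blast
  then obtain e :: "'a \<Rightarrow> 'u" where e: "inj_on e L" "small (e ` L)" by (rule small_in_code)
  define x where "x = inv_into L e"
  have xe: "x (e u) = u" if "u \<in> L" for u using e(1) that by (simp add: x_def)
  have xL: "x ` (e ` L) = L" using xe by (force simp: image_image)
  have "globally_epimorphic E (Dom E n) (e ` L) x"
  proof (rule cov_epi)
    fix k assume "k \<in> e ` L"
    hence "x k \<in> L" using xL by blast
    thus "x k \<in> Arr E \<and> Cod E (x k) = Dom E n" using aS by (simp add: L_def)
  next
    show "gen_sieve E (x ` (e ` L)) \<in> Cov (Dom E n)" using cov by (simp only: xL)
  qed (use na in simp)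
  moreover have "\<forall>k\<in>e ` L. \<forall>p q. is_pullback E m (n \<cdot> x k) p q \<longrightarrow> q \<in> J"
  proof (intro ballI allI impI)
    fix k p q assume "k \<in> e ` L" and pb: "is_pullback E m (n \<cdot> x k) p q"
    hence "x k \<in> L" using xL by blast
    hence "x k \<in> S" by (simp add: L_def)
    thus "q \<in> J" using pb by (rule loc)
  qed
  moreover have "m \<in> all_monos E" using m by (simp add: all_monos_def)
  ultimately show ?thesis
    using J_top n e(2) unfolding is_topology_def by (elim conjE) blast
qed

text \<open>If \<open>n\<close> factors through \<open>m\<close>, every pullback of \<open>m\<close> along an arrow that factors
  through \<open>n\<close> is an isomorphism.\<close>

lemma J_up:
  assumes n: "n \<in> J" and m: "is_mono E m" and t: "t \<in> Arr E" "Cod E t = Dom E m" "m \<cdot> t = n"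
  shows "m \<in> J"
proof (rule J_local[OF m n])
  have ma: "m \<in> Arr E" using E.mono_arr[OF m] .
  have d: "Dom E t = Dom E n" "Cod E n = Cod E m" using t ma by auto
  show "Cod E n = Cod E m" by (rule d)
  show "{f \<in> Arr E. Cod E f = Dom E n} \<in> Cov (Dom E n)" using J_arr n by (intro T.cov_max) simp
  fix u p q assume u: "u \<in> {f \<in> Arr E. Cod E f = Dom E n}" and pb: "is_pullback E m (n \<cdot> u) p q"
  have "m \<cdot> (t \<cdot> u) = m \<cdot> t \<cdot> u" using t(1,2) ma u d by simp
  also have "\<dots> = n \<cdot> u" by (simp only: t(3))
  finally have "m \<cdot> (t \<cdot> u) = n \<cdot> u" .
  hence "is_iso E q"
    using t(1,2) u d J_arr[OF n]
    by (intro E.pullback_of_factor_iso[OF pb m, of "t \<cdot> u"]) simp_all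
  thus "q \<in> J" by (rule J_iso)
qed

text \<open>The coarsest topology that contains the canonical one and the sieves generated by the elements
  of \<open>J\<close>.\<close>

definition JCov :: "'o \<Rightarrow> 'a set set" where
  "JCov X = {S. is_sieve E X S \<and> (\<exists>m\<in>J. Cod E m = X \<and> pullback_sieve E m S \<in> Cov (Dom E m))}"

text \<open>For transitivity the subobject is the image \<open>i\<close> of the sieve \<open>S'\<close>, which is the
  largest possible choice.  By \<open>J_local\<close> it belongs to \<open>J\<close> as soon as its pullbacks along the
  members of \<open>S\<close> do, and each of these contains a subobject from \<open>J\<close> by hypothesis.\<close>

lemma JCov_topology: "grothendieck_topology E JCov"
  unfolding grothendieck_topology_def
proof (intro conjI ballI allI impI)
  fix c S assume "S \<in> JCov c" thus "is_sieve E c S" by (simp add: JCov_def)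
next
  fix X assume X: "X \<in> Ob E"
  let ?M = "{f \<in> Arr E. Cod E f = X}"
  have "is_iso E (Idn E X)" using X by (intro E.isoI[of "Idn E X" "Idn E X"]) simp_all
  hence "Idn E X \<in> J" by (rule J_iso)
  moreover have "pullback_sieve E (Idn E X) ?M \<in> Cov (Dom E (Idn E X))"
    using E.pullback_sieve_id[OF E.max_sieve X] T.cov_max[OF X] X by simp
  moreover have "Cod E (Idn E X) = X" using X by simp
  ultimately show "?M \<in> JCov X" using E.max_sieve unfolding JCov_def by blast
next
  fix f S assume f: "f \<in> Arr E" and "S \<in> JCov (Cod E f)"
  then obtain m where S: "is_sieve E (Cod E f) S" and m: "m \<in> J" "Cod E m = Cod E f"
    "pullback_sieve E m S \<in> Cov (Dom E m)" by (auto simp: JCov_def)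
  have ma: "m \<in> Arr E" using J_arr m by blast
  obtain p q where pb: "is_pullback E m f p q" using pullback_ex[OF ma f m(2)] .
  note D = E.pullbackD[OF pb]
  have "pullback_sieve E q (pullback_sieve E f S) = pullback_sieve E p (pullback_sieve E m S)"
    using D by (simp add: E.pullback_sieve_comp)
  hence "pullback_sieve E q (pullback_sieve E f S) \<in> Cov (Dom E q)"
    using T.cov_pullback[OF m(3) D(4,7)] D(6) by simp
  thus "pullback_sieve E f S \<in> JCov (Dom E f)"
    using J_pullback[OF m(1) pb] D(8) E.pullback_sieve_sieve[OF S f refl] unfolding JCov_def by blast
next
  fix X S S' assume X: "X \<in> Ob E" and "S \<in> JCov X" and S': "is_sieve E X S'"
    and loc: "\<forall>f\<in>S. pullback_sieve E f S' \<in> JCov (Dom E f)"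
  then obtain m where S: "is_sieve E X S" and m: "m \<in> J" "Cod E m = X"
    "pullback_sieve E m S \<in> Cov (Dom E m)" by (auto simp: JCov_def)
  have ma: "m \<in> Arr E" using J_arr m by blast
  obtain i where i: "is_mono E i" "Cod E i = X" "\<And>f. f \<in> Arr E \<Longrightarrow> Cod E f = X \<Longrightarrow>
       (\<exists>h\<in>hom E (Dom E f) (Dom E i). i \<cdot> h = f) \<longleftrightarrow> T.locally (Dom E f) (\<lambda>g. f \<cdot> g \<in> S')"
    by (rule image_ex[OF X S']) blast
  have ia: "i \<in> Arr E" using E.mono_arr[OF i(1)] .
  have "i \<in> J"
  proof (rule J_local[OF i(1) m(1) _ m(3)])
    show "Cod E m = Cod E i" using i m by simp
    fix u p q assume "u \<in> pullback_sieve E m S" and pb: "is_pullback E i (m \<cdot> u) p q"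
    hence u: "u \<in> Arr E" "Cod E u = Dom E m" "m \<cdot> u \<in> S" by (auto simp: E.pullback_sieve_iff)
    note D = E.pullbackD[OF pb]
    have dmu: "Dom E (m \<cdot> u) = Dom E u" using u ma by simp
    obtain n where n: "n \<in> J" "Cod E n = Dom E u"
      "pullback_sieve E n (pullback_sieve E (m \<cdot> u) S') \<in> Cov (Dom E n)"
      using loc u(3) dmu by (auto simp: JCov_def)
    have na: "n \<in> Arr E" using J_arr n by blast
    have mun: "m \<cdot> u \<cdot> n \<in> Arr E" "Cod E (m \<cdot> u \<cdot> n) = X"
      "Dom E (m \<cdot> u \<cdot> n) = Dom E n"
      using ma u na n m by simp_all
    have "T.locally (Dom E n) (\<lambda>g. m \<cdot> u \<cdot> n \<cdot> g \<in> S')"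
      by (rule T.locally_mono[OF T.locally_cov[OF n(3)]])
         (use ma u na n in \<open>simp_all add: E.pullback_sieve_iff\<close>)
    hence "\<exists>h\<in>hom E (Dom E n) (Dom E i). i \<cdot> h = m \<cdot> u \<cdot> n"
      using i(3)[OF mun(1,2)] mun(3) by simp
    then obtain h where h: "h \<in> Arr E" "Dom E h = Dom E n" "Cod E h = Dom E i"
      "i \<cdot> h = m \<cdot> u \<cdot> n" by (auto simp: hom_def)
    have cn: "Cod E n = Dom E (m \<cdot> u)" using n(2) dmu by simp
    obtain w where w: "w \<in> Arr E" "Dom E w = Dom E h" "Cod E w = Dom E p" "p \<cdot> w = h"
        "q \<cdot> w = n"
      by (rule E.pullback_lift[OF pb h(1) na h(2,3) cn h(4)])
    show "q \<in> J"
      using J_up[OF n(1) E.pullback_mono[OF pb i(1)] w(1)] w D(6) by simp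
  qed
  moreover have "pullback_sieve E i S' \<in> Cov (Dom E i)"
  proof (rule T.locally_sieve)
    have "T.locally (Dom E i) (\<lambda>g. i \<cdot> g \<in> S')"
    proof (rule iffD1[OF i(3)[OF ia i(2)]], rule bexI[of _ "Idn E (Dom E i)"])
      show "i \<cdot> Idn E (Dom E i) = i" using ia by simp
      show "Idn E (Dom E i) \<in> hom E (Dom E i) (Dom E i)" using ia by (simp add: hom_def)
    qed
    thus "T.locally (Dom E i) (\<lambda>g. g \<in> pullback_sieve E i S')"
      by (rule T.locally_mono) (simp add: E.pullback_sieve_iff)
    show "is_sieve E (Dom E i) (pullback_sieve E i S')"
      using E.pullback_sieve_sieve[OF S' ia i(2)] .
  qed
  ultimately show "S' \<in> JCov X" using S' i(2) unfolding JCov_def by blast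
qed

sublocale J: site E JCov
  by unfold_locales (rule JCov_topology)

lemma Cov_JCov:
  assumes X: "X \<in> Ob E"
  shows "Cov X \<subseteq> JCov X"
proof
  fix S assume S: "S \<in> Cov X"
  have "is_iso E (Idn E X)" using X by (intro E.isoI[of "Idn E X" "Idn E X"]) simp_all
  hence "Idn E X \<in> J" by (rule J_iso)
  thus "S \<in> JCov X"
    using S CovD(1)[OF S] X unfolding JCov_def
    by (auto intro!: bexI[of _ "Idn E X"] simp: E.pullback_sieve_id)
qed

lemma J_gen_sieve:
  assumes m: "m \<in> J"
  shows "gen_sieve E {m} \<in> JCov (Cod E m)"
proof -
  have ma: "m \<in> Arr E" using J_arr m by blast
  have sv: "is_sieve E (Cod E m) (gen_sieve E {m})" using ma by (intro E.gen_sieve_sieve) simp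
  have "pullback_sieve E m (gen_sieve E {m}) = {g \<in> Arr E. Cod E g = Dom E m}"
    using E.pullback_sieve_mem[OF sv] E.gen_sieve_base[of m "{m}"] ma by simp
  thus ?thesis using sv m T.cov_max[of "Dom E m"] ma unfolding JCov_def by auto
qed

text \<open>The subobject \<open>n\<close> witnessing the covering is locally contained in \<open>m\<close>, and so the
  pullbacks of \<open>m\<close> along the members of a covering sieve of \<open>n\<close> are isomorphisms.\<close>

lemma J_of_gen_sieve:
  assumes m: "is_mono E m" and cov: "gen_sieve E {m} \<in> JCov (Cod E m)"
  shows "m \<in> J"
proof -
  have ma: "m \<in> Arr E" using E.mono_arr[OF m] .
  obtain n where n: "n \<in> J" "Cod E n = Cod E m" "pullback_sieve E n (gen_sieve E {m}) \<in> Cov (Dom E n)"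
    using cov by (auto simp: JCov_def)
  have na: "n \<in> Arr E" using J_arr n by blast
  show ?thesis
  proof (rule J_local[OF m n])
    fix u p q assume "u \<in> pullback_sieve E n (gen_sieve E {m})" and pb: "is_pullback E m (n \<cdot> u) p q"
    then obtain t where u: "u \<in> Arr E" "Cod E u = Dom E n"
      and t: "t \<in> Arr E" "Cod E t = Dom E m" "n \<cdot> u = m \<cdot> t"
      by (auto simp: E.pullback_sieve_iff gen_sieve_def)
    have "Dom E t = Dom E (n \<cdot> u)" unfolding t(3) using t(1,2) ma by simp
    from E.pullback_of_factor_iso[OF pb m t(1) this t(2) t(3)[symmetric]]
    show "q \<in> J" by (rule J_iso)
  qed
qed

text \<open>For the direction from left to right, \<open>JCov\<close> is contained in the topology \<open>ZCov Z\<close>,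
  as the latter is transitive and contains both the canonical topology and the sieves generated by
  elements of \<open>J\<close>.\<close>

lemma FR_sheaf_iff: "Z \<in> FR J \<longleftrightarrow> Z \<in> Ob E \<and> sheaf E JCov (hom_to Z) precomp"
proof
  assume "Z \<in> FR J"
  hence Z: "Z \<in> Ob E" and ZJ: "\<And>m. m \<in> J \<Longrightarrow> gen_sieve E {m} \<in> ZCov Z (Cod E m)"
    using FR_iff[OF J_mono] by auto
  interpret Z: site E "ZCov Z" by (rule ZCov_site)
  have "glues E (hom_to Z) precomp X S" if X: "X \<in> Ob E" and S: "S \<in> JCov X" for X S
  proof (rule E.glue_topD(3)[OF _ X])
    obtain m where sS: "is_sieve E X S" and m: "m \<in> J" "Cod E m = X"
      "pullback_sieve E m S \<in> Cov (Dom E m)" using S by (auto simp: JCov_def)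
    have ma: "m \<in> Arr E" using J_arr m by blast
    show "S \<in> ZCov Z X"
    proof (rule Z.cov_trans[OF _ X sS])
      show "gen_sieve E {m} \<in> ZCov Z X" using ZJ[OF m(1)] m(2) by simp
      fix f assume "f \<in> gen_sieve E {m}"
      then obtain w where w: "w \<in> Arr E" "Cod E w = Dom E m" "f = m \<cdot> w"
        unfolding gen_sieve_def by blast
      have "pullback_sieve E m S \<in> ZCov Z (Dom E m)" using m(3) Cov_ZCov[OF Z] by blast
      hence "pullback_sieve E w (pullback_sieve E m S) \<in> ZCov Z (Dom E w)"
        using Z.cov_pullback w by blast
      thus "pullback_sieve E f S \<in> ZCov Z (Dom E f)" using w ma by (simp add: E.pullback_sieve_comp)
    qed
  qed
  thus "Z \<in> Ob E \<and> sheaf E JCov (hom_to Z) precomp" using Z hom_presheaf unfolding sheaf_def by blast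
next
  assume Z: "Z \<in> Ob E \<and> sheaf E JCov (hom_to Z) precomp"
  have "gen_sieve E {m} \<in> ZCov Z (Cod E m)" if m: "m \<in> J" for m
  proof -
    have sv: "is_sieve E (Cod E m) (gen_sieve E {m})" using J_arr[OF m] by (intro E.gen_sieve_sieve) simp
    have "glues E (hom_to Z) precomp (Dom E f) (pullback_sieve E f (gen_sieve E {m}))"
      if "f \<in> Arr E" "Cod E f = Cod E m" for f
      using Z J.cov_pullback[OF J_gen_sieve[OF m] that] that(1) unfolding sheaf_def by simp
    thus ?thesis using sv unfolding glue_top_def by simp
  qed
  thus "Z \<in> FR J" using Z FR_iff[OF J_mono] by blast
qed

end


section \<open>Reflective full subcategories\<close>

locale reflection = category E for E :: "('o, 'a) cat" (structure) +
  fixes I :: "'o set" and L :: "('o, 'a, 'o, 'a) fctr" and \<eta> :: "'o \<Rightarrow> 'a"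
  assumes I_ob: "I \<subseteq> Ob E"
    and L_functor: "is_functor E (full_subcat E I) L"
    and unit: "X \<in> Ob E \<Longrightarrow> \<eta> X \<in> hom E X (FOb L X)"
    and unit_nat: "f \<in> Arr E \<Longrightarrow> \<eta> (Cod E f) \<cdot> f = FArr L f \<cdot> \<eta> (Dom E f)"
    and universal: "X \<in> Ob E \<Longrightarrow> Z \<in> I \<Longrightarrow> f \<in> hom E X Z \<Longrightarrow>
      \<exists>!g. g \<in> hom E (FOb L X) Z \<and> g \<cdot> \<eta> X = f"
begin

abbreviation "EI \<equiv> full_subcat E I"

lemma EI_hom: "a \<in> I \<Longrightarrow> b \<in> I \<Longrightarrow> hom EI a b = hom E a b"
  unfolding hom_def by auto

lemma EI_category: "category EI"
  using I_ob by unfold_locales (auto simp: hom_def)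

lemma L_ob [simp]: "X \<in> Ob E \<Longrightarrow> FOb L X \<in> I"
  using L_functor unfolding is_functor_def by simp

lemma L_ob' [simp]: "X \<in> Ob E \<Longrightarrow> FOb L X \<in> Ob E"
  using I_ob L_ob by blast

lemma L_arr [simp]:
  assumes "f \<in> Arr E"
  shows "FArr L f \<in> Arr E" "Dom E (FArr L f) = FOb L (Dom E f)" "Cod E (FArr L f) = FOb L (Cod E f)"
  using L_functor assms unfolding is_functor_def by (auto simp: hom_def)

lemma L_id: "X \<in> Ob E \<Longrightarrow> FArr L (Idn E X) = Idn E (FOb L X)"
  using L_functor unfolding is_functor_def by simp

lemma L_comp: "f \<in> Arr E \<Longrightarrow> g \<in> Arr E \<Longrightarrow> Cod E f = Dom E g \<Longrightarrow> FArr L (g \<cdot> f) = FArr L g \<cdot> FArr L f"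
  using L_functor unfolding is_functor_def by simp

lemma unit_arr [simp]:
  assumes "X \<in> Ob E" shows "\<eta> X \<in> Arr E" "Dom E (\<eta> X) = X" "Cod E (\<eta> X) = FOb L X"
  using unit[OF assms] by (auto simp: hom_def)

lemma extend:
  assumes "f \<in> Arr E" "Cod E f \<in> I"
  obtains g where "g \<in> Arr E" "Dom E g = FOb L (Dom E f)" "Cod E g = Cod E f" "g \<cdot> \<eta> (Dom E f) = f"
proof -
  have "\<exists>!g. g \<in> hom E (FOb L (Dom E f)) (Cod E f) \<and> g \<cdot> \<eta> (Dom E f) = f"
    using assms by (intro universal) (simp_all add: hom_def)
  then obtain g where "g \<in> hom E (FOb L (Dom E f)) (Cod E f) \<and> g \<cdot> \<eta> (Dom E f) = f" by (rule ex1E)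
  thus thesis by (intro that[of g]) (simp_all add: hom_def)
qed

lemma unit_cancel:
  assumes X: "X \<in> Ob E" and g: "g \<in> Arr E" "Dom E g = FOb L X" "Cod E g \<in> I"
    and h: "h \<in> Arr E" "Dom E h = FOb L X" "Cod E h = Cod E g" and eq: "g \<cdot> \<eta> X = h \<cdot> \<eta> X"
  shows "g = h"
proof -
  have "\<exists>!k. k \<in> hom E (FOb L X) (Cod E g) \<and> k \<cdot> \<eta> X = g \<cdot> \<eta> X"
    using X g by (intro universal) (simp_all add: hom_def)
  thus ?thesis using g h eq by (elim ex1E) (metis homI)
qed

lemma unit_iso:
  assumes X: "X \<in> I" shows "is_iso E (\<eta> X)"
proof -
  have Xo: "X \<in> Ob E" using X I_ob by blast
  obtain g where g: "g \<in> Arr E" "Dom E g = FOb L X" "Cod E g = X" "g \<cdot> \<eta> X = Idn E X"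
    using extend[of "Idn E X"] X Xo by auto
  have "\<eta> X \<cdot> g = Idn E (FOb L X)"
  proof (rule unit_cancel[OF Xo])
    have "\<eta> X \<cdot> g \<cdot> \<eta> X = \<eta> X \<cdot> (g \<cdot> \<eta> X)" using g(1-3) Xo by simp
    thus "\<eta> X \<cdot> g \<cdot> \<eta> X = Idn E (FOb L X) \<cdot> \<eta> X" using g(4) Xo by simp
  qed (use g Xo in simp_all)
  thus ?thesis using g Xo by (intro isoI[of "\<eta> X" g]) simp_all
qed

lemma adjunction_ex: "\<exists>\<epsilon>. adjunction E EI L id_functor \<eta> \<epsilon>"
proof -
  have "\<exists>g. g \<in> Arr E \<and> Dom E g = FOb L Z \<and> Cod E g = Z \<and> g \<cdot> \<eta> Z = Idn E Z" if Z: "Z \<in> I" for Z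
  proof -
    have Zo: "Z \<in> Ob E" using Z I_ob by blast
    show ?thesis using extend[of "Idn E Z"] Z Zo by auto
  qed
  then obtain \<epsilon> where \<epsilon>: "\<And>Z. Z \<in> I \<Longrightarrow> \<epsilon> Z \<in> Arr E" "\<And>Z. Z \<in> I \<Longrightarrow> Dom E (\<epsilon> Z) = FOb L Z"
    "\<And>Z. Z \<in> I \<Longrightarrow> Cod E (\<epsilon> Z) = Z" "\<And>Z. Z \<in> I \<Longrightarrow> \<epsilon> Z \<cdot> \<eta> Z = Idn E Z"
    by metis
  have Io: "Z \<in> Ob E" if "Z \<in> I" for Z using that I_ob by blast
  have "adjunction E EI L id_functor \<eta> \<epsilon>"
    unfolding adjunction_def
  proof (intro conjI ballI L_functor)
    show "is_functor EI E id_functor"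
      unfolding is_functor_def id_functor_def using Io by (auto simp: hom_def)
    show "nat_trans E E id_functor (comp_functor id_functor L) \<eta>"
      unfolding nat_trans_def id_functor_def comp_functor_def using unit unit_nat by simp
    show "nat_trans EI EI (comp_functor L id_functor) id_functor \<epsilon>"
      unfolding nat_trans_def
    proof (intro conjI ballI)
      fix Z assume "Z \<in> Ob EI"
      thus "\<epsilon> Z \<in> hom EI (FOb (comp_functor L id_functor) Z) (FOb id_functor Z)"
        using \<epsilon>(1-3)[of Z] Io[of Z] by (simp add: hom_def comp_functor_def id_functor_def)
    next
      fix f assume "f \<in> Arr EI"
      hence f: "f \<in> Arr E" "Dom E f \<in> I" "Cod E f \<in> I" by auto
      note d = \<epsilon>[OF f(2)] and c = \<epsilon>[OF f(3)]
      have "\<epsilon> (Cod E f) \<cdot> FArr L f = f \<cdot> \<epsilon> (Dom E f)"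
      proof (rule unit_cancel[of "Dom E f"])
        have "\<epsilon> (Cod E f) \<cdot> FArr L f \<cdot> \<eta> (Dom E f) = \<epsilon> (Cod E f) \<cdot> (FArr L f \<cdot> \<eta> (Dom E f))"
          using f(1) c(1-3) by simp
        also have "\<dots> = \<epsilon> (Cod E f) \<cdot> \<eta> (Cod E f) \<cdot> f"
          unfolding unit_nat[OF f(1), symmetric] using f(1) c(1-3) by simp
        also have "\<dots> = f \<cdot> (\<epsilon> (Dom E f) \<cdot> \<eta> (Dom E f))"
          unfolding c(4) d(4) using f(1) by simp
        also have "\<dots> = f \<cdot> \<epsilon> (Dom E f) \<cdot> \<eta> (Dom E f)" using f(1) d(1-3) by simp
        finally show "\<epsilon> (Cod E f) \<cdot> FArr L f \<cdot> \<eta> (Dom E f) = f \<cdot> \<epsilon> (Dom E f) \<cdot> \<eta> (Dom E f)" .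
      qed (use f c(1-3) d(1-3) in simp_all)
      thus "Comp EI (\<epsilon> (Cod EI f)) (FArr (comp_functor L id_functor) f) =
          Comp EI (FArr id_functor f) (\<epsilon> (Dom EI f))"
        by (simp add: comp_functor_def id_functor_def)
    qed
  next
    fix X assume X: "X \<in> Ob E"
    note l = \<epsilon>[OF L_ob[OF X]]
    have "\<epsilon> (FOb L X) \<cdot> FArr L (\<eta> X) = Idn E (FOb L X)"
    proof (rule unit_cancel[OF X])
      have "\<epsilon> (FOb L X) \<cdot> FArr L (\<eta> X) \<cdot> \<eta> X = \<epsilon> (FOb L X) \<cdot> (FArr L (\<eta> X) \<cdot> \<eta> X)"
        using X l(1-3) by simp
      also have "\<dots> = \<epsilon> (FOb L X) \<cdot> (\<eta> (FOb L X) \<cdot> \<eta> X)"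
        using unit_nat[of "\<eta> X"] X by simp
      also have "\<dots> = \<epsilon> (FOb L X) \<cdot> \<eta> (FOb L X) \<cdot> \<eta> X"
        using X l(1-3) by simp
      finally show "\<epsilon> (FOb L X) \<cdot> FArr L (\<eta> X) \<cdot> \<eta> X = Idn E (FOb L X) \<cdot> \<eta> X"
        by (simp only: l(4))
    qed (use X l(1-3) in simp_all)
    thus "Comp EI (\<epsilon> (FOb L X)) (FArr L (\<eta> X)) = Idn EI (FOb L X)" by simp
  next
    fix y assume "y \<in> Ob EI"
    thus "FArr id_functor (\<epsilon> y) \<cdot> \<eta> (FOb id_functor y) = Idn E (FOb id_functor y)"
      using \<epsilon>(4) by (simp add: id_functor_def)
  qed
  thus ?thesis by (intro exI[of _ \<epsilon>])
qed

text \<open>Cocones below the reflected diagram with vertex in \<open>I\<close> correspond to cocones below the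
  diagram itself by composition with the unit.\<close>

lemma preserves_colimits: "preserves_small_colimits U E EI L"
  unfolding preserves_small_colimits_def
proof (intro allI impI)
  fix K :: "('u, 'u) cat" and \<Delta> a \<iota>
  assume K: "small_category K" and colim: "is_colimit E K \<Delta> a \<iota>"
  have lim: "is_limit (op_cat E) (op_cat K) \<Delta> a \<iota>" using colim by (simp add: is_colimit_def)
  interpret K: category K using K by (simp add: small_category_def)
  have fD: "is_functor (op_cat K) (op_cat E) \<Delta>" and a: "a \<in> Ob E"
    and i: "\<And>k. k \<in> Ob K \<Longrightarrow> \<iota> k \<in> hom (op_cat E) a (FOb \<Delta> k)"
    and in': "\<And>u. u \<in> Arr K \<Longrightarrow> \<iota> (Cod K u) \<cdot> FArr \<Delta> u = \<iota> (Dom K u)"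
    using lim unfolding is_limit_def is_cone_def by auto
  have \<Delta>_ob: "FOb \<Delta> k \<in> Ob E" if "k \<in> Ob K" for k using fD that unfolding is_functor_def by simp
  have \<Delta>_arr: "FArr \<Delta> u \<in> Arr E" "Dom E (FArr \<Delta> u) = FOb \<Delta> (Dom K u)" "Cod E (FArr \<Delta> u) = FOb \<Delta> (Cod K u)"
    if "u \<in> Arr K" for u
    using fD that unfolding is_functor_def by (auto simp: hom_def)
  have \<Delta>_id: "FArr \<Delta> (Idn K k) = Idn E (FOb \<Delta> k)" if "k \<in> Ob K" for k
    using fD that unfolding is_functor_def by simp
  have \<Delta>_comp: "FArr \<Delta> (Comp K v u) = FArr \<Delta> v \<cdot> FArr \<Delta> u" if "u \<in> Arr K" "v \<in> Arr K" "Cod K u = Dom K v" for u v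
    using fD that unfolding is_functor_def by simp
  have i': "\<iota> k \<in> Arr E" "Dom E (\<iota> k) = FOb \<Delta> k" "Cod E (\<iota> k) = a" if "k \<in> Ob K" for k
    using i[OF that] by (auto simp: hom_def)
  have fLD: "is_functor (op_cat K) (op_cat EI) (comp_functor L \<Delta>)"
    unfolding is_functor_def comp_functor_def
    using \<Delta>_ob \<Delta>_arr \<Delta>_id \<Delta>_comp by (simp add: hom_def L_id L_comp)
  show "is_colimit EI K (comp_functor L \<Delta>) (FOb L a) (\<lambda>k. FArr L (\<iota> k))"
    unfolding is_colimit_def is_limit_def
  proof (intro conjI allI impI)
    show "is_cone (op_cat EI) (op_cat K) (comp_functor L \<Delta>) (FOb L a) (\<lambda>k. FArr L (\<iota> k))"
      unfolding is_cone_def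
    proof (intro conjI ballI fLD)
      show "FOb L a \<in> Ob (op_cat EI)" using a by simp
      fix k assume "k \<in> Ob (op_cat K)"
      thus "FArr L (\<iota> k) \<in> hom (op_cat EI) (FOb L a) (FOb (comp_functor L \<Delta>) k)"
        using i'[of k] \<Delta>_ob[of k] a by (simp add: hom_def comp_functor_def)
    next
      fix u assume "u \<in> Arr (op_cat K)"
      hence u: "u \<in> Arr K" by simp
      have "FArr L (\<iota> (Cod K u) \<cdot> FArr \<Delta> u) = FArr L (\<iota> (Cod K u)) \<cdot> FArr L (FArr \<Delta> u)"
        using i'[of "Cod K u"] \<Delta>_arr[OF u] u by (intro L_comp) simp_all
      thus "Comp (op_cat EI) (FArr (comp_functor L \<Delta>) u) (FArr L (\<iota> (Dom (op_cat K) u))) =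
          FArr L (\<iota> (Cod (op_cat K) u))"
        using in'[OF u] by (simp add: comp_functor_def)
    qed
    fix b \<sigma> assume cone: "is_cone (op_cat EI) (op_cat K) (comp_functor L \<Delta>) b \<sigma>"
    have b: "b \<in> I" using cone unfolding is_cone_def by simp
    have s: "\<sigma> k \<in> Arr E" "Dom E (\<sigma> k) = FOb L (FOb \<Delta> k)" "Cod E (\<sigma> k) = b" if "k \<in> Ob K" for k
      using cone that unfolding is_cone_def by (auto simp: hom_def comp_functor_def)
    have sn: "\<sigma> (Cod K u) \<cdot> FArr L (FArr \<Delta> u) = \<sigma> (Dom K u)" if "u \<in> Arr K" for u
      using cone that unfolding is_cone_def by (simp add: comp_functor_def)
    have bo: "b \<in> Ob E" using b I_ob by blast
    have se: "\<sigma> k \<cdot> \<eta> (FOb \<Delta> k) \<in> Arr E" "Dom E (\<sigma> k \<cdot> \<eta> (FOb \<Delta> k)) = FOb \<Delta> k"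
      "Cod E (\<sigma> k \<cdot> \<eta> (FOb \<Delta> k)) = b" if "k \<in> Ob K" for k
      using s[OF that] \<Delta>_ob[OF that] by simp_all
    have "is_cone (op_cat E) (op_cat K) \<Delta> b (\<lambda>k. \<sigma> k \<cdot> \<eta> (FOb \<Delta> k))"
      unfolding is_cone_def
    proof (intro conjI ballI fD)
      show "b \<in> Ob (op_cat E)" using bo by simp
      fix k assume "k \<in> Ob (op_cat K)"
      thus "\<sigma> k \<cdot> \<eta> (FOb \<Delta> k) \<in> hom (op_cat E) b (FOb \<Delta> k)" using se by (simp add: hom_def)
    next
      fix u assume "u \<in> Arr (op_cat K)"
      hence u: "u \<in> Arr K" by simp
      hence d: "Cod K u \<in> Ob K" "Dom K u \<in> Ob K" by auto
      note D = \<Delta>_arr[OF u] \<Delta>_ob[OF d(1)] \<Delta>_ob[OF d(2)] s[OF d(1)] s[OF d(2)]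
      have "\<sigma> (Cod K u) \<cdot> \<eta> (FOb \<Delta> (Cod K u)) \<cdot> FArr \<Delta> u =
          \<sigma> (Cod K u) \<cdot> (\<eta> (FOb \<Delta> (Cod K u)) \<cdot> FArr \<Delta> u)"
        using D by simp
      also have "\<dots> = \<sigma> (Cod K u) \<cdot> FArr L (FArr \<Delta> u) \<cdot> \<eta> (FOb \<Delta> (Dom K u))"
        using unit_nat[OF D(1)] D by simp
      also have "\<dots> = \<sigma> (Dom K u) \<cdot> \<eta> (FOb \<Delta> (Dom K u))" by (simp only: sn[OF u])
      finally show "Comp (op_cat E) (FArr \<Delta> u) (\<sigma> (Dom (op_cat K) u) \<cdot> \<eta> (FOb \<Delta> (Dom (op_cat K) u))) =
          \<sigma> (Cod (op_cat K) u) \<cdot> \<eta> (FOb \<Delta> (Cod (op_cat K) u))" by simp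
    qed
    hence ex1: "\<exists>!h. h \<in> hom (op_cat E) b a \<and>
        (\<forall>k\<in>Ob (op_cat K). Comp (op_cat E) (\<iota> k) h = \<sigma> k \<cdot> \<eta> (FOb \<Delta> k))"
      using lim unfolding is_limit_def by blast
    have cond: "h \<in> hom (op_cat E) b a \<and>
        (\<forall>k\<in>Ob (op_cat K). Comp (op_cat E) (\<iota> k) h = \<sigma> k \<cdot> \<eta> (FOb \<Delta> k)) \<longleftrightarrow>
      h \<in> hom E a b \<and> (\<forall>k\<in>Ob K. h \<cdot> \<iota> k = \<sigma> k \<cdot> \<eta> (FOb \<Delta> k))" for h
      by (auto simp: hom_def)
    have key: "(g \<in> hom (op_cat EI) b (FOb L a) \<and>
        (\<forall>k\<in>Ob (op_cat K). Comp (op_cat EI) (FArr L (\<iota> k)) g = \<sigma> k)) \<longleftrightarrow>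
      g \<in> hom E (FOb L a) b \<and> (\<forall>k\<in>Ob K. g \<cdot> \<eta> a \<cdot> \<iota> k = \<sigma> k \<cdot> \<eta> (FOb \<Delta> k))" for g
    proof -
      have "g \<cdot> FArr L (\<iota> k) = \<sigma> k \<longleftrightarrow> g \<cdot> \<eta> a \<cdot> \<iota> k = \<sigma> k \<cdot> \<eta> (FOb \<Delta> k)"
        if g: "g \<in> Arr E" "Dom E g = FOb L a" "Cod E g = b" and k: "k \<in> Ob K" for k
      proof -
        have e: "g \<cdot> \<eta> a \<cdot> \<iota> k = g \<cdot> FArr L (\<iota> k) \<cdot> \<eta> (FOb \<Delta> k)"
          using unit_nat[OF i'(1)[OF k]] i'[OF k] g a \<Delta>_ob[OF k] by simp
        show ?thesis
        proof
          assume "g \<cdot> FArr L (\<iota> k) = \<sigma> k"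
          thus "g \<cdot> \<eta> a \<cdot> \<iota> k = \<sigma> k \<cdot> \<eta> (FOb \<Delta> k)" by (simp only: e)
        next
          assume "g \<cdot> \<eta> a \<cdot> \<iota> k = \<sigma> k \<cdot> \<eta> (FOb \<Delta> k)"
          hence "g \<cdot> FArr L (\<iota> k) \<cdot> \<eta> (FOb \<Delta> k) = \<sigma> k \<cdot> \<eta> (FOb \<Delta> k)" by (simp only: e)
          thus "g \<cdot> FArr L (\<iota> k) = \<sigma> k"
            by (rule unit_cancel[OF \<Delta>_ob[OF k], rotated -1])
               (use g i'[OF k] s[OF k] b in simp_all)
        qed
      qed
      thus ?thesis using a b by (auto simp: hom_def)
    qed
    from ex1 obtain h where h: "h \<in> hom E a b" "\<And>k. k \<in> Ob K \<Longrightarrow> h \<cdot> \<iota> k = \<sigma> k \<cdot> \<eta> (FOb \<Delta> k)"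
      unfolding cond by (elim ex1E) blast
    have h_un: "h' = h" if "h' \<in> hom E a b" "\<forall>k\<in>Ob K. h' \<cdot> \<iota> k = \<sigma> k \<cdot> \<eta> (FOb \<Delta> k)" for h'
      using ex1 h that unfolding cond by blast
    have ha: "h \<in> Arr E" "Dom E h = a" "Cod E h = b" using h(1) by (auto simp: hom_def)
    obtain g where g: "g \<in> Arr E" "Dom E g = FOb L a" "Cod E g = b" "g \<cdot> \<eta> a = h"
      by (rule extend[of h]) (use ha b in simp_all)
    show "\<exists>!g. g \<in> hom (op_cat EI) b (FOb L a) \<and>
        (\<forall>k\<in>Ob (op_cat K). Comp (op_cat EI) (FArr L (\<iota> k)) g = \<sigma> k)"
      unfolding key
    proof (rule ex1I[of _ g])
      show "g \<in> hom E (FOb L a) b \<and> (\<forall>k\<in>Ob K. g \<cdot> \<eta> a \<cdot> \<iota> k = \<sigma> k \<cdot> \<eta> (FOb \<Delta> k))"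
        using g h(2) by (simp add: hom_def)
      fix g' assume g': "g' \<in> hom E (FOb L a) b \<and> (\<forall>k\<in>Ob K. g' \<cdot> \<eta> a \<cdot> \<iota> k = \<sigma> k \<cdot> \<eta> (FOb \<Delta> k))"
      hence ga: "g' \<in> Arr E" "Dom E g' = FOb L a" "Cod E g' = b" by (auto simp: hom_def)
      have "g' \<cdot> \<eta> a = h"
      proof (rule h_un)
        show "g' \<cdot> \<eta> a \<in> hom E a b" using ga a by (simp add: hom_def)
        show "\<forall>k\<in>Ob K. g' \<cdot> \<eta> a \<cdot> \<iota> k = \<sigma> k \<cdot> \<eta> (FOb \<Delta> k)" using g' by blast
      qed
      hence "g' \<cdot> \<eta> a = g \<cdot> \<eta> a" by (simp only: g(4))
      thus "g' = g"
        by (rule unit_cancel[OF a, rotated -1]) (use ga g(1-3) b in simp_all)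
    qed
  qed
qed

text \<open>The arrows inverted by the reflection, without mentioning the reflection.\<close>

definition local_eq :: "'a \<Rightarrow> bool" where
  "local_eq f \<longleftrightarrow> (\<forall>Z\<in>I. bij_betw (\<lambda>g. g \<cdot> f) (hom E (Cod E f) Z) (hom E (Dom E f) Z))"

lemma unit_local_eq:
  assumes X: "X \<in> Ob E" shows "local_eq (\<eta> X)"
  unfolding local_eq_def
proof
  fix Z assume Z: "Z \<in> I"
  show "bij_betw (\<lambda>g. g \<cdot> \<eta> X) (hom E (Cod E (\<eta> X)) Z) (hom E (Dom E (\<eta> X)) Z)"
    unfolding bij_betw_def
  proof (intro conjI equalityI subsetI)
    show "inj_on (\<lambda>g. g \<cdot> \<eta> X) (hom E (Cod E (\<eta> X)) Z)"
      using unit_cancel[OF X] X Z by (intro inj_onI) (simp add: hom_def)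
    fix f assume "f \<in> (\<lambda>g. g \<cdot> \<eta> X) ` hom E (Cod E (\<eta> X)) Z"
    thus "f \<in> hom E (Dom E (\<eta> X)) Z" using X by (auto simp: hom_def)
  next
    fix f assume "f \<in> hom E (Dom E (\<eta> X)) Z"
    hence f: "f \<in> Arr E" "Dom E f = X" "Cod E f = Z" using X by (auto simp: hom_def)
    obtain g where "g \<in> Arr E" "Dom E g = FOb L X" "Cod E g = Z" "g \<cdot> \<eta> X = f"
      using extend[of f] f Z by metis
    thus "f \<in> (\<lambda>g. g \<cdot> \<eta> X) ` hom E (Cod E (\<eta> X)) Z"
      using X by (intro image_eqI[of _ _ g]) (simp_all add: hom_def)
  qed
qed

lemma local_eq_iff:
  assumes f: "f \<in> Arr E"
  shows "local_eq f \<longleftrightarrow> is_iso E (FArr L f)"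
proof
  have ob: "Dom E f \<in> Ob E" "Cod E f \<in> Ob E" using f by auto
  note nat = unit_nat[OF f]
  assume le: "local_eq f"
  have bij: "bij_betw (\<lambda>g. g \<cdot> f) (hom E (Cod E f) Z) (hom E (Dom E f) Z)" if "Z \<in> I" for Z
    using le that unfolding local_eq_def by blast
  have "\<eta> (Dom E f) \<in> (\<lambda>g. g \<cdot> f) ` hom E (Cod E f) (FOb L (Dom E f))"
    using bij_betw_imp_surj_on[OF bij[OF L_ob[OF ob(1)]]] unit[OF ob(1)] by simp
  then obtain g where g: "g \<in> Arr E" "Dom E g = Cod E f" "Cod E g = FOb L (Dom E f)" "g \<cdot> f = \<eta> (Dom E f)"
    by (auto simp: hom_def)
  obtain h where h: "h \<in> Arr E" "Dom E h = FOb L (Cod E f)" "Cod E h = FOb L (Dom E f)" "h \<cdot> \<eta> (Cod E f) = g"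
    using extend[OF g(1)] g ob by auto
  have 1: "h \<cdot> FArr L f = Idn E (FOb L (Dom E f))"
  proof (rule unit_cancel[OF ob(1)])
    have "h \<cdot> FArr L f \<cdot> \<eta> (Dom E f) = h \<cdot> (FArr L f \<cdot> \<eta> (Dom E f))" using h(1-3) f ob by simp
    also have "\<dots> = h \<cdot> \<eta> (Cod E f) \<cdot> f" unfolding nat[symmetric] using h(1-3) f ob by simp
    also have "\<dots> = \<eta> (Dom E f)" by (simp only: h(4) g(4))
    finally show "h \<cdot> FArr L f \<cdot> \<eta> (Dom E f) = Idn E (FOb L (Dom E f)) \<cdot> \<eta> (Dom E f)" using ob by simp
  qed (use h(1-3) f ob in simp_all)
  have "FArr L f \<cdot> g \<cdot> f = \<eta> (Cod E f) \<cdot> f"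
    using g f ob nat by simp
  hence 2: "FArr L f \<cdot> g = \<eta> (Cod E f)"
    using inj_onD[OF bij_betw_imp_inj_on[OF bij[OF L_ob[OF ob(2)]]], of "FArr L f \<cdot> g" "\<eta> (Cod E f)"]
      f g(1-3) ob by (simp add: hom_def)
  have 3: "FArr L f \<cdot> h = Idn E (FOb L (Cod E f))"
  proof (rule unit_cancel[OF ob(2)])
    have "FArr L f \<cdot> h \<cdot> \<eta> (Cod E f) = FArr L f \<cdot> (h \<cdot> \<eta> (Cod E f))" using h(1-3) f ob by simp
    also have "\<dots> = \<eta> (Cod E f)" by (simp only: h(4) 2)
    finally show "FArr L f \<cdot> h \<cdot> \<eta> (Cod E f) = Idn E (FOb L (Cod E f)) \<cdot> \<eta> (Cod E f)" using ob by simp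
  qed (use h(1-3) f ob in simp_all)
  show "is_iso E (FArr L f)"
    using 1 3 h(1-3) f by (intro isoI[of "FArr L f" h]) simp_all
next
  have ob: "Dom E f \<in> Ob E" "Cod E f \<in> Ob E" using f by auto
  note nat = unit_nat[OF f]
  assume iso: "is_iso E (FArr L f)"
  then obtain i where i: "i \<in> Arr E" "Dom E i = FOb L (Cod E f)" "Cod E i = FOb L (Dom E f)"
    "i \<cdot> FArr L f = Idn E (FOb L (Dom E f))" by (rule isoE) (use f in simp)
  have nat': "c \<cdot> \<eta> (Cod E f) \<cdot> f = c \<cdot> FArr L f \<cdot> \<eta> (Dom E f)"
    if "c \<in> Arr E" "Dom E c = FOb L (Cod E f)" for c
    using nat that f ob by simp
  show "local_eq f"
    unfolding local_eq_def
  proof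
    fix Z assume Z: "Z \<in> I"
    show "bij_betw (\<lambda>g. g \<cdot> f) (hom E (Cod E f) Z) (hom E (Dom E f) Z)"
      unfolding bij_betw_def
    proof (intro conjI equalityI subsetI)
      show "inj_on (\<lambda>g. g \<cdot> f) (hom E (Cod E f) Z)"
      proof (rule inj_onI)
        fix a b assume "a \<in> hom E (Cod E f) Z" "b \<in> hom E (Cod E f) Z" and eq: "a \<cdot> f = b \<cdot> f"
        hence a: "a \<in> Arr E" "Dom E a = Cod E f" "Cod E a = Z"
          and b: "b \<in> Arr E" "Dom E b = Cod E f" "Cod E b = Z" by (auto simp: hom_def)
        obtain a' where a': "a' \<in> Arr E" "Dom E a' = FOb L (Cod E f)" "Cod E a' = Z" "a' \<cdot> \<eta> (Cod E f) = a"
          using extend[OF a(1)] a Z by metis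
        obtain b' where b': "b' \<in> Arr E" "Dom E b' = FOb L (Cod E f)" "Cod E b' = Z" "b' \<cdot> \<eta> (Cod E f) = b"
          using extend[OF b(1)] b Z by metis
        have "a' \<cdot> FArr L f \<cdot> \<eta> (Dom E f) = b' \<cdot> FArr L f \<cdot> \<eta> (Dom E f)"
          using nat'[OF a'(1,2)] nat'[OF b'(1,2)] eq unfolding a'(4) b'(4) by simp
        hence "a' \<cdot> FArr L f = b' \<cdot> FArr L f"
          by (rule unit_cancel[OF ob(1), rotated -1]) (use a' b' f Z in simp_all)
        hence "a' = b'" by (rule iso_epi[OF iso]) (use a' b' f in simp_all)
        thus "a = b" using a'(4) b'(4) by simp
      qed
      fix c assume "c \<in> (\<lambda>g. g \<cdot> f) ` hom E (Cod E f) Z"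
      thus "c \<in> hom E (Dom E f) Z" using f by (auto simp: hom_def)
    next
      fix c assume "c \<in> hom E (Dom E f) Z"
      hence c: "c \<in> Arr E" "Dom E c = Dom E f" "Cod E c = Z" by (auto simp: hom_def)
      obtain c' where c': "c' \<in> Arr E" "Dom E c' = FOb L (Dom E f)" "Cod E c' = Z" "c' \<cdot> \<eta> (Dom E f) = c"
        using extend[OF c(1)] c Z by metis
      have "c' \<cdot> i \<cdot> \<eta> (Cod E f) \<cdot> f = c' \<cdot> i \<cdot> FArr L f \<cdot> \<eta> (Dom E f)"
        using c' i by (intro nat') simp_all
      also have "\<dots> = c' \<cdot> (i \<cdot> FArr L f) \<cdot> \<eta> (Dom E f)" using c'(1-3) i(1-3) f by simp
      also have "\<dots> = c" unfolding i(4) using c' ob by simp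
      finally show "c \<in> (\<lambda>g. g \<cdot> f) ` hom E (Cod E f) Z"
        using c' i f ob by (intro image_eqI[of _ _ "c' \<cdot> i \<cdot> \<eta> (Cod E f)"]) (simp_all add: hom_def)
    qed
  qed
qed

lemma EI_iso_iff:
  assumes "f \<in> Arr E" "Dom E f \<in> I" "Cod E f \<in> I"
  shows "is_iso EI f \<longleftrightarrow> is_iso E f"
  using assms unfolding is_iso_def by (simp add: EI_hom)

end

lemma (in category) adjunction_reflection:
  assumes I: "I \<subseteq> Ob C" and adj: "adjunction C (full_subcat C I) L id_functor \<eta> \<epsilon>"
  shows "reflection C I L \<eta>"
proof
  have LF: "is_functor C (full_subcat C I) L"
    and n\<eta>: "nat_trans C C id_functor (comp_functor id_functor L) \<eta>"
    and n\<epsilon>: "nat_trans (full_subcat C I) (full_subcat C I) (comp_functor L id_functor) id_functor \<epsilon>"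
    and t1: "\<And>x. x \<in> Ob C \<Longrightarrow> \<epsilon> (FOb L x) \<cdot> FArr L (\<eta> x) = Idn C (FOb L x)"
    and t2: "\<And>y. y \<in> I \<Longrightarrow> \<epsilon> y \<cdot> \<eta> y = Idn C y"
    using adj unfolding adjunction_def by (auto simp: id_functor_def)
  show "I \<subseteq> Ob C" by (rule I)
  show "is_functor C (full_subcat C I) L" by (rule LF)
  show un: "\<eta> X \<in> hom C X (FOb L X)" if "X \<in> Ob C" for X
    using n\<eta> that unfolding nat_trans_def by (simp add: id_functor_def comp_functor_def)
  show nat: "\<eta> (Cod C f) \<cdot> f = FArr L f \<cdot> \<eta> (Dom C f)" if "f \<in> Arr C" for f
    using n\<eta> that unfolding nat_trans_def by (simp add: id_functor_def comp_functor_def)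
  have u: "\<eta> X \<in> Arr C" "Dom C (\<eta> X) = X" "Cod C (\<eta> X) = FOb L X" if "X \<in> Ob C" for X
    using un[OF that] by (auto simp: hom_def)
  have Lo: "FOb L X \<in> I" if "X \<in> Ob C" for X using LF that unfolding is_functor_def by simp
  have La: "FArr L f \<in> Arr C" "Dom C (FArr L f) = FOb L (Dom C f)" "Cod C (FArr L f) = FOb L (Cod C f)"
    if "f \<in> Arr C" for f using LF that unfolding is_functor_def by (auto simp: hom_def)
  have Lc: "FArr L (g \<cdot> f) = FArr L g \<cdot> FArr L f" if "f \<in> Arr C" "g \<in> Arr C" "Cod C f = Dom C g" for f g
    using LF that unfolding is_functor_def by simp
  have e: "\<epsilon> Z \<in> Arr C" "Dom C (\<epsilon> Z) = FOb L Z" "Cod C (\<epsilon> Z) = Z" if "Z \<in> I" for Z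
    using n\<epsilon> that unfolding nat_trans_def by (auto simp: id_functor_def comp_functor_def hom_def)
  have en: "\<epsilon> (Cod C f) \<cdot> FArr L f = f \<cdot> \<epsilon> (Dom C f)" if "f \<in> Arr C" "Dom C f \<in> I" "Cod C f \<in> I" for f
    using n\<epsilon> that unfolding nat_trans_def by (simp add: id_functor_def comp_functor_def)
  fix X Z f assume X: "X \<in> Ob C" and Z: "Z \<in> I" and "f \<in> hom C X Z"
  hence f: "f \<in> Arr C" "Dom C f = X" "Cod C f = Z" by (auto simp: hom_def)
  have Zo: "Z \<in> Ob C" using Z I by blast
  show "\<exists>!g. g \<in> hom C (FOb L X) Z \<and> g \<cdot> \<eta> X = f"
  proof (rule ex1I[of _ "\<epsilon> Z \<cdot> FArr L f"])
    have "\<epsilon> Z \<cdot> FArr L f \<cdot> \<eta> X = \<epsilon> Z \<cdot> (FArr L f \<cdot> \<eta> X)" using e[OF Z] La[OF f(1)] u[OF X] f by simp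
    also have "\<dots> = \<epsilon> Z \<cdot> (\<eta> Z \<cdot> f)" using nat[OF f(1)] f by simp
    also have "\<dots> = \<epsilon> Z \<cdot> \<eta> Z \<cdot> f" using e[OF Z] u[OF Zo] f by simp
    also have "\<dots> = f" using t2[OF Z] f by simp
    finally show "\<epsilon> Z \<cdot> FArr L f \<in> hom C (FOb L X) Z \<and> \<epsilon> Z \<cdot> FArr L f \<cdot> \<eta> X = f"
      using e[OF Z] La[OF f(1)] f by (simp add: hom_def)
    fix g assume "g \<in> hom C (FOb L X) Z \<and> g \<cdot> \<eta> X = f"
    hence g: "g \<in> Arr C" "Dom C g = FOb L X" "Cod C g = Z" "g \<cdot> \<eta> X = f" by (auto simp: hom_def)
    have "g = g \<cdot> (\<epsilon> (FOb L X) \<cdot> FArr L (\<eta> X))" unfolding t1[OF X] using g by simp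
    also have "\<dots> = g \<cdot> \<epsilon> (FOb L X) \<cdot> FArr L (\<eta> X)"
      using g(1-3) e[OF Lo[OF X]] La u[OF X] by simp
    also have "\<dots> = \<epsilon> Z \<cdot> FArr L g \<cdot> FArr L (\<eta> X)"
      using en[OF g(1)] g Lo[OF X] Z by simp
    also have "\<dots> = \<epsilon> Z \<cdot> FArr L f"
      using Lc[OF u(1)[OF X] g(1)] g u[OF X] e[OF Z] La by simp
    finally show "g = \<epsilon> Z \<cdot> FArr L f" .
  qed
qed

text \<open>The shape of a pullback diagram.  Preservation of finite limits is about shapes with objects and
  arrows in a given type, so they are taken from the values of an injective sequence: \<open>i 3 : i 0 \<rightarrow> i 2\<close> and \<open>i 4 : i 1 \<rightarrow> i 2\<close>.\<close>

definition cospan :: "(nat \<Rightarrow> 'k) \<Rightarrow> ('k, 'k) cat" where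
  "cospan i = \<lparr>Ob = {i 0, i 1, i 2}, Arr = {i 0, i 1, i 2, i 3, i 4},
     Dom = (\<lambda>a. if a = i 3 then i 0 else if a = i 4 then i 1 else a),
     Cod = (\<lambda>a. if a = i 3 \<or> a = i 4 then i 2 else a),
     Idn = (\<lambda>a. a), Comp = (\<lambda>g f. if f \<in> {i 0, i 1, i 2} then g else f)\<rparr>"

definition cospan_diagram :: "('o, 'a) cat \<Rightarrow> (nat \<Rightarrow> 'k) \<Rightarrow> 'a \<Rightarrow> 'a \<Rightarrow> ('k, 'k, 'o, 'a) fctr" where
  "cospan_diagram C i f g =
    \<lparr>FOb = (\<lambda>a. if a = i 0 then Dom C f else if a = i 1 then Dom C g else Cod C f),
     FArr = (\<lambda>a. if a = i 0 then Idn C (Dom C f) else if a = i 1 then Idn C (Dom C g)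
       else if a = i 2 then Idn C (Cod C f) else if a = i 3 then f else g)\<rparr>"

lemma cospan_category:
  assumes i: "inj i" shows "category (cospan i)"
proof -
  have d: "i m = i n \<longleftrightarrow> m = n" for m n using i by (rule inj_eq)
  show ?thesis by unfold_locales (auto simp: cospan_def hom_def d split: if_splits)
qed

lemma (in category) pullback_limit:
  assumes i: "inj i" and pb: "is_pullback C f g p q"
  shows "is_limit C (cospan i) (cospan_diagram C i f g) (Dom C p)
    (\<lambda>a. if a = i 0 then p else if a = i 1 then q else f \<cdot> p)"
proof -
  have d: "i m = i n \<longleftrightarrow> m = n" for m n using i by (rule inj_eq)
  note D = pullbackD[OF pb]
  have ob: "Dom C f \<in> Ob C" "Dom C g \<in> Ob C" "Cod C f \<in> Ob C" "Dom C p \<in> Ob C" using D by auto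
  have F: "is_functor (cospan i) C (cospan_diagram C i f g)"
    unfolding is_functor_def cospan_def cospan_diagram_def
    using D(1-3) ob by (auto simp: hom_def d)
  show ?thesis
    unfolding is_limit_def
  proof (intro conjI allI impI)
    show "is_cone C (cospan i) (cospan_diagram C i f g) (Dom C p)
      (\<lambda>a. if a = i 0 then p else if a = i 1 then q else f \<cdot> p)"
      unfolding is_cone_def using D ob F by (auto simp: cospan_def cospan_diagram_def hom_def d)
    fix b \<sigma> assume cone: "is_cone C (cospan i) (cospan_diagram C i f g) b \<sigma>"
    have b: "b \<in> Ob C" using cone unfolding is_cone_def by blast
    have s: "\<sigma> (i 0) \<in> hom C b (Dom C f)" "\<sigma> (i 1) \<in> hom C b (Dom C g)"
      "f \<cdot> \<sigma> (i 0) = \<sigma> (i 2)" "g \<cdot> \<sigma> (i 1) = \<sigma> (i 2)"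
      using cone unfolding is_cone_def by (simp_all add: cospan_def cospan_diagram_def d)
    have "(h \<in> hom C b (Dom C p) \<and> (\<forall>k\<in>Ob (cospan i).
        (if k = i 0 then p else if k = i 1 then q else f \<cdot> p) \<cdot> h = \<sigma> k)) \<longleftrightarrow>
        h \<in> hom C b (Dom C p) \<and> p \<cdot> h = \<sigma> (i 0) \<and> q \<cdot> h = \<sigma> (i 1)" for h
    proof -
      have "f \<cdot> p \<cdot> h = \<sigma> (i 2)" if "h \<in> hom C b (Dom C p)" "p \<cdot> h = \<sigma> (i 0)"
      proof -
        have "f \<cdot> p \<cdot> h = f \<cdot> (p \<cdot> h)" using that(1) D(1-8) by (intro comp_assoc) (auto simp: hom_def)
        thus ?thesis using that(2) s(3) by simp
      qed
      thus ?thesis by (auto simp: cospan_def d)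
    qed
    moreover have "\<exists>!h. h \<in> hom C b (Dom C p) \<and> p \<cdot> h = \<sigma> (i 0) \<and> q \<cdot> h = \<sigma> (i 1)"
      using pb b s unfolding is_pullback_def by simp
    ultimately show "\<exists>!h. h \<in> hom C b (Dom C p) \<and> (\<forall>k\<in>Ob (cospan i).
        (if k = i 0 then p else if k = i 1 then q else f \<cdot> p) \<cdot> h = \<sigma> k)" by simp
  qed
qed

lemma (in category) limit_pullback:
  assumes i: "inj i" and lim: "is_limit C (cospan i) \<Delta> a \<pi>"
  shows "is_pullback C (FArr \<Delta> (i 3)) (FArr \<Delta> (i 4)) (\<pi> (i 0)) (\<pi> (i 1))"
proof -
  have d: "i m = i n \<longleftrightarrow> m = n" for m n using i by (rule inj_eq)
  have F: "is_functor (cospan i) C \<Delta>" and cone: "is_cone C (cospan i) \<Delta> a \<pi>"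
    using lim unfolding is_limit_def is_cone_def by blast+
  have D: "FArr \<Delta> (i 3) \<in> hom C (FOb \<Delta> (i 0)) (FOb \<Delta> (i 2))"
    "FArr \<Delta> (i 4) \<in> hom C (FOb \<Delta> (i 1)) (FOb \<Delta> (i 2))"
    "FArr \<Delta> (i 0) = Idn C (FOb \<Delta> (i 0))" "FArr \<Delta> (i 1) = Idn C (FOb \<Delta> (i 1))"
    "FArr \<Delta> (i 2) = Idn C (FOb \<Delta> (i 2))"
    using F unfolding is_functor_def by (simp_all add: cospan_def d)
  have p: "\<pi> (i 0) \<in> hom C a (FOb \<Delta> (i 0))" "\<pi> (i 1) \<in> hom C a (FOb \<Delta> (i 1))"
    "FArr \<Delta> (i 3) \<cdot> \<pi> (i 0) = \<pi> (i 2)" "FArr \<Delta> (i 4) \<cdot> \<pi> (i 1) = \<pi> (i 2)"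
    using cone unfolding is_cone_def by (simp_all add: cospan_def d)
  show ?thesis
    unfolding is_pullback_def
  proof (intro conjI ballI impI)
    fix z p' q' assume z: "z \<in> Ob C" and "p' \<in> hom C z (Dom C (FArr \<Delta> (i 3)))"
      "q' \<in> hom C z (Dom C (FArr \<Delta> (i 4)))" and eq: "FArr \<Delta> (i 3) \<cdot> p' = FArr \<Delta> (i 4) \<cdot> q'"
    hence p': "p' \<in> Arr C" "Dom C p' = z" "Cod C p' = FOb \<Delta> (i 0)"
      and q': "q' \<in> Arr C" "Dom C q' = z" "Cod C q' = FOb \<Delta> (i 1)" using D by (auto simp: hom_def)
    define \<sigma> where "\<sigma> = (\<lambda>k. if k = i 0 then p' else if k = i 1 then q' else FArr \<Delta> (i 3) \<cdot> p')"
    have "is_cone C (cospan i) \<Delta> z \<sigma>"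
      unfolding is_cone_def using F z p' q' D eq by (auto simp: cospan_def hom_def d \<sigma>_def)
    hence "\<exists>!h. h \<in> hom C z a \<and> (\<forall>k\<in>Ob (cospan i). \<pi> k \<cdot> h = \<sigma> k)"
      using lim unfolding is_limit_def by blast
    moreover have "(h \<in> hom C z a \<and> (\<forall>k\<in>Ob (cospan i). \<pi> k \<cdot> h = \<sigma> k)) \<longleftrightarrow>
        h \<in> hom C z (Dom C (\<pi> (i 0))) \<and> \<pi> (i 0) \<cdot> h = p' \<and> \<pi> (i 1) \<cdot> h = q'" for h
    proof -
      have "\<pi> (i 2) \<cdot> h = FArr \<Delta> (i 3) \<cdot> p'" if "h \<in> hom C z a" "\<pi> (i 0) \<cdot> h = p'"
        unfolding p(3)[symmetric] that(2)[symmetric]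
        using that(1) p(1) D(1) by (intro comp_assoc) (auto simp: hom_def)
      thus ?thesis using p(1) by (auto simp: cospan_def d \<sigma>_def hom_def)
    qed
    ultimately show "\<exists>!u. u \<in> hom C z (Dom C (\<pi> (i 0))) \<and> \<pi> (i 0) \<cdot> u = p' \<and> \<pi> (i 1) \<cdot> u = q'"
      by simp
  qed (use D p in \<open>auto simp: hom_def\<close>)
qed

text \<open>The reflector turns the pullback square into a pullback square in which \<open>FArr L f\<close>, and hence
  the opposite side, is an isomorphism.\<close>

lemma (in reflection) local_eq_pullback:
  assumes U: "universe TYPE('u)" and lex: "preserves_finite_limits TYPE('u) E EI L"
    and pb: "is_pullback E f g p q" and f: "local_eq f"
  shows "local_eq q"
proof -
  interpret EI: category EI by (rule EI_category)
  note D = pullbackD[OF pb]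
  have "(UNIV :: nat set) \<lesssim> (UNIV :: 'u set)"
    using U unfolding universe_def by (meson lesspoll_imp_lepoll)
  then obtain i :: "nat \<Rightarrow> 'u" where i: "inj i" unfolding lepoll_def by auto
  have dst: "i m = i n \<longleftrightarrow> m = n" for m n using i by (rule inj_eq)
  have "is_limit EI (cospan i) (comp_functor L (cospan_diagram E i f g)) (FOb L (Dom E p))
      (\<lambda>k. FArr L (if k = i 0 then p else if k = i 1 then q else f \<cdot> p))"
    using lex cospan_category[OF i] pullback_limit[OF i pb]
    unfolding preserves_finite_limits_def by (simp add: cospan_def)
  from EI.limit_pullback[OF i this]
  have pbL: "is_pullback EI (FArr L f) (FArr L g) (FArr L p) (FArr L q)"
    by (simp add: comp_functor_def cospan_diagram_def dst)
  have "is_iso E (FArr L f)" using f local_eq_iff D by blast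
  hence isoL: "is_iso EI (FArr L f)" using EI_iso_iff[of "FArr L f"] D by simp
  then obtain j where j: "j \<in> Arr EI" "Dom EI j = Cod EI (FArr L f)" "Cod EI j = Dom EI (FArr L f)"
    "FArr L f \<cdot>\<^bsub>EI\<^esub> j = Idn EI (Cod EI (FArr L f))"
    by (rule EI.isoE)
  note DL = EI.pullbackD[OF pbL]
  have "FArr L f \<cdot>\<^bsub>EI\<^esub> j \<cdot>\<^bsub>EI\<^esub> FArr L g = FArr L g" unfolding j(4) using DL by (intro EI.id_comp) simp_all
  hence eq: "FArr L f \<cdot>\<^bsub>EI\<^esub> (j \<cdot>\<^bsub>EI\<^esub> FArr L g) = FArr L g"
    using EI.comp_assoc[OF DL(2) j(1) DL(1)] DL(3) j(2,3) by simp
  have "is_iso EI (FArr L q)"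
    by (rule EI.pullback_of_factor_iso[OF pbL EI.iso_mono[OF isoL] _ _ _ eq])
       (use EI.comp_arr[OF DL(2) j(1)] DL(3) j(2,3) in simp_all)
  hence "is_iso E (FArr L q)" using EI_iso_iff[of "FArr L q"] D by simp
  thus ?thesis using local_eq_iff D by blast
qed


section \<open>The reflector of a topology\<close>

context topos_topology
begin

text \<open>The object representing the sheafification, for the topology defined by \<open>J\<close>, of the functor
  represented by \<open>X\<close>.\<close>

lemma reflect_ex:
  assumes X: "X \<in> Ob E"
  shows "\<exists>L h. L \<in> FR J \<and> h \<in> hom E X L \<and> J.local_gen (hom_to L) precomp X h"
proof -
  have P: "presheaf E (J.functional_rel X) J.restrict_rel" using J.functional_rel_sheaf unfolding sheaf_def by blast
  have "sheaf E Cov (J.functional_rel X) J.restrict_rel"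
    using J.functional_rel_sheaf[of X] Cov_JCov unfolding sheaf_def by blast
  moreover have "small_in TYPE('u) (J.functional_rel X (FOb G c))" if "c \<in> Ob C" for c
    by (rule small_in_subset[OF small_closed_rel[OF J.site_axioms Cov_JCov X, of "FOb G c"]])
       (use that in \<open>auto simp: J.functional_rel_def\<close>)
  ultimately obtain R e where R: "R \<in> Ob E" "e \<in> J.functional_rel X R"
    "\<And>U. U \<in> Ob E \<Longrightarrow> bij_betw (\<lambda>x. J.restrict_rel x e) (hom E U R) (J.functional_rel X U)"
    using representable by blast
  define \<gamma> where "\<gamma> = (\<lambda>U. inv_into (hom E U R) (\<lambda>x. J.restrict_rel x e))"
  have bij: "bij_betw (\<gamma> U) (J.functional_rel X U) (hom E U R)" if "U \<in> Ob E" for U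
    unfolding \<gamma>_def by (rule bij_betw_inv_into[OF R(3)[OF that]])
  have \<gamma>: "\<gamma> U A \<in> hom E U R" "J.restrict_rel (\<gamma> U A) e = A" if "U \<in> Ob E" "A \<in> J.functional_rel X U" for U A
    using bij_betw_imp_surj_on[OF R(3)[OF that(1)]] that(2)
      inv_into_into[of A "\<lambda>x. J.restrict_rel x e" "hom E U R"] f_inv_into_f[of A "\<lambda>x. J.restrict_rel x e" "hom E U R"]
    unfolding \<gamma>_def by auto
  have nat: "\<gamma> (Dom E f) (J.restrict_rel f A) = \<gamma> (Cod E f) A \<cdot> f"
    if f: "f \<in> Arr E" and A: "A \<in> J.functional_rel X (Cod E f)" for f A
  proof (rule inj_onD[OF bij_betw_imp_inj_on[OF R(3)]])
    have ob: "Dom E f \<in> Ob E" "Cod E f \<in> Ob E" using f by auto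
    note gA = \<gamma>[OF ob(2) A]
    have fA: "J.restrict_rel f A \<in> J.functional_rel X (Dom E f)" using J.functional_rel_restrict[OF A f refl] .
    show "Dom E f \<in> Ob E" by (rule ob)
    show "\<gamma> (Dom E f) (J.restrict_rel f A) \<in> hom E (Dom E f) R" using \<gamma>(1)[OF ob(1) fA] .
    show "\<gamma> (Cod E f) A \<cdot> f \<in> hom E (Dom E f) R" using gA(1) f by (auto simp: hom_def)
    show "J.restrict_rel (\<gamma> (Dom E f) (J.restrict_rel f A)) e = J.restrict_rel (\<gamma> (Cod E f) A \<cdot> f) e"
      using \<gamma>(2)[OF ob(1) fA] J.restrict_rel_comp[OF f, of "\<gamma> (Cod E f) A" e] gA by (simp add: hom_def)
  qed
  have "sheaf E JCov (hom_to R) precomp" by (rule J.sheaf_transport[OF J.functional_rel_sheaf bij nat])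
  hence "R \<in> FR J" using FR_sheaf_iff R(1) by blast
  moreover have "J.local_gen (hom_to R) precomp X (\<gamma> X (J.graph (Idn E X)))"
    by (rule J.local_gen_transport[OF J.functional_rel_local_gen[OF X] P bij nat])
  moreover have "\<gamma> X (J.graph (Idn E X)) \<in> hom E X R"
    using \<gamma>(1)[OF X] J.graph_rel[of "Idn E X"] X by simp
  ultimately show ?thesis by blast
qed

lemma FR_ob: "Z \<in> FR J \<Longrightarrow> Z \<in> Ob E"
  and FR_sheaf: "Z \<in> FR J \<Longrightarrow> sheaf E JCov (hom_to Z) precomp"
  using FR_sheaf_iff by blast+

lemma FR_locally_eq:
  assumes "Z \<in> FR J" "x \<in> Arr E" "y \<in> Arr E" "Dom E x = Dom E y" "Cod E x = Z" "Cod E y = Z"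
    "J.locally (Dom E x) (\<lambda>g. x \<cdot> g = y \<cdot> g)"
  shows "x = y"
  by (rule J.sheaf_locally_eq[OF FR_sheaf[OF assms(1)], of x "Dom E x" y])
     (use assms in \<open>simp_all add: hom_def\<close>)

text \<open>A map into a sheaf extends along a local generator, and the extension to the functor
  represented by \<open>L\<close> is composition with an arrow by Yoneda.\<close>

lemma local_gen_universal:
  assumes g: "J.local_gen (hom_to L) precomp X h" and L: "L \<in> Ob E" and Z: "Z \<in> FR J" and f: "f \<in> hom E X Z"
  shows "\<exists>!g. g \<in> hom E L Z \<and> g \<cdot> h = f"
proof -
  have h: "h \<in> hom E X L" using J.local_genD(2)[OF g] .
  have h': "h \<in> Arr E" "Dom E h = X" "Cod E h = L" using h by (auto simp: hom_def)
  obtain th where th: "\<And>U z. U \<in> Ob E \<Longrightarrow> z \<in> hom E U L \<Longrightarrow> th U z \<in> hom E U Z"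
    "\<And>f z. f \<in> Arr E \<Longrightarrow> z \<in> hom E (Cod E f) L \<Longrightarrow> th (Dom E f) (z \<cdot> f) = th (Cod E f) z \<cdot> f"
    "th X h = f"
    using J.local_gen_extend[OF FR_sheaf[OF Z] hom_presheaf g f] by blast
  have id: "Idn E L \<in> hom E L L" using L by (simp add: hom_def)
  show ?thesis
  proof (rule ex1I[of _ "th L (Idn E L)"])
    show "th L (Idn E L) \<in> hom E L Z \<and> th L (Idn E L) \<cdot> h = f"
      using th(1)[OF L id] th(2)[OF h'(1), of "Idn E L"] th(3) h' id by simp
    fix k assume k: "k \<in> hom E L Z \<and> k \<cdot> h = f"
    have "k \<cdot> Idn E L = th L (Idn E L)"
      by (rule J.local_gen_unique[OF FR_sheaf[OF Z] hom_presheaf g, of "\<lambda>U z. k \<cdot> z" th])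
         (use k th id L in \<open>auto simp: hom_def\<close>)
    thus "k = th L (Idn E L)" using k by (simp add: hom_def)
  qed
qed

text \<open>If \<open>m : C \<rightarrow> X\<close> is dual to all sheaves, the unit of \<open>C\<close> extends to \<open>X\<close>.  As the
  unit of \<open>C\<close> is locally surjective and that of \<open>X\<close> is locally injective, arrows to
  \<open>X\<close> factor locally through \<open>m\<close>.\<close>

lemma GR_FR_subset: "GR (FR J) \<subseteq> J"
proof
  fix m assume m: "m \<in> GR (FR J)"
  have FRo: "FR J \<subseteq> Ob E" using FR_ob by blast
  have mm: "is_mono E m" and ZJ: "\<And>Z. Z \<in> FR J \<Longrightarrow> gen_sieve E {m} \<in> ZCov Z (Cod E m)"
    using m GR_iff[OF FRo] by blast+
  have ma: "m \<in> Arr E" using E.mono_arr[OF mm] .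
  define A X where "A = Dom E m" and "X = Cod E m"
  have ob: "A \<in> Ob E" "X \<in> Ob E" using ma by (auto simp: A_def X_def)
  have bij: "bij_betw (\<lambda>f. f \<cdot> m) (hom E X Z) (hom E A Z)" if "Z \<in> FR J" for Z
    using E.glues_mono_iff[OF mm, of Z] E.glue_topD(3)[OF ZJ[OF that]] ob by (simp add: A_def X_def)
  obtain LA h where LA: "LA \<in> FR J" "h \<in> hom E A LA" and gA: "J.local_gen (hom_to LA) precomp A h"
    using reflect_ex[OF ob(1)] by blast
  obtain LX k where LX: "LX \<in> FR J" "k \<in> hom E X LX" and gX: "J.local_gen (hom_to LX) precomp X k"
    using reflect_ex[OF ob(2)] by blast
  have h: "h \<in> Arr E" "Dom E h = A" "Cod E h = LA" and k: "k \<in> Arr E" "Dom E k = X" "Cod E k = LX"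
    using LA(2) LX(2) by (auto simp: hom_def)
  have m': "m \<in> Arr E" "Dom E m = A" "Cod E m = X" using ma by (simp_all add: A_def X_def)
  obtain a where "a \<in> hom E X LA" and am: "a \<cdot> m = h"
    using bij_betw_imp_surj_on[OF bij[OF LA(1)]] LA(2) by (metis (no_types, lifting) imageE)
  hence a: "a \<in> Arr E" "Dom E a = X" "Cod E a = LA" by (auto simp: hom_def)
  have "k \<cdot> m \<in> hom E A LX" using k m' by (simp add: hom_def)
  then obtain b where "b \<in> hom E LA LX" and bh: "b \<cdot> h = k \<cdot> m"
    using local_gen_universal[OF gA FR_ob[OF LA(1)] LX(1)] by blast
  hence b: "b \<in> Arr E" "Dom E b = LA" "Cod E b = LX" by (auto simp: hom_def)
  have "b \<cdot> a \<cdot> m = k \<cdot> m" using a b m' am bh by simp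
  hence ba: "b \<cdot> a = k"
    using inj_onD[OF bij_betw_imp_inj_on[OF bij[OF LX(1)]], of "b \<cdot> a" k] a b k by (simp add: hom_def)
  have loc: "J.locally X (\<lambda>f. \<exists>x\<in>Arr E. Cod E x = A \<and> Dom E x = Dom E f \<and> a \<cdot> f = h \<cdot> x)"
    using J.local_genD(3)[OF gA ob(2), of a] a by (simp add: hom_def)
  have "J.locally X (\<lambda>f. f \<in> gen_sieve E {m})"
  proof (rule J.locally_trans[OF loc])
    fix f assume f: "f \<in> Arr E" "Cod E f = X"
      "\<exists>x\<in>Arr E. Cod E x = A \<and> Dom E x = Dom E f \<and> a \<cdot> f = h \<cdot> x"
    then obtain x where x: "x \<in> Arr E" "Cod E x = A" "Dom E x = Dom E f" "a \<cdot> f = h \<cdot> x" by blast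
    have "k \<cdot> f = b \<cdot> (a \<cdot> f)" unfolding ba[symmetric] using a b f by simp
    also have "\<dots> = b \<cdot> h \<cdot> x" unfolding x(4) using b h x by simp
    also have "\<dots> = k \<cdot> (m \<cdot> x)" unfolding bh using k m' x by simp
    finally have "J.locally (Dom E f) (\<lambda>g. f \<cdot> g = m \<cdot> x \<cdot> g)"
      using J.local_genD(4)[OF gX f(1), of "m \<cdot> x"] f x m' by simp
    thus "J.locally (Dom E f) (\<lambda>g. f \<cdot> g \<in> gen_sieve E {m})"
    proof (rule J.locally_mono)
      fix g assume g: "g \<in> Arr E" "Cod E g = Dom E f" "f \<cdot> g = m \<cdot> x \<cdot> g"
      have "f \<cdot> g = m \<cdot> (x \<cdot> g)" unfolding g(3) using x m' g(1,2) by simp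
      thus "f \<cdot> g \<in> gen_sieve E {m}"
        using E.gen_sieveI[of m "{m}" "x \<cdot> g"] x m' g(1,2) by simp
    qed
  qed
  moreover have "is_sieve E X (gen_sieve E {m})" using m' by (intro E.gen_sieve_sieve) simp
  ultimately have "gen_sieve E {m} \<in> JCov (Cod E m)" using J.locally_sieve m'(3) by blast
  thus "m \<in> J" by (rule J_of_gen_sieve[OF mm])
qed

lemma reflection_ex:
  obtains L \<eta> where "reflection E (FR J) L \<eta>" "\<And>X. X \<in> Ob E \<Longrightarrow> J.local_gen (hom_to (FOb L X)) precomp X (\<eta> X)"
proof -
  have "\<forall>X. \<exists>p. X \<in> Ob E \<longrightarrow> fst p \<in> FR J \<and> snd p \<in> hom E X (fst p) \<and> J.local_gen (hom_to (fst p)) precomp X (snd p)"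
    using reflect_ex by (metis fst_conv snd_conv)
  then obtain p where p: "\<And>X. X \<in> Ob E \<Longrightarrow> fst (p X) \<in> FR J"
    "\<And>X. X \<in> Ob E \<Longrightarrow> snd (p X) \<in> hom E X (fst (p X))"
    "\<And>X. X \<in> Ob E \<Longrightarrow> J.local_gen (hom_to (fst (p X))) precomp X (snd (p X))"
    by metis
  define lx where "lx = (\<lambda>X. fst (p X))"
  define \<eta> where "\<eta> = (\<lambda>X. snd (p X))"
  have lx: "lx X \<in> FR J" "lx X \<in> Ob E" if "X \<in> Ob E" for X
    using p(1)[OF that] FR_ob by (auto simp: lx_def)
  have \<eta>: "\<eta> X \<in> Arr E" "Dom E (\<eta> X) = X" "Cod E (\<eta> X) = lx X" if "X \<in> Ob E" for X
    using p(2)[OF that] by (auto simp: lx_def \<eta>_def hom_def)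
  have gen: "J.local_gen (hom_to (lx X)) precomp X (\<eta> X)" if "X \<in> Ob E" for X
    using p(3)[OF that] by (simp add: lx_def \<eta>_def)
  have univ: "\<exists>!g. g \<in> hom E (lx X) Z \<and> g \<cdot> \<eta> X = f" if "X \<in> Ob E" "Z \<in> FR J" "f \<in> hom E X Z" for X Z f
    using local_gen_universal[OF gen[OF that(1)] lx(2)[OF that(1)] that(2,3)] .
  define la where "la = (\<lambda>f. THE g. g \<in> hom E (lx (Dom E f)) (lx (Cod E f)) \<and>
    g \<cdot> \<eta> (Dom E f) = \<eta> (Cod E f) \<cdot> f)"
  have un: "\<exists>!g. g \<in> hom E (lx (Dom E f)) (lx (Cod E f)) \<and> g \<cdot> \<eta> (Dom E f) = \<eta> (Cod E f) \<cdot> f"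
    if "f \<in> Arr E" for f
    using that \<eta> by (intro univ lx) (simp_all add: hom_def)
  have "la f \<in> hom E (lx (Dom E f)) (lx (Cod E f)) \<and> la f \<cdot> \<eta> (Dom E f) = \<eta> (Cod E f) \<cdot> f"
    if "f \<in> Arr E" for f
    unfolding la_def by (rule theI'[OF un[OF that]])
  hence la: "la f \<in> Arr E" "Dom E (la f) = lx (Dom E f)" "Cod E (la f) = lx (Cod E f)"
    "la f \<cdot> \<eta> (Dom E f) = \<eta> (Cod E f) \<cdot> f" if "f \<in> Arr E" for f
    using that by (auto simp: hom_def)
  have la_eq: "la f = g"
    if "f \<in> Arr E" "g \<in> Arr E" "Dom E g = lx (Dom E f)" "Cod E g = lx (Cod E f)"
      "g \<cdot> \<eta> (Dom E f) = \<eta> (Cod E f) \<cdot> f" for f g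
    unfolding la_def by (rule the1_equality[OF un[OF that(1)]]) (use that in \<open>simp add: hom_def\<close>)
  have la_id: "la (Idn E X) = Idn E (lx X)" if "X \<in> Ob E" for X
    using that lx \<eta> by (intro la_eq) simp_all
  have la_comp: "la (g \<cdot> f) = la g \<cdot> la f"
    if f: "f \<in> Arr E" and g: "g \<in> Arr E" "Cod E f = Dom E g" for f g
  proof (rule la_eq)
    note lf = la[OF f] and lg = la[OF g(1)]
    have ob: "Dom E f \<in> Ob E" "Cod E f \<in> Ob E" "Cod E g \<in> Ob E" using f g by auto
    have "la g \<cdot> la f \<cdot> \<eta> (Dom E f) = la g \<cdot> (la f \<cdot> \<eta> (Dom E f))"
      using lf(1-3) lg(1-3) \<eta>[OF ob(1)] g(2) by simp
    also have "\<dots> = la g \<cdot> \<eta> (Dom E g) \<cdot> f"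
      unfolding lf(4) using lg(1-3) \<eta>[OF ob(2)] g(2) f by simp
    also have "\<dots> = \<eta> (Cod E g) \<cdot> (g \<cdot> f)"
      unfolding lg(4) using \<eta>[OF ob(3)] g f by simp
    finally show "la g \<cdot> la f \<cdot> \<eta> (Dom E (g \<cdot> f)) = \<eta> (Cod E (g \<cdot> f)) \<cdot> (g \<cdot> f)"
      using f g by simp
  qed (use f g la[OF f] la[OF g(1)] in simp_all)
  have "reflection E (FR J) \<lparr>FOb = lx, FArr = la\<rparr> \<eta>"
  proof (unfold_locales, unfold fctr.select_convs)
    show "FR J \<subseteq> Ob E" using FR_ob by blast
    show "is_functor E (full_subcat E (FR J)) \<lparr>FOb = lx, FArr = la\<rparr>"
      unfolding is_functor_def using lx la(1-3) la_id la_comp by (simp add: hom_def)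
    show "\<eta> X \<in> hom E X (lx X)" if "X \<in> Ob E" for X using \<eta>[OF that] by (simp add: hom_def)
    show "\<eta> (Cod E f) \<cdot> f = la f \<cdot> \<eta> (Dom E f)" if "f \<in> Arr E" for f using la(4)[OF that] by simp
    show "\<exists>!g. g \<in> hom E (lx X) Z \<and> g \<cdot> \<eta> X = f" if "X \<in> Ob E" "Z \<in> FR J" "f \<in> hom E X Z" for X Z f
      using univ[OF that] .
  qed
  thus thesis by (rule that) (use gen in simp)
qed

text \<open>A cone on the reflected diagram lifts locally to a cone on the diagram itself: the finitely
  many components and the finitely many compatibility conditions only need a common refinement
  of finitely many covering sieves.\<close>

lemma reflection_lex:
  assumes refl: "reflection E (FR J) L \<eta>"
    and gen: "\<And>X. X \<in> Ob E \<Longrightarrow> J.local_gen (hom_to (FOb L X)) precomp X (\<eta> X)"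
  shows "preserves_finite_limits U E (full_subcat E (FR J)) L"
  unfolding preserves_finite_limits_def
proof (intro allI impI)
  interpret R: reflection E "FR J" L \<eta> by (rule refl)
  fix K :: "('z, 'z) cat" and \<Delta> a \<pi>
  assume K: "category K" and fin: "finite (Ob K)" "finite (Arr K)" and lim: "is_limit E K \<Delta> a \<pi>"
  interpret K: category K by (rule K)
  have cone: "is_cone E K \<Delta> a \<pi>" and univ: "\<And>b \<sigma>. is_cone E K \<Delta> b \<sigma> \<Longrightarrow>
      \<exists>!h. h \<in> hom E b a \<and> (\<forall>k\<in>Ob K. \<pi> k \<cdot> h = \<sigma> k)"
    using lim unfolding is_limit_def by blast+
  have fD: "is_functor K E \<Delta>" and a: "a \<in> Ob E" using cone unfolding is_cone_def by blast+
  have \<pi>: "\<pi> k \<in> Arr E" "Dom E (\<pi> k) = a" "Cod E (\<pi> k) = FOb \<Delta> k" if "k \<in> Ob K" for k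
    using cone that unfolding is_cone_def by (auto simp: hom_def)
  have \<pi>n: "FArr \<Delta> u \<cdot> \<pi> (Dom K u) = \<pi> (Cod K u)" if "u \<in> Arr K" for u
    using cone that unfolding is_cone_def by blast
  have \<Delta>_ob: "FOb \<Delta> k \<in> Ob E" if "k \<in> Ob K" for k using fD that unfolding is_functor_def by blast
  have \<Delta>_arr: "FArr \<Delta> u \<in> Arr E" "Dom E (FArr \<Delta> u) = FOb \<Delta> (Dom K u)" "Cod E (FArr \<Delta> u) = FOb \<Delta> (Cod K u)"
    if "u \<in> Arr K" for u using fD that unfolding is_functor_def by (auto simp: hom_def)
  have \<Delta>_id: "FArr \<Delta> (Idn K k) = Idn E (FOb \<Delta> k)" if "k \<in> Ob K" for k
    using fD that unfolding is_functor_def by simp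
  have \<Delta>_comp: "FArr \<Delta> (Comp K v u) = FArr \<Delta> v \<cdot> FArr \<Delta> u" if "u \<in> Arr K" "v \<in> Arr K" "Cod K u = Dom K v" for u v
    using fD that unfolding is_functor_def by simp
  have lim_eq: "y = y'" if "y \<in> Arr E" "y' \<in> Arr E" "Dom E y = Dom E y'" "Cod E y = a" "Cod E y' = a"
    and eq: "\<And>k. k \<in> Ob K \<Longrightarrow> \<pi> k \<cdot> y = \<pi> k \<cdot> y'" for y y'
  proof -
    have "is_cone E K \<Delta> (Dom E y) (\<lambda>k. \<pi> k \<cdot> y)"
      unfolding is_cone_def
    proof (intro conjI ballI fD)
      show "Dom E y \<in> Ob E" using that by simp
      show "\<pi> k \<cdot> y \<in> hom E (Dom E y) (FOb \<Delta> k)" if "k \<in> Ob K" for k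
        using \<pi>[OF that] \<open>y \<in> Arr E\<close> \<open>Cod E y = a\<close> by (simp add: hom_def)
      fix u assume u: "u \<in> Arr K"
      have "FArr \<Delta> u \<cdot> \<pi> (Dom K u) \<cdot> y = \<pi> (Cod K u) \<cdot> y" by (simp only: \<pi>n[OF u])
      thus "FArr \<Delta> u \<cdot> (\<pi> (Dom K u) \<cdot> y) = \<pi> (Cod K u) \<cdot> y"
        using \<Delta>_arr[OF u] \<pi>[of "Dom K u"] u that by simp
    qed
    from univ[OF this] show ?thesis
      using that by (elim ex1E) (metis (no_types, lifting) E.homI)
  qed
  note genk = gen[OF \<Delta>_ob]
  have Lo: "FOb L (FOb \<Delta> k) \<in> FR J" if "k \<in> Ob K" for k using R.L_ob[OF \<Delta>_ob[OF that]] .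
  have La: "FOb L a \<in> FR J" using R.L_ob[OF a] .
  \<comment> \<open>The projections determine an arrow to the limit up to local equality, hence after composition
    with the unit.\<close>
  have unit_eq: "\<eta> a \<cdot> y = \<eta> a \<cdot> y'" if y: "y \<in> Arr E" "y' \<in> Arr E" "Dom E y = Dom E y'" "Cod E y = a" "Cod E y' = a"
    and eq: "\<And>k. k \<in> Ob K \<Longrightarrow> \<eta> (FOb \<Delta> k) \<cdot> (\<pi> k \<cdot> y) = \<eta> (FOb \<Delta> k) \<cdot> (\<pi> k \<cdot> y')" for y y'
  proof (rule FR_locally_eq[OF La])
    have "J.locally (Dom E y) (\<lambda>g. \<forall>k\<in>Ob K. \<pi> k \<cdot> y \<cdot> g = \<pi> k \<cdot> y' \<cdot> g)"
    proof (rule J.locally_finite[OF fin(1)])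
      show "Dom E y \<in> Ob E" using y by simp
      fix k assume k: "k \<in> Ob K"
      show "J.locally (Dom E y) (\<lambda>g. \<pi> k \<cdot> y \<cdot> g = \<pi> k \<cdot> y' \<cdot> g)"
        using J.local_genD(4)[OF genk[OF k], of "\<pi> k \<cdot> y" "\<pi> k \<cdot> y'"] eq[OF k] \<pi>[OF k] y by simp
    qed
    hence "J.locally (Dom E y) (\<lambda>g. \<eta> a \<cdot> y \<cdot> g = \<eta> a \<cdot> y' \<cdot> g)"
    proof (rule J.locally_mono)
      fix g assume g: "g \<in> Arr E" "Cod E g = Dom E y"
        and e: "\<forall>k\<in>Ob K. \<pi> k \<cdot> y \<cdot> g = \<pi> k \<cdot> y' \<cdot> g"
      have "y \<cdot> g = y' \<cdot> g"
      proof (rule lim_eq)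
        fix k assume k: "k \<in> Ob K"
        show "\<pi> k \<cdot> (y \<cdot> g) = \<pi> k \<cdot> (y' \<cdot> g)" using e[rule_format, OF k] \<pi>[OF k] y g by simp
      qed (use y g in simp_all)
      thus "\<eta> a \<cdot> y \<cdot> g = \<eta> a \<cdot> y' \<cdot> g" using y g a by simp
    qed
    thus "J.locally (Dom E (\<eta> a \<cdot> y)) (\<lambda>g. \<eta> a \<cdot> y \<cdot> g = \<eta> a \<cdot> y' \<cdot> g)" using y a by simp
  qed (use y a in simp_all)
  have fLD: "is_functor K R.EI (comp_functor L \<Delta>)"
    unfolding is_functor_def comp_functor_def
    using \<Delta>_ob \<Delta>_arr \<Delta>_id \<Delta>_comp by (simp add: hom_def R.L_id R.L_comp)
  show "is_limit (full_subcat E (FR J)) K (comp_functor L \<Delta>) (FOb L a) (\<lambda>k. FArr L (\<pi> k))"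
    unfolding is_limit_def
  proof (intro conjI allI impI)
    show "is_cone R.EI K (comp_functor L \<Delta>) (FOb L a) (\<lambda>k. FArr L (\<pi> k))"
      unfolding is_cone_def
    proof (intro conjI ballI fLD)
      show "FOb L a \<in> Ob R.EI" using a by simp
      fix k assume "k \<in> Ob K"
      thus "FArr L (\<pi> k) \<in> hom R.EI (FOb L a) (FOb (comp_functor L \<Delta>) k)"
        using \<pi>[of k] \<Delta>_ob[of k] a by (simp add: hom_def comp_functor_def)
    next
      fix u assume u: "u \<in> Arr K"
      have "FArr L (FArr \<Delta> u \<cdot> \<pi> (Dom K u)) = FArr L (FArr \<Delta> u) \<cdot> FArr L (\<pi> (Dom K u))"
        using \<pi>[of "Dom K u"] \<Delta>_arr[OF u] u by (intro R.L_comp) simp_all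
      thus "Comp R.EI (FArr (comp_functor L \<Delta>) u) (FArr L (\<pi> (Dom K u))) = FArr L (\<pi> (Cod K u))"
        using \<pi>n[OF u] by (simp add: comp_functor_def)
    qed
    fix b \<sigma> assume cone\<sigma>: "is_cone R.EI K (comp_functor L \<Delta>) b \<sigma>"
    have b: "b \<in> FR J" using cone\<sigma> unfolding is_cone_def by simp
    have bo: "b \<in> Ob E" using FR_ob[OF b] .
    have s: "\<sigma> k \<in> Arr E" "Dom E (\<sigma> k) = b" "Cod E (\<sigma> k) = FOb L (FOb \<Delta> k)" if "k \<in> Ob K" for k
      using cone\<sigma> that unfolding is_cone_def by (auto simp: hom_def comp_functor_def)
    have sn: "FArr L (FArr \<Delta> u) \<cdot> \<sigma> (Dom K u) = \<sigma> (Cod K u)" if "u \<in> Arr K" for u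
      using cone\<sigma> that unfolding is_cone_def by (simp add: comp_functor_def)
    define P where "P = (\<lambda>v y. v \<in> Arr E \<and> Cod E v = b \<and> y \<in> Arr E \<and> Dom E y = Dom E v \<and> Cod E y = a \<and>
      (\<forall>k\<in>Ob K. \<sigma> k \<cdot> v = \<eta> (FOb \<Delta> k) \<cdot> (\<pi> k \<cdot> y)))"
    have Q1: "J.locally b (\<lambda>v. \<forall>k\<in>Ob K. \<exists>x\<in>Arr E. Cod E x = FOb \<Delta> k \<and> Dom E x = Dom E v \<and>
        \<sigma> k \<cdot> v = \<eta> (FOb \<Delta> k) \<cdot> x)"
    proof (rule J.locally_finite[OF fin(1) bo])
      fix k assume k: "k \<in> Ob K"
      show "J.locally b (\<lambda>v. \<exists>x\<in>Arr E. Cod E x = FOb \<Delta> k \<and> Dom E x = Dom E v \<and>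
        \<sigma> k \<cdot> v = \<eta> (FOb \<Delta> k) \<cdot> x)"
        using J.local_genD(3)[OF genk[OF k] bo, of "\<sigma> k"] s[OF k] by (simp add: hom_def)
    qed
    have Q: "J.locally b (\<lambda>v. \<exists>y. P v y)"
    proof (rule J.locally_trans[OF Q1])
      fix v assume v: "v \<in> Arr E" "Cod E v = b" and "\<forall>k\<in>Ob K. \<exists>x\<in>Arr E. Cod E x = FOb \<Delta> k \<and>
        Dom E x = Dom E v \<and> \<sigma> k \<cdot> v = \<eta> (FOb \<Delta> k) \<cdot> x"
      then obtain x where x: "\<And>k. k \<in> Ob K \<Longrightarrow> x k \<in> Arr E" "\<And>k. k \<in> Ob K \<Longrightarrow> Cod E (x k) = FOb \<Delta> k"
        "\<And>k. k \<in> Ob K \<Longrightarrow> Dom E (x k) = Dom E v" "\<And>k. k \<in> Ob K \<Longrightarrow> \<sigma> k \<cdot> v = \<eta> (FOb \<Delta> k) \<cdot> x k"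
        by metis
      have "J.locally (Dom E v) (\<lambda>g. \<forall>u\<in>Arr K. FArr \<Delta> u \<cdot> x (Dom K u) \<cdot> g = x (Cod K u) \<cdot> g)"
      proof (rule J.locally_finite[OF fin(2)])
        show "Dom E v \<in> Ob E" using v by simp
        fix u assume u: "u \<in> Arr K"
        hence d: "Dom K u \<in> Ob K" "Cod K u \<in> Ob K" by auto
        note D = \<Delta>_arr[OF u] x(1-3)[OF d(1)] x(1-3)[OF d(2)] \<Delta>_ob[OF d(1)] \<Delta>_ob[OF d(2)] s[OF d(1)] s[OF d(2)]
        have "\<eta> (FOb \<Delta> (Cod K u)) \<cdot> (FArr \<Delta> u \<cdot> x (Dom K u)) =
            \<eta> (FOb \<Delta> (Cod K u)) \<cdot> FArr \<Delta> u \<cdot> x (Dom K u)"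
          using D by simp
        also have "\<dots> = FArr L (FArr \<Delta> u) \<cdot> \<eta> (FOb \<Delta> (Dom K u)) \<cdot> x (Dom K u)"
          using R.unit_nat[OF D(1)] D(2,3) by simp
        also have "\<dots> = FArr L (FArr \<Delta> u) \<cdot> (\<sigma> (Dom K u) \<cdot> v)"
          unfolding x(4)[OF d(1)] using D by simp
        also have "\<dots> = FArr L (FArr \<Delta> u) \<cdot> \<sigma> (Dom K u) \<cdot> v"
          using D v by simp
        also have "\<dots> = \<eta> (FOb \<Delta> (Cod K u)) \<cdot> x (Cod K u)"
          by (simp only: sn[OF u] x(4)[OF d(2)])
        finally have "J.locally (Dom E (FArr \<Delta> u \<cdot> x (Dom K u)))
            (\<lambda>g. FArr \<Delta> u \<cdot> x (Dom K u) \<cdot> g = x (Cod K u) \<cdot> g)"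
          by (intro J.local_genD(4)[OF genk[OF d(2)]]) (use D in simp_all)
        thus "J.locally (Dom E v) (\<lambda>g. FArr \<Delta> u \<cdot> x (Dom K u) \<cdot> g = x (Cod K u) \<cdot> g)"
          using D by simp
      qed
      thus "J.locally (Dom E v) (\<lambda>g. \<exists>y. P (v \<cdot> g) y)"
      proof (rule J.locally_mono)
        fix g assume g: "g \<in> Arr E" "Cod E g = Dom E v"
          and e: "\<forall>u\<in>Arr K. FArr \<Delta> u \<cdot> x (Dom K u) \<cdot> g = x (Cod K u) \<cdot> g"
        have "is_cone E K \<Delta> (Dom E g) (\<lambda>k. x k \<cdot> g)"
          unfolding is_cone_def
        proof (intro conjI ballI fD)
          show "Dom E g \<in> Ob E" using g by simp
          show "x k \<cdot> g \<in> hom E (Dom E g) (FOb \<Delta> k)" if "k \<in> Ob K" for k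
            using x(1-3)[OF that] g by (simp add: hom_def)
          fix u assume u: "u \<in> Arr K"
          show "FArr \<Delta> u \<cdot> (x (Dom K u) \<cdot> g) = x (Cod K u) \<cdot> g"
            using e[rule_format, OF u] \<Delta>_arr[OF u] x(1-3)[of "Dom K u"] u g by simp
        qed
        from univ[OF this] obtain y where "y \<in> hom E (Dom E g) a \<and> (\<forall>k\<in>Ob K. \<pi> k \<cdot> y = x k \<cdot> g)"
          by (rule ex1E)
        hence y: "y \<in> Arr E" "Dom E y = Dom E g" "Cod E y = a" "\<And>k. k \<in> Ob K \<Longrightarrow> \<pi> k \<cdot> y = x k \<cdot> g"
          by (auto simp: hom_def)
        have "\<sigma> k \<cdot> (v \<cdot> g) = \<eta> (FOb \<Delta> k) \<cdot> (\<pi> k \<cdot> y)" if k: "k \<in> Ob K" for k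
        proof -
          have "\<sigma> k \<cdot> (v \<cdot> g) = \<sigma> k \<cdot> v \<cdot> g" using s[OF k] v g by simp
          also have "\<dots> = \<eta> (FOb \<Delta> k) \<cdot> (x k \<cdot> g)"
            unfolding x(4)[OF k] using x(1-3)[OF k] g \<Delta>_ob[OF k] by simp
          finally show ?thesis using y(4)[OF k] by simp
        qed
        hence "P (v \<cdot> g) y" unfolding P_def using v g y by simp
        thus "\<exists>y. P (v \<cdot> g) y" by blast
      qed
    qed
    have PD: "v \<in> Arr E" "Cod E v = b" "y \<in> Arr E" "Dom E y = Dom E v" "Cod E y = a"
      "\<And>k. k \<in> Ob K \<Longrightarrow> \<sigma> k \<cdot> v = \<eta> (FOb \<Delta> k) \<cdot> (\<pi> k \<cdot> y)" if "P v y" for v y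
      using that unfolding P_def by blast+
    have L\<pi>: "FArr L (\<pi> k) \<cdot> (\<eta> a \<cdot> y) = \<eta> (FOb \<Delta> k) \<cdot> (\<pi> k \<cdot> y)"
      if k: "k \<in> Ob K" and y: "y \<in> Arr E" "Cod E y = a" for k y
    proof -
      have "FArr L (\<pi> k) \<cdot> (\<eta> a \<cdot> y) = FArr L (\<pi> k) \<cdot> \<eta> a \<cdot> y"
        using \<pi>[OF k] y a by simp
      also have "\<dots> = \<eta> (FOb \<Delta> k) \<cdot> \<pi> k \<cdot> y" using R.unit_nat[OF \<pi>(1)[OF k]] \<pi>[OF k] by simp
      finally show ?thesis using \<pi>[OF k] y \<Delta>_ob[OF k] by simp
    qed
    obtain h where h: "h \<in> hom E b (FOb L a)" and hp: "\<And>p. p \<in> {(v, y). P v y} \<Longrightarrow> h \<cdot> fst p = \<eta> a \<cdot> snd p"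
    proof (rule J.glue_family[OF FR_sheaf[OF La], where L = "{(v, y). P v y}" and x = fst and U = b
          and s = "\<lambda>p. \<eta> a \<cdot> snd p"])
      show "fst p \<in> Arr E \<and> Cod E (fst p) = b" if "p \<in> {(v, y). P v y}" for p using that PD by auto
      show "\<eta> a \<cdot> snd p \<in> hom E (Dom E (fst p)) (FOb L a)" if "p \<in> {(v, y). P v y}" for p
        using that PD(3-5)[of "fst p" "snd p"] a by (auto simp: hom_def)
      show "J.locally b (\<lambda>f. \<exists>l\<in>{(v, y). P v y}. \<exists>w\<in>Arr E. Cod E w = Dom E (fst l) \<and> f = fst l \<cdot> w)"
      proof (rule J.locally_mono[OF Q])
        fix v assume v: "v \<in> Arr E" "\<exists>y. P v y"
        then obtain y where "P v y" by blast
        thus "\<exists>l\<in>{(v, y). P v y}. \<exists>w\<in>Arr E. Cod E w = Dom E (fst l) \<and> v = fst l \<cdot> w"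
          using v(1) by (intro bexI[of _ "(v, y)"] bexI[of _ "Idn E (Dom E v)"]) simp_all
      qed
    next
      fix l l' w w'
      assume "l \<in> {(v, y). P v y}" "l' \<in> {(v, y). P v y}" and w: "w \<in> Arr E" "w' \<in> Arr E"
        "Cod E w = Dom E (fst l)" "Cod E w' = Dom E (fst l')" "Dom E w = Dom E w'"
        "fst l \<cdot> w = fst l' \<cdot> w'"
      then obtain v y v' y' where l: "l = (v, y)" "l' = (v', y')" and Pv: "P v y" "P v' y'" by auto
      note v = PD[OF Pv(1)] and v' = PD[OF Pv(2)]
      have ww: "v \<cdot> w = v' \<cdot> w'" "Cod E w = Dom E v" "Cod E w' = Dom E v'" using w l by simp_all
      have "\<eta> a \<cdot> (y \<cdot> w) = \<eta> a \<cdot> (y' \<cdot> w')"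
      proof (rule unit_eq)
        fix k assume k: "k \<in> Ob K"
        have "\<eta> (FOb \<Delta> k) \<cdot> (\<pi> k \<cdot> (y \<cdot> w)) = \<eta> (FOb \<Delta> k) \<cdot> (\<pi> k \<cdot> y) \<cdot> w"
          using \<pi>[OF k] \<Delta>_ob[OF k] v(3-5) w(1) ww by simp
        also have "\<dots> = \<sigma> k \<cdot> (v \<cdot> w)"
          unfolding v(6)[OF k, symmetric] using s[OF k] v(1-2) w(1) ww(2) by simp
        also have "\<dots> = \<eta> (FOb \<Delta> k) \<cdot> (\<pi> k \<cdot> y') \<cdot> w'"
          unfolding v'(6)[OF k, symmetric] ww(1) using s[OF k] v'(1-2) w(2) ww(3) by simp
        also have "\<dots> = \<eta> (FOb \<Delta> k) \<cdot> (\<pi> k \<cdot> (y' \<cdot> w'))"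
          using \<pi>[OF k] \<Delta>_ob[OF k] v'(3-5) w(2) ww by simp
        finally show "\<eta> (FOb \<Delta> k) \<cdot> (\<pi> k \<cdot> (y \<cdot> w)) =
            \<eta> (FOb \<Delta> k) \<cdot> (\<pi> k \<cdot> (y' \<cdot> w'))" .
      qed (use v(3-5) v'(3-5) w(1,2,5) ww(2,3) in simp_all)
      thus "\<eta> a \<cdot> snd l \<cdot> w = \<eta> a \<cdot> snd l' \<cdot> w'"
        using l v(3-5) v'(3-5) w(1,2) ww(2,3) a by simp
    qed blast
    have h': "h \<in> Arr E" "Dom E h = b" "Cod E h = FOb L a" using h by (auto simp: hom_def)
    have hv: "h \<cdot> v = \<eta> a \<cdot> y" if "P v y" for v y using hp[of "(v, y)"] that by simp
    have hom_to: "FArr L (\<pi> k) \<cdot> h = \<sigma> k" if k: "k \<in> Ob K" for k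
    proof (rule FR_locally_eq[OF Lo[OF k]])
      have "J.locally b (\<lambda>v. FArr L (\<pi> k) \<cdot> h \<cdot> v = \<sigma> k \<cdot> v)"
      proof (rule J.locally_mono[OF Q])
        fix v assume "\<exists>y. P v y"
        then obtain y where Pv: "P v y" by blast
        note v = PD[OF Pv]
        have "FArr L (\<pi> k) \<cdot> h \<cdot> v = FArr L (\<pi> k) \<cdot> (\<eta> a \<cdot> y)"
          using hv[OF Pv] h' v(1,2) \<pi>[OF k] by simp
        thus "FArr L (\<pi> k) \<cdot> h \<cdot> v = \<sigma> k \<cdot> v"
          by (simp only: L\<pi>[OF k v(3,5)] v(6)[OF k])
      qed
      thus "J.locally (Dom E (FArr L (\<pi> k) \<cdot> h)) (\<lambda>v. FArr L (\<pi> k) \<cdot> h \<cdot> v = \<sigma> k \<cdot> v)"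
        using h' \<pi>[OF k] by simp
    qed (use h' \<pi>[OF k] s[OF k] \<Delta>_ob[OF k] in simp_all)
    show "\<exists>!h. h \<in> hom R.EI b (FOb L a) \<and> (\<forall>k\<in>Ob K. Comp R.EI (FArr L (\<pi> k)) h = \<sigma> k)"
    proof (rule ex1I[of _ h])
      show "h \<in> hom R.EI b (FOb L a) \<and> (\<forall>k\<in>Ob K. Comp R.EI (FArr L (\<pi> k)) h = \<sigma> k)"
        using h hom_to R.EI_hom[OF b La] by simp
      fix g assume "g \<in> hom R.EI b (FOb L a) \<and> (\<forall>k\<in>Ob K. Comp R.EI (FArr L (\<pi> k)) g = \<sigma> k)"
      hence g: "g \<in> Arr E" "Dom E g = b" "Cod E g = FOb L a"
        and gs: "\<And>k. k \<in> Ob K \<Longrightarrow> FArr L (\<pi> k) \<cdot> g = \<sigma> k"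
        by (auto simp: hom_def)
      have lg: "J.locally b (\<lambda>v. \<exists>y\<in>Arr E. Cod E y = a \<and> Dom E y = Dom E v \<and> g \<cdot> v = \<eta> a \<cdot> y)"
        using J.local_genD(3)[OF gen[OF a] bo, of g] g by (simp add: hom_def)
      show "g = h"
      proof (rule FR_locally_eq[OF La])
        have "J.locally b (\<lambda>v. g \<cdot> v = h \<cdot> v)"
        proof (rule J.locally_mono[OF J.locally_conj[OF lg Q]])
          fix v assume "(\<exists>y\<in>Arr E. Cod E y = a \<and> Dom E y = Dom E v \<and> g \<cdot> v = \<eta> a \<cdot> y) \<and> (\<exists>y. P v y)"
          then obtain y y' where y: "y \<in> Arr E" "Cod E y = a" "Dom E y = Dom E v" "g \<cdot> v = \<eta> a \<cdot> y"
            and Pv: "P v y'" by blast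
          note v = PD[OF Pv]
          have "\<eta> a \<cdot> y = \<eta> a \<cdot> y'"
          proof (rule unit_eq)
            fix k assume k: "k \<in> Ob K"
            have "\<eta> (FOb \<Delta> k) \<cdot> (\<pi> k \<cdot> y) = FArr L (\<pi> k) \<cdot> (g \<cdot> v)"
              using L\<pi>[OF k y(1,2)] y(4) by simp
            also have "\<dots> = FArr L (\<pi> k) \<cdot> g \<cdot> v" using \<pi>[OF k] g v(1,2) by simp
            finally show "\<eta> (FOb \<Delta> k) \<cdot> (\<pi> k \<cdot> y) = \<eta> (FOb \<Delta> k) \<cdot> (\<pi> k \<cdot> y')"
              by (simp only: gs[OF k] v(6)[OF k])
          qed (use y v in simp_all)
          thus "g \<cdot> v = h \<cdot> v" using y(4) hv[OF Pv] by simp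
        qed
        thus "J.locally (Dom E g) (\<lambda>v. g \<cdot> v = h \<cdot> v)" using g by simp
      qed (use g h' in simp_all)
    qed
  qed
qed

lemma FR_iso_closed:
  assumes f: "is_iso E f" and Z: "Cod E f \<in> FR J"
  shows "Dom E f \<in> FR J"
proof -
  obtain g where g: "g \<in> Arr E" "Dom E g = Cod E f" "Cod E g = Dom E f"
    "g \<cdot> f = Idn E (Dom E f)" "f \<cdot> g = Idn E (Cod E f)" by (rule E.isoE[OF f])
  have fa: "f \<in> Arr E" using E.iso_arr[OF f] .
  have "sheaf E JCov (hom_to (Dom E f)) precomp"
  proof (rule J.sheaf_transport[OF FR_sheaf[OF Z], of "\<lambda>U u. g \<cdot> u"])
    fix c
    show "bij_betw (\<lambda>u. g \<cdot> u) (hom E c (Cod E f)) (hom E c (Dom E f))"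
    proof (rule bij_betw_byWitness[of _ "\<lambda>u. f \<cdot> u"])
      show "\<forall>a\<in>hom E c (Cod E f). f \<cdot> (g \<cdot> a) = a"
      proof
        fix a assume "a \<in> hom E c (Cod E f)"
        hence a: "a \<in> Arr E" "Cod E a = Cod E f" by (auto simp: hom_def)
        have "f \<cdot> (g \<cdot> a) = f \<cdot> g \<cdot> a" using a g(1-3) fa by simp
        thus "f \<cdot> (g \<cdot> a) = a" using g(5) a by simp
      qed
      show "\<forall>a\<in>hom E c (Dom E f). g \<cdot> (f \<cdot> a) = a"
      proof
        fix a assume "a \<in> hom E c (Dom E f)"
        hence a: "a \<in> Arr E" "Cod E a = Dom E f" by (auto simp: hom_def)
        have "g \<cdot> (f \<cdot> a) = g \<cdot> f \<cdot> a" using a g(1-3) fa by simp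
        thus "g \<cdot> (f \<cdot> a) = a" using g(4) a by simp
      qed
    qed (use g(1-3) fa in \<open>auto simp: hom_def\<close>)
  next
    fix h u assume "h \<in> Arr E" "u \<in> hom E (Cod E h) (Cod E f)"
    thus "g \<cdot> (u \<cdot> h) = g \<cdot> u \<cdot> h" using g(1-3) by (simp add: hom_def)
  qed
  thus ?thesis using FR_sheaf_iff fa by simp
qed

lemma FR_subtopos: "is_subtopos TYPE('u) E (FR J)"
proof -
  obtain L \<eta> where refl: "reflection E (FR J) L \<eta>"
    and gen: "\<And>X. X \<in> Ob E \<Longrightarrow> J.local_gen (hom_to (FOb L X)) precomp X (\<eta> X)"
    using reflection_ex by blast
  interpret R: reflection E "FR J" L \<eta> by (rule refl)
  obtain \<epsilon> where "adjunction E R.EI L id_functor \<eta> \<epsilon>" using R.adjunction_ex by blast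
  moreover have "X \<in> FR J \<longleftrightarrow> is_iso E (\<eta> X)" if "X \<in> Ob E" for X
    using R.unit_iso[of X] FR_iso_closed[of "\<eta> X"] R.unit_arr[OF that] R.L_ob[OF that] by auto
  ultimately show ?thesis
    using R.preserves_colimits reflection_lex[OF refl gen] unfolding is_subtopos_def by blast
qed

end

section \<open>Subtoposes are determined by the duality\<close>

context generated_topos
begin

lemma dual_bij:
  assumes "m \<in> GR I" "I \<subseteq> Ob E" "Z \<in> FR (GR I)"
  shows "bij_betw (\<lambda>f. f \<cdot> m) (hom E (Cod E m) Z) (hom E (Dom E m) Z)"
proof -
  have m: "is_mono E m" using assms GR_iff by blast
  have "GR I \<subseteq> all_monos E" unfolding polar_G_def by blast
  hence "gen_sieve E {m} \<in> ZCov Z (Cod E m)" using assms(1,3) FR_iff by blast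
  thus ?thesis
    using E.glues_mono_iff[OF m, of Z] E.glue_topD(3) E.mono_arr[OF m] by (meson E.ob(2))
qed

text \<open>The diagonal of the kernel pair of the unit is inverted by the reflection, so an object that is
  dual to every monomorphism dual to \<open>I\<close> has a monic unit.  The unit is then itself such a
  monomorphism, and it splits.\<close>

lemma subtopos_fixed:
  assumes I: "I \<subseteq> Ob E" and sub: "is_subtopos TYPE('u) E I"
  shows "FR (GR I) = I"
proof
  show "I \<subseteq> FR (GR I)" using I unfolding polar_F_def polar_G_def by blast
  obtain L \<eta> \<epsilon> where adj: "adjunction E (full_subcat E I) L id_functor \<eta> \<epsilon>"
    and lex: "preserves_finite_limits TYPE('u) E (full_subcat E I) L"
    and iso: "\<And>X. X \<in> Ob E \<Longrightarrow> X \<in> I \<longleftrightarrow> is_iso E (\<eta> X)"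
    using sub unfolding is_subtopos_def by blast
  interpret R: reflection E I L \<eta> by (rule E.adjunction_reflection[OF I adj])
  have GRI: "m \<in> GR I" if m: "is_mono E m" and le: "R.local_eq m" for m
  proof -
    have "(m, Z) \<in> duality_rel E" if Z: "Z \<in> I" for Z
      unfolding duality_rel_def
    proof (intro CollectI case_prodI conjI ballI impI allI)
      fix x p q assume pb: "is_pullback E m x p q"
      have "R.local_eq q" by (rule R.local_eq_pullback[OF univ lex pb le])
      thus "bij_betw (\<lambda>f. f \<cdot> q) (hom E (Dom E x) Z) (hom E (Dom E q) Z)"
        using Z E.pullbackD(8)[OF pb] unfolding R.local_eq_def by simp
    qed (use m Z I in \<open>auto simp: all_monos_def\<close>)
    thus ?thesis using m unfolding polar_G_def all_monos_def by blast
  qed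
  show "FR (GR I) \<subseteq> I"
  proof
    fix X assume X: "X \<in> FR (GR I)"
    have Xo: "X \<in> Ob E" using X unfolding polar_F_def by blast
    note u = R.unit_arr[OF Xo]
    obtain p q where pb: "is_pullback E (\<eta> X) (\<eta> X) p q" by (rule pullback_ex[OF u(1) u(1) refl])
    note D = E.pullbackD[OF pb]
    have id: "Idn E X \<in> Arr E" "Dom E (Idn E X) = X" "Cod E (Idn E X) = X" using Xo by simp_all
    obtain d where d: "d \<in> Arr E" "Dom E d = X" "Cod E d = Dom E p"
      "p \<cdot> d = Idn E X" "q \<cdot> d = Idn E X"
      by (rule E.pullback_lift[OF pb id(1) id(1)]) (use id u in auto)
    have leq: "R.local_eq q"
      by (rule R.local_eq_pullback[OF univ lex pb R.unit_local_eq[OF Xo]])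
    have led: "R.local_eq d"
      unfolding R.local_eq_def
    proof
      fix Z assume Z: "Z \<in> I"
      have bq: "bij_betw (\<lambda>g. g \<cdot> q) (hom E X Z) (hom E (Dom E p) Z)"
        using leq Z D u unfolding R.local_eq_def by simp
      have "g \<cdot> q \<cdot> d = g" if "g \<in> hom E X Z" for g
        using that d D u by (auto simp: hom_def)
      hence "bij_betw ((\<lambda>g. g \<cdot> d) \<circ> (\<lambda>g. g \<cdot> q)) (hom E X Z) (hom E X Z)"
        by (subst bij_betw_cong[of _ _ id]) (simp_all add: bij_betw_id)
      hence "bij_betw (\<lambda>g. g \<cdot> d) (hom E (Dom E p) Z) (hom E X Z)"
        using bij_betw_comp_iff[OF bq] by blast
      thus "bij_betw (\<lambda>g. g \<cdot> d) (hom E (Cod E d) Z) (hom E (Dom E d) Z)" using d by simp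
    qed
    have "is_mono E d" by (rule E.retraction_mono[of d p]) (use d D u in simp_all)
    hence "d \<in> GR I" using GRI led by blast
    hence bd: "bij_betw (\<lambda>f. f \<cdot> d) (hom E (Dom E p) X) (hom E X X)"
      using dual_bij[OF _ I X, of d] d by simp
    have pq: "p = q"
    proof (rule inj_onD[OF bij_betw_imp_inj_on[OF bd]])
      show "p \<cdot> d = q \<cdot> d" by (simp only: d(4,5))
      show "p \<in> hom E (Dom E p) X" "q \<in> hom E (Dom E p) X"
        using D(4-8) u(2) by (simp_all add: hom_def)
    qed
    have mono: "is_mono E (\<eta> X)"
      unfolding is_mono_def
    proof (intro conjI ballI impI u)
      fix a b assume a: "a \<in> Arr E" "Cod E a = Dom E (\<eta> X)" and b: "b \<in> Arr E" "Cod E b = Dom E (\<eta> X)"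
        and ab: "Dom E a = Dom E b" "\<eta> X \<cdot> a = \<eta> X \<cdot> b"
      obtain w where "p \<cdot> w = a" "q \<cdot> w = b"
        by (rule E.pullback_lift[OF pb a(1) b(1) ab(1) a(2) b(2) ab(2)])
      thus "a = b" using pq by simp
    qed
    have bu: "bij_betw (\<lambda>f. f \<cdot> \<eta> X) (hom E (FOb L X) X) (hom E X X)"
      using dual_bij[OF GRI[OF mono R.unit_local_eq[OF Xo]] I X] u by simp
    have "Idn E X \<in> (\<lambda>f. f \<cdot> \<eta> X) ` hom E (FOb L X) X"
      using bij_betw_imp_surj_on[OF bu] id by (simp add: hom_def)
    then obtain r where r: "r \<in> Arr E" "Dom E r = FOb L X" "Cod E r = X" "r \<cdot> \<eta> X = Idn E X"
      by (auto simp: hom_def)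
    have "\<eta> X \<cdot> r = Idn E (FOb L X)"
    proof (rule R.unit_cancel[OF Xo])
      have "\<eta> X \<cdot> r \<cdot> \<eta> X = \<eta> X \<cdot> (r \<cdot> \<eta> X)" using r(1-3) u by simp
      thus "\<eta> X \<cdot> r \<cdot> \<eta> X = Idn E (FOb L X) \<cdot> \<eta> X" using r(4) u Xo by simp
    qed (use r(1-3) u Xo R.L_ob[OF Xo] in simp_all)
    hence "is_iso E (\<eta> X)" using r u by (intro E.isoI[of "\<eta> X" r]) simp_all
    thus "X \<in> I" using iso[OF Xo] by blast
  qed
qed

end

theorem mainTheorem6:
  fixes E :: "('o, 'a) cat"
    and T :: "'a set" and S :: "'o set" and R :: "('a \<times> 'o) set"
  assumes "universe TYPE('u)"
    and "grothendieck_topos TYPE('u) E"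
    and "T = all_monos E" and "S = Ob E" and "R = duality_rel E"
  shows "(\<forall>J. J \<subseteq> T \<longrightarrow>
            (polar_G T S R (polar_F T S R J) = J \<longleftrightarrow> is_topology TYPE('u) E J)) \<and>
         (\<forall>I. I \<subseteq> S \<longrightarrow>
            (polar_F T S R (polar_G T S R I) = I \<longleftrightarrow> is_subtopos TYPE('u) E I))"
proof -
  obtain C :: "('u, 'u) cat" and K G where "generated_topos E C K G"
    using topos_generated[OF assms(1,2)] by blast
  then interpret generated_topos E C K G .
  have topology: "GR (FR J) = J \<longleftrightarrow> is_topology TYPE('u) E J" if J: "J \<subseteq> all_monos E" for J
  proof
    assume fixed: "GR (FR J) = J"
    have "FR J \<subseteq> Ob E" unfolding polar_F_def by blast
    from GR_topology[OF this] show "is_topology TYPE('u) E J" by (simp only: fixed)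
  next
    assume "is_topology TYPE('u) E J"
    then interpret topos_topology E C K G J using J by unfold_locales
    have "J \<subseteq> GR (FR J)" using J unfolding polar_F_def polar_G_def by blast
    thus "GR (FR J) = J" using GR_FR_subset by blast
  qed
  have subtopos: "FR (GR I) = I \<longleftrightarrow> is_subtopos TYPE('u) E I" if I: "I \<subseteq> Ob E" for I
  proof
    assume fixed: "FR (GR I) = I"
    have "GR I \<subseteq> all_monos E" unfolding polar_G_def by blast
    then interpret topos_topology E C K G "GR I"
      using GR_topology[OF I] by unfold_locales
    show "is_subtopos TYPE('u) E I" using FR_subtopos by (simp only: fixed)
  next
    assume "is_subtopos TYPE('u) E I"
    thus "FR (GR I) = I" by (rule subtopos_fixed[OF I])
  qed
  have "\<forall>J. J \<subseteq> all_monos E \<longrightarrow> (GR (FR J) = J \<longleftrightarrow> is_topology TYPE('u) E J)"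
    by (intro allI impI) (rule topology)
  moreover have "\<forall>I. I \<subseteq> Ob E \<longrightarrow> (FR (GR I) = I \<longleftrightarrow> is_subtopos TYPE('u) E I)"
    by (intro allI impI) (rule subtopos)
  ultimately show ?thesis unfolding assms(3-5) by (rule conjI)
qed

end
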